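(* Let $d\ge1$, $\alpha\in(0,2)$, $\lambda>1$ and $2\le p<\infty$. There is a constant $c>0$ such that for every $f\in L^p(\mathbb{R}^d)$, $$\|G^*_{\lambda,f}\|_p\le c\,\|f\|_p .$$
   Context: For $s>0$ let $p(s,x,y)$ be the transition density of the rotationally symmetric $\alpha$-stable process on $\mathbb{R}^d$, i.e. $p(s,x,y)=p(s,x-y,0)$ and $\int_{\mathbb{R}^d}e^{i\xi\cdot x}p(s,x,0)\,dx=e^{-s|\xi|^\alpha}$. For $t>0$ let $\mu_t(ds)=\frac{t}{2\sqrt\pi}e^{-t^2/(4s)}s^{-3/2}\,ds$ on $(0,\infty)$, and $q_t(x)=\int_0^\infty p(s,x,0)\,\mu_t(ds)$ (a probability density whose Fourier transform is $e^{-t|\xi|^{\alpha/2}}$). For $f\in L^p(\mathbb{R}^d)$ its extension to the upper half-space is $f_t(x)=f(x,t)=Q_tf(x)=f*q_t(x)$, $t>0$. Define $$\Gamma_\alpha(f_t,f_t)(x)=\int_{|h|<t^{2/\alpha}}[f_t(x+h)-f_t(x)]^2\frac{dh}{|h|^{d+\alpha}},\qquad K_t^\lambda(x)=t^{-2d/\alpha}\Big[\frac{t^{2/\alpha}}{t^{2/\alpha}+|x|}\Big]^{\lambda d},$$ $$\overrightarrow{G}^*_{\lambda,f}(x)=\Big[\int_0^\infty t\cdot \big(K_t^\lambda*\Gamma_\alpha(f_t,f_t)\big)(x)\,dt\Big]^{1/2},\qquad G^{*,\uparrow}_{\lambda,f}(x)=\Big[\int_0^\infty t\cdot \big(K_t^\lambda*(\tfrac{\partial}{\partial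 t}f_t(\cdot))^2\big)(x)\,dt\Big]^{1/2},$$ and the $G^*$ functional $$G^*_{\lambda,f}(x)=\Big[\big(\overrightarrow{G}^*_{\lambda,f}(x)\big)^2+\big(G^{*,\uparrow}_{\lambda,f}(x)\big)^2\Big]^{1/2}.$$ $\|\cdot\|_p$ is the $L^p(\mathbb{R}^d)$ norm. *)

theory Defs
  imports "HOL-Analysis.Analysis"
begin

text \<open>
  Euclidean space of dimension \<open>d\<close> is a type of class \<^class>\<open>euclidean_space\<close> with
  \<open>d = DIM('a)\<close>. All functionals that may be infinite take values in \<^typ>\<open>ennreal\<close>, so that
  an inequality between norms also asserts finiteness.
\<close>

subsection \<open>Powers and \<open>L\<^sup>p\<close> norms\<close>

text \<open>Only meant for exponents \<open>a > 0\<close>, where \<open>\<infinity>\<close> raised to the power \<open>a\<close> is \<open>\<infinity>\<close>.\<close>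

definition ennreal_pow :: "ennreal \<Rightarrow> real \<Rightarrow> ennreal" where
  "ennreal_pow x a = (if x = top then top else ennreal (enn2real x powr a))"

definition Lp_norm :: "real \<Rightarrow> ('a::euclidean_space \<Rightarrow> ennreal) \<Rightarrow> ennreal" where
  "Lp_norm p g = ennreal_pow (\<integral>\<^sup>+ x. ennreal_pow (g x) p \<partial>lebesgue) (1 / p)"

definition Lp_space :: "real \<Rightarrow> ('a::euclidean_space \<Rightarrow> real) set" where
  "Lp_space p = {f. f \<in> borel_measurable lebesgue \<and> Lp_norm p (\<lambda>x. ennreal \<bar>f x\<bar>) < top}"

subsection \<open>The stable transition density and the extension to the upper half-space\<close>

text \<open>
  The Fourier transform determines each density \<open>k s\<close> only almost everywhere;
  continuity singles out the usual version, so that \<open>k s x y\<close> is uniquely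
  determined for all \<open>s > 0\<close>. Values at \<open>s \<le> 0\<close> are unconstrained and never used.
  Note \<open>0 powr \<alpha> = 0\<close>, so the transform is \<open>1\<close> at \<open>\<xi> = 0\<close>.
\<close>

definition stable_transition_density ::
    "real \<Rightarrow> (real \<Rightarrow> 'a::euclidean_space \<Rightarrow> 'a \<Rightarrow> real) \<Rightarrow> bool" where
  "stable_transition_density \<alpha> k \<longleftrightarrow>
     (\<forall>s>0.
        (\<forall>x y. 0 \<le> k s x y) \<and>
        (\<forall>x y. k s x y = k s (x - y) 0) \<and>
        continuous_on UNIV (\<lambda>x. k s x 0) \<and>
        integrable lborel (\<lambda>x. k s x 0) \<and>
        (\<forall>\<xi>. (LINT x|lborel. exp (\<i> * complex_of_real (\<xi> \<bullet> x)) * complex_of_real (k s x 0))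
               = complex_of_real (exp (- s * norm \<xi> powr \<alpha>))))"

definition subord_measure :: "real \<Rightarrow> real measure" where
  "subord_measure t = density lborel
     (\<lambda>s. ennreal (indicator {0<..} s *
       (t / (2 * sqrt pi) * exp (- (t\<^sup>2) / (4 * s)) * s powr (- 3 / 2))))"

definition subord_density ::
    "(real \<Rightarrow> 'a::euclidean_space \<Rightarrow> 'a \<Rightarrow> real) \<Rightarrow> real \<Rightarrow> 'a \<Rightarrow> real" where
  "subord_density k t x = (LINT s:{0<..}|subord_measure t. k s x 0)"

definition extension ::
    "(real \<Rightarrow> 'a::euclidean_space \<Rightarrow> 'a \<Rightarrow> real) \<Rightarrow> ('a \<Rightarrow> real) \<Rightarrow> real \<Rightarrow> 'a \<Rightarrow> real" where
  "extension k f t x = (LINT y|lebesgue. f y * subord_density k t (x - y))"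

subsection \<open>The \<open>G\<^sup>*\<close> functional\<close>

text \<open>At \<open>h = 0\<close> the integrand is \<open>0 / 0 = 0\<close>; this single point is a null set.\<close>

definition Gamma_form :: "real \<Rightarrow> real \<Rightarrow> ('a::euclidean_space \<Rightarrow> real) \<Rightarrow> 'a \<Rightarrow> ennreal" where
  "Gamma_form \<alpha> t u x =
     (\<integral>\<^sup>+ h \<in> {h. norm h < t powr (2 / \<alpha>)}.
        ennreal ((u (x + h) - u x)\<^sup>2 / norm h powr (real DIM('a) + \<alpha>)) \<partial>lborel)"

definition K_kernel :: "real \<Rightarrow> real \<Rightarrow> real \<Rightarrow> 'a::euclidean_space \<Rightarrow> real" where
  "K_kernel \<alpha> l t x = t powr (- 2 * real DIM('a) / \<alpha>) *
     (t powr (2 / \<alpha>) / (t powr (2 / \<alpha>) + norm x)) powr (l * real DIM('a))"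

definition K_conv ::
    "real \<Rightarrow> real \<Rightarrow> real \<Rightarrow> ('a::euclidean_space \<Rightarrow> ennreal) \<Rightarrow> 'a \<Rightarrow> ennreal" where
  "K_conv \<alpha> l t g x = (\<integral>\<^sup>+ y. ennreal (K_kernel \<alpha> l t (x - y)) * g y \<partial>lborel)"

definition G_star_horiz ::
    "(real \<Rightarrow> 'a::euclidean_space \<Rightarrow> 'a \<Rightarrow> real) \<Rightarrow> real \<Rightarrow> real \<Rightarrow> ('a \<Rightarrow> real) \<Rightarrow> 'a \<Rightarrow> ennreal" where
  "G_star_horiz k \<alpha> l f x = ennreal_pow
     (\<integral>\<^sup>+ t \<in> {0<..}.
        (ennreal t * K_conv \<alpha> l t (Gamma_form \<alpha> t (extension k f t)) x) \<partial>lborel) (1 / 2)"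

definition G_star_vert ::
    "(real \<Rightarrow> 'a::euclidean_space \<Rightarrow> 'a \<Rightarrow> real) \<Rightarrow> real \<Rightarrow> real \<Rightarrow> ('a \<Rightarrow> real) \<Rightarrow> 'a \<Rightarrow> ennreal" where
  "G_star_vert k \<alpha> l f x = ennreal_pow
     (\<integral>\<^sup>+ t \<in> {0<..}.
        (ennreal t *
          K_conv \<alpha> l t (\<lambda>y. ennreal ((deriv (\<lambda>\<tau>. extension k f \<tau> y) t)\<^sup>2)) x) \<partial>lborel) (1 / 2)"

definition G_star ::
    "(real \<Rightarrow> 'a::euclidean_space \<Rightarrow> 'a \<Rightarrow> real) \<Rightarrow> real \<Rightarrow> real \<Rightarrow> ('a \<Rightarrow> real) \<Rightarrow> 'a \<Rightarrow> ennreal" where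
  "G_star k \<alpha> l f x = ennreal_pow ((G_star_horiz k \<alpha> l f x)\<^sup>2 + (G_star_vert k \<alpha> l f x)\<^sup>2) (1 / 2)"

end

theory Submission
  imports Defs "HOL-Probability.Probability" "HOL-Real_Asymp.Real_Asymp"
begin

text \<open>
  Put \<open>\<beta> = \<alpha> / 2\<close>, \<open>r = t powr (2 / \<alpha>)\<close>, and let \<open>\<gamma>\<close> be the sum of the Gamma form of the extension and the square
  of its time derivative, so that the square of the functional is the integral of \<open>t (K\<^sub>t * \<gamma>)\<close> in \<open>t\<close>.
  The heart is a local estimate: the measure \<open>t \<gamma> dy dt\<close> gives the box \<open>{y \<in> ball x0 R, r \<le> R}\<close> at most a constant
  times the integral of \<open>f\<^sup>2 (1 + |y - x0| / R) powr (- (d + \<beta>))\<close>, hence at most \<open>C R\<^sup>d M(f\<^sup>2)(x)\<close>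
  for every \<open>x\<close> in the ball. The part of \<open>f\<close> near the ball is controlled by Plancherel, as the transform of
  the subordinated density is \<open>exp (- t |\<xi>| powr \<beta>)\<close>. The far part is controlled by the pointwise bound
  \<open>t |x| powr (- (d + \<beta>))\<close> for the kernel and its analogue for differences; these hold because
  \<open>s \<mapsto> exp (- t s powr (\<beta> / 2))\<close> is completely monotone, which makes the kernel a mixture of Gaussians.

  For \<open>h \<ge> 0\<close>, moving \<open>K\<^sub>t\<close> onto \<open>h\<close> gives a function on the half-space which at \<open>(y, t)\<close> is at most
  a constant times \<open>M h\<close> anywhere in the ball of radius \<open>r\<close> around \<open>y\<close>. Carleson's embedding then bounds
  the integral of the squared functional against \<open>h\<close> by that of \<open>M(f\<^sup>2) M h\<close>, and duality together with the
  maximal theorem for the exponent \<open>p / 2\<close> concludes (with \<open>h = 1\<close> when \<open>p = 2\<close>).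
\<close>

subsection \<open>Powers of extended nonnegative reals\<close>

text \<open>Membership in L^p gives neither integrability nor square integrability, so Plancherel is
  available only for a cutoff of f; what lies outside the cutoff must be controlled pointwise. The
  truncation |h| < r in the Gamma form fits this: in a box with r \<le> R it keeps x + h at a
  distance of order R from the far part of f, where the difference estimate gains |h| / R, and the
  relation r powr \<alpha> = t^2 balances the singularity in h. The local estimate keeps the
  weighted integral of f^2 instead of its maximal function because M(f^2) is in general not
  integrable: for p = 2 the boxes exhaust the half-space and the weight is bounded by 1. The
  hypothesis \<lambda> > 1 makes the decay \<lambda> d of the kernel integrable, \<alpha> < 2 makes
  the Levy integral converge at h = 0, and p \<ge> 2 makes p / 2 an admissible exponent. The square
  functions are integrated in \<open>ennreal\<close>, so that Tonelli and monotone limits apply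
  without prior finiteness; the absorption in the duality argument does need a finite quantity,
  hence its truncation.\<close>

lemma ennreal_pow_ennreal: "0 \<le> x \<Longrightarrow> ennreal_pow (ennreal x) a = ennreal (x powr a)"
  by (simp add: ennreal_pow_def)

lemma ennreal_pow_top [simp]: "ennreal_pow top a = top"
  by (simp add: ennreal_pow_def)

lemma ennreal_pow_zero [simp]: "ennreal_pow 0 a = 0"
  by (simp add: ennreal_pow_def)

lemma measurable_ennreal_pow [measurable]: "(\<lambda>x. ennreal_pow x a) \<in> borel_measurable borel"
  unfolding ennreal_pow_def by measurable

lemma ennreal_pow_one: "ennreal_pow x 1 = x"
  by (cases x) (auto simp: ennreal_pow_ennreal)

lemma ennreal_pow_mono: "x \<le> y \<Longrightarrow> 0 \<le> a \<Longrightarrow> ennreal_pow x a \<le> ennreal_pow y a"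
  by (cases x; cases y) (auto simp: ennreal_pow_ennreal powr_mono2 top_unique)

lemma ennreal_pow_mult:
  "0 < a \<Longrightarrow> ennreal_pow (x * y) a = ennreal_pow x a * ennreal_pow y a"
  by (cases x; cases y)
     (auto simp: ennreal_pow_ennreal ennreal_mult[symmetric] powr_mult ennreal_mult_top
        ennreal_top_mult ennreal_mult_eq_top_iff)

lemma ennreal_pow_pow: "0 < a \<Longrightarrow> 0 < b \<Longrightarrow> ennreal_pow (ennreal_pow x a) b = ennreal_pow x (a * b)"
  by (cases x) (auto simp: ennreal_pow_ennreal powr_powr)

lemma ennreal_pow_add: "0 < a \<Longrightarrow> 0 < b \<Longrightarrow> ennreal_pow x a * ennreal_pow x b = ennreal_pow x (a + b)"
  by (cases x) (auto simp: ennreal_pow_ennreal powr_add ennreal_mult[symmetric] ennreal_mult_top)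

lemma ennreal_pow_two: "ennreal_pow x 2 = x\<^sup>2"
  by (cases x) (auto simp: ennreal_pow_ennreal ennreal_power[symmetric] power_top_ennreal)

text \<open>Weighted AM-GM for \<open>r powr a\<close> and \<open>s powr b\<close>, after which the
  factors 1 / a and 1 / b are estimated by 1. Unlike Hoelder's inequality it is pointwise, so the
  integrals of the two terms can be treated separately.\<close>

lemma ennreal_pow_Young:
  assumes "1 < a" and b: "b = a / (a - 1)"
  shows "x * y \<le> ennreal_pow x a + ennreal_pow y b"
proof (cases x; cases y)
  fix r s :: real assume rs: "0 \<le> r" "x = ennreal r" "0 \<le> s" "y = ennreal s"
  have ab: "0 < a" "0 < b" "1 < b" "1 / a + 1 / b = 1"
  proof -
    show "0 < a" using assms by simp
    have "a - 1 > 0" using assms by simp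
    then show "0 < b" unfolding b using assms by simp
    show "1 < b" unfolding b using \<open>a - 1 > 0\<close> by (simp add: field_simps)
    show "1 / a + 1 / b = 1" unfolding b using \<open>a - 1 > 0\<close> by (simp add: field_simps)
  qed
  have "r * s \<le> r powr a + s powr b"
  proof (cases "r = 0 \<or> s = 0")
    case False
    then have "r > 0" "s > 0" using rs by auto
    have "r * s = (r powr a) powr (1/a) * (s powr b) powr (1/b)"
      using ab \<open>r > 0\<close> \<open>s > 0\<close> by (simp add: powr_powr)
    also have "\<dots> \<le> (1/a) * r powr a + (1/b) * s powr b"
      using Youngs_inequality_0[of "1/a" "1/b" "r powr a" "s powr b"] ab \<open>r > 0\<close> \<open>s > 0\<close> by simp
    also have "\<dots> \<le> r powr a + s powr b"
      using ab \<open>1 < a\<close> by (intro add_mono mult_left_le_one_le) auto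
    finally show ?thesis .
  qed auto
  then show ?thesis
    using rs by (simp add: ennreal_pow_ennreal flip: ennreal_mult ennreal_plus)
qed auto

text \<open>The power as the integral of its derivative over (0, x), by the fundamental theorem for
  finite \<open>x\<close>. Writing the interval as a set of levels below \<open>x\<close> makes
  superlevel sets appear when \<open>x\<close> is the value of a function.\<close>

lemma layer_cake_pow:
  fixes x :: ennreal
  assumes "0 < a"
  shows "(\<integral>\<^sup>+ s. ennreal (a * s powr (a - 1)) * indicator {s. 0 < s \<and> ennreal s < x} s \<partial>lborel) = ennreal_pow x a"
proof -
  have fin: "(\<integral>\<^sup>+ s. ennreal (a * s powr (a - 1)) * indicator {0<..<r} s \<partial>lborel) = ennreal (r powr a)"
    if "0 \<le> r" for r
  proof (cases "r = 0")
    case False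
    then have r: "r > 0" using that by simp
    have l: "((\<lambda>s::real. s powr a) \<longlongrightarrow> 0) (at_right 0)"
      using \<open>0 < a\<close> by (auto intro!: tendsto_eq_intros simp: eventually_at_filter)
    have d: "((\<lambda>s::real. s powr a) has_real_derivative a * s powr (a - 1)) (at s)" if "0 < s" for s
      using that by (auto intro!: derivative_eq_intros)
    have u: "((\<lambda>s::real. s powr a) \<longlongrightarrow> r powr a) (at_left r)"
      using r by (auto intro!: tendsto_eq_intros)
    note FTC = interval_integral_FTC_nonneg[where F = "\<lambda>s. s powr a" and f = "\<lambda>s. a * s powr (a-1)"
        and a = 0 and b = "ereal r" and A = 0 and B = "r powr a"]
    have 1: "set_integrable lborel (einterval 0 r) (\<lambda>s. a * s powr (a-1))"
      using r \<open>0 < a\<close> l d u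
      by (intro FTC) (auto simp: zero_ereal_def ereal_tendsto_simps intro!: continuous_intros)
    have 2: "(LBINT s=0..r. a * s powr (a-1)) = r powr a - 0"
      using r \<open>0 < a\<close> l d u
      by (intro FTC) (auto simp: zero_ereal_def ereal_tendsto_simps intro!: continuous_intros)
    have "(\<integral>\<^sup>+ s. ennreal (a * s powr (a - 1)) * indicator {0<..<r} s \<partial>lborel)
         = (\<integral>\<^sup>+ s. ennreal (indicator {0<..<r} s * (a * s powr (a - 1))) \<partial>lborel)"
      by (intro nn_integral_cong) (auto split: split_indicator)
    also have "\<dots> = ennreal (LINT s|lborel. indicator {0<..<r} s * (a * s powr (a - 1)))"
      using 1 \<open>0 < a\<close> by (intro nn_integral_eq_integral)
         (auto simp: set_integrable_def zero_ereal_def mult.commute split: split_indicator)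
    also have "(LINT s|lborel. indicator {0<..<r} s * (a * s powr (a - 1))) = r powr a"
      using 2 r by (simp add: interval_lebesgue_integral_def set_lebesgue_integral_def zero_ereal_def mult.left_commute[of _ a])
    finally show ?thesis .
  qed simp
  show ?thesis
  proof (cases x)
    case (real r)
    have "{s. 0 < s \<and> ennreal s < x} = {0<..<r}"
      using real by (auto simp: ennreal_less_iff)
    then show ?thesis using fin[of r] real by (simp add: ennreal_pow_ennreal)
  next
    case top
    \<comment> \<open>Infinite \<open>x\<close>: the domain contains the interval from 0 to u powr
      (1 / a), over which the integral is exactly \<open>u\<close>, so the integral exceeds every
      finite number.\<close>
    have "ennreal u \<le> (\<integral>\<^sup>+ s. ennreal (a * s powr (a - 1)) * indicator {s. 0 < s \<and> ennreal s < x} s \<partial>lborel)"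
      if "u > 0" for u
    proof -
      have "ennreal u = ennreal ((u powr (1/a)) powr a)"
        using that \<open>0 < a\<close> by (simp add: powr_powr)
      also have "\<dots> = (\<integral>\<^sup>+ s. ennreal (a * s powr (a - 1)) * indicator {0<..<u powr (1/a)} s \<partial>lborel)"
        by (rule fin[symmetric]) simp
      also have "\<dots> \<le> (\<integral>\<^sup>+ s. ennreal (a * s powr (a - 1)) * indicator {s. 0 < s \<and> ennreal s < x} s \<partial>lborel)"
        using top by (intro nn_integral_mono) (auto split: split_indicator)
      finally show ?thesis .
    qed
    then have lt: "ennreal u < (\<integral>\<^sup>+ s. ennreal (a * s powr (a - 1)) * indicator {s. 0 < s \<and> ennreal s < x} s \<partial>lborel)"
      if "0 \<le> u" for u
      using that by (intro less_le_trans[OF _ \<open>\<And>u. 0 < u \<Longrightarrow> _\<close>[of "u + 1"]]) (auto simp: ennreal_less_iff)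
    have "(\<integral>\<^sup>+ s. ennreal (a * s powr (a - 1)) * indicator {s. 0 < s \<and> ennreal s < x} s \<partial>lborel) = top" (is "?I = _")
    proof (cases ?I)
      case (real u)
      then show ?thesis using lt[of u] by (metis less_irrefl)
    qed
    then show ?thesis using top by simp
  qed
qed

lemma layer_cake:
  fixes x :: ennreal
  shows "(\<integral>\<^sup>+ s. indicator {s. 0 < s \<and> ennreal s < x} s \<partial>lborel) = x"
proof -
  have "(\<integral>\<^sup>+ s. indicator {s. 0 < s \<and> ennreal s < x} s \<partial>lborel)
     = (\<integral>\<^sup>+ s. ennreal (1 * s powr (1 - 1)) * indicator {s. 0 < s \<and> ennreal s < x} s \<partial>lborel)"
    by (intro nn_integral_cong) (auto split: split_indicator)
  also have "\<dots> = x" using layer_cake_pow[of 1 x] by (simp add: ennreal_pow_one)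
  finally show ?thesis .
qed

text \<open>With \<open>u\<close> a scaled distance this writes a polynomially decaying weight as a
  superposition of indicators of balls, so that integrals against the weight reduce to integrals
  over balls.\<close>

lemma nn_integral_one_plus_powr:
  assumes "a > 0" "u \<ge> 0"
  shows "(\<integral>\<^sup>+ s. ennreal (a * (1 + s) powr (- a - 1)) * indicator {u..} s \<partial>lborel) = ennreal ((1 + u) powr (- a))"
proof -
  have "(\<integral>\<^sup>+ s. ennreal (a * (1 + s) powr (- a - 1)) * indicator {u..} s \<partial>lborel) = 0 - (- ((1 + u) powr (- a)))"
  proof (rule nn_integral_FTC_atLeast)
    show "((\<lambda>s. - ((1 + s) powr (- a))) \<longlongrightarrow> 0) at_top"
      using tendsto_minus[OF tendsto_neg_powr[of "-a", OF _ filterlim_tendsto_add_at_top[OF tendsto_const filterlim_ident]]] assms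
      by simp
    show "((\<lambda>s. - ((1 + s) powr (- a))) has_real_derivative a * (1 + s) powr (- a - 1)) (at s)" if "u \<le> s" for s
      using that assms by (auto intro!: derivative_eq_intros)
  qed (use assms in auto)
  then show ?thesis by simp
qed

subsection \<open>The Hardy-Littlewood maximal function and Carleson's embedding\<close>

lemma ennreal_times_divide_cancel: "0 < c \<Longrightarrow> ennreal c * (x / ennreal c) = x"
  by (simp add: ennreal_times_divide ennreal_mult_divide_eq mult.commute[of "ennreal c"])

text \<open>The uncentred Hardy-Littlewood function, normalised by \<open>r ^ DIM('a)\<close>
  instead of the volume of the ball; the volume of the unit ball therefore reappears in later
  constants. Admitting every ball that contains the point lets a single value bound the mass of all
  of them, as the embedding requires.\<close>

definition hl_max :: "('a::euclidean_space \<Rightarrow> ennreal) \<Rightarrow> 'a \<Rightarrow> ennreal" where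
  "hl_max h x = (SUP (z, r) \<in> {(z, r). 0 < r \<and> x \<in> ball z r}.
     (\<integral>\<^sup>+ y. h y * indicator (ball z r) y \<partial>lborel) / ennreal (r ^ DIM('a)))"

lemma hl_max_upper:
  fixes h :: "'a::euclidean_space \<Rightarrow> ennreal"
  assumes "0 < r" "x \<in> ball z r"
  shows "(\<integral>\<^sup>+ y. h y * indicator (ball z r) y \<partial>lborel) \<le> ennreal (r ^ DIM('a)) * hl_max h x"
proof -
  have "(\<integral>\<^sup>+ y. h y * indicator (ball z r) y \<partial>lborel) / ennreal (r ^ DIM('a)) \<le> hl_max h x"
    unfolding hl_max_def using assms by (intro SUP_upper2[of "(z, r)"]) auto
  then have "ennreal (r ^ DIM('a)) * ((\<integral>\<^sup>+ y. h y * indicator (ball z r) y \<partial>lborel) / ennreal (r ^ DIM('a)))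
      \<le> ennreal (r ^ DIM('a)) * hl_max h x"
    by (rule mult_left_mono) simp
  then show ?thesis
    using assms by (simp add: ennreal_times_divide_cancel)
qed

text \<open>A ball witnessing a large value at \<open>x\<close> witnesses it at all its points,
  because balls need not be centred. Hence superlevel sets are open, and \<open>hl_max h\<close> is
  Borel for arbitrary \<open>h\<close>.\<close>

lemma less_hl_maxE:
  fixes h :: "'a::euclidean_space \<Rightarrow> ennreal"
  assumes "c < hl_max h x"
  obtains z r where "0 < r" "x \<in> ball z r"
    "c * ennreal (r ^ DIM('a)) \<le> (\<integral>\<^sup>+ y. h y * indicator (ball z r) y \<partial>lborel)"
    "\<And>w. w \<in> ball z r \<Longrightarrow> c < hl_max h w"
proof -
  obtain z r where zr: "0 < r" "x \<in> ball z r"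
    "c < (\<integral>\<^sup>+ y. h y * indicator (ball z r) y \<partial>lborel) / ennreal (r ^ DIM('a))"
    using assms unfolding hl_max_def less_SUP_iff by auto
  show ?thesis
  proof
    have "c * ennreal (r ^ DIM('a)) \<le>
       (\<integral>\<^sup>+ y. h y * indicator (ball z r) y \<partial>lborel) / ennreal (r ^ DIM('a)) * ennreal (r ^ DIM('a))"
      using zr by (intro mult_right_mono) auto
    also have "\<dots> = (\<integral>\<^sup>+ y. h y * indicator (ball z r) y \<partial>lborel)"
      using zr by (subst mult.commute) (simp add: ennreal_times_divide_cancel)
    finally show "c * ennreal (r ^ DIM('a)) \<le> (\<integral>\<^sup>+ y. h y * indicator (ball z r) y \<partial>lborel)" .
    show "c < hl_max h w" if "w \<in> ball z r" for w
      using zr(1,3) that unfolding hl_max_def less_SUP_iff by (intro bexI[of _ "(z, r)"]) auto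
  qed (use zr in auto)
qed

lemma borel_measurable_hl_max [measurable]: "hl_max h \<in> borel_measurable borel"
proof (rule borel_measurableI_greater)
  fix c
  have "open {x. c < hl_max h x}"
    unfolding open_subopen[of "{x. c < hl_max h x}"]
    by (auto elim!: less_hl_maxE)
  then show "{x \<in> space borel. c < hl_max h x} \<in> sets borel" by simp
qed

section \<open>Covering arguments: the weak type bound and tents\<close>

lemma nn_integral_indicator_disjoint_le_1:
  assumes "\<And>i j. i \<in> C \<Longrightarrow> j \<in> C \<Longrightarrow> i \<noteq> j \<Longrightarrow> disjnt (B i) (B j)"
  shows "(\<integral>\<^sup>+ i. indicator (B i) x \<partial>count_space C) \<le> 1"
proof (cases "\<exists>j\<in>C. x \<in> B j")
  case True
  then obtain j where j: "j \<in> C" "x \<in> B j" by auto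
  have "(\<integral>\<^sup>+ i. indicator (B i) x \<partial>count_space C) \<le> (\<integral>\<^sup>+ i. indicator {j} i \<partial>count_space C)"
    using j assms by (intro nn_integral_mono) (auto simp: disjnt_iff split: split_indicator)
  also have "\<dots> = 1" using j by (simp add: emeasure_count_space)
  finally show ?thesis .
next
  case False
  then have "(\<integral>\<^sup>+ i. indicator (B i) x \<partial>count_space C) = (\<integral>\<^sup>+ i. 0 \<partial>count_space C)"
    by (intro nn_integral_cong) (auto split: split_indicator)
  then show ?thesis by simp
qed

text \<open>Countable subadditivity without an enumeration: the sum over the covering family is an
  integral over \<open>count_space C\<close>, so that it can be exchanged with other integrals
  directly.\<close>

lemma emeasure_le_count_space_sum:
  assumes "countable C" "A \<in> sets M" "\<And>i. i \<in> C \<Longrightarrow> T i \<in> sets M" "A \<subseteq> (\<Union>i\<in>C. T i)"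
  shows "emeasure M A \<le> (\<integral>\<^sup>+ i. emeasure M (T i) \<partial>count_space C)"
proof -
  have "emeasure M A = (\<integral>\<^sup>+ x. indicator A x \<partial>M)" using assms by simp
  also have "\<dots> \<le> (\<integral>\<^sup>+ x. \<integral>\<^sup>+ i. indicator (T i) x \<partial>count_space C \<partial>M)"
  proof (rule nn_integral_mono)
    fix x
    show "indicator A x \<le> (\<integral>\<^sup>+ i. indicator (T i) x \<partial>count_space C)"
    proof (cases "x \<in> A")
      case True
      then obtain j where j: "j \<in> C" "x \<in> T j" using assms by auto
      have "1 = (\<integral>\<^sup>+ i. indicator {j} i \<partial>count_space C)" using j by simp
      also have "\<dots> \<le> (\<integral>\<^sup>+ i. indicator (T i) x \<partial>count_space C)"
        using j by (intro nn_integral_mono) (auto split: split_indicator)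
      finally show ?thesis by (simp add: True)
    qed simp
  qed
  also have "\<dots> = (\<integral>\<^sup>+ i. \<integral>\<^sup>+ x. indicator (T i) x \<partial>M \<partial>count_space C)"
    using assms by (intro nn_integral_count_space_nn_integral) auto
  also have "\<dots> = (\<integral>\<^sup>+ i. emeasure M (T i) \<partial>count_space C)"
    using assms by (intro nn_integral_cong) auto
  finally show ?thesis .
qed

lemma nn_integral_disjoint_family_le:
  fixes h :: "'b \<Rightarrow> ennreal"
  assumes "countable C" and [measurable]: "h \<in> borel_measurable M"
    and T: "\<And>i. i \<in> C \<Longrightarrow> T i \<in> sets M"
    and dj: "\<And>i j. i \<in> C \<Longrightarrow> j \<in> C \<Longrightarrow> i \<noteq> j \<Longrightarrow> disjnt (T i) (T j)"
    and sub: "\<And>i. i \<in> C \<Longrightarrow> T i \<subseteq> E"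
  shows "(\<integral>\<^sup>+ i. (\<integral>\<^sup>+ x. h x * indicator (T i) x \<partial>M) \<partial>count_space C) \<le> (\<integral>\<^sup>+ x. h x * indicator E x \<partial>M)"
proof -
  have "(\<integral>\<^sup>+ i. (\<integral>\<^sup>+ x. h x * indicator (T i) x \<partial>M) \<partial>count_space C)
     = (\<integral>\<^sup>+ x. \<integral>\<^sup>+ i. h x * indicator (T i) x \<partial>count_space C \<partial>M)"
    using assms by (intro nn_integral_count_space_nn_integral[symmetric]) auto
  also have "\<dots> \<le> (\<integral>\<^sup>+ x. h x * indicator E x \<partial>M)"
  proof (rule nn_integral_mono)
    fix x
    show "(\<integral>\<^sup>+ i. h x * indicator (T i) x \<partial>count_space C) \<le> h x * indicator E x"
    proof (cases "x \<in> E")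
      case True
      have "(\<integral>\<^sup>+ i. h x * indicator (T i) x \<partial>count_space C) = h x * (\<integral>\<^sup>+ i. indicator (T i) x \<partial>count_space C)"
        by (rule nn_integral_cmult) simp
      also have "\<dots> \<le> h x * 1"
        using dj by (intro mult_left_mono nn_integral_indicator_disjoint_le_1) auto
      finally show ?thesis using True by simp
    next
      case False
      then have "(\<integral>\<^sup>+ i. h x * indicator (T i) x \<partial>count_space C) = (\<integral>\<^sup>+ i. 0 \<partial>count_space C)"
        using sub by (intro nn_integral_cong) (auto split: split_indicator)
      then show ?thesis by simp
    qed
  qed
  finally show ?thesis .
qed

text \<open>Vitali's argument. Each point of the superlevel set lies in a ball on which
  \<open>h\<close> has mass at least s r^d; a disjoint subfamily covers the set after dilation by 5,
  and the masses of \<open>h\<close> on disjoint balls add up to at most the total mass.\<close>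

lemma hl_max_weak_type:
  fixes h :: "'a::euclidean_space \<Rightarrow> ennreal"
  assumes [measurable]: "h \<in> borel_measurable borel" and s: "0 < s"
  shows "ennreal s * emeasure lborel {x. ennreal s < hl_max h x}
      \<le> ennreal (unit_ball_vol (real DIM('a)) * 5 ^ DIM('a)) * (\<integral>\<^sup>+ x. h x \<partial>lborel)"
proof (cases "(\<integral>\<^sup>+ x. h x \<partial>lborel) = top")
  case True
  moreover have "unit_ball_vol (real DIM('a)) \<noteq> 0" using unit_ball_vol_pos[of "real DIM('a)"] by (metis less_irrefl of_nat_0_le_iff)
  ultimately show ?thesis by (simp add: ennreal_mult_top)
next
  case False
  define I where "I = enn2real (\<integral>\<^sup>+ x. h x \<partial>lborel)"
  have I: "(\<integral>\<^sup>+ x. h x \<partial>lborel) = ennreal I" "0 \<le> I"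
    using False by (auto simp: I_def less_top)
  define E where "E = {x. ennreal s < hl_max h x}"
  have [measurable]: "E \<in> sets borel" unfolding E_def by simp
  have "\<forall>x\<in>E. \<exists>z r. 0 < r \<and> x \<in> ball z r \<and>
     ennreal s * ennreal (r ^ DIM('a)) \<le> (\<integral>\<^sup>+ y. h y * indicator (ball z r) y \<partial>lborel)"
    unfolding E_def by (auto elim!: less_hl_maxE) blast
  then obtain z r where zr: "\<And>x. x \<in> E \<Longrightarrow> 0 < r x" "\<And>x. x \<in> E \<Longrightarrow> x \<in> ball (z x) (r x)"
    "\<And>x. x \<in> E \<Longrightarrow> ennreal s * ennreal (r x ^ DIM('a)) \<le> (\<integral>\<^sup>+ y. h y * indicator (ball (z x) (r x)) y \<partial>lborel)"
    by metis
  \<comment> \<open>Vitali's lemma needs bounded radii. They are bounded here because s r^d cannot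
    exceed the total mass \<open>I\<close>, which is finite in this case.\<close>
  have bd: "r x \<le> root DIM('a) (I / s)" if "x \<in> E" for x
  proof -
    have "ennreal (s * r x ^ DIM('a)) = ennreal s * ennreal (r x ^ DIM('a))"
      using s zr(1)[OF that] by (intro ennreal_mult) auto
    also have "\<dots> \<le> (\<integral>\<^sup>+ y. h y * indicator (ball (z x) (r x)) y \<partial>lborel)" by (rule zr(3)[OF that])
    also have "\<dots> \<le> (\<integral>\<^sup>+ x. h x \<partial>lborel)" by (intro nn_integral_mono) (auto split: split_indicator)
    also have "\<dots> = ennreal I" by (rule I)
    finally have "s * r x ^ DIM('a) \<le> I" using I by simp
    then have "r x ^ DIM('a) \<le> I / s" using s by (simp add: field_simps)
    then have "root DIM('a) (r x ^ DIM('a)) \<le> root DIM('a) (I / s)" by simp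
    then show ?thesis using zr(1)[OF that] by (simp add: real_root_power_cancel)
  qed
  have cover: "E \<subseteq> (\<Union>i\<in>E. ball (z i) (r i))" using zr(2) by blast
  have radii: "\<And>i. i \<in> E \<Longrightarrow> 0 < r i \<and> r i \<le> root DIM('a) (I / s)" using zr(1) bd by blast
  obtain C where C: "countable C" "C \<subseteq> E"
     "pairwise (\<lambda>i j. disjnt (ball (z i) (r i)) (ball (z j) (r j))) C"
     "E \<subseteq> (\<Union>i\<in>C. ball (z i) (5 * r i))"
    by (rule Vitali_covering_lemma_balls[OF cover radii])
  let ?c = "ennreal (unit_ball_vol (real DIM('a)) * 5 ^ DIM('a))"
  have "ennreal s * emeasure lborel E \<le> ennreal s * (\<integral>\<^sup>+ i. emeasure lborel (ball (z i) (5 * r i)) \<partial>count_space C)"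
    using C by (intro mult_left_mono emeasure_le_count_space_sum) auto
  also have "\<dots> = (\<integral>\<^sup>+ i. ennreal s * emeasure lborel (ball (z i) (5 * r i)) \<partial>count_space C)"
    by (rule nn_integral_cmult[symmetric]) simp
  also have "\<dots> \<le> (\<integral>\<^sup>+ i. ?c * (\<integral>\<^sup>+ y. h y * indicator (ball (z i) (r i)) y \<partial>lborel) \<partial>count_space C)"
  proof (rule nn_integral_mono)
    fix i assume "i \<in> space (count_space C)"
    then have i: "i \<in> E" using C by auto
    have "ennreal s * emeasure lborel (ball (z i) (5 * r i)) = ?c * (ennreal s * ennreal (r i ^ DIM('a)))"
      using zr(1)[OF i] s
      by (simp add: emeasure_ball power_mult_distrib flip: ennreal_mult)
    also have "\<dots> \<le> ?c * (\<integral>\<^sup>+ y. h y * indicator (ball (z i) (r i)) y \<partial>lborel)"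
      by (intro mult_left_mono zr(3)[OF i]) simp
    finally show "ennreal s * emeasure lborel (ball (z i) (5 * r i)) \<le> \<dots>" .
  qed
  also have "\<dots> = ?c * (\<integral>\<^sup>+ i. (\<integral>\<^sup>+ y. h y * indicator (ball (z i) (r i)) y \<partial>lborel) \<partial>count_space C)"
    by (rule nn_integral_cmult) simp
  also have "\<dots> \<le> ?c * (\<integral>\<^sup>+ y. h y * indicator UNIV y \<partial>lborel)"
    using C by (intro mult_left_mono nn_integral_disjoint_family_le) (auto simp: pairwise_def)
  finally show ?thesis unfolding E_def by simp
qed

text \<open>A point \<open>p\<close> of the half-space enters only through the ball with centre
  \<open>c p\<close> and radius \<open>\<rho> p\<close>. Vitali selects disjoint balls among those
  of the points with \<open>s < \<Phi> p\<close>; the tents over their 5-fold dilations cover the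
  superlevel set, and the mass of each tent is averaged over the selected ball, which lies in the
  superlevel set of \<open>H\<close>.\<close>

lemma emeasure_superlevel_Carleson:
  fixes \<mu> :: "'b measure" and c :: "'b \<Rightarrow> 'a::euclidean_space" and \<rho> :: "'b \<Rightarrow> real"
    and \<Phi> :: "'b \<Rightarrow> ennreal"
  assumes [measurable]: "c \<in> borel_measurable \<mu>" "\<rho> \<in> borel_measurable \<mu>" "\<Phi> \<in> borel_measurable \<mu>"
    and [measurable]: "b \<in> borel_measurable borel" "H \<in> borel_measurable borel"
    and \<rho>: "\<And>p. p \<in> space \<mu> \<Longrightarrow> 0 < \<rho> p"
    and tent: "\<And>z r x. 0 < r \<Longrightarrow> x \<in> ball z r \<Longrightarrow>
      emeasure \<mu> {p \<in> space \<mu>. c p \<in> ball z r \<and> \<rho> p \<le> r} \<le> ennreal (r ^ DIM('a)) * b x"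
    and H: "\<And>p x. p \<in> space \<mu> \<Longrightarrow> dist (c p) x \<le> \<rho> p \<Longrightarrow> \<Phi> p \<le> H x"
  shows "ennreal (unit_ball_vol (real DIM('a))) * emeasure \<mu> {p \<in> space \<mu>. s < \<Phi> p}
     \<le> ennreal (5 ^ DIM('a)) * (\<integral>\<^sup>+ x. b x * indicator {x. s < H x} x \<partial>lborel)"
proof -
  have meas: "{p \<in> space \<mu>. c p \<in> ball z r \<and> \<rho> p \<le> r} \<in> sets \<mu>" for z r
    unfolding mem_ball by measurable
  let ?v = "ennreal (unit_ball_vol (real DIM('a)))"
  let ?R = "ennreal (5 ^ DIM('a)) * (\<integral>\<^sup>+ x. b x * indicator {x. s < H x} x \<partial>lborel)"
  \<comment> \<open>The cut at \<open>\<rho> p \<le> real n\<close> supplies the bounded radii for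
    Vitali's lemma; the resulting bound does not depend on \<open>n\<close>.\<close>
  define K where "K n = {p \<in> space \<mu>. s < \<Phi> p \<and> \<rho> p \<le> real n}" for n :: nat
  have [measurable]: "K n \<in> sets \<mu>" for n unfolding K_def by measurable
  have bound: "?v * emeasure \<mu> (K n) \<le> ?R" for n
  proof -
    obtain C where C: "countable C" "C \<subseteq> K n"
       "pairwise (\<lambda>i j. disjnt (cball (c i) (\<rho> i)) (cball (c j) (\<rho> j))) C"
       and cov: "\<And>i. i \<in> K n \<Longrightarrow> \<exists>j. j \<in> C \<and>
                        \<not> disjnt (cball (c i) (\<rho> i)) (cball (c j) (\<rho> j)) \<and>
                        cball (c i) (\<rho> i) \<subseteq> ball (c j) (5 * \<rho> j)"
      by (rule Vitali_covering_lemma_cballs_balls[of "K n" \<rho> "real n" c]) (auto simp: K_def \<rho>)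
    define T where "T j = {p \<in> space \<mu>. c p \<in> ball (c j) (5 * \<rho> j) \<and> \<rho> p \<le> 5 * \<rho> j}" for j
    have [measurable]: "T j \<in> sets \<mu>" for j unfolding T_def by (rule meas)
    have sub: "K n \<subseteq> (\<Union>j\<in>C. T j)"
    proof
      fix i assume i: "i \<in> K n"
      then obtain j where j: "j \<in> C" "cball (c i) (\<rho> i) \<subseteq> ball (c j) (5 * \<rho> j)" using cov by blast
      have i': "i \<in> space \<mu>" "0 < \<rho> i" using i \<rho> by (auto simp: K_def)
      \<comment> \<open>Inclusion of one ball in another bounds centre and radius at the same time,
        which is exactly membership in the tent.\<close>
      then have lt: "dist (c i) (c j) + \<rho> i < 5 * \<rho> j"
        using j(2) by (simp add: cball_subset_ball_iff)
      then have "dist (c j) (c i) < 5 * \<rho> j" "\<rho> i \<le> 5 * \<rho> j"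
        using i' zero_le_dist[of "c i" "c j"] by (simp_all add: dist_commute del: zero_le_dist)
      then show "i \<in> (\<Union>j\<in>C. T j)"
        using i' j(1) by (auto simp: T_def)
    qed
    have "?v * emeasure \<mu> (K n) \<le> ?v * (\<integral>\<^sup>+ j. emeasure \<mu> (T j) \<partial>count_space C)"
      using C sub by (intro mult_left_mono emeasure_le_count_space_sum) auto
    also have "\<dots> = (\<integral>\<^sup>+ j. ?v * emeasure \<mu> (T j) \<partial>count_space C)"
      by (rule nn_integral_cmult[symmetric]) simp
    also have "\<dots> \<le> (\<integral>\<^sup>+ j. ennreal (5 ^ DIM('a)) * (\<integral>\<^sup>+ x. b x * indicator (cball (c j) (\<rho> j)) x \<partial>lborel) \<partial>count_space C)"
    proof (rule nn_integral_mono)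
      fix j assume "j \<in> space (count_space C)"
      then have j: "0 < \<rho> j" using C \<rho> by (auto simp: K_def)
      \<comment> \<open>The normalised mass of the tent over the dilated ball. The tent bound holds
        at every point of that ball, so the constant \<open>m\<close> lies below \<open>b\<close> on
        the undilated ball and can be integrated over it.\<close>
      define m where "m = emeasure \<mu> (T j) / ennreal ((5 * \<rho> j) ^ DIM('a))"
      have mb: "m \<le> b x" if "x \<in> cball (c j) (\<rho> j)" for x
      proof -
        have "emeasure \<mu> (T j) \<le> ennreal ((5 * \<rho> j) ^ DIM('a)) * b x"
          unfolding T_def using that j by (intro tent) auto
        then show ?thesis unfolding m_def using j by (simp add: divide_le_posI_ennreal mult.commute)
      qed
      have "?v * emeasure \<mu> (T j) = ?v * (m * ennreal ((5 * \<rho> j) ^ DIM('a)))"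
        unfolding m_def using j by (subst (2) mult.commute) (simp add: ennreal_times_divide_cancel)
      also have "\<dots> = ennreal (5 ^ DIM('a)) * (m * (?v * ennreal (\<rho> j ^ DIM('a))))"
        using j by (simp add: power_mult_distrib ennreal_mult mult_ac)
      also have "?v * ennreal (\<rho> j ^ DIM('a)) = emeasure lborel (cball (c j) (\<rho> j))"
        using j by (simp add: emeasure_cball flip: ennreal_mult)
      also have "m * emeasure lborel (cball (c j) (\<rho> j)) = (\<integral>\<^sup>+ x. m * indicator (cball (c j) (\<rho> j)) x \<partial>lborel)"
        by (subst nn_integral_cmult_indicator) auto
      also have "\<dots> \<le> (\<integral>\<^sup>+ x. b x * indicator (cball (c j) (\<rho> j)) x \<partial>lborel)"
        using mb by (intro nn_integral_mono) (auto split: split_indicator)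
      finally show "?v * emeasure \<mu> (T j) \<le> ennreal (5 ^ DIM('a)) * (\<integral>\<^sup>+ x. b x * indicator (cball (c j) (\<rho> j)) x \<partial>lborel)"
        by (simp add: mult_left_mono)
    qed
    also have "\<dots> = ennreal (5 ^ DIM('a)) * (\<integral>\<^sup>+ j. (\<integral>\<^sup>+ x. b x * indicator (cball (c j) (\<rho> j)) x \<partial>lborel) \<partial>count_space C)"
      by (rule nn_integral_cmult) simp
    also have "\<dots> \<le> ?R"
    proof (intro mult_left_mono nn_integral_disjoint_family_le)
      fix j assume "j \<in> C"
      then have j: "j \<in> K n" using C by auto
      show "cball (c j) (\<rho> j) \<subseteq> {x. s < H x}"
      proof
        fix x assume "x \<in> cball (c j) (\<rho> j)"
        then have "\<Phi> j \<le> H x" using j by (intro H) (auto simp: K_def)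
        moreover have "s < \<Phi> j" using j by (auto simp: K_def)
        ultimately show "x \<in> {x. s < H x}" by (auto intro: less_le_trans)
      qed
    qed (use C in \<open>auto simp: pairwise_def\<close>)
    finally show ?thesis .
  qed
  have U: "{p \<in> space \<mu>. s < \<Phi> p} = (\<Union>n. K n)"
    using real_arch_simple by (auto simp: K_def)
  have "incseq K" by (auto simp: incseq_def K_def intro: order_trans)
  then have "emeasure \<mu> {p \<in> space \<mu>. s < \<Phi> p} = (SUP n. emeasure \<mu> (K n))"
    unfolding U by (intro SUP_emeasure_incseq[symmetric]) auto
  then have "?v * emeasure \<mu> {p \<in> space \<mu>. s < \<Phi> p} = (SUP n. ?v * emeasure \<mu> (K n))"
    by (simp add: SUP_mult_left_ennreal)
  also have "\<dots> \<le> ?R" by (intro SUP_least bound)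
  finally show ?thesis .
qed

text \<open>The superlevel estimate for the measure \<open>density M w\<close>, integrated over all
  levels: Tonelli and the layer-cake formula turn the left side into the integral of
  \<open>w p * \<Phi> p\<close> and the right side into that of \<open>b x * H x\<close>.\<close>

lemma Carleson_embedding:
  fixes M :: "'b measure" and c :: "'b \<Rightarrow> 'a::euclidean_space" and \<rho> :: "'b \<Rightarrow> real"
    and \<Phi> w :: "'b \<Rightarrow> ennreal"
  assumes "sigma_finite_measure M"
    and [measurable]: "c \<in> borel_measurable M" "\<rho> \<in> borel_measurable M" "\<Phi> \<in> borel_measurable M"
      "w \<in> borel_measurable M"
    and [measurable]: "b \<in> borel_measurable borel" "H \<in> borel_measurable borel"
    and \<rho>: "\<And>p. p \<in> space M \<Longrightarrow> 0 < \<rho> p"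
    and tent: "\<And>z r x. 0 < r \<Longrightarrow> x \<in> ball z r \<Longrightarrow>
      (\<integral>\<^sup>+ p. w p * indicator {p. c p \<in> ball z r \<and> \<rho> p \<le> r} p \<partial>M) \<le> ennreal (r ^ DIM('a)) * b x"
    and H: "\<And>p x. p \<in> space M \<Longrightarrow> dist (c p) x \<le> \<rho> p \<Longrightarrow> \<Phi> p \<le> H x"
  shows "ennreal (unit_ball_vol (real DIM('a))) * (\<integral>\<^sup>+ p. w p * \<Phi> p \<partial>M)
     \<le> ennreal (5 ^ DIM('a)) * (\<integral>\<^sup>+ x. b x * H x \<partial>lborel)"
proof -
  interpret sigma_finite_measure M by fact
  interpret L: pair_sigma_finite M "lborel :: real measure" ..
  let ?v = "ennreal (unit_ball_vol (real DIM('a)))"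
  have em: "emeasure (density M w) {p \<in> space M. P p} = (\<integral>\<^sup>+ p. w p * indicator {p. P p} p \<partial>M)"
    if "{p \<in> space M. P p} \<in> sets M" for P
    using that by (subst emeasure_density) (auto intro!: nn_integral_cong split: split_indicator)
  have meas: "{p \<in> space M. c p \<in> ball z r \<and> \<rho> p \<le> r} \<in> sets M" for z r
    unfolding mem_ball by measurable
  have level: "?v * (\<integral>\<^sup>+ p. w p * indicator {p. ennreal s < \<Phi> p} p \<partial>M)
      \<le> ennreal (5 ^ DIM('a)) * (\<integral>\<^sup>+ x. b x * indicator {x. ennreal s < H x} x \<partial>lborel)" for s
  proof -
    have "?v * emeasure (density M w) {p \<in> space (density M w). ennreal s < \<Phi> p}
      \<le> ennreal (5 ^ DIM('a)) * (\<integral>\<^sup>+ x. b x * indicator {x. ennreal s < H x} x \<partial>lborel)"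
      by (rule emeasure_superlevel_Carleson[where c = c and \<rho> = \<rho>])
         (use \<rho> tent H meas in \<open>auto simp: em\<close>)
    then show ?thesis by (simp add: em)
  qed
  have "?v * (\<integral>\<^sup>+ p. w p * \<Phi> p \<partial>M)
      = ?v * (\<integral>\<^sup>+ p. w p * (\<integral>\<^sup>+ s. indicator {s. 0 < s \<and> ennreal s < \<Phi> p} s \<partial>lborel) \<partial>M)"
    by (simp add: layer_cake)
  also have "\<dots> = ?v * (\<integral>\<^sup>+ p. \<integral>\<^sup>+ s. w p * (indicator {0<..} s * indicator {p. ennreal s < \<Phi> p} p) \<partial>lborel \<partial>M)"
    by (subst nn_integral_cmult[symmetric]) (auto intro!: arg_cong2[where f = "(*)"] nn_integral_cong split: split_indicator)
  also have "\<dots> = ?v * (\<integral>\<^sup>+ s. \<integral>\<^sup>+ p. w p * (indicator {0<..} s * indicator {p. ennreal s < \<Phi> p} p) \<partial>M \<partial>lborel)"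
    by (subst L.Fubini') simp_all
  also have "\<dots> = (\<integral>\<^sup>+ s. ?v * (\<integral>\<^sup>+ p. w p * (indicator {0<..} s * indicator {p. ennreal s < \<Phi> p} p) \<partial>M) \<partial>lborel)"
    by (rule nn_integral_cmult[symmetric]) simp
  also have "\<dots> \<le> (\<integral>\<^sup>+ s. ennreal (5 ^ DIM('a)) * (\<integral>\<^sup>+ x. b x * (indicator {0<..} s * indicator {x. ennreal s < H x} x) \<partial>lborel) \<partial>lborel)"
    using level by (intro nn_integral_mono) (auto split: split_indicator)
  also have "\<dots> = ennreal (5 ^ DIM('a)) * (\<integral>\<^sup>+ s. \<integral>\<^sup>+ x. b x * (indicator {0<..} s * indicator {x. ennreal s < H x} x) \<partial>lborel \<partial>lborel)"
    by (rule nn_integral_cmult) simp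
  also have "\<dots> = ennreal (5 ^ DIM('a)) * (\<integral>\<^sup>+ x. \<integral>\<^sup>+ s. b x * (indicator {0<..} s * indicator {x. ennreal s < H x} x) \<partial>lborel \<partial>lborel)"
    by (subst lborel_pair.Fubini') simp_all
  also have "\<dots> = ennreal (5 ^ DIM('a)) * (\<integral>\<^sup>+ x. b x * (\<integral>\<^sup>+ s. indicator {s. 0 < s \<and> ennreal s < H x} s \<partial>lborel) \<partial>lborel)"
    by (subst nn_integral_cmult[symmetric]) (auto intro!: arg_cong2[where f = "(*)"] nn_integral_cong split: split_indicator)
  finally show ?thesis by (simp add: layer_cake)
qed

section \<open>Strong type of the maximal function by truncation\<close>

lemma hl_max_least:
  fixes h :: "'a::euclidean_space \<Rightarrow> ennreal"
  assumes "\<And>z r. 0 < r \<Longrightarrow> x \<in> ball z r \<Longrightarrow>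
    (\<integral>\<^sup>+ y. h y * indicator (ball z r) y \<partial>lborel) \<le> ennreal (r ^ DIM('a)) * B"
  shows "hl_max h x \<le> B"
  unfolding hl_max_def using assms by (intro SUP_least) (auto intro!: divide_le_posI_ennreal)

text \<open>Values of \<open>h\<close> up to \<open>c\<close> contribute at most \<open>c\<close>
  times the unit ball volume to every normalised average, so only the part of \<open>h\<close> above
  \<open>c\<close> has to be kept.\<close>

lemma hl_max_split:
  fixes h :: "'a::euclidean_space \<Rightarrow> ennreal"
  assumes [measurable]: "h \<in> borel_measurable borel" and "0 \<le> c"
  shows "hl_max h x \<le> hl_max (\<lambda>y. h y * indicator {y. ennreal c < h y} y) x
      + ennreal (c * unit_ball_vol (real DIM('a)))"
proof (rule hl_max_least)
  fix z and r :: real assume r: "0 < r" "x \<in> ball z r"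
  let ?h = "\<lambda>y. h y * indicator {y. ennreal c < h y} y"
  have [measurable]: "ball z r \<in> sets borel" by simp
  have "(\<integral>\<^sup>+ y. h y * indicator (ball z r) y \<partial>lborel) \<le>
      (\<integral>\<^sup>+ y. ?h y * indicator (ball z r) y + ennreal c * indicator (ball z r) y \<partial>lborel)"
    by (intro nn_integral_mono) (auto split: split_indicator)
  also have "\<dots> = (\<integral>\<^sup>+ y. ?h y * indicator (ball z r) y \<partial>lborel) + ennreal c * emeasure lborel (ball z r)"
    by (subst nn_integral_add) (simp_all add: nn_integral_cmult_indicator)
  also have "\<dots> \<le> ennreal (r ^ DIM('a)) * hl_max ?h x + ennreal c * emeasure lborel (ball z r)"
    by (intro add_right_mono hl_max_upper r)
  also have "ennreal c * emeasure lborel (ball z r) = ennreal (r ^ DIM('a)) * ennreal (c * unit_ball_vol (real DIM('a)))"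
    using r \<open>0 \<le> c\<close> by (simp add: emeasure_ball mult_ac flip: ennreal_mult)
  finally show "(\<integral>\<^sup>+ y. h y * indicator (ball z r) y \<partial>lborel) \<le> ennreal (r ^ DIM('a)) *
     (hl_max ?h x + ennreal (c * unit_ball_vol (real DIM('a))))"
    by (simp add: distrib_left)
qed

lemma unit_ball_vol_DIM_pos: "0 < unit_ball_vol (real DIM('a::euclidean_space))"
  by (rule unit_ball_vol_pos) simp

text \<open>Cutting \<open>h\<close> at height s / (2 v) leaves a low part whose maximal function is
  at most s / 2. Where the maximal function exceeds s, that of the high part exceeds s / 2, and the
  weak type bound is applied to the high part alone.\<close>

lemma hl_max_weak_type_truncated:
  fixes h :: "'a::euclidean_space \<Rightarrow> ennreal"
  defines "v \<equiv> unit_ball_vol (real DIM('a))"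
  assumes [measurable]: "h \<in> borel_measurable borel" and s: "0 < s"
  shows "ennreal s * emeasure lborel {x. ennreal s < hl_max h x}
      \<le> ennreal (2 * (v * 5 ^ DIM('a))) * (\<integral>\<^sup>+ x. h x * indicator {x. ennreal s < ennreal (2 * v) * h x} x \<partial>lborel)"
proof -
  have v: "0 < v" unfolding v_def by (rule unit_ball_vol_DIM_pos)
  let ?h = "\<lambda>y. h y * indicator {y. ennreal (s / (2 * v)) < h y} y"
  have sub: "{x. ennreal s < hl_max h x} \<subseteq> {x. ennreal (s/2) < hl_max ?h x}"
  proof (rule subsetI, rule CollectI, rule ccontr)
    fix x assume x: "x \<in> {x. ennreal s < hl_max h x}" and "\<not> ennreal (s/2) < hl_max ?h x"
    then have "hl_max ?h x \<le> ennreal (s/2)" by simp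
    then have "hl_max h x \<le> ennreal (s/2) + ennreal (s / (2 * v) * v)"
      using hl_max_split[of h "s / (2 * v)" x] s v unfolding v_def[symmetric]
      by (meson add_right_mono assms(2) divide_nonneg_pos less_imp_le mult_pos_pos order_trans zero_less_numeral)
    also have "\<dots> = ennreal s" using s v by (simp flip: ennreal_plus)
    finally show False using x by simp
  qed
  have "ennreal s * emeasure lborel {x. ennreal s < hl_max h x} \<le> ennreal s * emeasure lborel {x. ennreal (s/2) < hl_max ?h x}"
    using sub by (intro mult_left_mono emeasure_mono) auto
  also have "\<dots> = 2 * (ennreal (s/2) * emeasure lborel {x. ennreal (s/2) < hl_max ?h x})"
  proof -
    have "ennreal s = 2 * ennreal (s / 2)" using s by (simp add: ennreal_mult[symmetric] flip: ennreal_numeral)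
    then show ?thesis by (simp only: mult.assoc)
  qed
  also have "\<dots> \<le> 2 * (ennreal (v * 5 ^ DIM('a)) * (\<integral>\<^sup>+ x. ?h x \<partial>lborel))"
    unfolding v_def using s by (intro mult_left_mono hl_max_weak_type) auto
  also have "\<dots> = ennreal (2 * (v * 5 ^ DIM('a))) * (\<integral>\<^sup>+ x. ?h x \<partial>lborel)"
    using v by (subst ennreal_mult) (auto simp: mult.assoc)
  also have "{y. ennreal (s / (2 * v)) < h y} = {x. ennreal s < ennreal (2 * v) * h x}"
  proof -
    have "ennreal (s / (2 * v)) < u \<longleftrightarrow> ennreal s < ennreal (2 * v) * u" for u :: ennreal
      using v s by (cases u) (auto simp: ennreal_less_iff field_simps ennreal_mult_top ennreal_mult[symmetric])
    then show ?thesis by simp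
  qed
  finally show ?thesis .
qed

text \<open>Marcinkiewicz interpolation between the weak type bound and boundedness. The layer-cake
  formula and the truncated weak bound leave, for each \<open>x\<close>, the integral of s powr (q -
  2) over 0 < s < 2 v h(x); it converges at 0 because 1 < q, and it is the source of the factor q /
  (q - 1) in \<open>C\<close>.\<close>

lemma hl_max_strong_type:
  assumes q: "1 < q"
  shows "\<exists>C\<ge>0. \<forall>h :: 'a::euclidean_space \<Rightarrow> ennreal. h \<in> borel_measurable borel \<longrightarrow>
    (\<integral>\<^sup>+ x. ennreal_pow (hl_max h x) q \<partial>lborel) \<le> ennreal C * (\<integral>\<^sup>+ x. ennreal_pow (h x) q \<partial>lborel)"
proof -
  define v where "v = unit_ball_vol (real DIM('a))"
  have v: "0 < v" unfolding v_def by (rule unit_ball_vol_DIM_pos)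
  define K where "K = 2 * (v * 5 ^ DIM('a))"
  have K: "0 < K" using v by (simp add: K_def)
  define C where "C = K * (q / (q - 1)) * (2 * v) powr (q - 1)"
  have "(\<integral>\<^sup>+ x. ennreal_pow (hl_max h x) q \<partial>lborel) \<le> ennreal C * (\<integral>\<^sup>+ x. ennreal_pow (h x) q \<partial>lborel)"
    if [measurable]: "h \<in> borel_measurable borel" for h :: "'a \<Rightarrow> ennreal"
  proof -
        have "(\<integral>\<^sup>+ x. ennreal_pow (hl_max h x) q \<partial>lborel) =
       (\<integral>\<^sup>+ x. \<integral>\<^sup>+ s. ennreal (q * s powr (q - 1)) * indicator {s. 0 < s \<and> ennreal s < hl_max h x} s \<partial>lborel \<partial>lborel)"
      using q by (simp add: layer_cake_pow)
    also have "\<dots> = (\<integral>\<^sup>+ x. \<integral>\<^sup>+ s. ennreal (q * s powr (q - 1)) * (indicator {0<..} s * indicator {x. ennreal s < hl_max h x} x) \<partial>lborel \<partial>lborel)"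
      by (intro nn_integral_cong) (auto split: split_indicator)
    also have "\<dots> = (\<integral>\<^sup>+ s. \<integral>\<^sup>+ x. ennreal (q * s powr (q - 1)) * (indicator {0<..} s * indicator {x. ennreal s < hl_max h x} x) \<partial>lborel \<partial>lborel)"
      by (subst lborel_pair.Fubini') simp_all
    also have "\<dots> = (\<integral>\<^sup>+ s. ennreal (q * s powr (q - 1)) * indicator {0<..} s * emeasure lborel {x. ennreal s < hl_max h x} \<partial>lborel)"
      by (rule nn_integral_cong) (simp add: nn_integral_cmult mult.assoc)
    also have "\<dots> \<le> (\<integral>\<^sup>+ s. ennreal (K * q * s powr (q - 2)) * indicator {0<..} s *
        (\<integral>\<^sup>+ x. h x * indicator {x. ennreal s < ennreal (2 * v) * h x} x \<partial>lborel) \<partial>lborel)"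
    proof (rule nn_integral_mono)
      fix s :: real
      let ?J = "\<integral>\<^sup>+ x. h x * indicator {x. ennreal s < ennreal (2 * v) * h x} x \<partial>lborel"
      show "ennreal (q * s powr (q - 1)) * indicator {0<..} s * emeasure lborel {x. ennreal s < hl_max h x}
        \<le> ennreal (K * q * s powr (q - 2)) * indicator {0<..} s * ?J"
      proof (cases "0 < s")
        case True
        have "s powr (q - 1) = s powr (q - 2) * s"
          using powr_add[of s "q - 2" 1] True by simp
        then have "ennreal (q * s powr (q - 1)) = ennreal (q * s powr (q - 2)) * ennreal s"
          using q True by (subst ennreal_mult[symmetric]) (auto simp: mult.assoc)
        then have "ennreal (q * s powr (q - 1)) * emeasure lborel {x. ennreal s < hl_max h x}
          = ennreal (q * s powr (q - 2)) * (ennreal s * emeasure lborel {x. ennreal s < hl_max h x})"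
          by (simp only: mult.assoc)
        also have "\<dots> \<le> ennreal (q * s powr (q - 2)) * (ennreal K * ?J)"
          unfolding K_def v_def using True by (intro mult_left_mono hl_max_weak_type_truncated) auto
        also have "\<dots> = ennreal (K * q * s powr (q - 2)) * ?J"
          using q K by (simp add: ennreal_mult mult_ac)
        finally show ?thesis using True by simp
      qed simp
    qed
    also have "\<dots> = (\<integral>\<^sup>+ s. \<integral>\<^sup>+ x. ennreal (K * q * s powr (q - 2)) * indicator {0<..} s *
        (h x * indicator {x. ennreal s < ennreal (2 * v) * h x} x) \<partial>lborel \<partial>lborel)"
      by (rule nn_integral_cong, rule nn_integral_cmult[symmetric]) simp
    also have "\<dots> = (\<integral>\<^sup>+ x. \<integral>\<^sup>+ s. ennreal (K * q * s powr (q - 2)) * indicator {0<..} s *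
        (h x * indicator {x. ennreal s < ennreal (2 * v) * h x} x) \<partial>lborel \<partial>lborel)"
      by (subst lborel_pair.Fubini') simp_all
    also have "\<dots> = (\<integral>\<^sup>+ x. ennreal (K * (q / (q - 1))) * h x * (\<integral>\<^sup>+ s. ennreal ((q - 1) * s powr ((q - 1) - 1)) *
        indicator {s. 0 < s \<and> ennreal s < ennreal (2 * v) * h x} s \<partial>lborel) \<partial>lborel)"
    proof (rule nn_integral_cong)
      fix x :: 'a
      have "(\<integral>\<^sup>+ s. ennreal (K * q * s powr (q - 2)) * indicator {0<..} s *
        (h x * indicator {x. ennreal s < ennreal (2 * v) * h x} x) \<partial>lborel) =
        (\<integral>\<^sup>+ s. ennreal (K * (q / (q - 1))) * h x * (ennreal ((q - 1) * s powr ((q - 1) - 1)) *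
        indicator {s. 0 < s \<and> ennreal s < ennreal (2 * v) * h x} s) \<partial>lborel)"
      proof (rule nn_integral_cong)
        fix s :: real
        have "ennreal (K * q * s powr (q - 2)) = ennreal (K * (q / (q - 1))) * ennreal ((q - 1) * s powr ((q - 1) - 1))"
          using q K by (subst ennreal_mult[symmetric]) auto
        then show "ennreal (K * q * s powr (q - 2)) * indicator {0<..} s *
          (h x * indicator {x. ennreal s < ennreal (2 * v) * h x} x) =
          ennreal (K * (q / (q - 1))) * h x * (ennreal ((q - 1) * s powr ((q - 1) - 1)) *
          indicator {s. 0 < s \<and> ennreal s < ennreal (2 * v) * h x} s)"
          by (auto split: split_indicator simp: mult_ac)
      qed
      also have "\<dots> = ennreal (K * (q / (q - 1))) * h x * (\<integral>\<^sup>+ s. ennreal ((q - 1) * s powr ((q - 1) - 1)) *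
        indicator {s. 0 < s \<and> ennreal s < ennreal (2 * v) * h x} s \<partial>lborel)"
        by (rule nn_integral_cmult) simp
      finally show "(\<integral>\<^sup>+ s. ennreal (K * q * s powr (q - 2)) * indicator {0<..} s *
        (h x * indicator {x. ennreal s < ennreal (2 * v) * h x} x) \<partial>lborel) = \<dots>" .
    qed
    also have "\<dots> = (\<integral>\<^sup>+ x. ennreal C * ennreal_pow (h x) q \<partial>lborel)"
    proof (rule nn_integral_cong)
      fix x
      have "(\<integral>\<^sup>+ s. ennreal ((q - 1) * s powr ((q - 1) - 1)) *
        indicator {s. 0 < s \<and> ennreal s < ennreal (2 * v) * h x} s \<partial>lborel) = ennreal ((2 * v) powr (q - 1)) * ennreal_pow (h x) (q - 1)"
        using q v by (subst layer_cake_pow) (auto simp: ennreal_pow_mult ennreal_pow_ennreal)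
      then have "ennreal (K * (q / (q - 1))) * h x * (\<integral>\<^sup>+ s. ennreal ((q - 1) * s powr ((q - 1) - 1)) *
        indicator {s. 0 < s \<and> ennreal s < ennreal (2 * v) * h x} s \<partial>lborel)
        = (ennreal (K * (q / (q - 1))) * ennreal ((2 * v) powr (q - 1))) * (ennreal_pow (h x) 1 * ennreal_pow (h x) (q - 1))"
        by (simp add: mult_ac ennreal_pow_one)
      also have "\<dots> = ennreal C * ennreal_pow (h x) q"
      proof -
        have "ennreal C = ennreal (K * (q / (q - 1))) * ennreal ((2 * v) powr (q - 1))"
          unfolding C_def using q K by (intro ennreal_mult) auto
        then show ?thesis using q by (simp add: ennreal_pow_add)
      qed
      finally show "ennreal (K * (q / (q - 1))) * h x * (\<integral>\<^sup>+ s. ennreal ((q - 1) * s powr ((q - 1) - 1)) *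
        indicator {s. 0 < s \<and> ennreal s < ennreal (2 * v) * h x} s \<partial>lborel) = \<dots>" .
    qed
    also have "\<dots> = ennreal C * (\<integral>\<^sup>+ x. ennreal_pow (h x) q \<partial>lborel)"
      by (rule nn_integral_cmult) simp
    finally show ?thesis .
  qed
  moreover have "0 \<le> C" using q K by (simp add: C_def)
  ultimately show ?thesis by blast
qed

text \<open>The weight is a superposition of indicators of balls of radius s R with density of order
  (1 + s) powr (- a - 1). Such a ball has mass at most of order ((1 + s) R)^d times the maximal
  function, so the integral in \<open>s\<close> converges because d < a. The enlarged balls also
  contain \<open>x'\<close>, hence the maximal function may be evaluated anywhere within distance
  \<open>R\<close> of the centre.\<close>

lemma nn_integral_kernel_le_hl_max:
  fixes h :: "'a::euclidean_space \<Rightarrow> ennreal"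
  assumes [measurable]: "h \<in> borel_measurable borel" and a: "real DIM('a) < a" and R: "0 < R"
    and x': "dist x x' \<le> R"
  shows "(\<integral>\<^sup>+ y. h y * ennreal ((1 + norm (y - x) / R) powr (- a)) \<partial>lborel)
    \<le> ennreal (2 ^ DIM('a) * a / (a - real DIM('a)) * R ^ DIM('a)) * hl_max h x'"
proof -
    let ?d = "real DIM('a)"
  have d0: "0 < ?d" by simp
  have "(\<integral>\<^sup>+ y. h y * ennreal ((1 + norm (y - x) / R) powr (- a)) \<partial>lborel)
     = (\<integral>\<^sup>+ y. h y * (\<integral>\<^sup>+ s. ennreal (a * (1 + s) powr (- a - 1)) * indicator {norm (y - x) / R..} s \<partial>lborel) \<partial>lborel)"
    using a R d0 by (subst nn_integral_one_plus_powr) (auto intro: less_trans)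
  also have "\<dots> = (\<integral>\<^sup>+ y. \<integral>\<^sup>+ s. ennreal (a * (1 + s) powr (- a - 1)) * (h y * indicator {y. norm (y - x) / R \<le> s} y) \<partial>lborel \<partial>lborel)"
    by (subst nn_integral_cmult[symmetric]) (auto intro!: nn_integral_cong split: split_indicator simp: mult_ac)
  also have "\<dots> = (\<integral>\<^sup>+ s. \<integral>\<^sup>+ y. ennreal (a * (1 + s) powr (- a - 1)) * (h y * indicator {y. norm (y - x) / R \<le> s} y) \<partial>lborel \<partial>lborel)"
    by (subst lborel_pair.Fubini') simp_all
  also have "\<dots> = (\<integral>\<^sup>+ s. ennreal (a * (1 + s) powr (- a - 1)) * (\<integral>\<^sup>+ y. h y * indicator {y. norm (y - x) / R \<le> s} y \<partial>lborel) \<partial>lborel)"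
    by (rule nn_integral_cong, rule nn_integral_cmult) simp
  also have "\<dots> \<le> (\<integral>\<^sup>+ s. ennreal (2 ^ DIM('a) * a / (a - ?d) * R ^ DIM('a)) * hl_max h x' *
      (ennreal ((a - ?d) * (1 + s) powr (- (a - ?d) - 1)) * indicator {0..} s) \<partial>lborel)"
  proof (rule nn_integral_mono)
    fix s :: real
    let ?J = "\<integral>\<^sup>+ y. h y * indicator {y. norm (y - x) / R \<le> s} y \<partial>lborel"
    show "ennreal (a * (1 + s) powr (- a - 1)) * ?J
      \<le> ennreal (2 ^ DIM('a) * a / (a - ?d) * R ^ DIM('a)) * hl_max h x' *
      (ennreal ((a - ?d) * (1 + s) powr (- (a - ?d) - 1)) * indicator {0..} s)"
    proof (cases "0 \<le> s")
      case True
      \<comment> \<open>The radius 2 (1 + s) R turns the closed ball into an open one, also for s =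
        0, and is large enough to contain \<open>x'\<close>.\<close>
      have sub: "{y. norm (y - x) / R \<le> s} \<subseteq> ball x (2 * (1 + s) * R)"
      proof
        fix y assume "y \<in> {y. norm (y - x) / R \<le> s}"
        then have "dist x y \<le> s * R" using R by (simp add: field_simps dist_norm norm_minus_commute)
        also have "\<dots> < 2 * (1 + s) * R" using True R by (intro mult_strict_right_mono) auto
        finally show "y \<in> ball x (2 * (1 + s) * R)" by simp
      qed
      have "?J \<le> (\<integral>\<^sup>+ y. h y * indicator (ball x (2 * (1 + s) * R)) y \<partial>lborel)"
        using sub by (intro nn_integral_mono mult_left_mono) (auto split: split_indicator)
      also have "\<dots> \<le> ennreal ((2 * (1 + s) * R) ^ DIM('a)) * hl_max h x'"
      proof (rule hl_max_upper)
        have "R < 2 * (1 + s) * R" using True R by simp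
        then show "x' \<in> ball x (2 * (1 + s) * R)" using x' by simp
      qed (use True R in auto)
      finally have "ennreal (a * (1 + s) powr (- a - 1)) * ?J \<le>
         ennreal (a * (1 + s) powr (- a - 1)) * (ennreal ((2 * (1 + s) * R) ^ DIM('a)) * hl_max h x')"
        by (rule mult_left_mono) simp
      also have "\<dots> = ennreal (a * (1 + s) powr (- a - 1) * (2 * (1 + s) * R) ^ DIM('a)) * hl_max h x'"
        using a d0 R True by (subst ennreal_mult) (auto simp: mult_ac)
      also have "a * (1 + s) powr (- a - 1) * (2 * (1 + s) * R) ^ DIM('a)
         = (2 ^ DIM('a) * a / (a - ?d) * R ^ DIM('a)) * ((a - ?d) * (1 + s) powr (- (a - ?d) - 1))"
      proof -
        have "(1 + s) powr (- (a - ?d) - 1) = (1 + s) powr (- a - 1) * (1 + s) powr ?d"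
          using True by (subst powr_add[symmetric]) (simp add: algebra_simps)
        also have "(1 + s) powr ?d = (1 + s) ^ DIM('a)" using True by (intro powr_realpow) simp
        finally have "(1 + s) powr (- (a - ?d) - 1) = (1 + s) powr (- a - 1) * (1 + s) ^ DIM('a)" .
        moreover have "(2 * (1 + s) * R) ^ DIM('a) = 2 ^ DIM('a) * (1 + s) ^ DIM('a) * R ^ DIM('a)"
          by (simp only: power_mult_distrib)
        ultimately show ?thesis using a by (simp only:) simp
      qed
      also have "ennreal \<dots> = ennreal (2 ^ DIM('a) * a / (a - ?d) * R ^ DIM('a)) * ennreal ((a - ?d) * (1 + s) powr (- (a - ?d) - 1))"
        using a d0 R by (intro ennreal_mult) auto
      finally show ?thesis using True by (simp add: mult_ac)
    next
      case False
      have "{y. norm (y - x) / R \<le> s} = {}"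
      proof -
        have "\<not> norm (y - x) / R \<le> s" for y
          using False R by (metis divide_nonneg_pos norm_ge_zero order_trans)
        then show ?thesis by auto
      qed
      then show ?thesis by simp
    qed
  qed
  also have "\<dots> = ennreal (2 ^ DIM('a) * a / (a - ?d) * R ^ DIM('a)) * hl_max h x' *
      (\<integral>\<^sup>+ s. ennreal ((a - ?d) * (1 + s) powr (- (a - ?d) - 1)) * indicator {0..} s \<partial>lborel)"
    by (rule nn_integral_cmult) simp
  also have "(\<integral>\<^sup>+ s. ennreal ((a - ?d) * (1 + s) powr (- (a - ?d) - 1)) * indicator {0..} s \<partial>lborel) = 1"
    using a by (subst nn_integral_one_plus_powr) auto
  finally show ?thesis by simp
qed

lemma hl_max_one_le: "hl_max (\<lambda>_. 1) (x::'a::euclidean_space) \<le> ennreal (unit_ball_vol (real DIM('a)))"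
  by (rule hl_max_least) (simp add: emeasure_ball mult_ac flip: ennreal_mult)

lemma nn_integral_kernel_le:
  fixes x :: "'a::euclidean_space"
  assumes a: "real DIM('a) < a" and R: "0 < R"
  shows "(\<integral>\<^sup>+ y. ennreal ((1 + norm (y - x) / R) powr (- a)) \<partial>lborel)
    \<le> ennreal (2 ^ DIM('a) * a / (a - real DIM('a)) * unit_ball_vol (real DIM('a)) * R ^ DIM('a))"
proof -
  have d0: "0 < real DIM('a)" by simp
  have "(\<integral>\<^sup>+ y. ennreal ((1 + norm (y - x) / R) powr (- a)) \<partial>lborel)
     \<le> ennreal (2 ^ DIM('a) * a / (a - real DIM('a)) * R ^ DIM('a)) * hl_max (\<lambda>_. 1) x"
    using nn_integral_kernel_le_hl_max[of "\<lambda>_. 1" a R x x] assms by simp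
  also have "\<dots> \<le> ennreal (2 ^ DIM('a) * a / (a - real DIM('a)) * R ^ DIM('a)) * ennreal (unit_ball_vol (real DIM('a)))"
    by (intro mult_left_mono hl_max_one_le) simp
  also have "\<dots> = ennreal (2 ^ DIM('a) * a / (a - real DIM('a)) * unit_ball_vol (real DIM('a)) * R ^ DIM('a))"
    using a R d0 by (subst ennreal_mult[symmetric]) (auto simp: mult_ac unit_ball_vol_nonneg)
  finally show ?thesis .
qed

subsection \<open>Square functions under a Carleson condition\<close>

text \<open>Testing against A powr (q - 1) would produce the L^q integral of \<open>A\<close> on the
  left, while the maximal theorem for \<open>q\<close> and its conjugate exponent bounds the right
  by a multiple of the integral of F powr q plus a small multiple of the same L^q integral. That
  multiple can be absorbed only if it is finite, so truncated test functions are used and the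
  truncation is removed by monotone convergence.\<close>

lemma Lq_bound_by_duality:
  fixes q K :: real
  assumes q: "1 < q" and K: "0 \<le> K"
  shows "\<exists>C\<ge>0. \<forall>A F :: 'a::euclidean_space \<Rightarrow> ennreal.
    A \<in> borel_measurable borel \<longrightarrow> F \<in> borel_measurable borel \<longrightarrow>
    (\<forall>h \<in> borel_measurable borel. (\<integral>\<^sup>+ x. A x * h x \<partial>lborel) \<le> ennreal K * (\<integral>\<^sup>+ x. hl_max F x * hl_max h x \<partial>lborel)) \<longrightarrow>
    (\<integral>\<^sup>+ x. ennreal_pow (A x) q \<partial>lborel) \<le> ennreal C * (\<integral>\<^sup>+ x. ennreal_pow (F x) q \<partial>lborel)"
proof -
  define q' where "q' = q / (q - 1)"
  have q': "1 < q'" "(q - 1) * q' = q" using q by (auto simp: q'_def field_simps)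
  obtain C1 where C1: "0 \<le> C1" "\<And>h :: 'a \<Rightarrow> ennreal. h \<in> borel_measurable borel \<Longrightarrow>
    (\<integral>\<^sup>+ x. ennreal_pow (hl_max h x) q \<partial>lborel) \<le> ennreal C1 * (\<integral>\<^sup>+ x. ennreal_pow (h x) q \<partial>lborel)"
    using hl_max_strong_type[OF q] by blast
  obtain C2 where C2: "0 \<le> C2" "\<And>h :: 'a \<Rightarrow> ennreal. h \<in> borel_measurable borel \<Longrightarrow>
    (\<integral>\<^sup>+ x. ennreal_pow (hl_max h x) q' \<partial>lborel) \<le> ennreal C2 * (\<integral>\<^sup>+ x. ennreal_pow (h x) q' \<partial>lborel)"
    using hl_max_strong_type[OF q'(1)] by blast
  \<comment> \<open>Chosen so that, after Young's inequality with K split into (K / \<delta>) and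
    \<delta>, the term with the test function gets a coefficient of at most 1 / 2. The
    \<open>+ 1\<close> guards against \<open>C2 = 0\<close>.\<close>
  define \<delta> where "\<delta> = (1 / (2 * (C2 + 1))) powr (1 / q')"
  have \<delta>: "0 < \<delta>" "\<delta> powr q' * C2 \<le> 1 / 2"
  proof -
    show "0 < \<delta>" using C2(1) by (simp add: \<delta>_def)
    have "\<delta> powr q' = 1 / (2 * (C2 + 1))" using C2(1) q' by (simp add: \<delta>_def powr_powr)
    then have "\<delta> powr q' * (C2 + 1) = 1 / 2" using C2(1) by (simp add: field_simps)
    moreover have "\<delta> powr q' * C2 \<le> \<delta> powr q' * (C2 + 1)" by (intro mult_left_mono) auto
    ultimately show "\<delta> powr q' * C2 \<le> 1 / 2" by simp
  qed
  define C where "C = 2 * ((K / \<delta>) powr q * C1)"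
  have "(\<integral>\<^sup>+ x. ennreal_pow (A x) q \<partial>lborel) \<le> ennreal C * (\<integral>\<^sup>+ x. ennreal_pow (F x) q \<partial>lborel)"
    if [measurable]: "A \<in> borel_measurable borel" "F \<in> borel_measurable borel"
      and dual: "\<And>h. h \<in> borel_measurable borel \<Longrightarrow>
        (\<integral>\<^sup>+ x. A x * h x \<partial>lborel) \<le> ennreal K * (\<integral>\<^sup>+ x. hl_max F x * hl_max h x \<partial>lborel)"
    for A F :: "'a \<Rightarrow> ennreal"
  proof -
    \<comment> \<open>Cut off in height and in space, which makes the integral of \<open>g n\<close>
      finite; \<open>h n\<close> is the matching test function, whose power with exponent
      \<open>q'\<close> is \<open>g n\<close>.\<close>
    define g where "g n x = ennreal_pow (min (A x) (of_nat n)) q * indicator (ball 0 (real n)) x" for n x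
    define h where "h n x = ennreal_pow (min (A x) (of_nat n)) (q - 1) * indicator (ball 0 (real n)) x" for n x
    have [measurable]: "ball (0::'a) (real n) \<in> sets borel" for n by simp
    have [measurable]: "g n \<in> borel_measurable borel" "h n \<in> borel_measurable borel" for n
      unfolding g_def h_def by measurable
    let ?IF = "\<integral>\<^sup>+ x. ennreal_pow (F x) q \<partial>lborel"
    have bound: "(\<integral>\<^sup>+ x. g n x \<partial>lborel) \<le> ennreal C * ?IF" for n
    proof -
      let ?X = "\<integral>\<^sup>+ x. g n x \<partial>lborel"
      let ?Y = "ennreal ((K / \<delta>) powr q * C1) * ?IF"
      have "?X \<le> (\<integral>\<^sup>+ x. ennreal (real n powr q) * indicator (ball (0::'a) (real n)) x \<partial>lborel)"
      proof (rule nn_integral_mono)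
        fix x
        have "ennreal_pow (min (A x) (of_nat n)) q \<le> ennreal_pow (ennreal (real n)) q"
          using q by (intro ennreal_pow_mono) (auto simp: ennreal_of_nat_eq_real_of_nat)
        then show "g n x \<le> ennreal (real n powr q) * indicator (ball 0 (real n)) x"
          by (auto simp: g_def ennreal_pow_ennreal split: split_indicator)
      qed
      also have "\<dots> < top"
        by (simp add: nn_integral_cmult_indicator emeasure_ball ennreal_mult_less_top)
      finally have fin: "?X < top" .
      have hq: "ennreal_pow (h n x) q' = g n x" for x
        using q q' by (auto simp: h_def g_def ennreal_pow_pow split: split_indicator)
      have "?X \<le> (\<integral>\<^sup>+ x. A x * h n x \<partial>lborel)"
      proof (intro nn_integral_mono)
        fix x
        let ?m = "min (A x) (of_nat n)"
        have "ennreal_pow ?m q = ?m * ennreal_pow ?m (q - 1)"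
          using q ennreal_pow_add[of 1 "q - 1" ?m] by (simp add: ennreal_pow_one)
        also have "\<dots> \<le> A x * ennreal_pow ?m (q - 1)" by (intro mult_right_mono) auto
        finally show "g n x \<le> A x * h n x" by (auto simp: g_def h_def split: split_indicator)
      qed
      also have "\<dots> \<le> ennreal K * (\<integral>\<^sup>+ x. hl_max F x * hl_max (h n) x \<partial>lborel)" by (rule dual) simp
      also have "\<dots> = (\<integral>\<^sup>+ x. (ennreal (K / \<delta>) * hl_max F x) * (ennreal \<delta> * hl_max (h n) x) \<partial>lborel)"
      proof -
        have "ennreal K = ennreal (K / \<delta>) * ennreal \<delta>" using K \<delta> by (subst ennreal_mult[symmetric]) auto
        then have "ennreal K * (\<integral>\<^sup>+ x. hl_max F x * hl_max (h n) x \<partial>lborel)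
          = (\<integral>\<^sup>+ x. (ennreal (K / \<delta>) * ennreal \<delta>) * (hl_max F x * hl_max (h n) x) \<partial>lborel)"
          by (simp add: nn_integral_cmult)
        also have "\<dots> = (\<integral>\<^sup>+ x. (ennreal (K / \<delta>) * hl_max F x) * (ennreal \<delta> * hl_max (h n) x) \<partial>lborel)"
          by (intro nn_integral_cong) (simp add: mult_ac)
        finally show ?thesis .
      qed
      also have "\<dots> \<le> (\<integral>\<^sup>+ x. ennreal_pow (ennreal (K / \<delta>) * hl_max F x) q + ennreal_pow (ennreal \<delta> * hl_max (h n) x) q' \<partial>lborel)"
        by (intro nn_integral_mono ennreal_pow_Young q) (simp add: q'_def)
      also have "\<dots> = (\<integral>\<^sup>+ x. ennreal ((K / \<delta>) powr q) * ennreal_pow (hl_max F x) q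
          + ennreal (\<delta> powr q') * ennreal_pow (hl_max (h n) x) q' \<partial>lborel)"
        using q q' K \<delta> by (simp add: ennreal_pow_mult ennreal_pow_ennreal)
      also have "\<dots> = ennreal ((K / \<delta>) powr q) * (\<integral>\<^sup>+ x. ennreal_pow (hl_max F x) q \<partial>lborel)
          + ennreal (\<delta> powr q') * (\<integral>\<^sup>+ x. ennreal_pow (hl_max (h n) x) q' \<partial>lborel)"
        by (subst nn_integral_add) (simp_all add: nn_integral_cmult)
      also have "\<dots> \<le> ennreal ((K / \<delta>) powr q) * (ennreal C1 * ?IF)
          + ennreal (\<delta> powr q') * (ennreal C2 * (\<integral>\<^sup>+ x. ennreal_pow (h n x) q' \<partial>lborel))"
        by (intro add_mono mult_left_mono C1 C2) auto
      also have "\<dots> = ?Y + ennreal (\<delta> powr q' * C2) * ?X"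
        using C1 C2 by (simp add: hq ennreal_mult mult.assoc)
      also have "\<dots> \<le> ?Y + ennreal (1 / 2) * ?X"
        using \<delta> by (intro add_left_mono mult_right_mono ennreal_leI) auto
      finally have le: "?X \<le> ?Y + ennreal (1 / 2) * ?X" .
      \<comment> \<open>Absorption of half of \<open>?X\<close>, legitimate because
        \<open>?X\<close> is finite.\<close>
      have "?X \<le> 2 * ?Y"
      proof (cases "?Y")
        case (real y)
        obtain z where z: "?X = ennreal z" "0 \<le> z" using fin by (cases ?X) auto
        have "ennreal z \<le> ennreal (y + 1 / 2 * z)"
        proof -
          have "ennreal (y + 1 / 2 * z) = ennreal y + ennreal (1 / 2) * ennreal z"
            using real z by (subst ennreal_plus) (auto simp only: ennreal_mult[symmetric] intro: ennreal_mult)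
          then show ?thesis using le unfolding real z by (simp only:)
        qed
        then have "z \<le> y + 1 / 2 * z" using real z by (subst (asm) ennreal_le_iff) auto
        then have "ennreal z \<le> ennreal (2 * y)" by (intro ennreal_leI) simp
        also have "\<dots> = 2 * ?Y" using real by (simp add: ennreal_mult)
        finally show ?thesis using z by simp
      qed (simp add: ennreal_mult_top)
      also have "\<dots> = ennreal C * ?IF"
      proof -
        have "ennreal C = 2 * ennreal ((K / \<delta>) powr q * C1)"
          unfolding C_def using C1 by (subst ennreal_mult) auto
        then show ?thesis by (simp only: mult.assoc)
      qed
      finally show ?thesis .
    qed
    have sup: "(SUP n. g n x) = ennreal_pow (A x) q" for x
    proof (rule antisym)
      show "(SUP n. g n x) \<le> ennreal_pow (A x) q"
        unfolding g_def using q
        by (intro SUP_least) (auto intro!: ennreal_pow_mono split: split_indicator)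
      obtain N :: nat where N: "norm x < real N" using reals_Archimedean2 by blast
      show "ennreal_pow (A x) q \<le> (SUP n. g n x)"
      proof (cases "A x")
        case (real r)
        obtain M :: nat where M: "r \<le> real M" using real_arch_simple by blast
        let ?n = "max N M"
        have "min (A x) (of_nat ?n) = A x"
          using real M by (auto simp: min_def ennreal_of_nat_eq_real_of_nat)
        then have "ennreal_pow (A x) q = g ?n x"
          using N unfolding g_def by (simp del: of_nat_max)
        then show ?thesis by (simp only:) (rule SUP_upper, simp)
      next
        case top
        have "of_nat m \<le> (SUP n. g n x)" for m :: nat
        proof -
          let ?n = "max N (Suc m)"
          have "of_nat m \<le> ennreal (real ?n powr 1)" by (simp add: ennreal_of_nat_eq_real_of_nat)
          also have "\<dots> \<le> ennreal (real ?n powr q)" using q by (intro ennreal_leI powr_mono) auto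
          also have "\<dots> = ennreal_pow (of_nat ?n) q" by (simp only: ennreal_of_nat_eq_real_of_nat ennreal_pow_ennreal of_nat_0_le_iff)
          also have "\<dots> = g ?n x" using N top unfolding g_def by (auto simp del: of_nat_max split: split_indicator)
          also have "\<dots> \<le> (SUP n. g n x)" by (rule SUP_upper) simp
          finally show ?thesis .
        qed
        then have "(SUP m. of_nat m) \<le> (SUP n. g n x)" by (rule SUP_least)
        then show ?thesis using top by (simp add: ennreal_SUP_of_nat_eq_top top_unique)
      qed
    qed
    have mono: "incseq g"
      unfolding incseq_def le_fun_def g_def using q
      by (auto intro!: ennreal_pow_mono min.mono split: split_indicator)
    have "(\<integral>\<^sup>+ x. ennreal_pow (A x) q \<partial>lborel) = (SUP n. \<integral>\<^sup>+ x. g n x \<partial>lborel)"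
      unfolding sup[symmetric] by (rule nn_integral_monotone_convergence_SUP[OF mono]) simp
    also have "\<dots> \<le> ennreal C * ?IF" by (intro SUP_least bound)
    finally show ?thesis .
  qed
  moreover have "0 \<le> C" using C1 by (simp add: C_def)
  ultimately show ?thesis by blast
qed

text \<open>With r = t powr (2 / \<alpha>) the kernel is the dilation by \<open>r\<close>, divided
  by r^d, of a weight with decay exponent l d. This is the shape to which the bound by the maximal
  function applies, the exponent exceeding d once 1 < l.\<close>

lemma K_kernel_eq:
  fixes x :: "'a::euclidean_space" and \<alpha> :: real
  assumes "0 < t"
  defines "r \<equiv> t powr (2 / \<alpha>)"
  shows "K_kernel \<alpha> l t x = 1 / r ^ DIM('a) * (1 + norm x / r) powr (- (l * real DIM('a)))"
proof -
  have r: "0 < r" using assms by simp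
  have "t powr (- 2 * real DIM('a) / \<alpha>) = r powr (- real DIM('a))"
    by (simp add: r_def powr_powr)
  also have "\<dots> = 1 / r ^ DIM('a)" using r by (simp add: powr_minus powr_realpow field_simps)
  finally have 1: "t powr (- 2 * real DIM('a) / \<alpha>) = 1 / r ^ DIM('a)" .
  have "r / (r + norm x) = 1 / (1 + norm x / r)" using r by (simp add: field_simps)
  then have "(r / (r + norm x)) powr (l * real DIM('a)) = (1 / (1 + norm x / r)) powr (l * real DIM('a))" by simp
  also have "\<dots> = (1 + norm x / r) powr (- (l * real DIM('a)))"
    using r by (simp add: powr_divide powr_minus field_simps)
  finally show ?thesis unfolding K_kernel_def using 1 by (simp add: r_def)
qed

lemma measurable_K_kernel [measurable]:
  assumes [measurable]: "f \<in> borel_measurable M" "g \<in> borel_measurable M"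
  shows "(\<lambda>p. K_kernel \<alpha> l (f p) (g p)) \<in> borel_measurable M"
  unfolding K_kernel_def by measurable

text \<open>All that matters about the extension is put into the hypothesis on boxes, so that
  \<open>\<gamma>\<close> and \<open>F\<close> are arbitrary. For 1 < q the weighted integral of
  \<open>F\<close> is dominated by the maximal function and duality applies. For q = 1 the maximal
  function is not bounded; there the test function is 1, boxes with growing \<open>R\<close> exhaust
  the half-space, and the weight is at most 1.\<close>

theorem square_function_bound:
  fixes \<alpha> l a q C0 :: real
  assumes \<alpha>: "0 < \<alpha>" and l: "1 < l" and a: "real DIM('a::euclidean_space) < a" and q: "1 \<le> q" and C0: "0 \<le> C0"
  shows "\<exists>C\<ge>0. \<forall>(\<gamma> :: real \<Rightarrow> 'a \<Rightarrow> ennreal) F.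
    (\<lambda>(t, y). \<gamma> t y) \<in> borel_measurable (lborel \<Otimes>\<^sub>M lborel) \<longrightarrow> F \<in> borel_measurable borel \<longrightarrow>
    (\<forall>x0 R. 0 < R \<longrightarrow> (\<integral>\<^sup>+ t. \<integral>\<^sup>+ y. ennreal t * \<gamma> t y * (indicator {t. 0 < t \<and> t powr (2 / \<alpha>) \<le> R} t * indicator (ball x0 R) y) \<partial>lborel \<partial>lborel)
       \<le> ennreal C0 * (\<integral>\<^sup>+ y. F y * ennreal ((1 + norm (y - x0) / R) powr (- a)) \<partial>lborel)) \<longrightarrow>
    (\<integral>\<^sup>+ x. ennreal_pow (\<integral>\<^sup>+ t \<in> {0<..}. (ennreal t * K_conv \<alpha> l t (\<gamma> t) x) \<partial>lborel) q \<partial>lborel)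
      \<le> ennreal C * (\<integral>\<^sup>+ x. ennreal_pow (F x) q \<partial>lborel)"
proof -
  let ?d = "real DIM('a)"
  have d0: "0 < ?d" by simp
  define v where "v = unit_ball_vol ?d"
  have v: "0 < v" unfolding v_def by (rule unit_ball_vol_DIM_pos)
  define c1 where "c1 = 2 ^ DIM('a) * (l * ?d) / (l * ?d - ?d)"
  define c2 where "c2 = 2 ^ DIM('a) * a / (a - ?d)"
  have ld: "?d < l * ?d" using l d0 by simp
  have c: "0 < c1" "0 < c2" unfolding c1_def c2_def using a d0 ld l by auto
  \<comment> \<open>The factors come from the embedding (5^d / v), from the box hypothesis with its
    weight (C0 c2) and from the kernel acting on the test function (c1).\<close>
  define K where "K = 5 ^ DIM('a) * (C0 * c2 * c1) / v"
  have K: "0 \<le> K" using C0 c v by (simp add: K_def)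
  define A where "A \<gamma> x = (\<integral>\<^sup>+ t \<in> {0<..}. (ennreal t * K_conv \<alpha> l t (\<gamma> t) x) \<partial>lborel)"
    for \<gamma> :: "real \<Rightarrow> 'a \<Rightarrow> ennreal" and x
  define \<Phi> where "\<Phi> h p = (\<integral>\<^sup>+ x. ennreal (K_kernel \<alpha> l (fst p) (x - snd p)) * h x \<partial>lborel) * indicator {0<..} (fst p)"
    for h :: "'a \<Rightarrow> ennreal" and p :: "real \<times> 'a"
  define w where "w \<gamma> p = ennreal (fst p) * (case p of (t, y) \<Rightarrow> \<gamma> t y) * indicator {0<..} (fst p)"
    for \<gamma> :: "real \<Rightarrow> 'a \<Rightarrow> ennreal" and p :: "real \<times> 'a"
  \<comment> \<open>The value 1 for nonpositive times only keeps the radii positive on the whole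
    product space, as the embedding demands; \<open>w\<close> and \<open>\<Phi>\<close> vanish
    there.\<close>
  define \<rho> where "\<rho> p = (if 0 < fst p then fst p powr (2 / \<alpha>) else 1)" for p :: "real \<times> 'a"
  have \<Phi>_le: "\<Phi> h p \<le> ennreal c1 * hl_max h x"
    if [measurable]: "h \<in> borel_measurable borel" and "dist (snd p) x \<le> \<rho> p" for h p x
  proof (cases "0 < fst p")
    case True
    let ?r = "fst p powr (2 / \<alpha>)"
    have r: "0 < ?r" using True by simp
    have "\<Phi> h p = (\<integral>\<^sup>+ x. ennreal (1 / ?r ^ DIM('a)) * (h x * ennreal ((1 + norm (x - snd p) / ?r) powr (- (l * ?d)))) \<partial>lborel)"
    proof -
      have "ennreal (K_kernel \<alpha> l (fst p) y) = ennreal (1 / ?r ^ DIM('a)) * ennreal ((1 + norm y / ?r) powr (- (l * ?d)))" for y :: 'a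
        using True by (subst K_kernel_eq, simp, intro ennreal_mult) auto
      then show ?thesis using True by (auto simp: \<Phi>_def mult_ac intro!: nn_integral_cong)
    qed
    also have "\<dots> = ennreal (1 / ?r ^ DIM('a)) * (\<integral>\<^sup>+ x. h x * ennreal ((1 + norm (x - snd p) / ?r) powr (- (l * ?d))) \<partial>lborel)"
      by (rule nn_integral_cmult) simp
    also have "\<dots> \<le> ennreal (1 / ?r ^ DIM('a)) * (ennreal (c1 * ?r ^ DIM('a)) * hl_max h x)"
      unfolding c1_def using that True ld r by (intro mult_left_mono nn_integral_kernel_le_hl_max) (auto simp: \<rho>_def)
    also have "\<dots> = (ennreal (1 / ?r ^ DIM('a)) * ennreal (c1 * ?r ^ DIM('a))) * hl_max h x"
      by (simp only: mult.assoc)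
    also have "ennreal (1 / ?r ^ DIM('a)) * ennreal (c1 * ?r ^ DIM('a)) = ennreal c1"
      using True c by (subst ennreal_mult[symmetric]) auto
    finally show ?thesis .
  qed (simp add: \<Phi>_def)
  have meas_\<Phi>: "\<Phi> h \<in> borel_measurable (lborel \<Otimes>\<^sub>M lborel)" if [measurable]: "h \<in> borel_measurable borel" for h
    unfolding \<Phi>_def by measurable
  \<comment> \<open>Tonelli moves the kernel from \<open>\<gamma>\<close> onto the test function and
    leaves an integral over the half-space.\<close>
  have dual0: "(\<integral>\<^sup>+ x. A \<gamma> x * h x \<partial>lborel) = (\<integral>\<^sup>+ p. w \<gamma> p * \<Phi> h p \<partial>(lborel \<Otimes>\<^sub>M lborel))"
    if [measurable]: "(\<lambda>(t, y). \<gamma> t y) \<in> borel_measurable (lborel \<Otimes>\<^sub>M lborel)" "h \<in> borel_measurable borel" for \<gamma> h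
  proof -
    note [measurable] = meas_\<Phi>[OF that(2)]
    have [measurable]: "w \<gamma> \<in> borel_measurable (lborel \<Otimes>\<^sub>M lborel)" unfolding w_def by measurable
    have w: "w \<gamma> (t, y) = ennreal t * \<gamma> t y * indicator {0<..} t" for t y by (simp add: w_def)
    have "(\<integral>\<^sup>+ x. A \<gamma> x * h x \<partial>lborel)
       = (\<integral>\<^sup>+ x. \<integral>\<^sup>+ t. \<integral>\<^sup>+ y. w \<gamma> (t, y) * (ennreal (K_kernel \<alpha> l t (x - y)) * h x) \<partial>lborel \<partial>lborel \<partial>lborel)"
    proof (rule nn_integral_cong)
      fix x
      have "A \<gamma> x * h x = (\<integral>\<^sup>+ t. ennreal t * K_conv \<alpha> l t (\<gamma> t) x * indicator {0<..} t * h x \<partial>lborel)"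
        unfolding A_def K_conv_def by (rule nn_integral_multc[symmetric]) simp
      also have "\<dots> = (\<integral>\<^sup>+ t. \<integral>\<^sup>+ y. w \<gamma> (t, y) * (ennreal (K_kernel \<alpha> l t (x - y)) * h x) \<partial>lborel \<partial>lborel)"
      proof (rule nn_integral_cong)
        fix t :: real
        have "ennreal t * K_conv \<alpha> l t (\<gamma> t) x * indicator {0<..} t * h x
           = (ennreal t * indicator {0<..} t * h x) * K_conv \<alpha> l t (\<gamma> t) x" by (simp add: mult_ac)
        also have "\<dots> = (\<integral>\<^sup>+ y. (ennreal t * indicator {0<..} t * h x) * (ennreal (K_kernel \<alpha> l t (x - y)) * \<gamma> t y) \<partial>lborel)"
          unfolding K_conv_def by (rule nn_integral_cmult[symmetric]) simp
        also have "\<dots> = (\<integral>\<^sup>+ y. w \<gamma> (t, y) * (ennreal (K_kernel \<alpha> l t (x - y)) * h x) \<partial>lborel)"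
          by (intro nn_integral_cong) (simp add: w mult_ac)
        finally show "ennreal t * K_conv \<alpha> l t (\<gamma> t) x * indicator {0<..} t * h x = \<dots>" .
      qed
      finally show "A \<gamma> x * h x = \<dots>" .
    qed
    also have "\<dots> = (\<integral>\<^sup>+ x. \<integral>\<^sup>+ p. w \<gamma> p * (ennreal (K_kernel \<alpha> l (fst p) (x - snd p)) * h x) \<partial>(lborel \<Otimes>\<^sub>M lborel) \<partial>lborel)"
      by (rule nn_integral_cong, subst lborel.nn_integral_fst[symmetric]) simp_all
    also have "\<dots> = (\<integral>\<^sup>+ p. \<integral>\<^sup>+ x. w \<gamma> p * (ennreal (K_kernel \<alpha> l (fst p) (x - snd p)) * h x) \<partial>lborel \<partial>(lborel \<Otimes>\<^sub>M lborel))"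
    proof -
      interpret L: pair_sigma_finite "lborel :: 'a measure" "lborel \<Otimes>\<^sub>M lborel :: (real \<times> 'a) measure"
        by (intro pair_sigma_finite.intro lborel.sigma_finite_measure_axioms sigma_finite_pair_measure)
      show ?thesis by (rule L.Fubini'[symmetric]) simp
    qed
    also have "\<dots> = (\<integral>\<^sup>+ p. w \<gamma> p * \<Phi> h p \<partial>(lborel \<Otimes>\<^sub>M lborel))"
    proof (rule nn_integral_cong)
      fix p :: "real \<times> 'a"
      have "(\<integral>\<^sup>+ x. w \<gamma> p * (ennreal (K_kernel \<alpha> l (fst p) (x - snd p)) * h x) \<partial>lborel)
         = w \<gamma> p * (\<integral>\<^sup>+ x. ennreal (K_kernel \<alpha> l (fst p) (x - snd p)) * h x \<partial>lborel)"
        by (rule nn_integral_cmult) simp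
      also have "\<dots> = w \<gamma> p * \<Phi> h p" by (simp add: w_def \<Phi>_def split: split_indicator)
      finally show "(\<integral>\<^sup>+ x. w \<gamma> p * (ennreal (K_kernel \<alpha> l (fst p) (x - snd p)) * h x) \<partial>lborel) = w \<gamma> p * \<Phi> h p" .
    qed
    finally show ?thesis .
  qed
  have A_meas: "A \<gamma> \<in> borel_measurable borel"
    if [measurable]: "(\<lambda>(t, y). \<gamma> t y) \<in> borel_measurable (lborel \<Otimes>\<^sub>M lborel)" for \<gamma>
    unfolding A_def K_conv_def by measurable
  define T where "T R = {t. 0 < t \<and> t powr (2 / \<alpha>) \<le> R}" for R
  have [measurable]: "T R \<in> sets borel" for R unfolding T_def by measurable
  have [measurable]: "ball z r \<in> sets borel" for z :: 'a and r by simp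
  define hyp where "hyp \<gamma> F \<longleftrightarrow> (\<forall>x0 R. 0 < R \<longrightarrow>
     (\<integral>\<^sup>+ t. \<integral>\<^sup>+ y. ennreal t * \<gamma> t y * (indicator (T R) t * indicator (ball x0 R) y) \<partial>lborel \<partial>lborel)
       \<le> ennreal C0 * (\<integral>\<^sup>+ y. F y * ennreal ((1 + norm (y - x0) / R) powr (- a)) \<partial>lborel))"
    for \<gamma> and F :: "'a \<Rightarrow> ennreal"
  have tent_eq: "(\<integral>\<^sup>+ p. w \<gamma> p * indicator {p. snd p \<in> ball z r \<and> \<rho> p \<le> r} p \<partial>(lborel \<Otimes>\<^sub>M lborel))
     = (\<integral>\<^sup>+ t. \<integral>\<^sup>+ y. ennreal t * \<gamma> t y * (indicator (T r) t * indicator (ball z r) y) \<partial>lborel \<partial>lborel)"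
    if [measurable]: "(\<lambda>(t, y). \<gamma> t y) \<in> borel_measurable (lborel \<Otimes>\<^sub>M lborel)" for \<gamma> z r
  proof -
    have "(\<integral>\<^sup>+ t. \<integral>\<^sup>+ y. ennreal t * \<gamma> t y * (indicator (T r) t * indicator (ball z r) y) \<partial>lborel \<partial>lborel)
       = (\<integral>\<^sup>+ p. ennreal (fst p) * (case p of (t, y) \<Rightarrow> \<gamma> t y) * (indicator (T r) (fst p) * indicator (ball z r) (snd p)) \<partial>(lborel \<Otimes>\<^sub>M lborel))"
      by (subst lborel.nn_integral_fst[symmetric]) simp_all
    also have "\<dots> = (\<integral>\<^sup>+ p. w \<gamma> p * indicator {p. snd p \<in> ball z r \<and> \<rho> p \<le> r} p \<partial>(lborel \<Otimes>\<^sub>M lborel))"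
      by (intro nn_integral_cong) (auto simp: w_def T_def \<rho>_def split: split_indicator)
    finally show ?thesis by simp
  qed
  have sf: "sigma_finite_measure (lborel \<Otimes>\<^sub>M lborel :: (real \<times> 'a) measure)"
    by (intro sigma_finite_pair_measure lborel.sigma_finite_measure_axioms)
  have w_meas: "w \<gamma> \<in> borel_measurable (lborel \<Otimes>\<^sub>M lborel)"
    if [measurable]: "(\<lambda>(t, y). \<gamma> t y) \<in> borel_measurable (lborel \<Otimes>\<^sub>M lborel)" for \<gamma>
    unfolding w_def by measurable
  have dual: "(\<integral>\<^sup>+ x. A \<gamma> x * h x \<partial>lborel) \<le> ennreal K * (\<integral>\<^sup>+ x. hl_max F x * hl_max h x \<partial>lborel)"
    if [measurable]: "(\<lambda>(t, y). \<gamma> t y) \<in> borel_measurable (lborel \<Otimes>\<^sub>M lborel)" "F \<in> borel_measurable borel"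
      "h \<in> borel_measurable borel" and hyp: "hyp \<gamma> F" for \<gamma> F h
  proof -
    let ?I = "\<integral>\<^sup>+ x. A \<gamma> x * h x \<partial>lborel"
    have "ennreal v * (\<integral>\<^sup>+ p. w \<gamma> p * \<Phi> h p \<partial>(lborel \<Otimes>\<^sub>M lborel))
      \<le> ennreal (5 ^ DIM('a)) * (\<integral>\<^sup>+ x. (ennreal (C0 * c2) * hl_max F x) * (ennreal c1 * hl_max h x) \<partial>lborel)"
      unfolding v_def
    proof (rule Carleson_embedding[where c = snd and \<rho> = \<rho>])
      show "\<rho> \<in> borel_measurable (lborel \<Otimes>\<^sub>M lborel)" unfolding \<rho>_def by measurable
      show "0 < \<rho> p" for p by (simp add: \<rho>_def)
      show "\<Phi> h p \<le> ennreal c1 * hl_max h x" if "dist (snd p) x \<le> \<rho> p" for p x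
        using that by (intro \<Phi>_le) auto
      fix z :: 'a and r x assume r: "0 < r" "x \<in> ball z r"
      have "(\<integral>\<^sup>+ p. w \<gamma> p * indicator {p. snd p \<in> ball z r \<and> \<rho> p \<le> r} p \<partial>(lborel \<Otimes>\<^sub>M lborel))
         \<le> ennreal C0 * (\<integral>\<^sup>+ y. F y * ennreal ((1 + norm (y - z) / r) powr (- a)) \<partial>lborel)"
        using hyp r unfolding tent_eq[OF that(1)] hyp_def by blast
      also have "\<dots> \<le> ennreal C0 * (ennreal (c2 * r ^ DIM('a)) * hl_max F x)"
        unfolding c2_def using r a by (intro mult_left_mono nn_integral_kernel_le_hl_max) auto
      also have "\<dots> = ennreal (r ^ DIM('a)) * (ennreal (C0 * c2) * hl_max F x)"
        using r c C0 by (simp add: ennreal_mult mult_ac)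
      finally show "(\<integral>\<^sup>+ p. w \<gamma> p * indicator {p. snd p \<in> ball z r \<and> \<rho> p \<le> r} p \<partial>(lborel \<Otimes>\<^sub>M lborel))
         \<le> ennreal (r ^ DIM('a)) * (ennreal (C0 * c2) * hl_max F x)" .
    qed (use sf w_meas meas_\<Phi> that in simp_all)
    also have "\<dots> = ennreal (5 ^ DIM('a)) * (\<integral>\<^sup>+ x. ennreal (C0 * c2 * c1) * (hl_max F x * hl_max h x) \<partial>lborel)"
      using c C0 by (simp add: ennreal_mult mult_ac)
    also have "\<dots> = ennreal (5 ^ DIM('a)) * (ennreal (C0 * c2 * c1) * (\<integral>\<^sup>+ x. hl_max F x * hl_max h x \<partial>lborel))"
      by (subst nn_integral_cmult) auto
    also have "\<dots> = ennreal v * (ennreal K * (\<integral>\<^sup>+ x. hl_max F x * hl_max h x \<partial>lborel))"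
    proof -
      have "ennreal (5 ^ DIM('a)) * ennreal (C0 * c2 * c1) = ennreal v * ennreal K"
        using c C0 v K by (simp add: ennreal_mult[symmetric] K_def)
      then show ?thesis by (simp only: mult.assoc[symmetric])
    qed
    finally have "ennreal (1 / v) * (ennreal v * ?I) \<le> ennreal (1 / v) * (ennreal v * (ennreal K * (\<integral>\<^sup>+ x. hl_max F x * hl_max h x \<partial>lborel)))"
      unfolding dual0[OF that(1,3)] by (rule mult_left_mono) simp
    moreover have "ennreal (1 / v) * ennreal v = 1" using v by (simp add: ennreal_mult[symmetric])
    ultimately show ?thesis by (simp only: mult.assoc[symmetric] mult_1)
  qed
  show ?thesis
  proof (cases "q = 1")
    case False
    then have "1 < q" using q by simp
    from Lq_bound_by_duality[OF this K, where ?'a = 'a] obtain C where "0 \<le> C" and C: "\<forall>A F :: 'a \<Rightarrow> ennreal.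
      A \<in> borel_measurable borel \<longrightarrow> F \<in> borel_measurable borel \<longrightarrow>
      (\<forall>h \<in> borel_measurable borel. (\<integral>\<^sup>+ x. A x * h x \<partial>lborel) \<le> ennreal K * (\<integral>\<^sup>+ x. hl_max F x * hl_max h x \<partial>lborel)) \<longrightarrow>
      (\<integral>\<^sup>+ x. ennreal_pow (A x) q \<partial>lborel) \<le> ennreal C * (\<integral>\<^sup>+ x. ennreal_pow (F x) q \<partial>lborel)"
      by (elim exE conjE)
    show ?thesis
      unfolding A_def[symmetric] T_def[symmetric] hyp_def[symmetric]
    proof (intro exI[of _ C] conjI allI impI \<open>0 \<le> C\<close>)
      fix \<gamma> :: "real \<Rightarrow> 'a \<Rightarrow> ennreal" and F :: "'a \<Rightarrow> ennreal"
      assume *: "(\<lambda>(t, y). \<gamma> t y) \<in> borel_measurable (lborel \<Otimes>\<^sub>M lborel)" "F \<in> borel_measurable borel" "hyp \<gamma> F"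
      show "(\<integral>\<^sup>+ x. ennreal_pow (A \<gamma> x) q \<partial>lborel) \<le> ennreal C * (\<integral>\<^sup>+ x. ennreal_pow (F x) q \<partial>lborel)"
        by (rule C[rule_format, OF A_meas[OF *(1)] *(2) dual[OF *(1,2) _ *(3)]])
    qed
  next
    case True
    have "(\<integral>\<^sup>+ x. A \<gamma> x \<partial>lborel) \<le> ennreal (c1 * v * C0) * (\<integral>\<^sup>+ x. F x \<partial>lborel)"
      if [measurable]: "(\<lambda>(t, y). \<gamma> t y) \<in> borel_measurable (lborel \<Otimes>\<^sub>M lborel)" "F \<in> borel_measurable borel"
        and hyp: "hyp \<gamma> F" for \<gamma> F
    proof -
      note [measurable] = w_meas[OF that(1)]
      have [measurable]: "\<rho> \<in> borel_measurable (lborel \<Otimes>\<^sub>M lborel)" unfolding \<rho>_def by measurable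
      have "(\<integral>\<^sup>+ x. A \<gamma> x \<partial>lborel) = (\<integral>\<^sup>+ p. w \<gamma> p * \<Phi> (\<lambda>_. 1) p \<partial>(lborel \<Otimes>\<^sub>M lborel))"
        using dual0[OF that(1), of "\<lambda>_. 1"] by simp
      also have "\<dots> \<le> (\<integral>\<^sup>+ p. w \<gamma> p * ennreal (c1 * v) \<partial>(lborel \<Otimes>\<^sub>M lborel))"
      proof (intro nn_integral_mono mult_left_mono)
        fix p :: "real \<times> 'a"
        have "\<Phi> (\<lambda>_. 1) p \<le> ennreal c1 * hl_max (\<lambda>_. 1) (snd p)"
          by (rule \<Phi>_le) (auto simp: \<rho>_def)
        also have "\<dots> \<le> ennreal c1 * ennreal v" unfolding v_def by (intro mult_left_mono hl_max_one_le) simp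
        also have "\<dots> = ennreal (c1 * v)" using c v by (simp add: ennreal_mult)
        finally show "\<Phi> (\<lambda>_. 1) p \<le> ennreal (c1 * v)" .
      qed simp
      also have "\<dots> = (\<integral>\<^sup>+ p. w \<gamma> p \<partial>(lborel \<Otimes>\<^sub>M lborel)) * ennreal (c1 * v)"
        by (rule nn_integral_multc) simp
      also have "(\<integral>\<^sup>+ p. w \<gamma> p \<partial>(lborel \<Otimes>\<^sub>M lborel)) \<le> ennreal C0 * (\<integral>\<^sup>+ x. F x \<partial>lborel)"
      proof -
        \<comment> \<open>Increasing boxes over balls around 0 that exhaust the half-space;
          \<open>Suc n\<close> keeps their radius positive.\<close>
        let ?S = "\<lambda>n p. w \<gamma> p * indicator {p. snd p \<in> ball 0 (real (Suc n)) \<and> \<rho> p \<le> real (Suc n)} p"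
        have [measurable]: "{p. snd p \<in> ball 0 r \<and> \<rho> p \<le> r} \<in> sets (lborel \<Otimes>\<^sub>M lborel)" for r
        proof -
          have "{p \<in> space (lborel \<Otimes>\<^sub>M lborel). snd p \<in> ball 0 r \<and> \<rho> p \<le> r} \<in> sets (lborel \<Otimes>\<^sub>M lborel)"
            unfolding mem_ball by measurable
          then show ?thesis by (simp add: space_pair_measure)
        qed
        have "(SUP n. ?S n p) = w \<gamma> p" for p
        proof (rule antisym)
          show "(SUP n. ?S n p) \<le> w \<gamma> p" by (intro SUP_least) (auto split: split_indicator)
          obtain n where n: "max (norm (snd p)) (\<rho> p) \<le> real n" using real_arch_simple by blast
          have "w \<gamma> p \<le> ?S n p" using n by (auto split: split_indicator)
          also have "\<dots> \<le> (SUP n. ?S n p)" by (rule SUP_upper) simp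
          finally show "w \<gamma> p \<le> (SUP n. ?S n p)" .
        qed
        then have "(\<integral>\<^sup>+ p. w \<gamma> p \<partial>(lborel \<Otimes>\<^sub>M lborel)) = (\<integral>\<^sup>+ p. (SUP n. ?S n p) \<partial>(lborel \<Otimes>\<^sub>M lborel))" by simp
        also have "\<dots> = (SUP n. \<integral>\<^sup>+ p. ?S n p \<partial>(lborel \<Otimes>\<^sub>M lborel))"
          by (rule nn_integral_monotone_convergence_SUP)
             (auto simp: incseq_def le_fun_def split: split_indicator intro: order_trans less_le_trans)
        also have "\<dots> \<le> ennreal C0 * (\<integral>\<^sup>+ x. F x \<partial>lborel)"
        proof (rule SUP_least)
          fix n :: nat
          have "(\<integral>\<^sup>+ p. ?S n p \<partial>(lborel \<Otimes>\<^sub>M lborel))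
             \<le> ennreal C0 * (\<integral>\<^sup>+ y. F y * ennreal ((1 + norm (y - 0) / real (Suc n)) powr (- a)) \<partial>lborel)"
            unfolding tent_eq[OF that(1)]
            by (rule hyp[unfolded hyp_def, THEN spec, THEN spec, THEN mp]) simp
          also have "\<dots> \<le> ennreal C0 * (\<integral>\<^sup>+ x. F x \<partial>lborel)"
          proof (intro mult_left_mono nn_integral_mono)
            fix y :: 'a
            have "(1 + norm (y - 0) / real (Suc n)) powr (- a) \<le> (1 + norm (y - 0) / real (Suc n)) powr 0"
              using a d0 by (intro powr_mono) auto
            also have "\<dots> \<le> 1" by simp
            finally have "F y * ennreal ((1 + norm (y - 0) / real (Suc n)) powr (- a)) \<le> F y * 1"
              by (intro mult_left_mono) auto
            then show "F y * ennreal ((1 + norm (y - 0) / real (Suc n)) powr (- a)) \<le> F y" by simp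
          qed simp
          finally show "(\<integral>\<^sup>+ p. ?S n p \<partial>(lborel \<Otimes>\<^sub>M lborel)) \<le> ennreal C0 * (\<integral>\<^sup>+ x. F x \<partial>lborel)" .
        qed
        finally show ?thesis .
      qed
      finally have "(\<integral>\<^sup>+ x. A \<gamma> x \<partial>lborel) \<le> ennreal C0 * (\<integral>\<^sup>+ x. F x \<partial>lborel) * ennreal (c1 * v)"
        by (simp add: mult_right_mono)
      then show ?thesis using C0 c v by (simp add: ennreal_mult mult_ac)
    qed
    moreover have "0 \<le> c1 * v * C0" using C0 c v by simp
    ultimately show ?thesis
      unfolding A_def[symmetric] T_def[symmetric] hyp_def[symmetric] True ennreal_pow_one by blast
  qed
qed

subsection \<open>The Fourier transform\<close>

lemma nn_integral_lborel_affine: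
  fixes f :: "'a::euclidean_space \<Rightarrow> ennreal" and t :: 'a
  assumes [measurable]: "f \<in> borel_measurable borel" and c: "c \<noteq> 0"
  shows "(\<integral>\<^sup>+ x. f x \<partial>lborel) = ennreal (\<bar>c\<bar> ^ DIM('a)) * (\<integral>\<^sup>+ x. f (t + c *\<^sub>R x) \<partial>lborel)"
  by (subst lborel_affine[OF c, of t])
     (simp add: nn_integral_density nn_integral_distr nn_integral_cmult)

lemma integral_lborel_affine:
  fixes f :: "'a::euclidean_space \<Rightarrow> 'b::{banach, second_countable_topology}" and t :: 'a
  assumes [measurable]: "f \<in> borel_measurable borel" and c: "c \<noteq> 0"
  shows "(LINT x|lborel. f x) = \<bar>c\<bar> ^ DIM('a) *\<^sub>R (LINT x|lborel. f (t + c *\<^sub>R x))"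
  by (subst lborel_affine[OF c, of t]) (simp add: integral_density integral_distr)

lemma integrable_lborel_affine:
  fixes f :: "'a::euclidean_space \<Rightarrow> 'b::{banach, second_countable_topology}" and t :: 'a
  assumes f: "integrable lborel f" and c: "c \<noteq> 0"
  shows "integrable lborel (\<lambda>x. f (t + c *\<^sub>R x))"
proof -
  have [measurable]: "f \<in> borel_measurable borel" using borel_measurable_integrable[OF f] by simp
  have "(\<integral>\<^sup>+ x. norm (f x) \<partial>lborel) < \<infinity>" using f by (simp add: integrable_iff_bounded)
  then show ?thesis
    using c by (subst (asm) nn_integral_lborel_affine[where t = t and c = c])
       (auto simp: integrable_iff_bounded ennreal_mult_less_top)
qed

lemma measurable_cis [measurable]: "cis \<in> borel_measurable borel"
  by (intro borel_measurable_continuous_onI continuous_intros)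

lemma integrable_pair_bounded:
  fixes g :: "'a \<Rightarrow> complex" and m :: "'b \<Rightarrow> complex" and e :: "'a \<Rightarrow> 'b \<Rightarrow> complex"
  assumes g: "integrable M g" and m: "integrable N m" and "sigma_finite_measure N"
    and [measurable]: "(\<lambda>(x, y). e x y) \<in> borel_measurable (M \<Otimes>\<^sub>M N)"
    and e: "\<And>x y. norm (e x y) \<le> 1"
  shows "integrable (M \<Otimes>\<^sub>M N) (\<lambda>(x, y). g x * m y * e x y)"
proof -
  interpret N: sigma_finite_measure N by fact
  have [measurable]: "g \<in> borel_measurable M" "m \<in> borel_measurable N" using g m by auto
  show ?thesis
  proof (rule integrableI_bounded)
    have "(\<integral>\<^sup>+ p. norm (case p of (x, y) \<Rightarrow> g x * m y * e x y) \<partial>(M \<Otimes>\<^sub>M N))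
       \<le> (\<integral>\<^sup>+ p. ennreal (norm (g (fst p))) * ennreal (norm (m (snd p))) \<partial>(M \<Otimes>\<^sub>M N))"
    proof (intro nn_integral_mono)
      fix p
      have "norm (g (fst p) * m (snd p) * e (fst p) (snd p)) \<le> norm (g (fst p)) * norm (m (snd p)) * 1"
        unfolding norm_mult by (intro mult_left_mono e) auto
      then show "ennreal (norm (case p of (x, y) \<Rightarrow> g x * m y * e x y)) \<le> ennreal (norm (g (fst p))) * ennreal (norm (m (snd p)))"
        by (simp add: case_prod_beta ennreal_mult[symmetric])
    qed
    also have "\<dots> = (\<integral>\<^sup>+ x. ennreal (norm (g x)) \<partial>M) * (\<integral>\<^sup>+ y. ennreal (norm (m y)) \<partial>N)"
      by (subst N.nn_integral_fst[symmetric]) (simp_all add: nn_integral_cmult nn_integral_multc)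
    also have "\<dots> < \<infinity>" using g m by (simp add: integrable_iff_bounded ennreal_mult_less_top)
    finally show "(\<integral>\<^sup>+ p. norm (case p of (x, y) \<Rightarrow> g x * m y * e x y) \<partial>(M \<Otimes>\<^sub>M N)) < \<infinity>" .
  qed measurable
qed

text \<open>Sign and normalisation are those of the characteristic function, as in
  \<open>stable_transition_density\<close>; with no factor in the definition, (2 pi)^d appears in
  Plancherel and in the inversion formula.\<close>

definition fourier :: "('a::euclidean_space \<Rightarrow> complex) \<Rightarrow> 'a \<Rightarrow> complex" where
  "fourier g \<xi> = (LINT x|lborel. cis (\<xi> \<bullet> x) * g x)"

lemma integrable_cis_mult:
  fixes g :: "'a::euclidean_space \<Rightarrow> complex"
  assumes "integrable lborel g"
  shows "integrable lborel (\<lambda>x. cis (\<xi> \<bullet> x) * g x)"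
proof (rule Bochner_Integration.integrable_bound[OF assms])
  have [measurable]: "g \<in> borel_measurable borel" using borel_measurable_integrable[OF assms] by simp
  show "(\<lambda>x. cis (\<xi> \<bullet> x) * g x) \<in> borel_measurable lborel" by measurable
qed (simp add: norm_mult)

lemma measurable_fourier [measurable]:
  assumes "integrable lborel g"
  shows "fourier g \<in> borel_measurable borel"
proof -
  have [measurable]: "g \<in> borel_measurable borel" using borel_measurable_integrable[OF assms] by simp
  show ?thesis unfolding fourier_def by measurable
qed

lemma norm_fourier_le: "norm (fourier g \<xi>) \<le> (LINT x|lborel. norm (g x))"
proof -
  have "norm (fourier g \<xi>) \<le> (LINT x|lborel. norm (cis (\<xi> \<bullet> x) * g x))"
    unfolding fourier_def by (rule integral_norm_bound)
  then show ?thesis by (simp add: norm_mult)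
qed

text \<open>Fubini for the kernel \<open>cis (\<xi> \<bullet> x)\<close>, bounded and symmetric in
  its arguments. The regularised inversion, the Plancherel inequality and the convolution formula
  below are special choices of \<open>m\<close>.\<close>

lemma fourier_multiplication:
  fixes g m :: "'a::euclidean_space \<Rightarrow> complex"
  assumes g: "integrable lborel g" and m: "integrable lborel m"
  shows "(LINT \<xi>|lborel. fourier g \<xi> * m \<xi>) = (LINT x|lborel. g x * fourier m x)"
proof -
  have int: "integrable (lborel \<Otimes>\<^sub>M lborel) (\<lambda>(\<xi>, x). m \<xi> * g x * cis (\<xi> \<bullet> x))"
    by (intro integrable_pair_bounded g m lborel.sigma_finite_measure_axioms) auto
  have "(LINT \<xi>|lborel. fourier g \<xi> * m \<xi>) = (LINT \<xi>|lborel. LINT x|lborel. m \<xi> * g x * cis (\<xi> \<bullet> x))"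
  proof (rule Bochner_Integration.integral_cong)
    fix \<xi> :: 'a
    have "fourier g \<xi> * m \<xi> = (LINT x|lborel. cis (\<xi> \<bullet> x) * g x * m \<xi>)"
      unfolding fourier_def by (rule integral_mult_left_zero[symmetric])
    then show "fourier g \<xi> * m \<xi> = (LINT x|lborel. m \<xi> * g x * cis (\<xi> \<bullet> x))" by (simp add: mult_ac)
  qed simp
  also have "\<dots> = (LINT x|lborel. LINT \<xi>|lborel. m \<xi> * g x * cis (\<xi> \<bullet> x))"
    using lborel_pair.Fubini_integral[OF int] by simp
  also have "\<dots> = (LINT x|lborel. g x * fourier m x)"
  proof (rule Bochner_Integration.integral_cong)
    fix x :: 'a
    have "g x * fourier m x = (LINT \<xi>|lborel. g x * (cis (x \<bullet> \<xi>) * m \<xi>))"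
      unfolding fourier_def by (rule integral_mult_right_zero[symmetric])
    then show "(LINT \<xi>|lborel. m \<xi> * g x * cis (\<xi> \<bullet> x)) = g x * fourier m x"
      by (subst eq_commute) (simp add: mult_ac inner_commute)
  qed simp
  finally show ?thesis .
qed

section \<open>Gaussians and their transforms\<close>

lemma has_bochner_integral_gaussian_1d:
  fixes u x :: real
  assumes u: "0 < u"
  shows "has_bochner_integral lborel (\<lambda>s. cis (x * s) * complex_of_real (exp (- u * s\<^sup>2)))
     (complex_of_real (sqrt (pi / u) * exp (- x\<^sup>2 / (4 * u))))"
proof -
  \<comment> \<open>The scaling that carries exp (- u s^2) to the standard normal density, whose
    characteristic function is known.\<close>
  define c where "c = sqrt (2 * u)"
  have c: "0 < c" "c\<^sup>2 = 2 * u" using u by (auto simp: c_def)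
  let ?g = "\<lambda>s::real. cis (x * s) * complex_of_real (exp (- u * s\<^sup>2))"
  let ?f = "\<lambda>y. complex_of_real (std_normal_density y) * cis ((x / c) * y)"
  have f: "?g s = complex_of_real (sqrt (2 * pi)) * ?f (0 + c * s)" for s
    using c u by (simp add: std_normal_density_def power_mult_distrib)
  have int_f: "integrable lborel ?f"
  proof (rule Bochner_Integration.integrable_bound)
    show "integrable lborel std_normal_density" using integrable_std_normal_moment[of 0] by simp
  qed (auto simp: norm_mult)
  have "char std_normal_distribution (x / c) = (LINT y|lborel. ?f y)"
    unfolding char_def by (subst integral_density) (auto simp: cis_conv_exp scaleR_conv_of_real)
  then have If: "(LINT y|lborel. ?f y) = complex_of_real (exp (- (x / c)\<^sup>2 / 2))"
    by (simp add: char_std_normal_distribution)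
  have "integrable lborel ?g"
    unfolding f using lborel_integrable_real_affine[OF int_f, of c 0] c by simp
  moreover have "(LINT s|lborel. ?g s) = complex_of_real (sqrt (pi / u) * exp (- x\<^sup>2 / (4 * u)))"
  proof -
    have "(LINT y|lborel. ?f y) = c *\<^sub>R (LINT s|lborel. ?f (0 + c * s))"
      using lborel_integral_real_affine[of c ?f 0] c by simp
    then have "(LINT s|lborel. ?f (0 + c * s)) = complex_of_real (exp (- (x / c)\<^sup>2 / 2) / c)"
      using c If by (simp add: scaleR_conv_of_real field_simps)
    then have "(LINT s|lborel. ?g s) = complex_of_real (sqrt (2 * pi)) * complex_of_real (exp (- (x / c)\<^sup>2 / 2) / c)"
      unfolding f by simp
    also have "\<dots> = complex_of_real (sqrt (2 * pi) / c * exp (- (x / c)\<^sup>2 / 2))" by simp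
    also have "sqrt (2 * pi) / c = sqrt (pi / u)"
      using u unfolding c_def by (simp add: real_sqrt_divide[symmetric])
    also have "- (x / c)\<^sup>2 / 2 = - x\<^sup>2 / (4 * u)" using c by (simp add: power_divide)
    finally show ?thesis .
  qed
  ultimately show ?thesis by (simp add: has_bochner_integral_iff)
qed

text \<open>The transform of exp (- u |\<xi>|^2), left unnormalised: its total mass is (2 pi)^d for
  every u > 0, and it concentrates at 0 as \<open>u\<close> tends to 0.\<close>

definition gauss_kernel :: "real \<Rightarrow> 'a::euclidean_space \<Rightarrow> real" where
  "gauss_kernel u x = sqrt (pi / u) ^ DIM('a) * exp (- (norm x)\<^sup>2 / (4 * u))"

lemma cis_sum: "finite A \<Longrightarrow> cis (\<Sum>i\<in>A. f i) = (\<Prod>i\<in>A. cis (f i))"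
  by (induction A rule: finite_induct) (auto simp: cis_mult[symmetric])

text \<open>Integrand and Lebesgue measure both factor over \<open>Basis\<close>, so integrability
  and value follow from dimension one.\<close>

lemma
  fixes x :: "'a::euclidean_space"
  assumes u: "0 < u"
  shows integrable_gaussian: "integrable lborel (\<lambda>\<xi>::'a. complex_of_real (exp (- u * (norm \<xi>)\<^sup>2)))"
    and fourier_gaussian: "fourier (\<lambda>\<xi>. complex_of_real (exp (- u * (norm \<xi>)\<^sup>2))) x = complex_of_real (gauss_kernel u x)"
proof -
  let ?F = "\<lambda>(x::'a) b s. cis ((x \<bullet> b) * s) * complex_of_real (exp (- u * s\<^sup>2))"
  interpret product_sigma_finite "\<lambda>_::'a. lborel :: real measure" ..
  have prod: "(\<Prod>b\<in>Basis. ?F x b (\<xi> \<bullet> b)) = cis (x \<bullet> \<xi>) * complex_of_real (exp (- u * (norm \<xi>)\<^sup>2))" for \<xi> x :: 'a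
  proof -
    have "(norm \<xi>)\<^sup>2 = (\<Sum>b\<in>Basis. (\<xi> \<bullet> b)\<^sup>2)"
      unfolding power2_norm_eq_inner by (subst euclidean_inner) (simp add: power2_eq_square)
    then have "complex_of_real (exp (- u * (norm \<xi>)\<^sup>2)) = (\<Prod>b\<in>Basis. complex_of_real (exp (- u * (\<xi> \<bullet> b)\<^sup>2)))"
      by (simp add: sum_distrib_left exp_sum sum_negf[symmetric] del: sum_negf)
    moreover have "cis (x \<bullet> \<xi>) = (\<Prod>b\<in>Basis. cis ((x \<bullet> b) * (\<xi> \<bullet> b)))"
      by (subst euclidean_inner) (simp add: cis_sum)
    ultimately show ?thesis by (simp add: prod.distrib)
  qed
  have I1: "integrable lborel (?F x b)" and E1: "(LINT s|lborel. ?F x b s) = complex_of_real (sqrt (pi / u) * exp (- (x \<bullet> b)\<^sup>2 / (4 * u)))" for x b :: 'a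
    using has_bochner_integral_gaussian_1d[OF u, of "x \<bullet> b"] by (auto simp: has_bochner_integral_iff)
  have red: "(\<Sum>b\<in>Basis. f b *\<^sub>R b) \<bullet> b' = f b'" if "b' \<in> Basis" for f and b' :: 'a
    using that by (simp add: inner_sum_left inner_Basis if_distrib[of "\<lambda>x. _ * x"] cong: if_cong)
  have meas: "(\<lambda>f. \<Sum>b\<in>Basis. f b *\<^sub>R b) \<in> measurable (\<Pi>\<^sub>M b\<in>Basis. lborel) (borel :: 'a measure)"
    by measurable
  have m2: "(\<lambda>\<xi>. cis (x \<bullet> \<xi>) * complex_of_real (exp (- u * (norm \<xi>)\<^sup>2))) \<in> borel_measurable borel" for x :: 'a
    by measurable
  have eq: "cis (x \<bullet> (\<Sum>b\<in>Basis. f b *\<^sub>R b)) * complex_of_real (exp (- u * (norm (\<Sum>b\<in>Basis. f b *\<^sub>R b))\<^sup>2))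
      = (\<Prod>b\<in>Basis. ?F x b (f b))" for x and f :: "'a \<Rightarrow> real"
    unfolding prod[symmetric] by (rule prod.cong) (simp_all add: red)
  have I: "integrable lborel (\<lambda>\<xi>. cis (x \<bullet> \<xi>) * complex_of_real (exp (- u * (norm \<xi>)\<^sup>2)))" for x :: 'a
    unfolding lborel_eq[where ?'a = 'a] integrable_distr_eq[OF meas m2] eq
    by (rule product_integrable_prod) (simp, rule I1)
  show "integrable lborel (\<lambda>\<xi>::'a. complex_of_real (exp (- u * (norm \<xi>)\<^sup>2)))" using I[of 0] by simp
  have "fourier (\<lambda>\<xi>. complex_of_real (exp (- u * (norm \<xi>)\<^sup>2))) x = (\<Prod>b\<in>Basis. (LINT s|lborel. ?F x b s))"
    unfolding fourier_def lborel_eq[where ?'a = 'a] integral_distr[OF meas m2] eq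
    by (rule product_integral_prod) (simp, rule I1)
  also have "\<dots> = complex_of_real (\<Prod>b\<in>Basis. sqrt (pi / u) * exp (- (x \<bullet> b)\<^sup>2 / (4 * u)))"
    unfolding E1 by simp
  also have "(\<Prod>b\<in>Basis. sqrt (pi / u) * exp (- (x \<bullet> b)\<^sup>2 / (4 * u))) = gauss_kernel u x"
  proof -
    have "(norm x)\<^sup>2 = (\<Sum>b\<in>Basis. (x \<bullet> b)\<^sup>2)"
      unfolding power2_norm_eq_inner by (subst euclidean_inner) (simp add: power2_eq_square)
    then show ?thesis
      by (simp add: gauss_kernel_def prod.distrib exp_sum[symmetric] sum_divide_distrib sum_negf)
  qed
  finally show "fourier (\<lambda>\<xi>. complex_of_real (exp (- u * (norm \<xi>)\<^sup>2))) x = complex_of_real (gauss_kernel u x)" .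
qed

lemma measurable_gauss_kernel [measurable]: "gauss_kernel u \<in> borel_measurable borel"
  unfolding gauss_kernel_def by measurable

lemma gauss_kernel_nonneg: "0 < u \<Longrightarrow> 0 \<le> gauss_kernel u x"
  by (auto simp: gauss_kernel_def)

lemma gauss_kernel_le: "0 < u \<Longrightarrow> gauss_kernel u (x::'a::euclidean_space) \<le> sqrt (pi / u) ^ DIM('a)"
  unfolding gauss_kernel_def by (rule mult_right_le_one_le) auto

lemma integrable_mult_gauss_kernel:
  fixes g :: "'a::euclidean_space \<Rightarrow> complex"
  assumes g: "integrable lborel g" and u: "0 < u"
  shows "integrable lborel (\<lambda>y. g y * complex_of_real (gauss_kernel u (x + y)))"
proof (rule Bochner_Integration.integrable_bound[OF integrable_scaleR_right[OF g, of "sqrt (pi / u) ^ DIM('a)"]])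
  have [measurable]: "g \<in> borel_measurable borel" using borel_measurable_integrable[OF g] by simp
  show "(\<lambda>y. g y * complex_of_real (gauss_kernel u (x + y))) \<in> borel_measurable lborel" by measurable
  have "norm (g y) * gauss_kernel u (x + y) \<le> norm (g y) * sqrt (pi / u) ^ DIM('a)" for y
    by (intro mult_left_mono gauss_kernel_le u) simp
  then show "AE y in lborel. norm (g y * complex_of_real (gauss_kernel u (x + y))) \<le> norm (sqrt (pi / u) ^ DIM('a) *\<^sub>R g y)"
    using u by (intro AE_I2) (simp add: norm_mult gauss_kernel_nonneg mult.commute)
qed

lemma measurable_cnj [measurable]: "cnj \<in> borel_measurable borel"
  by (intro borel_measurable_continuous_onI continuous_intros)

text \<open>The kernel is again a Gaussian, with parameter 1 / (4 u), so its integral is the value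
  at 0 of a transform already computed.\<close>

lemma nn_integral_gauss_kernel:
  fixes y :: "'a::euclidean_space"
  assumes u: "0 < u"
  shows "(\<integral>\<^sup>+ x. ennreal (gauss_kernel u (x - y)) \<partial>lborel) = ennreal ((2 * pi) ^ DIM('a))"
proof -
  let ?v = "1 / (4 * u)"
  note gauss_kernel_nonneg[OF u, simp]
  have v: "0 < ?v" using u by simp
  have 1: "gauss_kernel u x = sqrt (pi / u) ^ DIM('a) * exp (- ?v * (norm x)\<^sup>2)" for x :: 'a
    by (simp add: gauss_kernel_def)
  have int: "integrable lborel (\<lambda>x::'a. exp (- ?v * (norm x)\<^sup>2))"
    using integrable_Re[OF integrable_gaussian[OF v, where ?'a = 'a]] by simp
  have "complex_of_real (LINT x|lborel. exp (- ?v * (norm (x::'a))\<^sup>2)) = fourier (\<lambda>\<xi>::'a. complex_of_real (exp (- ?v * (norm \<xi>)\<^sup>2))) 0"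
    unfolding fourier_def by (subst integral_complex_of_real[symmetric]) simp
  also have "\<dots> = complex_of_real (sqrt (pi / ?v) ^ DIM('a))"
    using fourier_gaussian[OF v, of "0::'a"] by (simp add: gauss_kernel_def)
  finally have val: "(LINT x|lborel. exp (- ?v * (norm (x::'a))\<^sup>2)) = sqrt (pi / ?v) ^ DIM('a)"
    by (simp only: of_real_eq_iff)
  have "(\<integral>\<^sup>+ x. ennreal (gauss_kernel u (x - y)) \<partial>lborel) = (\<integral>\<^sup>+ x. ennreal (gauss_kernel u (x::'a)) \<partial>lborel)"
    using nn_integral_lborel_affine[of "\<lambda>x. ennreal (gauss_kernel u (x - y))" 1 y] by simp
  also have "\<dots> = ennreal (LINT x|lborel. gauss_kernel u (x::'a))"
    by (rule nn_integral_eq_integral) (simp only: 1 integrable_mult_right int, rule AE_I2, rule gauss_kernel_nonneg[OF u])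
  also have "(LINT x|lborel. gauss_kernel u (x::'a)) = sqrt (pi / u) ^ DIM('a) * sqrt (pi / ?v) ^ DIM('a)"
    unfolding 1 val[symmetric] by simp
  also have "\<dots> = (2 * pi) ^ DIM('a)"
  proof -
    have "sqrt (pi / u) * sqrt (pi / ?v) = sqrt ((2 * pi)\<^sup>2)"
      using u by (subst real_sqrt_mult[symmetric]) (simp add: power2_eq_square)
    also have "\<dots> = 2 * pi" by (subst real_sqrt_abs) simp
    finally have "sqrt (pi / u) * sqrt (pi / ?v) = 2 * pi" .
    then show ?thesis by (simp only: power_mult_distrib[symmetric])
  qed
  finally show ?thesis .
qed

section \<open>The Plancherel inequality\<close>

lemma fourier_cis_shift: "fourier (\<lambda>\<xi>. cis (x \<bullet> \<xi>) * m \<xi>) y = fourier m (x + y)"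
  unfolding fourier_def by (intro Bochner_Integration.integral_cong) (auto simp: inner_add_left cis_mult[symmetric])

lemma integral_lborel_reflect:
  fixes f :: "'a::euclidean_space \<Rightarrow> 'b::{banach, second_countable_topology}"
  assumes "f \<in> borel_measurable borel"
  shows "(LINT x|lborel. f (- x)) = (LINT x|lborel. f x)"
  using integral_lborel_affine[OF assms, of "-1" 0] by simp

lemma fourier_uminus:
  assumes [measurable]: "g \<in> borel_measurable borel"
  shows "fourier (\<lambda>x. g (- x)) \<xi> = fourier g (- \<xi>)"
  unfolding fourier_def using integral_lborel_reflect[of "\<lambda>x. cis (- \<xi> \<bullet> x) * g x"] by simp

lemma cnj_fourier:
  assumes "integrable lborel g"
  shows "cnj (fourier g \<xi>) = fourier (\<lambda>x. cnj (g x)) (- \<xi>)"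
  unfolding fourier_def integral_bounded_linear[OF bounded_linear_cnj integrable_cis_mult[OF assms], symmetric]
  by (simp add: cis_cnj)

text \<open>The transform of an integrable function need not be integrable. The Gaussian factor
  makes its second transform converge, and the multiplication formula identifies the result as a
  smoothing of the reflected function.\<close>

lemma fourier_gauss_regularized:
  fixes g :: "'a::euclidean_space \<Rightarrow> complex"
  assumes g: "integrable lborel g" and u: "0 < u"
  shows "(LINT \<xi>|lborel. fourier g \<xi> * (cis (x \<bullet> \<xi>) * complex_of_real (exp (- u * (norm \<xi>)\<^sup>2))))
     = (LINT y|lborel. g y * complex_of_real (gauss_kernel u (x + y)))"
proof -
  have "integrable lborel (\<lambda>\<xi>. cis (x \<bullet> \<xi>) * complex_of_real (exp (- u * (norm \<xi>)\<^sup>2)))"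
    by (intro integrable_cis_mult integrable_gaussian u)
  from fourier_multiplication[OF g this] show ?thesis
    by (simp only: fourier_cis_shift fourier_gaussian[OF u])
qed

text \<open>One half of Plancherel's identity. With a Gaussian factor, the integral of the squared
  transform becomes the double integral of g(x) and the conjugate of g(y) against the Gaussian
  kernel at x - y. That is at most (2 pi)^d times the integral of |g|^2, uniformly in the factor,
  which Fatou's lemma then removes.\<close>

lemma Bessel_fourier:
  fixes g :: "'a::euclidean_space \<Rightarrow> complex"
  assumes g: "integrable lborel g"
  shows "(\<integral>\<^sup>+ \<xi>. ennreal ((norm (fourier g \<xi>))\<^sup>2) \<partial>lborel) \<le> ennreal ((2 * pi) ^ DIM('a)) * (\<integral>\<^sup>+ x. ennreal ((norm (g x))\<^sup>2) \<partial>lborel)"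
proof -
  have [measurable]: "g \<in> borel_measurable borel" using borel_measurable_integrable[OF g] by simp
  note [measurable] = measurable_fourier[OF g]
  let ?R = "ennreal ((2 * pi) ^ DIM('a)) * (\<integral>\<^sup>+ x. ennreal ((norm (g x))\<^sup>2) \<partial>lborel)"
  have reg: "(\<integral>\<^sup>+ \<xi>. ennreal (exp (- u * (norm \<xi>)\<^sup>2) * (norm (fourier g \<xi>))\<^sup>2) \<partial>lborel) \<le> ?R" if u: "0 < u" for u
  proof -
    note gauss_kernel_nonneg[OF u, simp]
    \<comment> \<open>The reflected conjugate, chosen because its transform is the conjugate of
      \<open>fourier g\<close>.\<close>
    define g' where "g' y = cnj (g (- y))" for y
    have g': "integrable lborel g'"
      unfolding g'_def using integrable_lborel_affine[OF g, of "-1" 0] by simp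
    have fg': "fourier g' \<xi> = cnj (fourier g \<xi>)" for \<xi>
      unfolding g'_def cnj_fourier[OF g] by (rule fourier_uminus) measurable
    define m where "m \<xi> = cnj (fourier g \<xi>) * complex_of_real (exp (- u * (norm \<xi>)\<^sup>2))" for \<xi> :: 'a
    have m: "integrable lborel m"
    proof (rule Bochner_Integration.integrable_bound)
      show "integrable lborel (\<lambda>\<xi>::'a. (LINT x|lborel. norm (g x)) *\<^sub>R complex_of_real (exp (- u * (norm \<xi>)\<^sup>2)))"
        by (intro integrable_scaleR_right integrable_gaussian u)
      show "m \<in> borel_measurable lborel" unfolding m_def by measurable
      show "AE \<xi> in lborel. norm (m \<xi>) \<le> norm ((LINT x|lborel. norm (g x)) *\<^sub>R complex_of_real (exp (- u * (norm \<xi>)\<^sup>2)))"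
        by (intro AE_I2) (auto simp: m_def norm_mult intro!: mult_right_mono order_trans[OF norm_fourier_le])
    qed
    have [measurable]: "m \<in> borel_measurable borel" using borel_measurable_integrable[OF m] by simp
    have fm: "fourier m x = (LINT y|lborel. g' y * complex_of_real (gauss_kernel u (x + y)))" for x
      unfolding fourier_gauss_regularized[OF g' u, of x, symmetric]
      unfolding fourier_def[of m] m_def fg' by (simp only: mult_ac)
    have nfm: "ennreal (norm (fourier m x)) \<le> (\<integral>\<^sup>+ y. ennreal (norm (g y)) * ennreal (gauss_kernel u (x - y)) \<partial>lborel)" for x
    proof -
      have "ennreal (norm (fourier m x)) \<le> (\<integral>\<^sup>+ y. norm (g' y * complex_of_real (gauss_kernel u (x + y))) \<partial>lborel)"
        unfolding fm by (rule integral_norm_bound_ennreal[OF integrable_mult_gauss_kernel[OF g' u]])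
      also have "\<dots> = (\<integral>\<^sup>+ y. ennreal (norm (g (- y))) * ennreal (gauss_kernel u (x + y)) \<partial>lborel)"
        by (intro nn_integral_cong) (simp add: g'_def norm_mult ennreal_mult)
      also have "\<dots> = (\<integral>\<^sup>+ y. ennreal (norm (g y)) * ennreal (gauss_kernel u (x - y)) \<partial>lborel)"
        using nn_integral_lborel_affine[of "\<lambda>y. ennreal (norm (g y)) * ennreal (gauss_kernel u (x - y))" "-1" 0] by simp
      finally show ?thesis .
    qed
    have real: "fourier g \<xi> * m \<xi> = complex_of_real (exp (- u * (norm \<xi>)\<^sup>2) * (norm (fourier g \<xi>))\<^sup>2)" for \<xi>
    proof -
      have "fourier g \<xi> * cnj (fourier g \<xi>) = complex_of_real ((norm (fourier g \<xi>))\<^sup>2)"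
        by (rule complex_norm_square[symmetric])
      then show ?thesis unfolding m_def mult.assoc[symmetric] by (simp only: of_real_mult mult.commute)
    qed
    have intr: "integrable lborel (\<lambda>\<xi>. fourier g \<xi> * m \<xi>)"
      by (rule Bochner_Integration.integrable_bound[OF integrable_scaleR_right[OF m, of "LINT x|lborel. norm (g x)"]])
         (auto simp: norm_mult intro!: mult_right_mono order_trans[OF norm_fourier_le])
    have intr': "integrable lborel (\<lambda>\<xi>. exp (- u * (norm \<xi>)\<^sup>2) * (norm (fourier g \<xi>))\<^sup>2)"
      using integrable_Re[OF intr] unfolding real by simp
    let ?J = "LINT \<xi>|lborel. exp (- u * (norm \<xi>)\<^sup>2) * (norm (fourier g \<xi>))\<^sup>2"
    have "complex_of_real ?J = (LINT x|lborel. g x * fourier m x)"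
      unfolding fourier_multiplication[OF g m, symmetric] real by (rule integral_complex_of_real[symmetric])
    then have J: "norm (complex_of_real ?J) = norm (LINT x|lborel. g x * fourier m x)" by simp
    have "(\<integral>\<^sup>+ \<xi>. ennreal (exp (- u * (norm \<xi>)\<^sup>2) * (norm (fourier g \<xi>))\<^sup>2) \<partial>lborel) = ennreal ?J"
      by (rule nn_integral_eq_integral[OF intr']) auto
    also have "\<dots> \<le> ennreal (norm (LINT x|lborel. g x * fourier m x))"
      unfolding J[symmetric] by (simp add: ennreal_leI)
    also have "\<dots> \<le> (\<integral>\<^sup>+ x. norm (g x * fourier m x) \<partial>lborel)"
    proof (rule integral_norm_bound_ennreal)
      show "integrable lborel (\<lambda>x. g x * fourier m x)"
        by (rule Bochner_Integration.integrable_bound[OF integrable_scaleR_right[OF g, of "LINT x|lborel. norm (m x)"]])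
           (use measurable_fourier[OF m] in \<open>auto simp: norm_mult mult.commute[of "norm (g _)"] intro!: mult_right_mono order_trans[OF norm_fourier_le]\<close>)
    qed
    also have "\<dots> \<le> (\<integral>\<^sup>+ x. ennreal (norm (g x)) * (\<integral>\<^sup>+ y. ennreal (norm (g y)) * ennreal (gauss_kernel u (x - y)) \<partial>lborel) \<partial>lborel)"
      by (intro nn_integral_mono) (auto simp: norm_mult ennreal_mult intro!: mult_left_mono nfm)
    also have "\<dots> = (\<integral>\<^sup>+ x. \<integral>\<^sup>+ y. ennreal (norm (g x)) * (ennreal (norm (g y)) * ennreal (gauss_kernel u (x - y))) \<partial>lborel \<partial>lborel)"
      by (simp add: nn_integral_cmult)
    \<comment> \<open>Schur's test in its simplest form: |g(x) g(y)| is split into squares, and in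
      each term the kernel, whose mass is constant, is integrated in the other variable.\<close>
    also have "\<dots> \<le> (\<integral>\<^sup>+ x. \<integral>\<^sup>+ y. ennreal ((norm (g x))\<^sup>2 / 2) * ennreal (gauss_kernel u (y - x))
        + ennreal ((norm (g y))\<^sup>2 / 2) * ennreal (gauss_kernel u (x - y)) \<partial>lborel \<partial>lborel)"
    proof (intro nn_integral_mono)
      fix x y
      have "norm (g x) * norm (g y) \<le> (norm (g x))\<^sup>2 / 2 + (norm (g y))\<^sup>2 / 2"
        using sum_squares_bound[of "norm (g x)" "norm (g y)"] by simp
      then have "norm (g x) * (norm (g y) * gauss_kernel u (x - y)) \<le> ((norm (g x))\<^sup>2 / 2 + (norm (g y))\<^sup>2 / 2) * gauss_kernel u (x - y)"
        by (simp add: mult.assoc[symmetric] mult_right_mono)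
      moreover have "gauss_kernel u (y - x) = gauss_kernel u (x - y)" by (simp add: gauss_kernel_def norm_minus_commute)
      ultimately show "ennreal (norm (g x)) * (ennreal (norm (g y)) * ennreal (gauss_kernel u (x - y)))
        \<le> ennreal ((norm (g x))\<^sup>2 / 2) * ennreal (gauss_kernel u (y - x))
        + ennreal ((norm (g y))\<^sup>2 / 2) * ennreal (gauss_kernel u (x - y))"
        by (simp add: ennreal_mult[symmetric] ennreal_plus[symmetric] distrib_right del: ennreal_plus)
    qed
    also have "\<dots> = (\<integral>\<^sup>+ x. ennreal ((norm (g x))\<^sup>2 / 2) * ennreal ((2 * pi) ^ DIM('a)) \<partial>lborel)
        + (\<integral>\<^sup>+ x. \<integral>\<^sup>+ y. ennreal ((norm (g y))\<^sup>2 / 2) * ennreal (gauss_kernel u (x - y)) \<partial>lborel \<partial>lborel)"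
      using nn_integral_gauss_kernel[OF u, where ?'a = 'a] by (simp add: nn_integral_add nn_integral_cmult)
    also have "(\<integral>\<^sup>+ x. \<integral>\<^sup>+ y. ennreal ((norm (g y))\<^sup>2 / 2) * ennreal (gauss_kernel u (x - y)) \<partial>lborel \<partial>lborel)
        = (\<integral>\<^sup>+ y. \<integral>\<^sup>+ x. ennreal ((norm (g y))\<^sup>2 / 2) * ennreal (gauss_kernel u (x - y)) \<partial>lborel \<partial>lborel)"
      by (rule lborel_pair.Fubini') measurable
    also have "\<dots> = (\<integral>\<^sup>+ x. ennreal ((norm (g x))\<^sup>2 / 2) * ennreal ((2 * pi) ^ DIM('a)) \<partial>lborel)"
      using nn_integral_gauss_kernel[OF u, where ?'a = 'a] by (simp add: nn_integral_cmult)
    also have "(\<integral>\<^sup>+ x. ennreal ((norm (g x))\<^sup>2 / 2) * ennreal ((2 * pi) ^ DIM('a)) \<partial>lborel)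
       + (\<integral>\<^sup>+ x. ennreal ((norm (g x))\<^sup>2 / 2) * ennreal ((2 * pi) ^ DIM('a)) \<partial>lborel) = ?R"
      by (subst nn_integral_add[symmetric], measurable, subst nn_integral_cmult[symmetric], measurable)
         (auto intro!: nn_integral_cong simp: ennreal_mult[symmetric] ennreal_plus[symmetric] simp del: ennreal_plus)
    finally show ?thesis .
  qed
  have "(\<integral>\<^sup>+ \<xi>. ennreal ((norm (fourier g \<xi>))\<^sup>2) \<partial>lborel)
     = (\<integral>\<^sup>+ \<xi>. liminf (\<lambda>n. ennreal (exp (- (1 / real (Suc n)) * (norm \<xi>)\<^sup>2) * (norm (fourier g \<xi>))\<^sup>2)) \<partial>lborel)"
  proof (rule nn_integral_cong)
    fix \<xi> :: 'a
    have "(\<lambda>n. exp (- (1 / real (Suc n)) * (norm \<xi>)\<^sup>2) * (norm (fourier g \<xi>))\<^sup>2) \<longlonglongrightarrow> exp (- 0 * (norm \<xi>)\<^sup>2) * (norm (fourier g \<xi>))\<^sup>2"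
      by (intro tendsto_intros LIMSEQ_Suc[OF lim_1_over_n])
    then have "(\<lambda>n. ennreal (exp (- (1 / real (Suc n)) * (norm \<xi>)\<^sup>2) * (norm (fourier g \<xi>))\<^sup>2)) \<longlonglongrightarrow> ennreal ((norm (fourier g \<xi>))\<^sup>2)"
      by (intro tendsto_ennrealI) simp
    from lim_imp_Liminf[OF _ this] show "ennreal ((norm (fourier g \<xi>))\<^sup>2) =
       liminf (\<lambda>n. ennreal (exp (- (1 / real (Suc n)) * (norm \<xi>)\<^sup>2) * (norm (fourier g \<xi>))\<^sup>2))" by simp
  qed
  also have "\<dots> \<le> liminf (\<lambda>n. \<integral>\<^sup>+ \<xi>. ennreal (exp (- (1 / real (Suc n)) * (norm \<xi>)\<^sup>2) * (norm (fourier g \<xi>))\<^sup>2) \<partial>lborel)"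
    by (rule nn_integral_liminf) measurable
  also have "\<dots> \<le> ?R"
    by (intro Liminf_le always_eventually allI reg) (auto simp: sequentially_bot)
  finally show ?thesis .
qed

section \<open>Fourier inversion at points of continuity\<close>

lemma gauss_kernel_tail:
  fixes z :: "'a::euclidean_space"
  assumes u: "0 < u" and "\<eta> \<le> norm z" "0 \<le> \<eta>"
  shows "gauss_kernel u z \<le> exp (- \<eta>\<^sup>2 / (8 * u)) * sqrt 2 ^ DIM('a) * gauss_kernel (2 * u) z"
proof -
  \<comment> \<open>Half of the exponent is spent on decay in \<open>\<eta>\<close>; the other half
    is the exponent of the kernel with parameter 2 u, so that its mass and its height remain
    available.\<close>
  have "gauss_kernel u z = exp (- (norm z)\<^sup>2 / (8 * u)) * (sqrt (pi / u) ^ DIM('a) * exp (- (norm z)\<^sup>2 / (4 * (2 * u))))"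
    using u by (simp add: gauss_kernel_def mult_exp_exp mult.left_commute)
  also have "\<dots> \<le> exp (- \<eta>\<^sup>2 / (8 * u)) * (sqrt (pi / u) ^ DIM('a) * exp (- (norm z)\<^sup>2 / (4 * (2 * u))))"
    using assms by (intro mult_right_mono) (auto intro!: divide_right_mono power_mono)
  also have "sqrt (pi / u) = sqrt 2 * sqrt (pi / (2 * u))"
    using u by (subst real_sqrt_mult[symmetric]) simp
  finally show ?thesis by (simp add: gauss_kernel_def power_mult_distrib mult_ac)
qed

text \<open>Here u = 1 / (n + 1): away from the centre the exponential factor beats the height of
  the kernel, which grows only polynomially in \<open>n\<close>.\<close>

lemma tendsto_exp_gauss_factor:
  assumes "0 < \<eta>"
  shows "(\<lambda>n. exp (- \<eta>\<^sup>2 / (8 * (1 / real (Suc n)))) * sqrt (pi / (1 / real (Suc n))) ^ m) \<longlonglongrightarrow> 0"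
proof -
  define c where "c = \<eta>\<^sup>2 / 8"
  have c: "0 < c" using assms by (simp add: c_def)
  have 1: "((\<lambda>x::real. (x ^ m / exp x)) \<longlongrightarrow> 0) at_top" by (rule tendsto_power_div_exp_0)
  have "filterlim (\<lambda>n. c * real (Suc n)) at_top sequentially" using c by real_asymp
  from filterlim_compose[OF 1 this]
  have 2: "(\<lambda>n. ((c * real (Suc n)) ^ m / exp (c * real (Suc n))) * ((1 + pi) / c) ^ m) \<longlonglongrightarrow> 0 * ((1 + pi) / c) ^ m"
    by (rule tendsto_mult_right)
  show ?thesis
  proof (rule tendsto_sandwich[OF _ _ tendsto_const, where h = "\<lambda>n. ((c * real (Suc n)) ^ m / exp (c * real (Suc n))) * ((1 + pi) / c) ^ m"])
    show "\<forall>\<^sub>F n in sequentially. exp (- \<eta>\<^sup>2 / (8 * (1 / real (Suc n)))) * sqrt (pi / (1 / real (Suc n))) ^ m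
      \<le> ((c * real (Suc n)) ^ m / exp (c * real (Suc n))) * ((1 + pi) / c) ^ m"
    proof (intro always_eventually allI)
      fix n
      have "sqrt (pi / (1 / real (Suc n))) \<le> (1 + pi) * real (Suc n)"
      proof (rule real_le_lsqrt)
        have "pi * real (Suc n) \<le> (1 + pi)\<^sup>2 * (real (Suc n))\<^sup>2"
        proof (rule mult_mono)
          have "pi * 1 \<le> (1 + pi) * (1 + pi)" by (intro mult_mono) auto
          then show "pi \<le> (1 + pi)\<^sup>2" by (simp add: power2_eq_square)
          show "real (Suc n) \<le> (real (Suc n))\<^sup>2" by (simp add: power2_eq_square)
        qed auto
        then show "pi / (1 / real (Suc n)) \<le> ((1 + pi) * real (Suc n))\<^sup>2" by (simp add: power_mult_distrib)
      qed auto
      then have "sqrt (pi / (1 / real (Suc n))) ^ m \<le> ((1 + pi) * real (Suc n)) ^ m" by (intro power_mono) auto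
      then have "exp (- (c * real (Suc n))) * sqrt (pi / (1 / real (Suc n))) ^ m \<le> exp (- (c * real (Suc n))) * ((1 + pi) * real (Suc n)) ^ m"
        by (intro mult_left_mono) auto
      also have "\<dots> = ((c * real (Suc n)) ^ m / exp (c * real (Suc n))) * ((1 + pi) / c) ^ m"
      proof -
        have "((1 + pi) * real (Suc n)) ^ m = (c * real (Suc n)) ^ m * ((1 + pi) / c) ^ m"
          by (subst power_mult_distrib[symmetric]) (use c in \<open>simp add: mult.commute\<close>)
        then show ?thesis by (simp only: exp_minus divide_inverse mult_ac)
      qed
      also have "- (c * real (Suc n)) = - \<eta>\<^sup>2 / (8 * (1 / real (Suc n)))" by (simp add: c_def del: of_nat_Suc)
      finally show "exp (- \<eta>\<^sup>2 / (8 * (1 / real (Suc n)))) * sqrt (pi / (1 / real (Suc n))) ^ m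
        \<le> ((c * real (Suc n)) ^ m / exp (c * real (Suc n))) * ((1 + pi) / c) ^ m" .
    qed
  qed (use 2 in auto)
qed

lemma integrable_gauss_kernel:
  fixes x :: "'a::euclidean_space"
  assumes "0 < u"
  shows "integrable lborel (\<lambda>y. gauss_kernel u (y - x))"
    and "(LINT y|lborel. gauss_kernel u (y - x)) = (2 * pi) ^ DIM('a)"
proof -
  show "integrable lborel (\<lambda>y. gauss_kernel u (y - x))"
    using nn_integral_gauss_kernel[OF assms, of x] gauss_kernel_nonneg[OF assms]
    by (intro integrableI_nonneg) auto
  show "(LINT y|lborel. gauss_kernel u (y - x)) = (2 * pi) ^ DIM('a)"
    using nn_integral_gauss_kernel[OF assms, of x] gauss_kernel_nonneg[OF assms]
    by (subst integral_eq_nn_integral) auto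
qed

text \<open>Gaussian means of \<open>k\<close> tend to (2 pi)^d k(x) by continuity at
  \<open>x\<close>, and to the iterated transform by dominated convergence, \<open>fourier k\<close>
  being integrable. Since \<open>k\<close> may be unbounded away from \<open>x\<close>, its far part
  is estimated by the height of the kernel tail times the L^1 norm of \<open>k\<close>, while the
  constant k(x) is estimated by the mass of that tail.\<close>

lemma fourier_inversion:
  fixes k :: "'a::euclidean_space \<Rightarrow> complex"
  assumes k: "integrable lborel k" and fk: "integrable lborel (fourier k)" and cont: "isCont k x"
  shows "fourier (fourier k) (- x) = complex_of_real ((2 * pi) ^ DIM('a)) * k x"
proof -
  have [measurable]: "k \<in> borel_measurable borel" using borel_measurable_integrable[OF k] by simp
  note [measurable] = measurable_fourier[OF k]
  define u where "u n = 1 / real (Suc n)" for n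
  have u: "0 < u n" for n by (simp add: u_def)
  have u0: "u \<longlonglongrightarrow> 0" unfolding u_def by (rule LIMSEQ_Suc[OF lim_1_over_n])
  let ?C = "complex_of_real ((2 * pi) ^ DIM('a))"
  define V where "V = fourier (fourier k) (- x)"
  define L where "L n = (LINT \<xi>|lborel. fourier k \<xi> * (cis (- x \<bullet> \<xi>) * complex_of_real (exp (- u n * (norm \<xi>)\<^sup>2))))" for n
  have LV: "L \<longlonglongrightarrow> V"
    unfolding L_def V_def fourier_def[of "fourier k"]
  proof (rule integral_dominated_convergence[where w = "\<lambda>\<xi>. norm (fourier k \<xi>)"])
    show "AE \<xi> in lborel. (\<lambda>n. fourier k \<xi> * (cis (- x \<bullet> \<xi>) * complex_of_real (exp (- u n * (norm \<xi>)\<^sup>2)))) \<longlonglongrightarrow> cis (- x \<bullet> \<xi>) * fourier k \<xi>"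
    proof (intro AE_I2)
      fix \<xi> :: 'a
      have "(\<lambda>n. fourier k \<xi> * (cis (- x \<bullet> \<xi>) * complex_of_real (exp (- u n * (norm \<xi>)\<^sup>2)))) \<longlonglongrightarrow> fourier k \<xi> * (cis (- x \<bullet> \<xi>) * complex_of_real (exp (- 0 * (norm \<xi>)\<^sup>2)))"
        by (intro tendsto_intros u0)
      then show "(\<lambda>n. fourier k \<xi> * (cis (- x \<bullet> \<xi>) * complex_of_real (exp (- u n * (norm \<xi>)\<^sup>2)))) \<longlonglongrightarrow> cis (- x \<bullet> \<xi>) * fourier k \<xi>"
        by (simp add: mult.commute)
    qed
    show "AE \<xi> in lborel. norm (fourier k \<xi> * (cis (- x \<bullet> \<xi>) * complex_of_real (exp (- u n * (norm \<xi>)\<^sup>2)))) \<le> norm (fourier k \<xi>)" for n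
      using u[of n] by (intro AE_I2) (simp add: norm_mult mult_left_le)
  qed (use fk in \<open>auto intro: integrable_norm\<close>)
  have L: "L n - ?C * k x = (LINT y|lborel. (k y - k x) * complex_of_real (gauss_kernel (u n) (y - x)))" for n
  proof -
    have i1: "integrable lborel (\<lambda>y. k y * complex_of_real (gauss_kernel (u n) (y - x)))"
      using integrable_mult_gauss_kernel[OF k u[of n], of "- x"] by simp
    have i2: "integrable lborel (\<lambda>y. k x * complex_of_real (gauss_kernel (u n) (y - x)))"
      by (intro integrable_mult_right integrable_of_real integrable_gauss_kernel u)
    have "L n = (LINT y|lborel. k y * complex_of_real (gauss_kernel (u n) (y - x)))"
      unfolding L_def using fourier_gauss_regularized[OF k u[of n], of "- x"] by simp
    moreover have "?C * k x = (LINT y|lborel. k x * complex_of_real (gauss_kernel (u n) (y - x)))"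
      by (simp add: integrable_gauss_kernel[OF u[of n]] mult.commute)
    ultimately show ?thesis
      unfolding left_diff_distrib Bochner_Integration.integral_diff[OF i1 i2] by (simp only:)
  qed
  have "norm (V - ?C * k x) \<le> \<epsilon> * (2 * pi) ^ DIM('a)" if \<epsilon>: "0 < \<epsilon>" for \<epsilon>
  proof -
    obtain \<eta> where \<eta>: "0 < \<eta>" "\<And>y. dist y x < \<eta> \<Longrightarrow> dist (k y) (k x) < \<epsilon>"
      using cont \<epsilon> unfolding continuous_at_eps_delta by metis
    define A where "A n = exp (- \<eta>\<^sup>2 / (8 * u n))" for n
    define N1 where "N1 = (LINT y|lborel. norm (k y))"
    define B where "B n = \<epsilon> * (2 * pi) ^ DIM('a) + A n * sqrt (pi / u n) ^ DIM('a) * N1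
       + norm (k x) * (A n * sqrt 2 ^ DIM('a) * (2 * pi) ^ DIM('a))" for n
    have bd: "norm (L n - ?C * k x) \<le> B n" for n
    proof -
      let ?G = "\<lambda>y. gauss_kernel (u n) (y - x)"
      let ?G2 = "\<lambda>y. gauss_kernel (2 * u n) (y - x)"
      have u2: "0 < 2 * u n" using u[of n] by simp
      have nn: "0 \<le> gauss_kernel (u n) z" "0 \<le> gauss_kernel (2 * u n) z" for z :: 'a
        by (intro gauss_kernel_nonneg u u2)+
      have "norm (L n - ?C * k x) \<le> (LINT y|lborel. \<epsilon> * ?G y + A n * sqrt (pi / u n) ^ DIM('a) * norm (k y) + norm (k x) * (A n * sqrt 2 ^ DIM('a) * ?G2 y))"
        unfolding L
      proof (rule order_trans[OF integral_norm_bound integral_mono'])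
        show "integrable lborel (\<lambda>y. \<epsilon> * ?G y + A n * sqrt (pi / u n) ^ DIM('a) * norm (k y) + norm (k x) * (A n * sqrt 2 ^ DIM('a) * ?G2 y))"
          by (intro Bochner_Integration.integrable_add integrable_mult_right integrable_gauss_kernel u u2 integrable_norm k)
        fix y
        show "norm ((k y - k x) * complex_of_real (?G y)) \<le> \<epsilon> * ?G y + A n * sqrt (pi / u n) ^ DIM('a) * norm (k y) + norm (k x) * (A n * sqrt 2 ^ DIM('a) * ?G2 y)"
        proof -
          have eq: "norm ((k y - k x) * complex_of_real (?G y)) = norm (k y - k x) * ?G y"
            by (simp add: norm_mult abs_of_nonneg[OF nn(1)])
          show ?thesis
        proof (cases "dist y x < \<eta>")
          case True
          then have "norm (k y - k x) \<le> \<epsilon>" using \<eta>(2)[OF True] by (simp add: dist_norm)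
          then have "norm (k y - k x) * ?G y \<le> \<epsilon> * ?G y" using nn by (intro mult_right_mono) auto
          moreover have "0 \<le> A n * sqrt (pi / u n) ^ DIM('a) * norm (k y) + norm (k x) * (A n * sqrt 2 ^ DIM('a) * ?G2 y)"
            using nn u[of n] by (auto simp: A_def intro!: add_nonneg_nonneg mult_nonneg_nonneg)
          ultimately show ?thesis unfolding eq by linarith
        next
          case False
          then have tail: "?G y \<le> A n * sqrt 2 ^ DIM('a) * ?G2 y"
            unfolding A_def using \<eta> u by (intro gauss_kernel_tail) (auto simp: dist_norm)
          have "?G y \<le> A n * sqrt (pi / u n) ^ DIM('a)"
          proof -
            have "?G2 y \<le> sqrt (pi / (2 * u n)) ^ DIM('a)" by (rule gauss_kernel_le[OF u2])
            then have "A n * sqrt 2 ^ DIM('a) * ?G2 y \<le> A n * sqrt 2 ^ DIM('a) * sqrt (pi / (2 * u n)) ^ DIM('a)"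
              by (intro mult_left_mono) (auto simp: A_def)
            also have "\<dots> = A n * sqrt (pi / u n) ^ DIM('a)"
              using u[of n] by (simp add: power_mult_distrib[symmetric] real_sqrt_mult[symmetric] mult.assoc)
            finally show ?thesis using tail by simp
          qed
          then have "norm (k y) * ?G y \<le> A n * sqrt (pi / u n) ^ DIM('a) * norm (k y)"
            by (subst mult.commute) (intro mult_right_mono, auto)
          moreover have "norm (k x) * ?G y \<le> norm (k x) * (A n * sqrt 2 ^ DIM('a) * ?G2 y)"
            by (intro mult_left_mono tail) auto
          moreover have "norm (k y - k x) * ?G y \<le> norm (k y) * ?G y + norm (k x) * ?G y"
            unfolding distrib_right[symmetric] using nn by (intro mult_right_mono norm_triangle_ineq4) auto
          moreover have "0 \<le> \<epsilon> * ?G y" using \<epsilon> nn by simp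
          ultimately show ?thesis unfolding eq by linarith
        qed
        qed
      qed (use nn \<epsilon> u[of n] in \<open>auto simp: A_def intro!: add_nonneg_nonneg mult_nonneg_nonneg\<close>)
      also have "\<dots> = B n"
        unfolding B_def N1_def using integrable_gauss_kernel[OF u[of n], of x] integrable_gauss_kernel[OF u2, of x] integrable_norm[OF k]
        by simp
      finally show ?thesis .
    qed
    have lim: "B \<longlonglongrightarrow> \<epsilon> * (2 * pi) ^ DIM('a) + 0 * N1 + norm (k x) * (0 * sqrt 2 ^ DIM('a) * (2 * pi) ^ DIM('a))"
      unfolding B_def A_def u_def
      using tendsto_exp_gauss_factor[OF \<eta>(1), of "DIM('a)"] tendsto_exp_gauss_factor[OF \<eta>(1), of 0]
      by (intro tendsto_intros) auto
    have "(\<lambda>n. norm (L n - ?C * k x)) \<longlonglongrightarrow> norm (V - ?C * k x)"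
      by (intro tendsto_intros LV)
    then have "norm (V - ?C * k x) \<le> \<epsilon> * (2 * pi) ^ DIM('a) + 0 * N1 + norm (k x) * (0 * sqrt 2 ^ DIM('a) * (2 * pi) ^ DIM('a))"
      by (rule LIMSEQ_le[OF _ lim]) (use bd in auto)
    then show ?thesis by simp
  qed
  then have "norm (V - ?C * k x) \<le> e" if "0 < e" for e
  proof -
    have "norm (V - ?C * k x) \<le> (e / (2 * pi) ^ DIM('a)) * (2 * pi) ^ DIM('a)"
      using that by (intro \<open>\<And>\<epsilon>. 0 < \<epsilon> \<Longrightarrow> _\<close>) simp
    then show ?thesis by simp
  qed
  then have "norm (V - ?C * k x) \<le> 0" by (rule field_le_epsilon) simp
  then show ?thesis by (simp add: V_def)
qed

subsection \<open>The stable kernel\<close>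

lemma tendsto_std_normal_cdf:
  shows "(cdf std_normal_distribution \<longlongrightarrow> 0) at_bot" "(cdf std_normal_distribution \<longlongrightarrow> 1) at_top"
proof -
  interpret real_distribution std_normal_distribution
    by (rule real_dist_normal_dist)
  show "(cdf std_normal_distribution \<longlongrightarrow> 0) at_bot" by (rule cdf_lim_at_bot)
  show "(cdf std_normal_distribution \<longlongrightarrow> 1) at_top" by (rule cdf_lim_at_top_prob)
qed

lemma DERIV_std_normal_cdf:
  "(cdf std_normal_distribution has_real_derivative std_normal_density x) (at x)"
proof -
  interpret real_distribution std_normal_distribution
    by (rule real_dist_normal_dist)
  let ?c = "x - 1"
  have *: "cdf std_normal_distribution y = cdf std_normal_distribution ?c + (LBINT z=?c..y. std_normal_density z)" if "?c < y" for y
  proof -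
    have "cdf std_normal_distribution y - cdf std_normal_distribution ?c = measure std_normal_distribution {?c<..y}"
      using that by (rule cdf_diff_eq)
    also have "\<dots> = (LINT z|std_normal_distribution. indicator {?c<..y} z)" by simp
    also have "\<dots> = (LINT z|lborel. std_normal_density z * indicator {?c<..y} z)"
      by (subst integral_density) auto
    also have "\<dots> = (LBINT z=?c..y. std_normal_density z)"
      using that by (simp add: interval_integral_Ioc set_lebesgue_integral_def mult.commute)
    finally show ?thesis by simp
  qed
  have "((\<lambda>y. LBINT z=?c..y. std_normal_density z) has_vector_derivative std_normal_density x) (at x within {?c..x + 1})"
    by (rule interval_integral_FTC2) (auto simp: std_normal_density_def intro!: continuous_intros)
  then have "((\<lambda>y. LBINT z=?c..y. std_normal_density z) has_real_derivative std_normal_density x) (at x)"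
    by (simp add: has_real_derivative_iff_has_vector_derivative at_within_Icc_at)
  then have "((\<lambda>y. cdf std_normal_distribution ?c + (LBINT z=?c..y. std_normal_density z)) has_real_derivative std_normal_density x) (at x)"
    by (auto intro!: derivative_eq_intros)
  then show ?thesis
    by (rule has_field_derivative_transform_within_open[where S = "{?c<..}"]) (use * in auto)
qed

text \<open>Integration by the explicit antiderivative \<open>\<Lambda>\<close>. The squares of
  \<open>p\<close> and \<open>m\<close> differ only in the sign of the mixed term, which the factors
  exp (2 a b) and exp (- 2 a b) compensate. Both normal densities thus become the same exponential,
  the b-terms of the derivative cancel, and the a-terms add up to the integrand.\<close>

lemma has_bochner_integral_one_half_stable:
  fixes t b :: real
  assumes t: "0 < t" and b: "0 < b"
  shows "has_bochner_integral lborel (\<lambda>s. indicator {0<..} s * (t / (2 * sqrt pi) * exp (- t\<^sup>2 / (4 * s)) * s powr (- 3 / 2)) * exp (- s * b\<^sup>2))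
    (exp (- t * b))"
proof -
  define F where "F = cdf std_normal_distribution"
  define a where "a = t / 2"
  have a: "0 < a" using t by (simp add: a_def)
  define p where "p s = sqrt 2 * (a / sqrt s + b * sqrt s)" for s
  define m where "m s = sqrt 2 * (a / sqrt s - b * sqrt s)" for s
  define \<Lambda> where "\<Lambda> s = exp (2 * a * b) * (1 - F (p s)) + exp (- 2 * a * b) * (1 - F (m s))" for s
  let ?f = "\<lambda>s. (t / (2 * sqrt pi) * exp (- t\<^sup>2 / (4 * s)) * s powr (- 3 / 2)) * exp (- s * b\<^sup>2)"
  have F0: "(F \<longlongrightarrow> 0) at_bot" and F1: "(F \<longlongrightarrow> 1) at_top"
    unfolding F_def by (rule tendsto_std_normal_cdf)+
  have dF: "(F has_real_derivative std_normal_density x) (at x)" for x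
    unfolding F_def by (rule DERIV_std_normal_cdf)
  have d\<Lambda>: "(\<Lambda> has_real_derivative ?f s) (at s)" if s: "0 < s" for s
  proof -
    define r where "r = sqrt s"
    have r: "0 < r" "s = r\<^sup>2" using s by (auto simp: r_def)
    have dp: "(p has_real_derivative sqrt 2 * (- a / (2 * r ^ 3) + b / (2 * r))) (at s)"
      unfolding p_def r_def using s
      by (auto intro!: derivative_eq_intros simp: field_simps power2_eq_square power3_eq_cube)
    have dm: "(m has_real_derivative sqrt 2 * (- a / (2 * r ^ 3) - b / (2 * r))) (at s)"
      unfolding m_def r_def using s
      by (auto intro!: derivative_eq_intros simp: field_simps power2_eq_square power3_eq_cube)
    have "(\<Lambda> has_real_derivative exp (2 * a * b) * (0 - std_normal_density (p s) * (sqrt 2 * (- a / (2 * r ^ 3) + b / (2 * r))))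
       + exp (- 2 * a * b) * (0 - std_normal_density (m s) * (sqrt 2 * (- a / (2 * r ^ 3) - b / (2 * r))))) (at s)"
      unfolding \<Lambda>_def
      by (intro DERIV_add DERIV_cmult DERIV_diff DERIV_const DERIV_chain2[OF dF] dp dm)
    also have "exp (2 * a * b) * (0 - std_normal_density (p s) * (sqrt 2 * (- a / (2 * r ^ 3) + b / (2 * r))))
       + exp (- 2 * a * b) * (0 - std_normal_density (m s) * (sqrt 2 * (- a / (2 * r ^ 3) - b / (2 * r)))) = ?f s"
    proof -
      have e1: "exp (2 * a * b) * std_normal_density (p s) = exp (- a\<^sup>2 / s - b\<^sup>2 * s) / sqrt (2 * pi)"
      proof -
        have "2 * a * b + - (p s)\<^sup>2 / 2 = - a\<^sup>2 / s - b\<^sup>2 * s"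
          using r unfolding p_def by (simp add: power_mult_distrib power2_sum power_divide) (simp add: field_simps)
        then show ?thesis by (simp add: std_normal_density_def mult_exp_exp)
      qed
      have e2: "exp (- 2 * a * b) * std_normal_density (m s) = exp (- a\<^sup>2 / s - b\<^sup>2 * s) / sqrt (2 * pi)"
      proof -
        have "- 2 * a * b + - (m s)\<^sup>2 / 2 = - a\<^sup>2 / s - b\<^sup>2 * s"
          using r unfolding m_def by (simp add: power_mult_distrib power2_diff power_divide) (simp add: field_simps)
        then show ?thesis by (simp add: std_normal_density_def mult_exp_exp)
      qed
      have "exp (2 * a * b) * (0 - std_normal_density (p s) * (sqrt 2 * (- a / (2 * r ^ 3) + b / (2 * r))))
       + exp (- 2 * a * b) * (0 - std_normal_density (m s) * (sqrt 2 * (- a / (2 * r ^ 3) - b / (2 * r))))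
       = - (exp (2 * a * b) * std_normal_density (p s)) * (sqrt 2 * (- a / (2 * r ^ 3) + b / (2 * r)))
       - (exp (- 2 * a * b) * std_normal_density (m s)) * (sqrt 2 * (- a / (2 * r ^ 3) - b / (2 * r)))"
        by (simp add: algebra_simps)
      also have "\<dots> = exp (- a\<^sup>2 / s - b\<^sup>2 * s) / sqrt (2 * pi) * (sqrt 2 * (a / r ^ 3))"
        unfolding e1 e2 by (simp add: algebra_simps add_divide_distrib[symmetric])
      also have "\<dots> = a / sqrt pi * exp (- a\<^sup>2 / s - b\<^sup>2 * s) / r ^ 3"
        by (simp add: real_sqrt_mult)
      also have "1 / r ^ 3 = s powr (- 3 / 2)"
      proof -
        have "s powr (- 3 / 2) = (s powr (1/2)) powr (- 3)" by (simp add: powr_powr)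
        also have "\<dots> = 1 / r ^ 3" using r by (simp add: powr_half_sqrt r_def[symmetric] powr_minus powr_numeral field_simps)
        finally show ?thesis by simp
      qed
      then have "a / sqrt pi * exp (- a\<^sup>2 / s - b\<^sup>2 * s) / r ^ 3 = a / sqrt pi * exp (- a\<^sup>2 / s - b\<^sup>2 * s) * s powr (- 3 / 2)"
        by (metis divide_inverse inverse_eq_divide)
      also have "\<dots> = ?f s"
      proof -
        have "exp (- a\<^sup>2 / s - b\<^sup>2 * s) = exp (- t\<^sup>2 / (4 * s)) * exp (- s * b\<^sup>2)"
          by (simp add: mult_exp_exp a_def power_divide mult.commute)
        then show ?thesis by (simp add: a_def)
      qed
      finally show ?thesis .
    qed
    finally show ?thesis .
  qed
  \<comment> \<open>At 0 both arguments tend to infinity and \<open>\<Lambda>\<close> to 0; at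
    infinity \<open>m\<close> tends to minus infinity instead, and only its factor exp (- 2 a b) =
    exp (- t b) survives.\<close>
  have lim0: "(\<Lambda> \<longlongrightarrow> exp (2 * a * b) * (1 - 1) + exp (- 2 * a * b) * (1 - 1)) (at_right 0)"
  proof -
    have "filterlim p at_top (at_right 0)" unfolding p_def using a b by real_asymp
    moreover have "filterlim m at_top (at_right 0)" unfolding m_def using a b by real_asymp
    ultimately show ?thesis unfolding \<Lambda>_def
      by (intro tendsto_intros filterlim_compose[OF F1])
  qed
  have limtop: "(\<Lambda> \<longlongrightarrow> exp (2 * a * b) * (1 - 1) + exp (- 2 * a * b) * (1 - 0)) at_top"
  proof -
    have "filterlim p at_top at_top" unfolding p_def using a b by real_asymp
    moreover have "filterlim m at_bot at_top" unfolding m_def using a b by real_asymp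
    ultimately show ?thesis unfolding \<Lambda>_def
      by (intro tendsto_intros filterlim_compose[OF F1] filterlim_compose[OF F0])
  qed
  have lim0': "(\<Lambda> \<longlongrightarrow> 0) (at_right 0)" and limtop': "(\<Lambda> \<longlongrightarrow> exp (- t * b)) at_top"
    using lim0 limtop by (simp_all add: a_def)
  have l0: "((\<Lambda> \<circ> real_of_ereal) \<longlongrightarrow> 0) (at_right 0)"
    using lim0' unfolding zero_ereal_def by (simp add: ereal_tendsto_simps)
  have l1: "((\<Lambda> \<circ> real_of_ereal) \<longlongrightarrow> exp (- t * b)) (at_left \<infinity>)"
    using limtop' by (simp add: ereal_tendsto_simps)
  note FTC = interval_integral_FTC_nonneg[where F = \<Lambda> and f = ?f and a = 0 and b = \<infinity> and A = 0 and B = "exp (- t * b)"]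
  have pos: "AE s in lborel. 0 < ereal s \<longrightarrow> ereal s < \<infinity> \<longrightarrow> 0 \<le> ?f s" using t by auto
  have ct: "isCont ?f s" if "0 < ereal s" "ereal s < \<infinity>" for s
    using that by (auto intro!: continuous_intros simp: zero_ereal_def)
  have dv: "DERIV \<Lambda> s :> ?f s" if "0 < ereal s" "ereal s < \<infinity>" for s
    using that by (intro d\<Lambda>) (simp add: zero_ereal_def)
  have ss: "(0::ereal) < \<infinity>" by simp
  have 1: "set_integrable lborel (einterval 0 \<infinity>) ?f" by (rule FTC(1)[OF ss dv ct pos l0 l1])
  have 2: "(LBINT s=0..\<infinity>. ?f s) = exp (- t * b) - 0" by (rule FTC(2)[OF ss dv ct pos l0 l1])
  have e: "einterval 0 \<infinity> = {0::real<..}" by (auto simp: einterval_def zero_ereal_def)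
  have "integrable lborel (\<lambda>s. indicator {0<..} s *\<^sub>R ?f s)"
    using 1 unfolding set_integrable_def e .
  moreover have "(LINT s|lborel. indicator {0<..} s *\<^sub>R ?f s) = exp (- t * b)"
    using 2 unfolding interval_lebesgue_integral_def set_lebesgue_integral_def e by (simp only: ss less_imp_le if_True diff_0_right)
  ultimately show ?thesis
    unfolding has_bochner_integral_iff by (simp only: real_scaleR_def mult.assoc)
qed

section \<open>Integrability of the symbols\<close>

lemma powr_exp_le_kernel:
  fixes s a b m :: real
  assumes s: "0 < s" and a: "0 < a" and b: "0 \<le> b" and m: "0 \<le> m"
  shows "\<exists>C\<ge>0. \<forall>x\<ge>0. x powr b * exp (- s * x powr a) \<le> C * (1 + x) powr (- m)"
proof -
  \<comment> \<open>For x \<ge> 1 the single term of order \<open>n\<close> of the exponential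
    series already outweighs x powr (b + m).\<close>
  obtain n :: nat where n: "(b + m) / a \<le> real n" using real_arch_simple by blast
  define C where "C = 2 powr m * (1 + fact n / s ^ n)"
  have C: "0 \<le> C" using s by (simp add: C_def)
  have "x powr b * exp (- s * x powr a) \<le> C * (1 + x) powr (- m)" if x: "0 \<le> x" for x
  proof -
    have "x powr b * exp (- s * x powr a) * (1 + x) powr m \<le> C"
    proof (cases "x \<le> 1")
      case True
      have "x powr b * exp (- s * x powr a) * (1 + x) powr m \<le> 1 * 1 * 2 powr m"
        using True x b m s by (intro mult_mono powr_mono2) (auto simp: powr_le1)
      also have "\<dots> \<le> C" using s by (simp add: C_def)
      finally show ?thesis .
    next
      case False
      then have x1: "1 \<le> x" by simp
      let ?y = "s * x powr a"
      have y: "0 < ?y" using s x1 by simp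
      have "?y ^ n / fact n \<le> exp ?y"
      proof -
        have sm: "summable (\<lambda>k. ?y ^ k /\<^sub>R fact k)" using exp_converges[of ?y] by (rule sums_summable)
        have "?y ^ n /\<^sub>R fact n = (\<Sum>k\<in>{n}. ?y ^ k /\<^sub>R fact k)" by simp
        also have "\<dots> \<le> (\<Sum>k. ?y ^ k /\<^sub>R fact k)" using y by (intro sum_le_suminf[OF sm]) auto
        also have "\<dots> = exp ?y" by (simp add: exp_def)
        finally show ?thesis by (simp add: field_simps)
      qed
      then have e: "exp (- ?y) * ?y ^ n \<le> fact n"
        by (simp add: exp_minus field_simps)
      have "x powr b * (1 + x) powr m \<le> x powr b * (2 powr m * x powr m)"
        using x1 m by (intro mult_left_mono) (auto simp: powr_mult[symmetric] intro!: powr_mono2)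
      also have "\<dots> = 2 powr m * x powr (b + m)" by (simp add: powr_add)
      also have "\<dots> \<le> 2 powr m * x powr (a * real n)"
        using n a x1 by (intro mult_left_mono powr_mono) (auto simp: field_simps)
      also have "x powr (a * real n) = ?y ^ n / s ^ n"
        using x1 s by (simp add: power_mult_distrib powr_powr[symmetric] powr_realpow)
      finally have "exp (- ?y) * (x powr b * (1 + x) powr m) \<le> exp (- ?y) * (2 powr m * (?y ^ n / s ^ n))"
        by (rule mult_left_mono) simp
      then have "x powr b * exp (- ?y) * (1 + x) powr m \<le> exp (- ?y) * (2 powr m * (?y ^ n / s ^ n))"
        by (simp only: mult.commute[of "x powr b"] mult.assoc)
      also have "\<dots> = 2 powr m / s ^ n * (exp (- ?y) * ?y ^ n)" by simp
      also have "\<dots> \<le> 2 powr m / s ^ n * fact n"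
        using s by (intro mult_left_mono e) auto
      also have "\<dots> \<le> C" unfolding C_def using s by (simp add: field_simps)
      finally show ?thesis by simp
    qed
    moreover have "(1 + x) powr (- m) = 1 / (1 + x) powr m" by (simp add: powr_minus field_simps)
    moreover have "0 < (1 + x) powr m" using x by simp
    ultimately show ?thesis by (simp add: pos_le_divide_eq)
  qed
  with C show ?thesis by blast
qed

lemma integrable_kernel:
  assumes a: "real DIM('a::euclidean_space) < a"
  shows "integrable lborel (\<lambda>x::'a. (1 + norm x) powr (- a))"
proof (rule integrableI_nonneg)
  show "(\<integral>\<^sup>+ x. ennreal ((1 + norm (x::'a)) powr (- a)) \<partial>lborel) < \<infinity>"
    using nn_integral_kernel_le[OF a, of 1 0] by (auto simp: top_unique less_top[symmetric] intro: le_less_trans)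
qed auto

lemma integrable_powr_exp:
  fixes s a b :: real
  assumes "0 < s" "0 < a" "0 \<le> b"
  shows "integrable lborel (\<lambda>\<xi>::'a::euclidean_space. norm \<xi> powr b * exp (- s * norm \<xi> powr a))"
proof -
  obtain C where C: "0 \<le> C" "\<And>x. 0 \<le> x \<Longrightarrow> x powr b * exp (- s * x powr a) \<le> C * (1 + x) powr (- (real DIM('a) + 1))"
    using powr_exp_le_kernel[OF assms, of "real DIM('a) + 1"] by auto
  show ?thesis
  proof (rule Bochner_Integration.integrable_bound)
    show "integrable lborel (\<lambda>\<xi>::'a. C * (1 + norm \<xi>) powr (- (real DIM('a) + 1)))"
      by (intro integrable_mult_right integrable_kernel) simp
    show "AE \<xi>::'a in lborel. norm (norm \<xi> powr b * exp (- s * norm \<xi> powr a)) \<le> norm (C * (1 + norm \<xi>) powr (- (real DIM('a) + 1)))"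
      using C by (intro AE_I2) (simp add: abs_mult)
  qed measurable
qed

lemma integrable_exp_powr:
  fixes s a :: real
  assumes "0 < s" "0 < a"
  shows "integrable lborel (\<lambda>\<xi>::'a::euclidean_space. exp (- s * norm \<xi> powr a))"
proof -
  obtain C where C: "0 \<le> C" "\<And>x. 0 \<le> x \<Longrightarrow> x powr 0 * exp (- s * x powr a) \<le> C * (1 + x) powr (- (real DIM('a) + 1))"
    using powr_exp_le_kernel[OF assms, of 0 "real DIM('a) + 1"] by auto
show ?thesis
proof (rule Bochner_Integration.integrable_bound)
  \<comment> \<open>The maximum with 1 serves the point \<xi> = 0: there \<open>0 powr 0 = 0\<close>
    makes the bound with \<open>C\<close> empty, while the symbol equals 1.\<close>
  show "integrable lborel (\<lambda>\<xi>::'a. max 1 C * (1 + norm \<xi>) powr (- (real DIM('a) + 1)))"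
    by (intro integrable_mult_right integrable_kernel) simp
  show "AE \<xi>::'a in lborel. norm (exp (- s * norm \<xi> powr a)) \<le> norm (max 1 C * (1 + norm \<xi>) powr (- (real DIM('a) + 1)))"
  proof (intro AE_I2)
    fix \<xi> :: 'a
    have "exp (- s * norm \<xi> powr a) \<le> max 1 C * (1 + norm \<xi>) powr (- (real DIM('a) + 1))"
    proof (cases "\<xi> = 0")
      case False
      then have "exp (- s * norm \<xi> powr a) \<le> C * (1 + norm \<xi>) powr (- (real DIM('a) + 1))" using C(2)[of "norm \<xi>"] by simp
      also have "\<dots> \<le> max 1 C * (1 + norm \<xi>) powr (- (real DIM('a) + 1))" by (intro mult_right_mono) auto
      finally show ?thesis .
    qed simp
    then show "norm (exp (- s * norm \<xi> powr a)) \<le> norm (max 1 C * (1 + norm \<xi>) powr (- (real DIM('a) + 1)))" by simp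
  qed
qed measurable
qed

text \<open>Inverse transform of exp (- t |\<xi>| powr a). The symbol is even, so the cosine
  suffices and the kernel is real by construction. Keeping the exponent as a parameter treats the
  stable density and its subordinated version alike.\<close>

definition stable_kernel :: "real \<Rightarrow> real \<Rightarrow> 'a::euclidean_space \<Rightarrow> real" where
  "stable_kernel a t x = (LINT \<xi>|lborel. cos (x \<bullet> \<xi>) * exp (- t * norm \<xi> powr a)) / (2 * pi) ^ DIM('a)"

lemma Re_fourier_of_real:
  assumes "integrable lborel m"
  shows "Re (fourier (\<lambda>\<xi>. complex_of_real (m \<xi>)) x) = (LINT \<xi>|lborel. cos (x \<bullet> \<xi>) * m \<xi>)"
proof -
  have "integrable lborel (\<lambda>\<xi>. cis (x \<bullet> \<xi>) * complex_of_real (m \<xi>))"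
    using assms by (intro integrable_cis_mult integrable_of_real)
  from integral_Re[OF this] show ?thesis unfolding fourier_def by simp
qed

text \<open>Inversion determines the density at every point, because it is continuous and its
  transform is integrable.\<close>

lemma transition_density_eq_stable_kernel:
  fixes k :: "real \<Rightarrow> 'a::euclidean_space \<Rightarrow> 'a \<Rightarrow> real"
  assumes k: "stable_transition_density \<alpha> k" and \<alpha>: "0 < \<alpha>" and s: "0 < s"
  shows "k s x 0 = stable_kernel \<alpha> s x"
proof -
  have cont: "continuous_on UNIV (\<lambda>x. k s x 0)" and int: "integrable lborel (\<lambda>x. k s x 0)"
    and ft: "\<And>\<xi>. (LINT x|lborel. exp (\<i> * complex_of_real (\<xi> \<bullet> x)) * complex_of_real (k s x 0)) = complex_of_real (exp (- s * norm \<xi> powr \<alpha>))"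
    using k[unfolded stable_transition_density_def, THEN spec, THEN mp, OF s] by - (elim conjE, assumption, elim conjE, assumption, elim conjE, erule spec)
  let ?k = "\<lambda>x. complex_of_real (k s x 0)"
  let ?m = "\<lambda>\<xi>::'a. exp (- s * norm \<xi> powr \<alpha>)"
  have fk: "fourier ?k = (\<lambda>\<xi>. complex_of_real (?m \<xi>))"
    using ft unfolding fourier_def cis_conv_exp by (intro ext)
  have m: "integrable lborel ?m" by (rule integrable_exp_powr[OF s \<alpha>])
  have "isCont ?k x"
    using continuous_on_eq_continuous_at[of UNIV "\<lambda>x. k s x 0"] cont by (intro continuous_intros) simp
  from fourier_inversion[OF _ _ this] have "fourier (\<lambda>\<xi>. complex_of_real (?m \<xi>)) (- x) = complex_of_real ((2 * pi) ^ DIM('a)) * ?k x"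
    unfolding fk using int m by simp
  then have "Re (fourier (\<lambda>\<xi>. complex_of_real (?m \<xi>)) (- x)) = (2 * pi) ^ DIM('a) * k s x 0"
    by (simp only: of_real_mult[symmetric] Re_complex_of_real)
  then show ?thesis unfolding Re_fourier_of_real[OF m] by (simp add: stable_kernel_def)
qed

text \<open>Subordination on the Fourier side: Fubini brings the integral in \<open>s\<close>
  inside, where the one-half stable Laplace transform with b = |\<xi>| powr (\<alpha> / 2) replaces
  exp (- s |\<xi>| powr \<alpha>) by exp (- t |\<xi>| powr (\<alpha> / 2)). The null set \<xi> = 0
  is left out, since \<open>b\<close> must be positive.\<close>

lemma subord_density_eq_stable_kernel:
  fixes k :: "real \<Rightarrow> 'a::euclidean_space \<Rightarrow> 'a \<Rightarrow> real"
  assumes k: "stable_transition_density \<alpha> k" and \<alpha>: "0 < \<alpha>" and t: "0 < t"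
  shows "subord_density k t x = stable_kernel (\<alpha> / 2) t x"
proof -
  define W where "W s = indicator {0<..} s * (t / (2 * sqrt pi) * exp (- t\<^sup>2 / (4 * s)) * s powr (- 3 / 2))" for s
  have W: "0 \<le> W s" for s using t by (auto simp: W_def split: split_indicator)
  have [measurable]: "W \<in> borel_measurable borel" unfolding W_def by measurable
  have laplace: "integrable lborel (\<lambda>s. W s * exp (- s * norm \<xi> powr \<alpha>))"
      "(LINT s|lborel. W s * exp (- s * norm \<xi> powr \<alpha>)) = exp (- t * norm \<xi> powr (\<alpha> / 2))"
    if "\<xi> \<noteq> 0" for \<xi> :: 'a
  proof -
    have "(norm \<xi> powr (\<alpha> / 2))\<^sup>2 = norm \<xi> powr \<alpha>"
      using that by (simp add: powr_realpow[symmetric] powr_powr)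
    then show "integrable lborel (\<lambda>s. W s * exp (- s * norm \<xi> powr \<alpha>))"
      "(LINT s|lborel. W s * exp (- s * norm \<xi> powr \<alpha>)) = exp (- t * norm \<xi> powr (\<alpha> / 2))"
      using has_bochner_integral_one_half_stable[OF t, of "norm \<xi> powr (\<alpha> / 2)"] that
      unfolding has_bochner_integral_iff W_def[symmetric] by auto
  qed
  have ae: "AE \<xi>::'a in lborel. \<xi> \<noteq> 0" by (rule AE_lborel_singleton)
  have int: "integrable (lborel \<Otimes>\<^sub>M lborel) (\<lambda>(s, \<xi>). W s * (cos (x \<bullet> \<xi>) * exp (- s * norm \<xi> powr \<alpha>)))"
  proof (rule integrableI_bounded)
    have "(\<integral>\<^sup>+ p. norm (case p of (s, \<xi>) \<Rightarrow> W s * (cos (x \<bullet> \<xi>) * exp (- s * norm \<xi> powr \<alpha>))) \<partial>(lborel \<Otimes>\<^sub>M lborel))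
      \<le> (\<integral>\<^sup>+ p. ennreal (W (fst p) * exp (- fst p * norm (snd p) powr \<alpha>)) \<partial>(lborel \<Otimes>\<^sub>M lborel :: (real \<times> 'a) measure))"
    proof (intro nn_integral_mono ennreal_leI)
      fix p :: "real \<times> 'a"
      have "\<bar>cos (x \<bullet> snd p)\<bar> * (W (fst p) * exp (- fst p * norm (snd p) powr \<alpha>)) \<le> 1 * (W (fst p) * exp (- fst p * norm (snd p) powr \<alpha>))"
        using W by (intro mult_right_mono) auto
      then show "norm (case p of (s, \<xi>) \<Rightarrow> W s * (cos (x \<bullet> \<xi>) * exp (- s * norm \<xi> powr \<alpha>))) \<le> W (fst p) * exp (- fst p * norm (snd p) powr \<alpha>)"
        using W[of "fst p"] by (simp add: case_prod_beta abs_mult mult_ac)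
    qed
    also have "\<dots> = (\<integral>\<^sup>+ \<xi>. \<integral>\<^sup>+ s. ennreal (W s * exp (- s * norm (\<xi>::'a) powr \<alpha>)) \<partial>lborel \<partial>lborel)"
      by (subst lborel_pair.nn_integral_snd[symmetric]) simp_all
    also have "\<dots> = (\<integral>\<^sup>+ \<xi>. ennreal (exp (- t * norm (\<xi>::'a) powr (\<alpha> / 2))) \<partial>lborel)"
    proof (intro nn_integral_cong_AE AE_mp[OF ae AE_I2] impI)
      fix \<xi> :: 'a assume *: "\<xi> \<noteq> 0"
      have "AE s in lborel. 0 \<le> W s * exp (- s * norm \<xi> powr \<alpha>)" using W by (intro AE_I2) simp
      from nn_integral_eq_integral[OF laplace(1)[OF *] this]
      show "(\<integral>\<^sup>+ s. ennreal (W s * exp (- s * norm \<xi> powr \<alpha>)) \<partial>lborel) = ennreal (exp (- t * norm \<xi> powr (\<alpha> / 2)))"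
        unfolding laplace(2)[OF *] .
    qed
    also have "\<dots> < \<infinity>"
      using integrable_exp_powr[OF t, of "\<alpha> / 2", where ?'a = 'a] \<alpha> by (simp add: integrable_iff_bounded)
    finally show "(\<integral>\<^sup>+ p. norm (case p of (s, \<xi>) \<Rightarrow> W s * (cos (x \<bullet> \<xi>) * exp (- s * norm \<xi> powr \<alpha>))) \<partial>(lborel \<Otimes>\<^sub>M lborel)) < \<infinity>" .
  qed measurable
  have [measurable]: "(\<lambda>s. stable_kernel \<alpha> s x) \<in> borel_measurable borel"
    unfolding stable_kernel_def by measurable
  have "subord_density k t x = (LINT s|subord_measure t. indicator {0<..} s * stable_kernel \<alpha> s x)"
    unfolding subord_density_def set_lebesgue_integral_def
    by (intro Bochner_Integration.integral_cong)
       (auto simp: transition_density_eq_stable_kernel[OF k \<alpha>] split: split_indicator)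
  also have "\<dots> = (LINT s|lborel. W s * (indicator {0<..} s * stable_kernel \<alpha> s x))"
    unfolding subord_measure_def W_def[symmetric] using W by (subst integral_density) auto
  also have "\<dots> = (LINT s|lborel. (LINT \<xi>|lborel. W s * (cos (x \<bullet> \<xi>) * exp (- s * norm \<xi> powr \<alpha>))) / (2 * pi) ^ DIM('a))"
    by (intro Bochner_Integration.integral_cong) (auto simp: stable_kernel_def W_def split: split_indicator)
  also have "\<dots> = (LINT s|lborel. LINT \<xi>|lborel. W s * (cos (x \<bullet> \<xi>) * exp (- s * norm \<xi> powr \<alpha>))) / (2 * pi) ^ DIM('a)"
    by (rule integral_divide_zero)
  also have "(LINT s|lborel. LINT \<xi>|lborel. W s * (cos (x \<bullet> \<xi>) * exp (- s * norm \<xi> powr \<alpha>)))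
     = (LINT \<xi>|lborel. LINT s|lborel. W s * (cos (x \<bullet> \<xi>) * exp (- s * norm \<xi> powr \<alpha>)))"
    by (rule lborel_pair.Fubini_integral[OF int, symmetric])
  also have "\<dots> = (LINT \<xi>|lborel. cos (x \<bullet> \<xi>) * exp (- t * norm \<xi> powr (\<alpha> / 2)))"
  proof (intro integral_cong_AE AE_mp[OF ae AE_I2] impI)
    fix \<xi> :: 'a assume "\<xi> \<noteq> 0"
    have "(LINT s|lborel. W s * (cos (x \<bullet> \<xi>) * exp (- s * norm \<xi> powr \<alpha>))) = (LINT s|lborel. cos (x \<bullet> \<xi>) * (W s * exp (- s * norm \<xi> powr \<alpha>)))"
      by (simp only: mult.left_commute)
    also have "\<dots> = cos (x \<bullet> \<xi>) * (LINT s|lborel. W s * exp (- s * norm \<xi> powr \<alpha>))"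
      by (rule integral_mult_right_zero)
    finally show "(LINT s|lborel. W s * (cos (x \<bullet> \<xi>) * exp (- s * norm \<xi> powr \<alpha>))) = cos (x \<bullet> \<xi>) * exp (- t * norm \<xi> powr (\<alpha> / 2))"
      unfolding laplace(2)[OF \<open>\<xi> \<noteq> 0\<close>] .
  qed measurable
  finally show ?thesis by (simp add: stable_kernel_def)
qed

subsection \<open>Kernel estimates by Gaussian mixtures\<close>

text \<open>Bernstein's theorem is avoided: \<open>cm m \<phi>\<close> stands for \<open>\<phi>\<close> being, on \<open>{0<..}\<close>, the Laplace transform of a
  measure of mass at most \<open>m\<close>, and linear estimates for exponentials extend to \<open>cm\<close> by rule induction.\<close>

inductive cm :: "real \<Rightarrow> (real \<Rightarrow> real) \<Rightarrow> bool" where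
  cm_exp: "0 \<le> u \<Longrightarrow> cm 1 (\<lambda>l. exp (- u * l))"
| cm_add: "cm m \<phi> \<Longrightarrow> cm m' \<psi> \<Longrightarrow> cm (m + m') (\<lambda>l. \<phi> l + \<psi> l)"
| cm_scale: "0 \<le> c \<Longrightarrow> cm m \<phi> \<Longrightarrow> cm (c * m) (\<lambda>l. c * \<phi> l)"
| cm_lim: "(\<And>n. cm m (\<Phi> n)) \<Longrightarrow> (\<And>l. 0 < l \<Longrightarrow> (\<lambda>n. \<Phi> n l) \<longlonglongrightarrow> \<phi> l) \<Longrightarrow> cm m \<phi>"
| cm_weaken: "cm m \<phi> \<Longrightarrow> m \<le> m' \<Longrightarrow> cm m' \<phi>"

text \<open>The rule \<open>cm_lim\<close> controls limits only at positive arguments, so bounds and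
  measurability are claimed only there; the indicator turns this into a statement about a function
  on the whole line.\<close>

lemma cm_bounds:
  assumes "cm m \<phi>"
  shows "0 \<le> m" and "\<And>l. 0 < l \<Longrightarrow> 0 \<le> \<phi> l \<and> \<phi> l \<le> m"
    and "(\<lambda>l. \<phi> l * indicator {0<..} l) \<in> borel_measurable borel"
proof -
  have "0 \<le> m \<and> (\<forall>l>0. 0 \<le> \<phi> l \<and> \<phi> l \<le> m) \<and> (\<lambda>l. \<phi> l * indicator {0<..} l) \<in> borel_measurable borel"
    using assms
  proof induction
    case (cm_exp u)
    then show ?case by (auto simp: mult_nonneg_nonneg)
  next
    case (cm_add m \<phi> m' \<psi>)
    have "(\<lambda>l. (\<phi> l + \<psi> l) * indicator {0<..} l) = (\<lambda>l. \<phi> l * indicator {0<..} l + \<psi> l * indicator {0<..} l)"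
      by (simp add: distrib_right)
    with cm_add.IH show ?case by (auto intro: add_mono)
  next
    case (cm_scale c m \<phi>)
    have "(\<lambda>l. c * \<phi> l * indicator {0<..} l) = (\<lambda>l. c * (\<phi> l * indicator {0<..} l))"
      by (simp add: mult.assoc)
    with cm_scale show ?case by (auto intro: mult_left_mono)
  next
    case (cm_lim m \<Phi> \<phi>)
    have "0 \<le> \<phi> l \<and> \<phi> l \<le> m" if "0 < l" for l
      using LIMSEQ_le_const[OF cm_lim.hyps(2)[OF that], of 0] LIMSEQ_le_const2[OF cm_lim.hyps(2)[OF that], of m] cm_lim.IH that by blast
    moreover have "(\<lambda>l. \<phi> l * indicator {0<..} l) \<in> borel_measurable borel"
    proof (rule borel_measurable_LIMSEQ_real)
      show "(\<lambda>l. \<Phi> n l * indicator {0<..} l) \<in> borel_measurable borel" for n using cm_lim.IH by auto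
      show "(\<lambda>n. \<Phi> n l * indicator {0<..} l) \<longlonglongrightarrow> \<phi> l * indicator {0<..} l" for l
        using cm_lim.hyps(2)[of l] by (auto split: split_indicator)
    qed
    ultimately show ?case using cm_lim.IH by auto
  next
    case (cm_weaken m \<phi> m')
    then show ?case by force
  qed
  then show "0 \<le> m" "\<And>l. 0 < l \<Longrightarrow> 0 \<le> \<phi> l \<and> \<phi> l \<le> m" "(\<lambda>l. \<phi> l * indicator {0<..} l) \<in> borel_measurable borel"
    by auto
qed

lemma cm_exp_mult:
  assumes "cm m \<psi>" "0 \<le> u"
  shows "cm m (\<lambda>l. exp (- u * l) * \<psi> l)"
  using assms
proof induction
  case (cm_exp v)
  have "(\<lambda>l. exp (- u * l) * exp (- v * l)) = (\<lambda>l. exp (- (u + v) * l))"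
    by (simp add: mult_exp_exp algebra_simps)
  with cm_exp show ?case using cm.cm_exp[of "u + v"] by simp
next
  case (cm_add m \<phi> m' \<psi>)
  then show ?case using cm.cm_add[of m _ m'] by (simp add: distrib_left)
next
  case (cm_scale c m \<phi>)
  then show ?case using cm.cm_scale[of c m] by (simp add: mult.left_commute)
next
  case (cm_lim m \<Phi> \<phi>)
  show ?case
  proof (rule cm.cm_lim)
    show "cm m (\<lambda>l. exp (- u * l) * \<Phi> n l)" for n by (rule cm_lim.IH[OF cm_lim.prems])
    show "(\<lambda>n. exp (- u * l) * \<Phi> n l) \<longlonglongrightarrow> exp (- u * l) * \<phi> l" if "0 < l" for l
      by (rule tendsto_mult_left[OF cm_lim.hyps(2)[OF that]])
  qed
next
  case (cm_weaken m \<phi> m')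
  show ?case by (rule cm.cm_weaken[OF cm_weaken.IH[OF cm_weaken.prems] cm_weaken.hyps(2)])
qed

text \<open>For the representing measures this would be convolution. Two inductions take its place:
  one over the first factor here, and one over the second, for a single exponential, in
  \<open>cm_exp_mult\<close>.\<close>

lemma cm_mult:
  assumes "cm m \<phi>" "cm m' \<psi>"
  shows "cm (m * m') (\<lambda>l. \<phi> l * \<psi> l)"
  using assms
proof induction
  case (cm_exp v)
  then show ?case using cm_exp_mult[of m' \<psi> v] by simp
next
  case (cm_add m1 \<phi> m2 \<phi>2)
  then show ?case using cm.cm_add[of "m1 * m'" _ "m2 * m'"] by (simp add: distrib_right)
next
  case (cm_scale c m \<phi>)
  then show ?case using cm.cm_scale[of c "m * m'"] by (simp add: mult.assoc)
next
  case (cm_lim m \<Phi> \<phi>)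
  show ?case
  proof (rule cm.cm_lim)
    show "cm (m * m') (\<lambda>l. \<Phi> n l * \<psi> l)" for n by (rule cm_lim.IH[OF cm_lim.prems])
    show "(\<lambda>n. \<Phi> n l * \<psi> l) \<longlonglongrightarrow> \<phi> l * \<psi> l" if "0 < l" for l
      by (rule tendsto_mult_right[OF cm_lim.hyps(2)[OF that]])
  qed
next
  case (cm_weaken m1 \<phi> m2)
  show ?case
    by (rule cm.cm_weaken[OF cm_weaken.IH[OF cm_weaken.prems]])
       (intro mult_right_mono cm_weaken.hyps cm_bounds(1)[OF cm_weaken.prems])
qed

section \<open>Complete monotonicity of stretched exponentials\<close>

lemma cm_one: "cm 1 (\<lambda>_. 1)"
  using cm_exp[of 0] by simp

lemma cm_zero: "cm 0 (\<lambda>_. 0)"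
  using cm_scale[OF order_refl cm_one] by simp

lemma cm_power: "cm m \<phi> \<Longrightarrow> cm (m ^ n) (\<lambda>l. \<phi> l ^ n)"
  by (induction n) (auto intro: cm_one cm_mult)

lemma cm_sum: "finite A \<Longrightarrow> (\<And>i. i \<in> A \<Longrightarrow> cm (m i) (\<phi> i)) \<Longrightarrow> cm (\<Sum>i\<in>A. m i) (\<lambda>l. \<Sum>i\<in>A. \<phi> i l)"
  by (induction A rule: finite_induct) (auto intro: cm_zero cm_add)

text \<open>Partial sums of the exponential series are nonnegative combinations of powers with total
  mass at most exp m, the uniform bound that \<open>cm_lim\<close> asks for.\<close>

lemma cm_exp_comp:
  assumes "cm m \<phi>"
  shows "cm (exp m) (\<lambda>l. exp (\<phi> l))"
proof (rule cm_lim)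
  fix N
  have m: "0 \<le> m" by (rule cm_bounds(1)[OF assms])
  have "cm (\<Sum>n<N. inverse (fact n) * m ^ n) (\<lambda>l. \<Sum>n<N. inverse (fact n) * \<phi> l ^ n)"
    by (intro cm_sum cm_scale cm_power assms) auto
  moreover have "(\<Sum>n<N. inverse (fact n) * m ^ n) \<le> exp m"
  proof -
    have "(\<Sum>n<N. m ^ n /\<^sub>R fact n) \<le> (\<Sum>n. m ^ n /\<^sub>R fact n)"
      using m by (intro sum_le_suminf sums_summable[OF exp_converges]) auto
    also have "\<dots> = exp m" by (simp add: exp_def)
    finally show ?thesis by simp
  qed
  ultimately show "cm (exp m) (\<lambda>l. \<Sum>n<N. inverse (fact n) * \<phi> l ^ n)" by (rule cm_weaken)
next
  fix l
  show "(\<lambda>N. \<Sum>n<N. inverse (fact n) * \<phi> l ^ n) \<longlonglongrightarrow> exp (\<phi> l)"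
    using exp_converges[of "\<phi> l"] by (simp add: sums_def)
qed

lemma gbinomial_alternating_nonneg:
  fixes b :: real
  assumes "b \<le> 0"
  shows "0 \<le> (- 1) ^ n * (b gchoose n)"
proof -
  have "(- 1) ^ n * (b gchoose n) = (\<Prod>i=0..<n. - 1 * (b - of_nat i)) / fact n"
    unfolding prod.distrib by (simp add: gbinomial_prod_rev)
  moreover have "0 \<le> (\<Prod>i=0..<n. - 1 * (b - of_nat i))" using assms by (intro prod_nonneg) auto
  ultimately show ?thesis by simp
qed

text \<open>Binomial series of (1 - z) powr g at z = exp (- h l). For 0 < g < 1 all coefficients
  after the constant one are nonpositive, so one minus the series has nonnegative coefficients;
  powers of z are exponentials in \<open>l\<close>.\<close>

lemma cm_one_minus_powr:
  assumes g: "0 < g" "g < 1" and h: "0 < h"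
  shows "cm 1 (\<lambda>l. 1 - (1 - exp (- h * l)) powr g)"
proof (rule cm_lim)
  define a where "a n = (- 1) ^ n * (g gchoose (Suc n))" for n
  have a: "0 \<le> a n" for n
  proof -
    have "a n = g / real (Suc n) * ((- 1) ^ n * ((g - 1) gchoose n))"
    proof -
      have "g gchoose Suc n = g / real (Suc n) * ((g - 1) gchoose n)"
        using gbinomial_absorption[of n g] by (simp add: field_simps del: of_nat_Suc)
      then show ?thesis by (simp add: a_def del: of_nat_Suc)
    qed
    then show ?thesis using gbinomial_alternating_nonneg[of "g - 1" n] g by simp
  qed
  have part: "(\<Sum>n<N. a n * z ^ Suc n) = 1 - (\<Sum>n<Suc N. (g gchoose n) * (- z) ^ n)" for N z
  proof -
    have "(g gchoose Suc n) * (- z) ^ Suc n = - (a n * z ^ Suc n)" for n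
      unfolding power_minus[of z "Suc n"] a_def by simp
    then show ?thesis unfolding sum.lessThan_Suc_shift by (simp only: sum_negf) simp
  qed
  fix N
  have "cm (\<Sum>n<N. a n * 1) (\<lambda>l. \<Sum>n<N. a n * exp (- (h * real (Suc n)) * l))"
    using h by (intro cm_sum cm_scale cm_exp a) auto
  moreover have "(\<Sum>n<N. a n * 1) \<le> 1"
  proof -
    \<comment> \<open>Alternating partial sums of binomial coefficients have a closed form of known
      sign, so the mass bound is obtained without any convergence at z = 1.\<close>
    have "(\<Sum>n<N. a n * 1) = 1 - (\<Sum>n\<le>N. (g gchoose n) * (- 1) ^ n)"
      using part[of 1 N] by (simp add: lessThan_Suc_atMost)
    also have "(\<Sum>n\<le>N. (g gchoose n) * (- 1) ^ n) = (- 1) ^ N * (g - 1 gchoose N)"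
      by (rule gbinomial_sum_lower_neg)
    finally show ?thesis using gbinomial_alternating_nonneg[of "g - 1" N] g by simp
  qed
  ultimately show "cm 1 (\<lambda>l. \<Sum>n<N. a n * exp (- (h * real (Suc n)) * l))" by (rule cm_weaken)
next
  define a where "a n = (- 1) ^ n * (g gchoose (Suc n))" for n
  have part: "(\<Sum>n<N. a n * z ^ Suc n) = 1 - (\<Sum>n<Suc N. (g gchoose n) * (- z) ^ n)" for N z
  proof -
    have "(g gchoose Suc n) * (- z) ^ Suc n = - (a n * z ^ Suc n)" for n
      unfolding power_minus[of z "Suc n"] a_def by simp
    then show ?thesis unfolding sum.lessThan_Suc_shift by (simp only: sum_negf) simp
  qed
  fix l :: real assume l: "0 < l"
  let ?z = "exp (- h * l)"
  have z: "0 < ?z" "?z < 1" using h l by auto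
  have "(\<lambda>n. (g gchoose n) * (- ?z) ^ n) sums (1 + (- ?z)) powr g"
    by (rule gen_binomial_real) (use z in auto)
  then have "(\<lambda>N. 1 - (\<Sum>n<Suc N. (g gchoose n) * (- ?z) ^ n)) \<longlonglongrightarrow> 1 - (1 - ?z) powr g"
    unfolding sums_def by (intro tendsto_intros LIMSEQ_Suc) simp
  moreover have "?z ^ Suc n = exp (- (h * real (Suc n)) * l)" for n
    by (subst exp_of_nat_mult[symmetric]) (simp add: algebra_simps)
  ultimately show "(\<lambda>N. \<Sum>n<N. (- 1) ^ n * (g gchoose (Suc n)) * exp (- (h * real (Suc n)) * l)) \<longlonglongrightarrow> 1 - (1 - ?z) powr g"
    unfolding part[symmetric] a_def by (simp only:)
qed

text \<open>Compound Poisson approximation. For small h the quantity t ((1 - exp (- h l)) / h) powr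
  g is close to t l powr g, and its negative exponential equals exp (- T) exp (T \<phi>(l)) with T =
  t (1 / h) powr g and \<phi> the function of mass 1 from \<open>cm_one_minus_powr\<close>. The mass
  bound exp (- T) exp T is exactly 1 for every h.\<close>

lemma cm_stable:
  assumes g: "0 < g" "g < 1" and t: "0 \<le> t"
  shows "cm 1 (\<lambda>l. exp (- t * l powr g))"
proof (rule cm_lim)
  fix n :: nat
  let ?h = "1 / real (Suc n)"
  let ?T = "t * (1 / ?h) powr g"
  have 1: "cm 1 (\<lambda>l. 1 - (1 - exp (- ?h * l)) powr g)"
    by (rule cm_one_minus_powr[OF g]) simp
  have "0 \<le> ?T" using t by simp
  from cm_exp_comp[OF cm_scale[OF this 1]]
  have "cm (exp (- ?T) * exp (?T * 1)) (\<lambda>l. exp (- ?T) * exp (?T * (1 - (1 - exp (- ?h * l)) powr g)))"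
    by (rule cm_scale[OF exp_ge_zero])
  moreover have "exp (- ?T) * exp (?T * 1) = 1" unfolding mult_exp_exp by simp
  ultimately show "cm 1 (\<lambda>l. exp (- ?T) * exp (?T * (1 - (1 - exp (- ?h * l)) powr g)))"
    by (simp only:)
next
  fix l :: real assume l: "0 < l"
  have "(\<lambda>n. exp (- t * ((1 - exp (- (1 / real (Suc n)) * l)) / (1 / real (Suc n))) powr g)) \<longlonglongrightarrow> exp (- t * l powr g)"
  proof -
    have "(\<lambda>n. (1 - exp (- (1 / real (Suc n)) * l)) / (1 / real (Suc n))) \<longlonglongrightarrow> l"
      using l by real_asymp
    then show ?thesis using l by (intro tendsto_intros) auto
  qed
  moreover have "exp (- t * ((1 - exp (- (1 / real (Suc n)) * l)) / (1 / real (Suc n))) powr g)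
     = exp (- (t * (1 / (1 / real (Suc n))) powr g)) * exp ((t * (1 / (1 / real (Suc n))) powr g) * (1 - (1 - exp (- (1 / real (Suc n)) * l)) powr g))" for n
  proof -
    have "((1 - exp (- (1 / real (Suc n)) * l)) / (1 / real (Suc n))) powr g
      = (1 - exp (- (1 / real (Suc n)) * l)) powr g * (1 / (1 / real (Suc n))) powr g"
      using l by (subst powr_mult[symmetric]) auto
    then show ?thesis by (simp add: mult_exp_exp algebra_simps)
  qed
  ultimately show "(\<lambda>n. exp (- (t * (1 / (1 / real (Suc n))) powr g)) * exp ((t * (1 / (1 / real (Suc n))) powr g) * (1 - (1 - exp (- (1 / real (Suc n)) * l)) powr g)))
    \<longlonglongrightarrow> exp (- t * l powr g)" by (simp only:)
qed

text \<open>The transform of \<phi>(|\<xi>|^2) with a Gaussian regularisation, which makes it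
  converge for every bounded \<open>\<phi>\<close>; only for the stable symbol is
  \<open>\<delta>\<close> sent to 0. The indicator discards the value at \<xi> = 0, about which
  \<open>cm\<close> says nothing.\<close>

definition gtrans :: "real \<Rightarrow> (real \<Rightarrow> real) \<Rightarrow> 'a::euclidean_space \<Rightarrow> real" where
  "gtrans \<delta> \<phi> x = (LINT \<xi>|lborel. cos (x \<bullet> \<xi>) * (exp (- \<delta> * (norm \<xi>)\<^sup>2) * (\<phi> ((norm \<xi>)\<^sup>2) * indicator {0<..} ((norm \<xi>)\<^sup>2))))"

lemma integrable_gtrans:
  fixes x :: "'a::euclidean_space"
  assumes "cm m \<phi>" "0 < \<delta>"
  shows "integrable lborel (\<lambda>\<xi>. cos (x \<bullet> \<xi>) * (exp (- \<delta> * (norm \<xi>)\<^sup>2) * (\<phi> ((norm \<xi>)\<^sup>2) * indicator {0<..} ((norm \<xi>)\<^sup>2))))"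
    (is "integrable _ ?f")
    and "\<And>\<xi>. norm (cos (x \<bullet> \<xi>) * (exp (- \<delta> * (norm \<xi>)\<^sup>2) * (\<phi> ((norm \<xi>)\<^sup>2) * indicator {0<..} ((norm \<xi>)\<^sup>2)))) \<le> m * exp (- \<delta> * (norm \<xi>)\<^sup>2)"
    and "(\<lambda>\<xi>. cos (x \<bullet> \<xi>) * (exp (- \<delta> * (norm \<xi>)\<^sup>2) * (\<phi> ((norm \<xi>)\<^sup>2) * indicator {0<..} ((norm \<xi>)\<^sup>2)))) \<in> borel_measurable borel"
    and "integrable lborel (\<lambda>\<xi>::'a. m * exp (- \<delta> * (norm \<xi>)\<^sup>2))"
proof -
  note b = cm_bounds[OF assms(1)]
  define g where "g \<xi> = \<phi> ((norm \<xi>)\<^sup>2) * indicator {0<..} ((norm \<xi>)\<^sup>2)" for \<xi> :: 'a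
  have "(\<lambda>\<xi>::'a. (norm \<xi>)\<^sup>2) \<in> borel_measurable borel" by measurable
  from measurable_compose[OF this b(3)] have [measurable]: "g \<in> borel_measurable borel"
    unfolding g_def .
  show meas: "?f \<in> borel_measurable borel" unfolding g_def[symmetric] by measurable
  show bd: "norm (?f \<xi>) \<le> m * exp (- \<delta> * (norm \<xi>)\<^sup>2)" for \<xi>
  proof -
    have "\<bar>\<phi> ((norm \<xi>)\<^sup>2) * indicator {0<..} ((norm \<xi>)\<^sup>2)\<bar> \<le> m"
      using b(1) b(2)[of "(norm \<xi>)\<^sup>2"] by (auto split: split_indicator)
    then have "\<bar>cos (x \<bullet> \<xi>)\<bar> * (exp (- \<delta> * (norm \<xi>)\<^sup>2) * \<bar>\<phi> ((norm \<xi>)\<^sup>2) * indicator {0<..} ((norm \<xi>)\<^sup>2)\<bar>)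
      \<le> 1 * (exp (- \<delta> * (norm \<xi>)\<^sup>2) * m)"
      by (intro mult_mono) auto
    then show ?thesis by (simp add: abs_mult mult.commute)
  qed
  show int: "integrable lborel (\<lambda>\<xi>::'a. m * exp (- \<delta> * (norm \<xi>)\<^sup>2))"
    using integrable_Re[OF integrable_gaussian[OF assms(2), where ?'a = 'a]] by (intro integrable_mult_right) simp
  show "integrable lborel ?f"
    by (rule Bochner_Integration.integrable_bound[OF int]) (use meas bd b(1) in \<open>auto simp: AE_I2 abs_mult\<close>)
qed

lemma gtrans_tendsto:
  fixes x :: "'a::euclidean_space"
  assumes cm: "\<And>n. cm m (\<Phi> n)" and lim: "\<And>l. 0 < l \<Longrightarrow> (\<lambda>n. \<Phi> n l) \<longlonglongrightarrow> \<phi> l" and \<delta>: "0 < \<delta>"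
  shows "(\<lambda>n. gtrans \<delta> (\<Phi> n) x) \<longlonglongrightarrow> gtrans \<delta> \<phi> x"
  unfolding gtrans_def
proof (rule integral_dominated_convergence)
  have c: "cm m \<phi>" by (rule cm_lim[OF cm lim])
  show "(\<lambda>\<xi>. cos (x \<bullet> \<xi>) * (exp (- \<delta> * (norm \<xi>)\<^sup>2) * (\<phi> ((norm \<xi>)\<^sup>2) * indicator {0<..} ((norm \<xi>)\<^sup>2)))) \<in> borel_measurable lborel"
    using integrable_gtrans(3)[OF c \<delta>] by simp
  show "(\<lambda>\<xi>. cos (x \<bullet> \<xi>) * (exp (- \<delta> * (norm \<xi>)\<^sup>2) * (\<Phi> n ((norm \<xi>)\<^sup>2) * indicator {0<..} ((norm \<xi>)\<^sup>2)))) \<in> borel_measurable lborel" for n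
    using integrable_gtrans(3)[OF cm \<delta>] by simp
  show "integrable lborel (\<lambda>\<xi>::'a. m * exp (- \<delta> * (norm \<xi>)\<^sup>2))" by (rule integrable_gtrans(4)[OF c \<delta>])
  show "AE \<xi> in lborel. norm (cos (x \<bullet> \<xi>) * (exp (- \<delta> * (norm \<xi>)\<^sup>2) * (\<Phi> n ((norm \<xi>)\<^sup>2) * indicator {0<..} ((norm \<xi>)\<^sup>2)))) \<le> m * exp (- \<delta> * (norm \<xi>)\<^sup>2)" for n
    by (intro AE_I2 integrable_gtrans(2)[OF cm \<delta>])
  show "AE \<xi> in lborel. (\<lambda>n. cos (x \<bullet> \<xi>) * (exp (- \<delta> * (norm \<xi>)\<^sup>2) * (\<Phi> n ((norm \<xi>)\<^sup>2) * indicator {0<..} ((norm \<xi>)\<^sup>2))))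
    \<longlonglongrightarrow> cos (x \<bullet> \<xi>) * (exp (- \<delta> * (norm \<xi>)\<^sup>2) * (\<phi> ((norm \<xi>)\<^sup>2) * indicator {0<..} ((norm \<xi>)\<^sup>2)))"
  proof (rule AE_I2, rule tendsto_mult_left, rule tendsto_mult_left)
    fix \<xi> :: 'a
    show "(\<lambda>n. \<Phi> n ((norm \<xi>)\<^sup>2) * indicator {0<..} ((norm \<xi>)\<^sup>2)) \<longlonglongrightarrow> \<phi> ((norm \<xi>)\<^sup>2) * indicator {0<..} ((norm \<xi>)\<^sup>2)"
      using lim[of "(norm \<xi>)\<^sup>2"] by (auto split: split_indicator)
  qed
qed

text \<open>One exponential in |\<xi>|^2 corresponds to one Gaussian, the regularisation merely
  shifting its parameter. This is the base case of the induction over mixtures.\<close>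

lemma gtrans_exp:
  fixes x :: "'a::euclidean_space"
  assumes "0 \<le> u" "0 < \<delta>"
  shows "gtrans \<delta> (\<lambda>l. exp (- u * l)) x = gauss_kernel (u + \<delta>) x"
proof -
  have ud: "0 < u + \<delta>" using assms by simp
  have "gtrans \<delta> (\<lambda>l. exp (- u * l)) x = (LINT \<xi>|lborel. cos (x \<bullet> \<xi>) * exp (- (u + \<delta>) * (norm \<xi>)\<^sup>2))"
    unfolding gtrans_def
  proof (intro integral_cong_AE AE_mp[OF AE_lborel_singleton[of 0] AE_I2] impI)
    fix \<xi> :: 'a assume "\<xi> \<noteq> 0"
    then show "cos (x \<bullet> \<xi>) * (exp (- \<delta> * (norm \<xi>)\<^sup>2) * (exp (- u * (norm \<xi>)\<^sup>2) * indicator {0<..} ((norm \<xi>)\<^sup>2))) = cos (x \<bullet> \<xi>) * exp (- (u + \<delta>) * (norm \<xi>)\<^sup>2)"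
      by (simp add: mult_exp_exp algebra_simps)
  qed measurable
  also have "\<dots> = Re (fourier (\<lambda>\<xi>. complex_of_real (exp (- (u + \<delta>) * (norm \<xi>)\<^sup>2))) x)"
    using integrable_Re[OF integrable_gaussian[OF ud, where ?'a = 'a]]
    by (subst Re_fourier_of_real) auto
  also have "\<dots> = gauss_kernel (u + \<delta>) x" by (subst fourier_gaussian[OF ud]) simp
  finally show ?thesis .
qed

lemma power_div_fact_le_exp:
  fixes y :: real
  assumes "0 \<le> y"
  shows "y ^ n \<le> fact n * exp y"
proof -
  have sm: "summable (\<lambda>k. y ^ k /\<^sub>R fact k)" using exp_converges[of y] by (rule sums_summable)
  have "y ^ n /\<^sub>R fact n = (\<Sum>k\<in>{n}. y ^ k /\<^sub>R fact k)" by simp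
  also have "\<dots> \<le> (\<Sum>k. y ^ k /\<^sub>R fact k)" using assms by (intro sum_le_suminf[OF sm]) auto
  also have "\<dots> = exp y" by (simp add: exp_def)
  finally show ?thesis by (simp add: field_simps)
qed

lemma one_minus_exp_ge:
  fixes a :: real
  assumes "0 < a"
  shows "1 / (1 + a) \<le> 1 - exp (- (1 / a))"
proof -
  have "1 + 1 / a \<le> exp (1 / a)" by (rule exp_ge_add_one_self)
  moreover have p: "0 < 1 + 1 / a" using assms by (simp add: add_pos_pos)
  ultimately have "exp (- (1 / a)) \<le> 1 / (1 + 1 / a)"
    unfolding exp_minus inverse_eq_divide by (intro divide_left_mono mult_pos_pos) auto
  also have "\<dots> = 1 - 1 / (1 + a)" using assms by (simp add: field_simps)
  finally show ?thesis by simp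
qed

lemma abs_exp_diff_le:
  fixes A B c :: real
  assumes "c \<le> A" "c \<le> B"
  shows "\<bar>exp (- A) - exp (- B)\<bar> \<le> \<bar>A - B\<bar> * exp (- c)"
proof -
  have *: "\<bar>exp (- A) - exp (- B)\<bar> \<le> \<bar>A - B\<bar> * exp (- c)" if "c \<le> A" "A \<le> B" for A B
  proof -
    have "exp (- A) - exp (- B) = exp (- A) * (1 - exp (- (B - A)))" by (simp add: algebra_simps mult_exp_exp)
    also have "\<dots> \<le> exp (- c) * (B - A)"
    proof (rule mult_mono)
      show "1 - exp (- (B - A)) \<le> B - A" using exp_ge_add_one_self[of "- (B - A)"] by linarith
    qed (use that in auto)
    finally show ?thesis using that by (simp add: mult.commute)
  qed
  show ?thesis
    using *[of A B] *[of B A] assms by (cases "A \<le> B") (auto simp: abs_minus_commute)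
qed

text \<open>Writing \<open>a = |x|\<^sup>2 / v\<close>, the Gaussian of variance parameter \<open>v\<close> satisfies these bounds with constants
  independent of \<open>v\<close>, and both sides are linear in \<open>\<lambda>l. exp (- v * l)\<close>. Hence they survive passing to
  mixtures of Gaussians.\<close>

lemma gauss_kernel_bounds:
  "\<exists>C\<ge>0. \<forall>v>0. \<forall>(x::'a::euclidean_space) (y::'a). x \<noteq> 0 \<longrightarrow> norm x / 2 \<le> norm y \<longrightarrow> norm y \<le> 2 * norm x \<longrightarrow>
     gauss_kernel v x * norm x ^ DIM('a) \<le> C * (1 - exp (- v * (1 / (norm x)\<^sup>2))) \<and>
     \<bar>gauss_kernel v x - gauss_kernel v y\<bar> * norm x ^ DIM('a)
       \<le> C * (\<bar>norm x - norm y\<bar> / norm x) * (1 - exp (- v * (1 / (norm x)\<^sup>2)))"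
proof -
  \<comment> \<open>The height of the kernel costs (1 + a)^d, the Lipschitz bound for the
    exponential one more factor 1 + a, and the comparison of 1 / (1 + a) with 1 - exp (- 1 / a) the
    last one; the decay in \<open>a\<close> absorbs all of them.\<close>
  define n where "n = DIM('a) + 2"
  define C where "C = (1 + pi) ^ DIM('a) * (16 ^ n * (fact n * exp (1 / 16)))"
  have C: "0 \<le> C" by (simp add: C_def)
  have key: "sqrt (pi * a) ^ DIM('a) * (1 + a) * exp (- a / 16) \<le> C * (1 - exp (- (1 / a)))" if a: "0 < a" for a :: real
  proof -
    have "sqrt (pi * a) \<le> (1 + pi) * (1 + a)"
    proof (rule real_le_lsqrt)
      have "pi * a \<le> (1 + pi)\<^sup>2 * (1 + a)\<^sup>2"
      proof (rule mult_mono)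
        have "pi * 1 \<le> (1 + pi) * (1 + pi)" by (intro mult_mono) auto
        then show "pi \<le> (1 + pi)\<^sup>2" by (simp add: power2_eq_square)
        have "a * 1 \<le> (1 + a) * (1 + a)" using a by (intro mult_mono) auto
        then show "a \<le> (1 + a)\<^sup>2" by (simp add: power2_eq_square)
      qed (use a in auto)
      then show "pi * a \<le> ((1 + pi) * (1 + a))\<^sup>2" by (simp only: power_mult_distrib)
    qed (use a in auto)
    then have "sqrt (pi * a) ^ DIM('a) \<le> ((1 + pi) * (1 + a)) ^ DIM('a)"
      using a by (intro power_mono) auto
    then have 1: "sqrt (pi * a) ^ DIM('a) * ((1 + a)\<^sup>2 * exp (- a / 16)) \<le> ((1 + pi) * (1 + a)) ^ DIM('a) * ((1 + a)\<^sup>2 * exp (- a / 16))"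
      by (intro mult_right_mono) auto
    have 2: "((1 + pi) * (1 + a)) ^ DIM('a) * ((1 + a)\<^sup>2 * exp (- a / 16)) = (1 + pi) ^ DIM('a) * ((1 + a) ^ n * exp (- a / 16))"
      by (simp only: power_mult_distrib n_def power_add mult_ac)
    have "((1 + a) / 16) ^ n \<le> fact n * exp ((1 + a) / 16)"
      using a by (intro power_div_fact_le_exp) auto
    then have "(1 + a) ^ n \<le> 16 ^ n * (fact n * exp ((1 + a) / 16))"
      by (simp add: power_divide field_simps)
    then have "(1 + a) ^ n * exp (- a / 16) \<le> (16 ^ n * (fact n * exp ((1 + a) / 16))) * exp (- a / 16)"
      by (intro mult_right_mono) auto
    also have "\<dots> = 16 ^ n * (fact n * (exp ((1 + a) / 16) * exp (- a / 16)))" by (simp only: mult.assoc)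
    also have "exp ((1 + a) / 16) * exp (- a / 16) = exp (1 / 16)"
    proof -
      have "(1 + a) / 16 + - a / 16 = 1 / 16" by (simp add: add_divide_distrib)
      then show ?thesis unfolding mult_exp_exp by (simp only:)
    qed
    finally have "(1 + pi) ^ DIM('a) * ((1 + a) ^ n * exp (- a / 16)) \<le> C"
      unfolding C_def by (intro mult_left_mono) auto
    then have "sqrt (pi * a) ^ DIM('a) * ((1 + a)\<^sup>2 * exp (- a / 16)) \<le> C" using 1 2 by linarith
    then have "(sqrt (pi * a) ^ DIM('a) * (1 + a) * exp (- a / 16)) * (1 + a) \<le> C"
      by (simp add: power2_eq_square mult_ac)
    then have "sqrt (pi * a) ^ DIM('a) * (1 + a) * exp (- a / 16) \<le> C * (1 / (1 + a))"
      using a by (simp add: pos_le_divide_eq)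
    also have "\<dots> \<le> C * (1 - exp (- (1 / a)))"
      using C one_minus_exp_ge[OF a] by (intro mult_left_mono) auto
    finally show ?thesis .
  qed
  have "gauss_kernel v x * norm x ^ DIM('a) \<le> C * (1 - exp (- v * (1 / (norm x)\<^sup>2))) \<and>
     \<bar>gauss_kernel v x - gauss_kernel v y\<bar> * norm x ^ DIM('a)
       \<le> C * (\<bar>norm x - norm y\<bar> / norm x) * (1 - exp (- v * (1 / (norm x)\<^sup>2)))"
    if v: "0 < v" and x: "x \<noteq> 0" and y: "norm x / 2 \<le> norm y" "norm y \<le> 2 * norm x" for v and x y :: 'a
  proof -
    define a where "a = (norm x)\<^sup>2 / v"
    define b where "b = (norm y)\<^sup>2 / v"
    define \<rho> where "\<rho> = \<bar>norm x - norm y\<bar> / norm x"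
    have a: "0 < a" using v x by (simp add: a_def)
    have \<rho>: "0 \<le> \<rho>" by (simp add: \<rho>_def)
    have e: "exp (- v * (1 / (norm x)\<^sup>2)) = exp (- (1 / a))" by (simp add: a_def)
    have P: "sqrt (pi / v) ^ DIM('a) * norm x ^ DIM('a) = sqrt (pi * a) ^ DIM('a)"
    proof -
      have "sqrt (pi * a) = sqrt (pi / v * (norm x)\<^sup>2)" by (simp add: a_def)
      also have "\<dots> = sqrt (pi / v) * norm x" by (simp only: real_sqrt_mult real_sqrt_abs abs_norm_cancel)
      finally show ?thesis by (simp add: power_mult_distrib)
    qed
    have g: "gauss_kernel v x * norm x ^ DIM('a) = sqrt (pi * a) ^ DIM('a) * exp (- (a / 4))"
      unfolding P[symmetric] gauss_kernel_def by (simp add: a_def)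
    have d: "\<bar>gauss_kernel v x - gauss_kernel v y\<bar> * norm x ^ DIM('a) = sqrt (pi * a) ^ DIM('a) * \<bar>exp (- (a / 4)) - exp (- (b / 4))\<bar>"
    proof -
      have "gauss_kernel v x - gauss_kernel v y = sqrt (pi / v) ^ DIM('a) * (exp (- (a / 4)) - exp (- (b / 4)))"
        by (simp add: gauss_kernel_def a_def b_def algebra_simps)
      then show ?thesis unfolding P[symmetric] using v by (simp add: abs_mult)
    qed
    have "exp (- (a / 4)) \<le> (1 + a) * exp (- a / 16)"
    proof -
      have "exp (- (a / 4)) \<le> 1 * exp (- a / 16)" using a by simp
      also have "\<dots> \<le> (1 + a) * exp (- a / 16)" using a by (intro mult_right_mono) auto
      finally show ?thesis .
    qed
    then have "sqrt (pi * a) ^ DIM('a) * exp (- (a / 4)) \<le> sqrt (pi * a) ^ DIM('a) * ((1 + a) * exp (- a / 16))"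
      using a by (intro mult_left_mono) auto
    then have 1: "sqrt (pi * a) ^ DIM('a) * exp (- (a / 4)) \<le> C * (1 - exp (- (1 / a)))"
      using key[OF a] by (simp add: mult.assoc)
    have "(norm x / 2)\<^sup>2 \<le> (norm y)\<^sup>2" using y by (intro power_mono) auto
    then have "(norm x)\<^sup>2 / 4 / v \<le> (norm y)\<^sup>2 / v" using v by (intro divide_right_mono) (auto simp: power_divide)
    \<comment> \<open>As |y| \<ge> |x| / 2, both exponents a / 4 and b / 4 are at least a / 16,
      whence the rate 1 / 16 throughout.\<close>
    then have ba: "a / 4 \<le> b" by (simp add: a_def b_def)
    have ab: "\<bar>a / 4 - b / 4\<bar> \<le> \<rho> * (1 + a)"
    proof -
      have "(norm x)\<^sup>2 - (norm y)\<^sup>2 = (norm x - norm y) * (norm x + norm y)" by (simp add: power2_eq_square algebra_simps)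
      then have "\<bar>(norm x)\<^sup>2 - (norm y)\<^sup>2\<bar> = \<bar>norm x - norm y\<bar> * (norm x + norm y)" by (simp add: abs_mult)
      also have "\<dots> \<le> \<bar>norm x - norm y\<bar> * (4 * norm x)" using y by (intro mult_left_mono) auto
      also have "\<dots> = \<rho> * (4 * (norm x)\<^sup>2)" using x by (simp add: \<rho>_def power2_eq_square)
      finally have "\<bar>(norm x)\<^sup>2 - (norm y)\<^sup>2\<bar> / (4 * v) \<le> \<rho> * (4 * (norm x)\<^sup>2) / (4 * v)"
        using v by (intro divide_right_mono) auto
      moreover have "\<bar>a / 4 - b / 4\<bar> = \<bar>(norm x)\<^sup>2 - (norm y)\<^sup>2\<bar> / (4 * v)"
        using v by (simp add: a_def b_def diff_divide_distrib[symmetric] abs_divide)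
      moreover have "\<rho> * (4 * (norm x)\<^sup>2) / (4 * v) = \<rho> * a" by (simp add: a_def)
      moreover have "\<rho> * a \<le> \<rho> * (1 + a)" using \<rho> by (intro mult_left_mono) auto
      ultimately show ?thesis by linarith
    qed
    have "\<bar>exp (- (a / 4)) - exp (- (b / 4))\<bar> \<le> \<bar>a / 4 - b / 4\<bar> * exp (- (a / 16))"
      using a ba by (intro abs_exp_diff_le) auto
    also have "\<dots> \<le> (\<rho> * (1 + a)) * exp (- (a / 16))" using ab by (intro mult_right_mono) auto
    finally have "sqrt (pi * a) ^ DIM('a) * \<bar>exp (- (a / 4)) - exp (- (b / 4))\<bar> \<le> sqrt (pi * a) ^ DIM('a) * ((\<rho> * (1 + a)) * exp (- (a / 16)))"
      using a by (intro mult_left_mono) auto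
    also have "\<dots> = \<rho> * (sqrt (pi * a) ^ DIM('a) * (1 + a) * exp (- a / 16))" by simp
    also have "\<dots> \<le> \<rho> * (C * (1 - exp (- (1 / a))))" using \<rho> by (intro mult_left_mono key[OF a])
    finally show ?thesis using 1 unfolding g d e \<rho>_def[symmetric] by (simp add: mult_ac)
  qed
  with C show ?thesis by blast
qed

text \<open>Rule induction over \<open>cm\<close>. With l0 = 1 / |x|^2, the expression m - exp (-
  \<delta> l0) \<phi>(l0) is the linear functional of mass and function that reproduces 1 - exp (- v
  l0) for a single Gaussian with v = u + \<delta>. It passes to limits and grows when the mass bound
  is weakened.\<close>

lemma gtrans_bounds:
  "\<exists>C\<ge>0. \<forall>m \<phi> \<delta>. \<forall>(x::'a::euclidean_space) (y::'a). cm m \<phi> \<longrightarrow> 0 < \<delta> \<longrightarrow> x \<noteq> 0 \<longrightarrow> norm x / 2 \<le> norm y \<longrightarrow> norm y \<le> 2 * norm x \<longrightarrow>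
     gtrans \<delta> \<phi> x * norm x ^ DIM('a) \<le> C * (m - exp (- \<delta> * (1 / (norm x)\<^sup>2)) * \<phi> (1 / (norm x)\<^sup>2)) \<and>
     0 \<le> gtrans \<delta> \<phi> x \<and>
     \<bar>gtrans \<delta> \<phi> x - gtrans \<delta> \<phi> y\<bar> * norm x ^ DIM('a)
       \<le> C * (\<bar>norm x - norm y\<bar> / norm x) * (m - exp (- \<delta> * (1 / (norm x)\<^sup>2)) * \<phi> (1 / (norm x)\<^sup>2))"
proof -
  obtain C where C: "0 \<le> C" and G: "\<And>v (x::'a) (y::'a). 0 < v \<Longrightarrow> x \<noteq> 0 \<Longrightarrow> norm x / 2 \<le> norm y \<Longrightarrow> norm y \<le> 2 * norm x \<Longrightarrow>
     gauss_kernel v x * norm x ^ DIM('a) \<le> C * (1 - exp (- v * (1 / (norm x)\<^sup>2))) \<and>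
     \<bar>gauss_kernel v x - gauss_kernel v y\<bar> * norm x ^ DIM('a)
       \<le> C * (\<bar>norm x - norm y\<bar> / norm x) * (1 - exp (- v * (1 / (norm x)\<^sup>2)))"
    using gauss_kernel_bounds[where ?'a = 'a] by blast
  have "gtrans \<delta> \<phi> x * norm x ^ DIM('a) \<le> C * (m - exp (- \<delta> * (1 / (norm x)\<^sup>2)) * \<phi> (1 / (norm x)\<^sup>2)) \<and>
     0 \<le> gtrans \<delta> \<phi> x \<and>
     \<bar>gtrans \<delta> \<phi> x - gtrans \<delta> \<phi> y\<bar> * norm x ^ DIM('a)
       \<le> C * (\<bar>norm x - norm y\<bar> / norm x) * (m - exp (- \<delta> * (1 / (norm x)\<^sup>2)) * \<phi> (1 / (norm x)\<^sup>2))"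
    if "cm m \<phi>" and \<delta>: "0 < \<delta>" and x: "x \<noteq> 0" and y: "norm x / 2 \<le> norm y" "norm y \<le> 2 * norm x"
    for m \<phi> \<delta> and x y :: 'a
  proof -
    define l0 where "l0 = 1 / (norm x)\<^sup>2"
    define D where "D = norm x ^ DIM('a)"
    define K where "K = C * (\<bar>norm x - norm y\<bar> / norm x)"
    define E where "E = exp (- \<delta> * l0)"
    have l0: "0 < l0" using x by (simp add: l0_def)
    have D: "0 \<le> D" by (simp add: D_def)
    have K: "0 \<le> K" using C by (simp add: K_def)
    have E: "0 \<le> E" by (simp add: E_def)
    have "gtrans \<delta> \<phi> x * D \<le> C * (m - E * \<phi> l0) \<and> 0 \<le> gtrans \<delta> \<phi> x \<and> \<bar>gtrans \<delta> \<phi> x - gtrans \<delta> \<phi> y\<bar> * D \<le> K * (m - E * \<phi> l0)"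
      using \<open>cm m \<phi>\<close>
    proof induction
      case (cm_exp u)
      have "0 < u + \<delta>" using cm_exp \<delta> by simp
      moreover have "E * exp (- u * l0) = exp (- (u + \<delta>) * l0)"
        by (simp add: E_def mult_exp_exp algebra_simps)
      ultimately show ?case
        using G[of "u + \<delta>" x y] x y gauss_kernel_nonneg[of "u + \<delta>" x] unfolding gtrans_exp[OF cm_exp \<delta>] D_def K_def l0_def by simp
    next
      case (cm_add m \<phi> m' \<psi>)
      have add: "gtrans \<delta> (\<lambda>l. \<phi> l + \<psi> l) z = gtrans \<delta> \<phi> z + gtrans \<delta> \<psi> z" for z :: 'a
        unfolding gtrans_def distrib_left distrib_right
        by (rule Bochner_Integration.integral_add[OF integrable_gtrans(1)[OF cm_add(1) \<delta>] integrable_gtrans(1)[OF cm_add(2) \<delta>]])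
      have "\<bar>gtrans \<delta> \<phi> x + gtrans \<delta> \<psi> x - (gtrans \<delta> \<phi> y + gtrans \<delta> \<psi> y)\<bar> * D
         \<le> \<bar>gtrans \<delta> \<phi> x - gtrans \<delta> \<phi> y\<bar> * D + \<bar>gtrans \<delta> \<psi> x - gtrans \<delta> \<psi> y\<bar> * D"
        unfolding distrib_right[symmetric] using D by (intro mult_right_mono) auto
      then show ?case using cm_add.IH unfolding add by (simp add: algebra_simps)
    next
      case (cm_scale c m \<phi>)
      have sc: "gtrans \<delta> (\<lambda>l. c * \<phi> l) z = c * gtrans \<delta> \<phi> z" for z :: 'a
        unfolding gtrans_def integral_mult_right_zero[symmetric] by (simp only: mult_ac)
      have "c * (gtrans \<delta> \<phi> x * D) \<le> c * (C * (m - E * \<phi> l0))"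
        "c * (\<bar>gtrans \<delta> \<phi> x - gtrans \<delta> \<phi> y\<bar> * D) \<le> c * (K * (m - E * \<phi> l0))"
        using cm_scale by (auto intro: mult_left_mono)
      moreover have "\<bar>c * gtrans \<delta> \<phi> x - c * gtrans \<delta> \<phi> y\<bar> = c * \<bar>gtrans \<delta> \<phi> x - gtrans \<delta> \<phi> y\<bar>"
        using cm_scale(1) unfolding right_diff_distrib[symmetric] by (simp add: abs_mult)
      ultimately show ?case using cm_scale unfolding sc by (simp add: algebra_simps)
    next
      case (cm_lim m \<Phi> \<phi>)
      note t = gtrans_tendsto[OF cm_lim.hyps \<delta>]
      have r: "(\<lambda>n. c * (m - E * \<Phi> n l0)) \<longlonglongrightarrow> c * (m - E * \<phi> l0)" for c
        by (intro tendsto_intros cm_lim.hyps(2) l0)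
      have "(\<lambda>n. gtrans \<delta> (\<Phi> n) x * D) \<longlonglongrightarrow> gtrans \<delta> \<phi> x * D" by (intro tendsto_intros t)
      from LIMSEQ_le[OF this r[of C]] have 1: "gtrans \<delta> \<phi> x * D \<le> C * (m - E * \<phi> l0)" using cm_lim.IH by auto
      have "(\<lambda>n. \<bar>gtrans \<delta> (\<Phi> n) x - gtrans \<delta> (\<Phi> n) y\<bar> * D) \<longlonglongrightarrow> \<bar>gtrans \<delta> \<phi> x - gtrans \<delta> \<phi> y\<bar> * D" by (intro tendsto_intros t)
      from LIMSEQ_le[OF this r[of K]] have 2: "\<bar>gtrans \<delta> \<phi> x - gtrans \<delta> \<phi> y\<bar> * D \<le> K * (m - E * \<phi> l0)" using cm_lim.IH by auto
      have 3: "0 \<le> gtrans \<delta> \<phi> x" by (rule LIMSEQ_le_const[OF t]) (use cm_lim.IH in auto)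
      show ?case using 1 2 3 by simp
    next
      case (cm_weaken m \<phi> m')
      have "C * (m - E * \<phi> l0) \<le> C * (m' - E * \<phi> l0)" "K * (m - E * \<phi> l0) \<le> K * (m' - E * \<phi> l0)"
        using C K cm_weaken.hyps by (auto intro: mult_left_mono)
      then show ?case using cm_weaken.IH by linarith
    qed
    then show ?thesis by (simp only: D_def E_def K_def l0_def)
  qed
  with C show ?thesis by blast
qed

text \<open>The mixture bounds for exp (- t l powr (\<beta> / 2)), with \<delta> tending to 0;
  \<beta> / 2 < 1 is what complete monotonicity requires. The remaining factor 1 - exp (- t |x| powr
  (- \<beta>)) is at most t |x| powr (- \<beta>), the origin of the factor \<open>t\<close> and of
  the decay exponent d + \<beta>.\<close>

lemma stable_kernel_bounds:
  fixes \<beta> :: real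
  assumes \<beta>: "0 < \<beta>" "\<beta> < 2"
  shows "\<exists>C\<ge>0. \<forall>t>0. \<forall>(x::'a::euclidean_space) (y::'a). x \<noteq> 0 \<longrightarrow> norm x / 2 \<le> norm y \<longrightarrow> norm y \<le> 2 * norm x \<longrightarrow>
     \<bar>stable_kernel \<beta> t x\<bar> \<le> C * t * norm x powr (- (real DIM('a) + \<beta>)) \<and>
     \<bar>stable_kernel \<beta> t x - stable_kernel \<beta> t y\<bar>
       \<le> C * t * (\<bar>norm x - norm y\<bar> / norm x) * norm x powr (- (real DIM('a) + \<beta>))"
proof -
  from gtrans_bounds[where ?'a = 'a] obtain C where C: "0 \<le> C" and "\<forall>m \<phi> \<delta>. \<forall>(x::'a) (y::'a). cm m \<phi> \<longrightarrow> 0 < \<delta> \<longrightarrow> x \<noteq> 0 \<longrightarrow> norm x / 2 \<le> norm y \<longrightarrow> norm y \<le> 2 * norm x \<longrightarrow>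
     gtrans \<delta> \<phi> x * norm x ^ DIM('a) \<le> C * (m - exp (- \<delta> * (1 / (norm x)\<^sup>2)) * \<phi> (1 / (norm x)\<^sup>2)) \<and>
     0 \<le> gtrans \<delta> \<phi> x \<and>
     \<bar>gtrans \<delta> \<phi> x - gtrans \<delta> \<phi> y\<bar> * norm x ^ DIM('a)
       \<le> C * (\<bar>norm x - norm y\<bar> / norm x) * (m - exp (- \<delta> * (1 / (norm x)\<^sup>2)) * \<phi> (1 / (norm x)\<^sup>2))"
    by (elim exE conjE)
  note G = this(2)[rule_format]
  have "\<bar>stable_kernel \<beta> t x\<bar> \<le> C * t * norm x powr (- (real DIM('a) + \<beta>)) \<and>
     \<bar>stable_kernel \<beta> t x - stable_kernel \<beta> t y\<bar>
       \<le> C * t * (\<bar>norm x - norm y\<bar> / norm x) * norm x powr (- (real DIM('a) + \<beta>))"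
    if t: "0 < t" and x: "x \<noteq> 0" and y: "norm x / 2 \<le> norm y" "norm y \<le> 2 * norm x" for t and x y :: 'a
  proof -
    let ?\<phi> = "\<lambda>l. exp (- t * l powr (\<beta> / 2))"
    let ?c = "(2 * pi) ^ DIM('a)"
    define \<delta> where "\<delta> n = 1 / real (Suc n)" for n
    have \<delta>: "0 < \<delta> n" for n by (simp add: \<delta>_def)
    have \<delta>0: "\<delta> \<longlonglongrightarrow> 0" unfolding \<delta>_def by (rule LIMSEQ_Suc[OF lim_1_over_n])
    have cm: "cm 1 ?\<phi>" using \<beta> t by (intro cm_stable) auto
    have pw: "((norm \<xi>)\<^sup>2) powr (\<beta> / 2) = norm \<xi> powr \<beta>" if "\<xi> \<noteq> 0" for \<xi> :: 'a
    proof -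
      have "(norm \<xi>)\<^sup>2 = norm \<xi> powr 2" using that by simp
      then show ?thesis by (simp only: powr_powr) simp
    qed
    have lim: "(\<lambda>n. gtrans (\<delta> n) ?\<phi> z) \<longlonglongrightarrow> ?c * stable_kernel \<beta> t z" for z :: 'a
    proof -
      have "(\<lambda>n. gtrans (\<delta> n) ?\<phi> z) \<longlonglongrightarrow> (LINT \<xi>|lborel. cos (z \<bullet> \<xi>) * exp (- t * norm \<xi> powr \<beta>))"
        unfolding gtrans_def
      proof (rule integral_dominated_convergence)
        show "integrable lborel (\<lambda>\<xi>::'a. exp (- t * norm \<xi> powr \<beta>))" by (rule integrable_exp_powr[OF t \<beta>(1)])
        show "(\<lambda>\<xi>. cos (z \<bullet> \<xi>) * exp (- t * norm \<xi> powr \<beta>)) \<in> borel_measurable lborel" by measurable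
        show "(\<lambda>\<xi>. cos (z \<bullet> \<xi>) * (exp (- \<delta> n * (norm \<xi>)\<^sup>2) * (?\<phi> ((norm \<xi>)\<^sup>2) * indicator {0<..} ((norm \<xi>)\<^sup>2)))) \<in> borel_measurable lborel" for n
          by measurable
        show "AE \<xi> in lborel. (\<lambda>n. cos (z \<bullet> \<xi>) * (exp (- \<delta> n * (norm \<xi>)\<^sup>2) * (?\<phi> ((norm \<xi>)\<^sup>2) * indicator {0<..} ((norm \<xi>)\<^sup>2))))
          \<longlonglongrightarrow> cos (z \<bullet> \<xi>) * exp (- t * norm \<xi> powr \<beta>)"
        proof (intro AE_mp[OF AE_lborel_singleton[of 0] AE_I2] impI)
          fix \<xi> :: 'a assume "\<xi> \<noteq> 0"
          have "(\<lambda>n. cos (z \<bullet> \<xi>) * (exp (- \<delta> n * (norm \<xi>)\<^sup>2) * exp (- t * norm \<xi> powr \<beta>)))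
             \<longlonglongrightarrow> cos (z \<bullet> \<xi>) * (exp (- 0 * (norm \<xi>)\<^sup>2) * exp (- t * norm \<xi> powr \<beta>))"
            by (intro tendsto_intros \<delta>0)
          then show "(\<lambda>n. cos (z \<bullet> \<xi>) * (exp (- \<delta> n * (norm \<xi>)\<^sup>2) * (?\<phi> ((norm \<xi>)\<^sup>2) * indicator {0<..} ((norm \<xi>)\<^sup>2))))
             \<longlonglongrightarrow> cos (z \<bullet> \<xi>) * exp (- t * norm \<xi> powr \<beta>)"
            using \<open>\<xi> \<noteq> 0\<close> by (simp add: pw)
        qed
        show "AE \<xi> in lborel. norm (cos (z \<bullet> \<xi>) * (exp (- \<delta> n * (norm \<xi>)\<^sup>2) * (?\<phi> ((norm \<xi>)\<^sup>2) * indicator {0<..} ((norm \<xi>)\<^sup>2)))) \<le> exp (- t * norm \<xi> powr \<beta>)" for n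
        proof (intro AE_mp[OF AE_lborel_singleton[of 0] AE_I2] impI)
          fix \<xi> :: 'a assume "\<xi> \<noteq> 0"
          have "\<bar>cos (z \<bullet> \<xi>)\<bar> * (exp (- \<delta> n * (norm \<xi>)\<^sup>2) * exp (- t * norm \<xi> powr \<beta>)) \<le> 1 * (1 * exp (- t * norm \<xi> powr \<beta>))"
            using \<delta>[of n] by (intro mult_mono) auto
          then show "norm (cos (z \<bullet> \<xi>) * (exp (- \<delta> n * (norm \<xi>)\<^sup>2) * (?\<phi> ((norm \<xi>)\<^sup>2) * indicator {0<..} ((norm \<xi>)\<^sup>2)))) \<le> exp (- t * norm \<xi> powr \<beta>)"
            using \<open>\<xi> \<noteq> 0\<close> by (simp add: pw abs_mult)
        qed
      qed
      then show ?thesis by (simp add: stable_kernel_def)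
    qed
    define W where "W = 1 - ?\<phi> (1 / (norm x)\<^sup>2)"
    have W: "W \<le> t * norm x powr (- \<beta>)"
    proof -
      have "(1 / (norm x)\<^sup>2) powr (\<beta> / 2) = norm x powr (- \<beta>)"
        using x pw[OF x] by (simp add: powr_divide powr_minus field_simps)
      then have "W = 1 - exp (- t * norm x powr (- \<beta>))" by (simp only: W_def)
      then show ?thesis using exp_ge_add_one_self[of "- t * norm x powr (- \<beta>)"] by linarith
    qed
    have limr: "(\<lambda>n. c * (1 - exp (- \<delta> n * (1 / (norm x)\<^sup>2)) * ?\<phi> (1 / (norm x)\<^sup>2))) \<longlonglongrightarrow> c * W" for c
    proof -
      have "(\<lambda>n. c * (1 - exp (- \<delta> n * (1 / (norm x)\<^sup>2)) * ?\<phi> (1 / (norm x)\<^sup>2))) \<longlonglongrightarrow> c * (1 - exp (- 0 * (1 / (norm x)\<^sup>2)) * ?\<phi> (1 / (norm x)\<^sup>2))"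
        by (intro tendsto_intros \<delta>0)
      then show ?thesis by (simp add: W_def)
    qed
    define D where "D = norm x ^ DIM('a)"
    have D: "0 < D" using x by (simp add: D_def)
    have c1: "1 \<le> ?c"
    proof (rule one_le_power)
      show "1 \<le> 2 * pi" using pi_ge_two by linarith
    qed
    define K where "K = C * (\<bar>norm x - norm y\<bar> / norm x)"
    have K: "0 \<le> K" using C by (simp add: K_def)
    note G' = G[OF cm \<delta> x y, folded D_def K_def]
    have "(\<lambda>n. gtrans (\<delta> n) ?\<phi> x * D) \<longlonglongrightarrow> ?c * stable_kernel \<beta> t x * D" by (intro tendsto_intros lim)
    from LIMSEQ_le[OF this limr[of C]] have 1: "?c * stable_kernel \<beta> t x * D \<le> C * W" using G' by auto
    have "0 \<le> ?c * stable_kernel \<beta> t x" by (rule LIMSEQ_le_const[OF lim]) (use G' in auto)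
    then have pos: "0 \<le> stable_kernel \<beta> t x" using c1 by (simp add: zero_le_mult_iff)
    have "(\<lambda>n. \<bar>gtrans (\<delta> n) ?\<phi> x - gtrans (\<delta> n) ?\<phi> y\<bar> * D) \<longlonglongrightarrow> \<bar>?c * stable_kernel \<beta> t x - ?c * stable_kernel \<beta> t y\<bar> * D"
      by (intro tendsto_intros lim)
    from LIMSEQ_le[OF this limr[of K]] have 2: "\<bar>?c * stable_kernel \<beta> t x - ?c * stable_kernel \<beta> t y\<bar> * D \<le> K * W" using G' by auto
    have e: "norm x powr (- (real DIM('a) + \<beta>)) = norm x powr (- \<beta>) / D"
      using x unfolding D_def by (simp add: powr_diff powr_realpow powr_minus field_simps)
    have fin: "A \<le> B * t * norm x powr (- (real DIM('a) + \<beta>))" if "?c * A * D \<le> B * W" "0 \<le> A" "0 \<le> B" for A B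
    proof -
      have "1 * (A * D) \<le> ?c * (A * D)" using c1 that D by (intro mult_right_mono) auto
      also have "\<dots> = ?c * A * D" by simp
      also have "\<dots> \<le> B * W" by (rule that)
      also have "\<dots> \<le> B * (t * norm x powr (- \<beta>))" using that W by (intro mult_left_mono)
      finally show ?thesis using D unfolding e by (simp add: field_simps)
    qed
    have "\<bar>?c * stable_kernel \<beta> t x - ?c * stable_kernel \<beta> t y\<bar> = ?c * \<bar>stable_kernel \<beta> t x - stable_kernel \<beta> t y\<bar>"
      unfolding right_diff_distrib[symmetric] by (simp add: abs_mult)
    then have "\<bar>stable_kernel \<beta> t x - stable_kernel \<beta> t y\<bar> \<le> K * t * norm x powr (- (real DIM('a) + \<beta>))"
      using 2 K by (intro fin) auto
    moreover have "\<bar>stable_kernel \<beta> t x\<bar> \<le> C * t * norm x powr (- (real DIM('a) + \<beta>))"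
      using 1 pos C by (intro fin) auto
    ultimately show ?thesis by (simp add: K_def mult_ac)
  qed
  with C show ?thesis by blast
qed

section \<open>Dependence of the kernel on time\<close>

lemma has_real_derivative_integral:
  fixes F :: "real \<Rightarrow> 'b \<Rightarrow> real"
  assumes e: "0 < e"
    and int: "\<And>s. \<bar>s - t\<bar> < e \<Longrightarrow> integrable M (F s)"
    and lip: "\<And>s z. \<bar>s - t\<bar> < e \<Longrightarrow> z \<in> space M \<Longrightarrow> \<bar>F s z - F t z\<bar> \<le> \<bar>s - t\<bar> * w z"
    and w: "integrable M w"
    and der: "\<And>z. z \<in> space M \<Longrightarrow> ((\<lambda>s. F s z) has_real_derivative F' z) (at t)"
    and F': "F' \<in> borel_measurable M"
  shows "((\<lambda>s. LINT z|M. F s z) has_real_derivative (LINT z|M. F' z)) (at t)"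
  unfolding has_field_derivative_iff tendsto_at_iff_sequentially
proof (intro allI impI)
  fix X :: "nat \<Rightarrow> real" assume X: "\<forall>i. X i \<in> UNIV - {t}" and lim: "X \<longlonglongrightarrow> t"
  have ev: "\<forall>\<^sub>F i in sequentially. \<bar>X i - t\<bar> < e"
    using lim e unfolding tendsto_iff dist_real_def by auto
  \<comment> \<open>Difference quotients, set to 0 for the finitely many indices outside the
    neighbourhood, so that \<open>w\<close> dominates at every index.\<close>
  define S where "S i z = (if \<bar>X i - t\<bar> < e then (F (X i) z - F t z) / (X i - t) else 0)" for i z
  have "(\<lambda>i. LINT z|M. S i z) \<longlonglongrightarrow> (LINT z|M. F' z)"
  proof (rule integral_dominated_convergence[OF F' _ w])
    have "integrable M (F t)" using int[of t] e by simp
    then show "S i \<in> borel_measurable M" for i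
      using int[of "X i"] unfolding S_def by (cases "\<bar>X i - t\<bar> < e") auto
    show "AE z in M. (\<lambda>i. S i z) \<longlonglongrightarrow> F' z"
    proof (rule AE_I2)
      fix z assume "z \<in> space M"
      from der[OF this] have "((\<lambda>s. (F s z - F t z) / (s - t)) \<longlongrightarrow> F' z) (at t)"
        by (simp add: has_field_derivative_iff)
      then have "(\<lambda>i. (F (X i) z - F t z) / (X i - t)) \<longlonglongrightarrow> F' z"
        using X lim unfolding tendsto_at_iff_sequentially comp_def by auto
      moreover have "\<forall>\<^sub>F i in sequentially. (F (X i) z - F t z) / (X i - t) = S i z"
        using ev by eventually_elim (simp add: S_def)
      ultimately show "(\<lambda>i. S i z) \<longlonglongrightarrow> F' z" by (rule Lim_transform_eventually)
    qed
    show "AE z in M. norm (S i z) \<le> w z" for i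
    proof (rule AE_I2)
      fix z assume z: "z \<in> space M"
      have xt: "0 < \<bar>X i - t\<bar>" using X by auto
      have "0 \<le> w z"
      proof -
        have "\<bar>(t + e / 2) - t\<bar> < e" using e by simp
        from order_trans[OF abs_ge_zero lip[OF this z]] have "0 \<le> \<bar>(t + e / 2) - t\<bar> * w z" .
        then show ?thesis using e by (simp add: zero_le_mult_iff)
      qed
      moreover have "\<bar>F (X i) z - F t z\<bar> / \<bar>X i - t\<bar> \<le> w z" if "\<bar>X i - t\<bar> < e"
        using lip[OF that z] xt by (simp add: pos_divide_le_eq mult.commute)
      ultimately show "norm (S i z) \<le> w z" by (simp add: S_def abs_divide)
    qed
  qed
  moreover have "\<forall>\<^sub>F i in sequentially. (LINT z|M. S i z) = ((\<lambda>s. ((LINT z|M. F s z) - (LINT z|M. F t z)) / (s - t)) \<circ> X) i"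
    using ev
  proof eventually_elim
    fix i assume i: "\<bar>X i - t\<bar> < e"
    have "integrable M (F t)" "integrable M (F (X i))" using int[of t] int[OF i] e by simp_all
    then show "(LINT z|M. S i z) = ((\<lambda>s. ((LINT z|M. F s z) - (LINT z|M. F t z)) / (s - t)) \<circ> X) i"
      using i by (simp add: S_def)
  qed
  ultimately show "((\<lambda>s. ((LINT z|M. F s z) - (LINT z|M. F t z)) / (s - t)) \<circ> X) \<longlonglongrightarrow> (LINT z|M. F' z)"
    by (rule Lim_transform_eventually)
qed

definition stable_kernel_dt :: "real \<Rightarrow> real \<Rightarrow> 'a::euclidean_space \<Rightarrow> real" where
  "stable_kernel_dt a t x = - (LINT \<xi>|lborel. cos (x \<bullet> \<xi>) * (norm \<xi> powr a * exp (- t * norm \<xi> powr a))) / (2 * pi) ^ DIM('a)"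

lemma abs_exp_time_diff_le:
  fixes A :: real
  assumes "0 < t" "\<bar>s - t\<bar> < t / 2" "0 \<le> A"
  shows "\<bar>exp (- s * A) - exp (- t * A)\<bar> \<le> \<bar>s - t\<bar> * (A * exp (- (t / 2) * A))"
proof -
  have s: "t / 2 \<le> s" using assms(2) unfolding abs_less_iff by linarith
  have "\<bar>exp (- (s * A)) - exp (- (t * A))\<bar> \<le> \<bar>s * A - t * A\<bar> * exp (- ((t / 2) * A))"
    using assms s by (intro abs_exp_diff_le mult_right_mono) auto
  also have "\<bar>s * A - t * A\<bar> = \<bar>s - t\<bar> * A" using assms by (simp add: left_diff_distrib[symmetric] abs_mult)
  finally show ?thesis by (simp add: mult.assoc)
qed

lemma integrable_cos_mult:
  fixes m :: "'a::euclidean_space \<Rightarrow> real"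
  assumes "integrable lborel m"
  shows "integrable lborel (\<lambda>\<xi>. cos (x \<bullet> \<xi>) * m \<xi>)"
proof (rule Bochner_Integration.integrable_bound[OF assms])
  have [measurable]: "m \<in> borel_measurable borel" using borel_measurable_integrable[OF assms] by simp
  show "(\<lambda>\<xi>. cos (x \<bullet> \<xi>) * m \<xi>) \<in> borel_measurable lborel" by measurable
qed (auto intro!: AE_I2 mult_left_le_one_le simp: abs_mult)

lemma DERIV_stable_kernel:
  fixes x :: "'a::euclidean_space"
  assumes \<beta>: "0 < \<beta>" and t: "0 < t"
  shows "((\<lambda>s. stable_kernel \<beta> s x) has_real_derivative stable_kernel_dt \<beta> t x) (at t)"
proof -
  have "((\<lambda>s. LINT \<xi>|lborel. cos (x \<bullet> \<xi>) * exp (- s * norm \<xi> powr \<beta>)) has_real_derivative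
     (LINT \<xi>|lborel. cos (x \<bullet> \<xi>) * (- (norm \<xi> powr \<beta>) * exp (- t * norm \<xi> powr \<beta>)))) (at t)"
  proof (rule has_real_derivative_integral[where e = "t / 2"])
    show "integrable lborel (\<lambda>\<xi>. cos (x \<bullet> \<xi>) * exp (- s * norm \<xi> powr \<beta>))" if "\<bar>s - t\<bar> < t / 2" for s
    proof -
      have "0 < s" using that t unfolding abs_less_iff by linarith
      then show ?thesis by (intro integrable_cos_mult integrable_exp_powr \<beta>)
    qed
    show "integrable lborel (\<lambda>\<xi>::'a. norm \<xi> powr \<beta> * exp (- (t / 2) * norm \<xi> powr \<beta>))"
      by (intro integrable_powr_exp) (use t \<beta> in auto)
    fix \<xi> :: 'a
    show "((\<lambda>s. cos (x \<bullet> \<xi>) * exp (- s * norm \<xi> powr \<beta>)) has_real_derivative cos (x \<bullet> \<xi>) * (- (norm \<xi> powr \<beta>) * exp (- t * norm \<xi> powr \<beta>))) (at t)"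
      by (auto intro!: derivative_eq_intros)
    fix s assume s: "\<bar>s - t\<bar> < t / 2"
    have "\<bar>cos (x \<bullet> \<xi>)\<bar> * \<bar>exp (- s * norm \<xi> powr \<beta>) - exp (- t * norm \<xi> powr \<beta>)\<bar> \<le> 1 * (\<bar>s - t\<bar> * (norm \<xi> powr \<beta> * exp (- (t / 2) * norm \<xi> powr \<beta>)))"
      by (intro mult_mono abs_exp_time_diff_le t s) auto
    then show "\<bar>cos (x \<bullet> \<xi>) * exp (- s * norm \<xi> powr \<beta>) - cos (x \<bullet> \<xi>) * exp (- t * norm \<xi> powr \<beta>)\<bar> \<le> \<bar>s - t\<bar> * (norm \<xi> powr \<beta> * exp (- (t / 2) * norm \<xi> powr \<beta>))"
      unfolding right_diff_distrib[symmetric] abs_mult by (simp only: mult_1)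
  qed (use t in \<open>auto\<close>)
  from DERIV_cdivide[OF this, of "(2 * pi) ^ DIM('a)"]
  show ?thesis unfolding stable_kernel_def stable_kernel_dt_def by simp
qed

text \<open>Uniform in \<open>x\<close>, with a constant that depends on \<open>t\<close>; it covers
  a neighbourhood of the origin, where a bound by a negative power of |x| is of no use.\<close>

lemma stable_kernel_time_lipschitz_near:
  fixes x :: "'a::euclidean_space"
  assumes \<beta>: "0 < \<beta>" and t: "0 < t"
  shows "\<exists>C\<ge>0. \<forall>s (x::'a). \<bar>s - t\<bar> < t / 2 \<longrightarrow> \<bar>stable_kernel \<beta> s x - stable_kernel \<beta> t x\<bar> \<le> C * \<bar>s - t\<bar>"
proof -
  let ?w = "\<lambda>\<xi>::'a. norm \<xi> powr \<beta> * exp (- (t / 2) * norm \<xi> powr \<beta>)"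
  define C where "C = (LINT \<xi>|lborel. ?w \<xi>) / (2 * pi) ^ DIM('a)"
  have w: "integrable lborel ?w" by (intro integrable_powr_exp) (use t \<beta> in auto)
  have "\<bar>stable_kernel \<beta> s x - stable_kernel \<beta> t x\<bar> \<le> C * \<bar>s - t\<bar>" if s: "\<bar>s - t\<bar> < t / 2" for s and x :: 'a
  proof -
    have "0 < s" using s t unfolding abs_less_iff by linarith
    then have i: "integrable lborel (\<lambda>\<xi>. cos (x \<bullet> \<xi>) * exp (- s * norm \<xi> powr \<beta>))" "integrable lborel (\<lambda>\<xi>. cos (x \<bullet> \<xi>) * exp (- t * norm \<xi> powr \<beta>))"
      by (intro integrable_cos_mult integrable_exp_powr \<beta> t; assumption)+
    have "\<bar>(LINT \<xi>|lborel. cos (x \<bullet> \<xi>) * exp (- s * norm \<xi> powr \<beta>)) - (LINT \<xi>|lborel. cos (x \<bullet> \<xi>) * exp (- t * norm \<xi> powr \<beta>))\<bar>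
       = norm (LINT \<xi>|lborel. cos (x \<bullet> \<xi>) * exp (- s * norm \<xi> powr \<beta>) - cos (x \<bullet> \<xi>) * exp (- t * norm \<xi> powr \<beta>))"
      by (simp only: Bochner_Integration.integral_diff[OF i] real_norm_def)
    also have "\<dots> \<le> (LINT \<xi>|lborel. \<bar>s - t\<bar> * ?w \<xi>)"
    proof (rule order_trans[OF integral_norm_bound integral_mono'])
      show "integrable lborel (\<lambda>\<xi>. \<bar>s - t\<bar> * ?w \<xi>)" by (intro integrable_mult_right w)
      fix \<xi> :: 'a
      have "\<bar>cos (x \<bullet> \<xi>)\<bar> * \<bar>exp (- s * norm \<xi> powr \<beta>) - exp (- t * norm \<xi> powr \<beta>)\<bar> \<le> 1 * (\<bar>s - t\<bar> * ?w \<xi>)"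
        by (intro mult_mono abs_exp_time_diff_le t s) auto
      then show "norm (cos (x \<bullet> \<xi>) * exp (- s * norm \<xi> powr \<beta>) - cos (x \<bullet> \<xi>) * exp (- t * norm \<xi> powr \<beta>)) \<le> \<bar>s - t\<bar> * ?w \<xi>"
        unfolding right_diff_distrib[symmetric] real_norm_def abs_mult by (simp only: mult_1)
    qed auto
    also have "\<dots> = \<bar>s - t\<bar> * (LINT \<xi>|lborel. ?w \<xi>)" by (rule integral_mult_right_zero)
    finally have "\<bar>(LINT \<xi>|lborel. cos (x \<bullet> \<xi>) * exp (- s * norm \<xi> powr \<beta>)) - (LINT \<xi>|lborel. cos (x \<bullet> \<xi>) * exp (- t * norm \<xi> powr \<beta>))\<bar> / (2 * pi) ^ DIM('a)
        \<le> (\<bar>s - t\<bar> * (LINT \<xi>|lborel. ?w \<xi>)) / (2 * pi) ^ DIM('a)"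
      by (intro divide_right_mono) auto
    then show ?thesis
      unfolding stable_kernel_def C_def diff_divide_distrib[symmetric] by (simp add: abs_divide mult.commute)
  qed
  moreover have "0 \<le> C" unfolding C_def by (intro divide_nonneg_nonneg integral_nonneg) auto
  ultimately show ?thesis by blast
qed

text \<open>Substitution of \<rho> \<xi> for \<xi>. A change of time thus amounts to a dilation of
  space, which lets spatial estimates control increments in time.\<close>

lemma stable_kernel_scaling:
  fixes x :: "'a::euclidean_space"
  assumes \<beta>: "0 < \<beta>" and st: "0 < s" "0 < t"
  defines "\<rho> \<equiv> (t / s) powr (1 / \<beta>)"
  shows "stable_kernel \<beta> s x = \<rho> ^ DIM('a) * stable_kernel \<beta> t (\<rho> *\<^sub>R x)"
proof -
  have \<rho>: "0 < \<rho>" using st by (simp add: \<rho>_def)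
  have e: "s * (\<rho> * n) powr \<beta> = t * n powr \<beta>" if "0 \<le> n" for n
  proof -
    have "\<rho> powr \<beta> = t / s" using st \<beta> by (simp add: \<rho>_def powr_powr)
    then show ?thesis using that st \<rho> by (simp add: powr_mult)
  qed
  have "(LINT \<xi>|lborel. cos (x \<bullet> \<xi>) * exp (- s * norm \<xi> powr \<beta>)) =
    \<bar>\<rho>\<bar> ^ DIM('a) *\<^sub>R (LINT \<xi>|lborel. cos (x \<bullet> (0 + \<rho> *\<^sub>R \<xi>)) * exp (- s * norm (0 + \<rho> *\<^sub>R \<xi>) powr \<beta>))"
    by (rule integral_lborel_affine) (use \<rho> in auto)
  also have "\<dots> = \<rho> ^ DIM('a) * (LINT \<xi>|lborel. cos ((\<rho> *\<^sub>R x) \<bullet> \<xi>) * exp (- t * norm \<xi> powr \<beta>))"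
    using \<rho> e by simp
  finally show ?thesis by (simp add: stable_kernel_def)
qed

lemma abs_power_minus_one_le:
  fixes r :: real
  assumes "0 \<le> r" "r \<le> 2"
  shows "\<bar>r ^ n - 1\<bar> \<le> real n * 2 ^ n * \<bar>r - 1\<bar>"
proof -
  have "r ^ n - 1 = (r - 1) * (\<Sum>i<n. r ^ i)" by (rule power_diff_1_eq)
  then have "\<bar>r ^ n - 1\<bar> = \<bar>r - 1\<bar> * (\<Sum>i<n. r ^ i)" using assms by (simp add: abs_mult sum_nonneg)
  also have "\<dots> \<le> \<bar>r - 1\<bar> * (\<Sum>i<n. 2 ^ n)"
  proof (intro mult_left_mono sum_mono)
    fix i assume "i \<in> {..<n}"
    have "r ^ i \<le> 2 ^ i" using assms by (intro power_mono) auto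
    also have "\<dots> \<le> (2::real) ^ n" using \<open>i \<in> {..<n}\<close> by (intro power_increasing) auto
    finally show "r ^ i \<le> 2 ^ n" .
  qed simp
  finally show ?thesis by (simp add: mult.commute)
qed

text \<open>The time derivative of exp (- t l powr g) contains the factor l powr g, which vanishes
  as l tends to 0; it is therefore not completely monotone, even up to sign, and the mixture bounds
  do not apply to it. Scaling is used instead: the kernel at time \<open>s\<close> is a dilation of
  the kernel at time \<open>t\<close>, so its increment is controlled by the size bound and by the
  difference bound for the points x and \<rho> x.\<close>

lemma stable_kernel_time_lipschitz:
  fixes \<beta> :: real
  assumes \<beta>: "0 < \<beta>" "\<beta> < 2"
  shows "\<exists>C\<ge>0. \<exists>\<kappa>>0. \<forall>t s. \<forall>x :: 'a::euclidean_space. 0 < t \<longrightarrow> \<bar>s - t\<bar> \<le> \<kappa> * t \<longrightarrow> x \<noteq> 0 \<longrightarrow>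
     \<bar>stable_kernel \<beta> s x - stable_kernel \<beta> t x\<bar> \<le> C * \<bar>s - t\<bar> * norm x powr (- (real DIM('a) + \<beta>))"
proof -
  from stable_kernel_bounds[OF \<beta>, where ?'a = 'a] obtain C where C: "0 \<le> C" and
    "\<forall>t>0. \<forall>(x::'a) (y::'a). x \<noteq> 0 \<longrightarrow> norm x / 2 \<le> norm y \<longrightarrow> norm y \<le> 2 * norm x \<longrightarrow>
     \<bar>stable_kernel \<beta> t x\<bar> \<le> C * t * norm x powr (- (real DIM('a) + \<beta>)) \<and>
     \<bar>stable_kernel \<beta> t x - stable_kernel \<beta> t y\<bar>
       \<le> C * t * (\<bar>norm x - norm y\<bar> / norm x) * norm x powr (- (real DIM('a) + \<beta>))"
    by (elim exE conjE)
  note G = this(2)[rule_format]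
  \<comment> \<open>A bound on u \<ge> 1 / 2 for the derivative of u powr (- 1 / \<beta>), the
    dilation factor in terms of u = s / t.\<close>
  define L where "L = (1 / \<beta>) * 2 powr (1 / \<beta> + 1)"
  have L: "0 < L" using \<beta> by (simp add: L_def)
  \<comment> \<open>The first entry keeps s / t above 1 / 2, the second keeps \<rho> within 1 / 2 of
    1, so that \<rho> x meets the size condition of the spatial bound.\<close>
  define \<kappa> where "\<kappa> = min (1 / 2) (1 / (2 * L))"
  have \<kappa>: "0 < \<kappa>" using L by (simp add: \<kappa>_def)
  define C' where "C' = (real DIM('a) * 2 ^ DIM('a) + 2 ^ DIM('a)) * L * C"
  have C': "0 \<le> C'" using C L by (simp add: C'_def)
  have "\<bar>stable_kernel \<beta> s x - stable_kernel \<beta> t x\<bar> \<le> C' * \<bar>s - t\<bar> * norm x powr (- (real DIM('a) + \<beta>))"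
    if t: "0 < t" and s: "\<bar>s - t\<bar> \<le> \<kappa> * t" and x: "x \<noteq> 0" for t s and x :: 'a
  proof -
    define u where "u = s / t"
    have u1: "\<bar>u - 1\<bar> \<le> \<kappa>" "\<bar>u - 1\<bar> = \<bar>s - t\<bar> / t"
    proof -
      have "u - 1 = (s - t) / t" using t by (simp add: u_def field_simps)
      then show "\<bar>u - 1\<bar> = \<bar>s - t\<bar> / t" using t by simp
      then show "\<bar>u - 1\<bar> \<le> \<kappa>" using s t by (simp add: pos_divide_le_eq)
    qed
    have "\<bar>u - 1\<bar> \<le> 1 / 2" using u1(1) by (simp add: \<kappa>_def)
    then have u: "1 / 2 \<le> u" unfolding abs_le_iff by linarith
    have s0: "0 < s" using u t unfolding u_def by (simp add: field_simps)
    define \<rho> where "\<rho> = (t / s) powr (1 / \<beta>)"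
    have \<rho>u: "\<rho> = u powr (- (1 / \<beta>))"
      using t s0 by (simp add: \<rho>_def u_def powr_divide powr_minus field_simps)
    have \<rho>1: "\<bar>\<rho> - 1\<bar> \<le> L * \<bar>u - 1\<bar>"
    proof -
      have "norm (u powr (- (1 / \<beta>)) - 1 powr (- (1 / \<beta>))) \<le> L * norm (u - 1)"
      proof (rule field_differentiable_bound[where S = "{1 / 2..}" and f' = "\<lambda>z. - (1 / \<beta>) * z powr (- (1 / \<beta>) - 1)"])
        fix z :: real assume z: "z \<in> {1 / 2..}"
        then show "((\<lambda>w. w powr (- (1 / \<beta>))) has_field_derivative - (1 / \<beta>) * z powr (- (1 / \<beta>) - 1)) (at z within {1 / 2..})"
          by (auto intro!: derivative_eq_intros)
        have "z powr (- (1 / \<beta>) - 1) \<le> (1 / 2) powr (- (1 / \<beta>) - 1)"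
        proof (rule powr_mono2')
          have "0 < 1 / \<beta>" using \<beta> by simp
          then show "- (1 / \<beta>) - 1 \<le> 0" by linarith
        qed (use z in auto)
        also have "\<dots> = 2 powr (1 / \<beta> + 1)"
        proof -
          have "(1 / 2 :: real) powr c = 2 powr (- c)" for c by (simp add: powr_divide powr_minus_divide)
          then show ?thesis by (simp add: add.commute)
        qed
        finally show "norm (- (1 / \<beta>) * z powr (- (1 / \<beta>) - 1)) \<le> L"
          unfolding L_def using \<beta> by (simp add: abs_mult divide_right_mono)
      qed (use u in auto)
      then show ?thesis unfolding \<rho>u by simp
    qed
    have "L * \<bar>u - 1\<bar> \<le> L * (1 / (2 * L))" using u1(1) L by (intro mult_left_mono) (auto simp: \<kappa>_def)
    then have \<rho>h: "\<bar>\<rho> - 1\<bar> \<le> 1 / 2" using \<rho>1 L by simp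
    then have \<rho>: "1 / 2 \<le> \<rho>" "\<rho> \<le> 2" unfolding abs_le_iff by linarith+
    define N where "N = norm x powr (- (real DIM('a) + \<beta>))"
    have N: "0 \<le> N" by (simp add: N_def)
    have nr: "norm (\<rho> *\<^sub>R x) = \<rho> * norm x" using \<rho> by simp
    have B: "\<bar>stable_kernel \<beta> t x\<bar> \<le> C * t * N" "\<bar>stable_kernel \<beta> t x - stable_kernel \<beta> t (\<rho> *\<^sub>R x)\<bar> \<le> C * t * \<bar>\<rho> - 1\<bar> * N"
    proof -
      have "norm x / 2 \<le> norm (\<rho> *\<^sub>R x)" "norm (\<rho> *\<^sub>R x) \<le> 2 * norm x"
        using mult_right_mono[OF \<rho>(1), of "norm x"] mult_right_mono[OF \<rho>(2), of "norm x"] unfolding nr by simp_all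
      note GG = G[OF t x this, folded N_def]
      show "\<bar>stable_kernel \<beta> t x\<bar> \<le> C * t * N" using GG by blast
      have "\<bar>norm x - norm (\<rho> *\<^sub>R x)\<bar> / norm x = \<bar>\<rho> - 1\<bar>"
      proof -
        have "norm x - norm (\<rho> *\<^sub>R x) = (1 - \<rho>) * norm x" unfolding nr by (simp add: algebra_simps)
        then show ?thesis using x by (simp add: abs_mult abs_minus_commute)
      qed
      then show "\<bar>stable_kernel \<beta> t x - stable_kernel \<beta> t (\<rho> *\<^sub>R x)\<bar> \<le> C * t * \<bar>\<rho> - 1\<bar> * N" using GG by simp
    qed
    have sc: "stable_kernel \<beta> s x = \<rho> ^ DIM('a) * stable_kernel \<beta> t (\<rho> *\<^sub>R x)"
      unfolding \<rho>_def by (rule stable_kernel_scaling[OF \<beta>(1) s0 t])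
    have "\<bar>stable_kernel \<beta> s x - stable_kernel \<beta> t x\<bar> =
       \<bar>\<rho> ^ DIM('a) * (stable_kernel \<beta> t (\<rho> *\<^sub>R x) - stable_kernel \<beta> t x) + (\<rho> ^ DIM('a) - 1) * stable_kernel \<beta> t x\<bar>"
      unfolding sc by (simp add: algebra_simps)
    also have "\<dots> \<le> \<rho> ^ DIM('a) * \<bar>stable_kernel \<beta> t x - stable_kernel \<beta> t (\<rho> *\<^sub>R x)\<bar> + \<bar>\<rho> ^ DIM('a) - 1\<bar> * \<bar>stable_kernel \<beta> t x\<bar>"
      using \<rho> by (intro order_trans[OF abs_triangle_ineq]) (simp add: abs_mult abs_minus_commute)
    also have "\<dots> \<le> 2 ^ DIM('a) * (C * t * \<bar>\<rho> - 1\<bar> * N) + (real DIM('a) * 2 ^ DIM('a) * \<bar>\<rho> - 1\<bar>) * (C * t * N)"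
      using \<rho> B by (intro add_mono mult_mono power_mono abs_power_minus_one_le) auto
    also have "\<dots> = \<bar>\<rho> - 1\<bar> * ((real DIM('a) * 2 ^ DIM('a) + 2 ^ DIM('a)) * (C * t * N))" by (simp add: algebra_simps)
    also have "\<dots> \<le> (L * \<bar>u - 1\<bar>) * ((real DIM('a) * 2 ^ DIM('a) + 2 ^ DIM('a)) * (C * t * N))"
      using \<rho>1 C t N by (intro mult_right_mono) auto
    also have "\<dots> = C' * \<bar>s - t\<bar> * N" using t unfolding u1(2) C'_def by simp
    finally show ?thesis unfolding N_def .
  qed
  with C' \<kappa> show ?thesis by blast
qed

subsection \<open>The extension of a weighted integrable function\<close>

text \<open>Merges a bound near the origin and a decay at infinity into one weight: 1 + |z| is at
  most 2 inside the unit ball and at most 2 |z| outside.\<close>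

lemma le_kernel_weight:
  fixes z :: "'a::euclidean_space"
  assumes A: "A \<le> C1" "z \<noteq> 0 \<Longrightarrow> A \<le> C2 * norm z powr (- a)" and C: "0 \<le> C1" "0 \<le> C2" and a: "0 \<le> a"
  shows "A \<le> (C1 + C2) * 2 powr a * (1 + norm z) powr (- a)"
proof (cases "norm z \<le> 1")
  case True
  have "(1 + norm z) powr a \<le> 2 powr a" using True a by (intro powr_mono2) auto
  moreover have "0 < 1 + norm z" by (simp add: add_pos_nonneg)
  ultimately have "1 \<le> 2 powr a * (1 + norm z) powr (- a)"
    by (simp add: powr_minus_divide pos_le_divide_eq)
  then have "(C1 + C2) * 1 \<le> (C1 + C2) * (2 powr a * (1 + norm z) powr (- a))"
    using C by (intro mult_left_mono) auto
  then show ?thesis using A C by (simp add: mult.assoc)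
next
  case False
  then have z: "z \<noteq> 0" "1 < norm z" by auto
  have "(1 + norm z) powr a \<le> (2 * norm z) powr a" using z a by (intro powr_mono2) auto
  then have "(1 + norm z) powr a \<le> 2 powr a * norm z powr a" by (simp add: powr_mult)
  moreover have "0 < (1 + norm z) powr a" "0 < norm z powr a" using z by auto
  ultimately have "norm z powr (- a) \<le> 2 powr a * (1 + norm z) powr (- a)"
    by (simp add: powr_minus_divide divide_simps mult.commute)
  then have "C2 * norm z powr (- a) \<le> (C1 + C2) * (2 powr a * (1 + norm z) powr (- a))"
    using C by (intro mult_mono) auto
  then show ?thesis using A(2)[OF z(1)] by (simp add: mult.assoc)
qed

lemma DERIV_abs_le:
  fixes f :: "real \<Rightarrow> real"
  assumes d: "(f has_real_derivative D) (at t)" and e: "0 < e"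
    and lip: "\<And>s. \<bar>s - t\<bar> < e \<Longrightarrow> \<bar>f s - f t\<bar> \<le> K * \<bar>s - t\<bar>"
  shows "\<bar>D\<bar> \<le> K"
proof (rule tendsto_upperbound)
  have "((\<lambda>s. (f s - f t) / (s - t)) \<longlongrightarrow> D) (at t)" using d by (simp add: has_field_derivative_iff)
  then show "((\<lambda>s. \<bar>(f s - f t) / (s - t)\<bar>) \<longlongrightarrow> \<bar>D\<bar>) (at t)" by (rule tendsto_rabs)
  have "\<forall>\<^sub>F s in at t. \<bar>s - t\<bar> < e \<and> s \<noteq> t"
    unfolding eventually_at using e by (intro exI[of _ e]) (auto simp: dist_real_def)
  then show "\<forall>\<^sub>F s in at t. \<bar>(f s - f t) / (s - t)\<bar> \<le> K"
  proof eventually_elim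
    fix s assume "\<bar>s - t\<bar> < e \<and> s \<noteq> t"
    then show "\<bar>(f s - f t) / (s - t)\<bar> \<le> K" using lip[of s] by (simp add: abs_divide pos_divide_le_eq)
  qed
qed simp

lemma stable_kernel_dt_bound:
  fixes \<beta> :: real
  assumes \<beta>: "0 < \<beta>" "\<beta> < 2"
  shows "\<exists>C\<ge>0. \<forall>t. \<forall>x :: 'a::euclidean_space. 0 < t \<longrightarrow> x \<noteq> 0 \<longrightarrow>
     \<bar>stable_kernel_dt \<beta> t x\<bar> \<le> C * norm x powr (- (real DIM('a) + \<beta>))"
proof -
  from stable_kernel_time_lipschitz[OF \<beta>, where ?'a = 'a] obtain C \<kappa> where C: "0 \<le> C" and \<kappa>: "0 < \<kappa>" and
    "\<forall>t s. \<forall>x :: 'a. 0 < t \<longrightarrow> \<bar>s - t\<bar> \<le> \<kappa> * t \<longrightarrow> x \<noteq> 0 \<longrightarrow>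
     \<bar>stable_kernel \<beta> s x - stable_kernel \<beta> t x\<bar> \<le> C * \<bar>s - t\<bar> * norm x powr (- (real DIM('a) + \<beta>))"
    by (elim exE conjE)
  note G = this(3)[rule_format]
  have "\<bar>stable_kernel_dt \<beta> t x\<bar> \<le> C * norm x powr (- (real DIM('a) + \<beta>))" if "0 < t" "x \<noteq> 0" for t and x :: 'a
  proof (rule DERIV_abs_le[OF DERIV_stable_kernel[OF \<beta>(1) that(1)]])
    show "0 < \<kappa> * t" using \<kappa> that by simp
    show "\<bar>stable_kernel \<beta> s x - stable_kernel \<beta> t x\<bar> \<le> C * norm x powr (- (real DIM('a) + \<beta>)) * \<bar>s - t\<bar>" if "\<bar>s - t\<bar> < \<kappa> * t" for s
      using G[OF \<open>0 < t\<close> less_imp_le[OF that] \<open>x \<noteq> 0\<close>] by (simp only: mult_ac)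
  qed
  with C show ?thesis by blast
qed

text \<open>Majorants, locally uniform in time, for differentiating the extension under the
  integral. The constant may depend on \<open>t\<close>, since it serves integrability and
  differentiability only; the quantitative estimates rest on the homogeneous bounds.\<close>

lemma stable_kernel_weights:
  fixes \<beta> :: real
  assumes \<beta>: "0 < \<beta>" "\<beta> < 2" and t: "0 < t"
  shows "\<exists>C\<ge>0. \<exists>e>0. e < t \<and> (\<forall>s. \<forall>z :: 'a::euclidean_space. \<bar>s - t\<bar> < e \<longrightarrow>
     \<bar>stable_kernel \<beta> s z\<bar> \<le> C * (1 + norm z) powr (- (real DIM('a) + \<beta>)) \<and>
     \<bar>stable_kernel \<beta> s z - stable_kernel \<beta> t z\<bar> \<le> \<bar>s - t\<bar> * (C * (1 + norm z) powr (- (real DIM('a) + \<beta>))) \<and>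
     \<bar>stable_kernel_dt \<beta> t z\<bar> \<le> C * (1 + norm z) powr (- (real DIM('a) + \<beta>)))"
proof -
  let ?a = "real DIM('a) + \<beta>"
  have a: "0 \<le> ?a" using \<beta> by simp
  from stable_kernel_time_lipschitz[OF \<beta>, where ?'a = 'a] obtain C \<kappa> where C: "0 \<le> C" and \<kappa>: "0 < \<kappa>" and
    "\<forall>t s. \<forall>x :: 'a. 0 < t \<longrightarrow> \<bar>s - t\<bar> \<le> \<kappa> * t \<longrightarrow> x \<noteq> 0 \<longrightarrow>
     \<bar>stable_kernel \<beta> s x - stable_kernel \<beta> t x\<bar> \<le> C * \<bar>s - t\<bar> * norm x powr (- ?a)"
    by (elim exE conjE)
  note far = this(3)[rule_format]
  from stable_kernel_time_lipschitz_near[OF \<beta>(1) t, where ?'a = 'a] obtain C' where C': "0 \<le> C'" and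
    "\<forall>s (x::'a). \<bar>s - t\<bar> < t / 2 \<longrightarrow> \<bar>stable_kernel \<beta> s x - stable_kernel \<beta> t x\<bar> \<le> C' * \<bar>s - t\<bar>"
    by (elim exE conjE)
  note near = this(2)[rule_format]
  from stable_kernel_bounds[OF \<beta>, where ?'a = 'a] obtain D where D: "0 \<le> D" and
    "\<forall>t>0. \<forall>(x::'a) (y::'a). x \<noteq> 0 \<longrightarrow> norm x / 2 \<le> norm y \<longrightarrow> norm y \<le> 2 * norm x \<longrightarrow>
     \<bar>stable_kernel \<beta> t x\<bar> \<le> D * t * norm x powr (- ?a) \<and>
     \<bar>stable_kernel \<beta> t x - stable_kernel \<beta> t y\<bar>
       \<le> D * t * (\<bar>norm x - norm y\<bar> / norm x) * norm x powr (- ?a)"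
    by (elim exE conjE)
  note bd = this(2)[rule_format]
  define e where "e = min 1 (min (t / 2) (\<kappa> * t))"
  have e: "0 < e" "e \<le> 1" "e \<le> t / 2" "e \<le> \<kappa> * t" "e < t"
  proof -
    show "0 < e" "e \<le> 1" "e \<le> \<kappa> * t" using t \<kappa> by (simp_all add: e_def)
    show "e \<le> t / 2" by (simp add: e_def)
    then show "e < t" using t by simp
  qed
  define W where "W = (C' + C) * 2 powr ?a"
  define D' where "D' = (LINT \<xi>|lborel. exp (- t * norm (\<xi>::'a) powr \<beta>)) / (2 * pi) ^ DIM('a)"
  have D': "0 \<le> D'" unfolding D'_def by (intro divide_nonneg_nonneg integral_nonneg) auto
  define V where "V = (D' + D * t) * 2 powr ?a"
  have W: "0 \<le> W" "0 \<le> V" using C C' D D' t by (auto simp: W_def V_def)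
  have diff: "\<bar>stable_kernel \<beta> s z - stable_kernel \<beta> t z\<bar> \<le> \<bar>s - t\<bar> * (W * (1 + norm z) powr (- ?a))" if s: "\<bar>s - t\<bar> < e" for s and z :: 'a
  proof -
    have "\<bar>stable_kernel \<beta> s z - stable_kernel \<beta> t z\<bar> \<le> (C' * \<bar>s - t\<bar> + C * \<bar>s - t\<bar>) * 2 powr ?a * (1 + norm z) powr (- ?a)"
      using near[of s z] far[OF t, of s z] s e C C' a by (intro le_kernel_weight) auto
    also have "\<dots> = \<bar>s - t\<bar> * (W * (1 + norm z) powr (- ?a))" by (simp add: W_def algebra_simps)
    finally show ?thesis .
  qed
  have val: "\<bar>stable_kernel \<beta> t z\<bar> \<le> V * (1 + norm z) powr (- ?a)" for z :: 'a
    unfolding V_def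
  proof (rule le_kernel_weight)
    have "\<bar>LINT \<xi>|lborel. cos (z \<bullet> \<xi>) * exp (- t * norm \<xi> powr \<beta>)\<bar> \<le> (LINT \<xi>|lborel. \<bar>cos (z \<bullet> \<xi>) * exp (- t * norm \<xi> powr \<beta>)\<bar>)"
      by (rule integral_abs_bound)
    also have "\<dots> \<le> (LINT \<xi>|lborel. exp (- t * norm (\<xi>::'a) powr \<beta>))"
      by (rule integral_mono'[OF integrable_exp_powr[OF t \<beta>(1)]]) (auto intro!: mult_left_le_one_le simp: abs_mult)
    finally show "\<bar>stable_kernel \<beta> t z\<bar> \<le> D'"
      unfolding stable_kernel_def D'_def by (simp add: abs_divide divide_right_mono)
    show "\<bar>stable_kernel \<beta> t z\<bar> \<le> D * t * norm z powr (- ?a)" if "z \<noteq> 0"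
      using bd[OF t that, of z] by auto
  qed (use D D' t a in auto)
  have dt: "\<bar>stable_kernel_dt \<beta> t z\<bar> \<le> W * (1 + norm z) powr (- ?a)" for z :: 'a
    by (rule DERIV_abs_le[OF DERIV_stable_kernel[OF \<beta>(1) t] e(1)]) (use diff in \<open>simp add: mult.commute\<close>)
  show ?thesis
  proof (rule exI[of _ "V + W"], rule conjI, use W in simp, rule exI[of _ e], intro conjI allI impI)
    fix s and z :: 'a assume s: "\<bar>s - t\<bar> < e"
    let ?w = "(1 + norm z) powr (- ?a)"
    have w: "0 \<le> ?w" by simp
    have "\<bar>s - t\<bar> * (W * ?w) \<le> 1 * (W * ?w)" using s e W w by (intro mult_right_mono) auto
    then show "\<bar>stable_kernel \<beta> s z\<bar> \<le> (V + W) * ?w"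
      using diff[OF s, of z] val[of z] by (simp add: distrib_right)
    have "\<bar>s - t\<bar> * (W * ?w) \<le> \<bar>s - t\<bar> * ((V + W) * ?w)" using W w by (intro mult_left_mono mult_right_mono) auto
    then show "\<bar>stable_kernel \<beta> s z - stable_kernel \<beta> t z\<bar> \<le> \<bar>s - t\<bar> * ((V + W) * ?w)" using diff[OF s, of z] by linarith
    have "W * ?w \<le> (V + W) * ?w" using W w by (intro mult_right_mono) auto
    then show "\<bar>stable_kernel_dt \<beta> t z\<bar> \<le> (V + W) * ?w" using dt[of z] by linarith
  qed (use W e in auto)
qed

lemma measurable_stable_kernel [measurable]:
  fixes g :: "'b \<Rightarrow> 'a::euclidean_space"
  assumes [measurable]: "f \<in> borel_measurable M" "g \<in> borel_measurable M"
  shows "(\<lambda>p. stable_kernel \<beta> (f p) (g p)) \<in> borel_measurable M"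
  unfolding stable_kernel_def by measurable

lemma measurable_stable_kernel_dt [measurable]:
  fixes g :: "'b \<Rightarrow> 'a::euclidean_space"
  assumes [measurable]: "f \<in> borel_measurable M" "g \<in> borel_measurable M"
  shows "(\<lambda>p. stable_kernel_dt \<beta> (f p) (g p)) \<in> borel_measurable M"
  unfolding stable_kernel_dt_def by measurable

text \<open>The extension with the explicit kernel and against \<open>lborel\<close>, which gives
  joint Borel measurability in time and space.\<close>

definition stable_ext :: "real \<Rightarrow> ('a::euclidean_space \<Rightarrow> real) \<Rightarrow> real \<Rightarrow> 'a \<Rightarrow> real" where
  "stable_ext \<beta> f t x = (LINT y|lborel. f y * stable_kernel \<beta> t (x - y))"

definition stable_ext_dt :: "real \<Rightarrow> ('a::euclidean_space \<Rightarrow> real) \<Rightarrow> real \<Rightarrow> 'a \<Rightarrow> real" where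
  "stable_ext_dt \<beta> f t x = (LINT y|lborel. f y * stable_kernel_dt \<beta> t (x - y))"

text \<open>The weight decays like the kernel, so this is the natural condition for the extension to
  converge. It holds for L^p functions and is inherited by restrictions to Borel sets, as the
  splitting into near and far parts requires.\<close>

definition weight_integrable :: "real \<Rightarrow> ('a::euclidean_space \<Rightarrow> real) \<Rightarrow> bool" where
  "weight_integrable \<beta> f \<longleftrightarrow> integrable lborel (\<lambda>y. f y * (1 + norm y) powr (- (real DIM('a) + \<beta>)))"

text \<open>From 1 + |y| \<le> (1 + |x|) (1 + |x - y|): moving the centre of the weight costs a
  factor depending on \<open>x\<close> alone.\<close>

lemma kernel_weight_shift:
  fixes x y :: "'a::euclidean_space"
  assumes "0 \<le> a"
  shows "(1 + norm (x - y)) powr (- a) \<le> (1 + norm x) powr a * (1 + norm y) powr (- a)"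
proof -
  have "norm y \<le> norm x + norm (x - y)" using norm_triangle_sub[of y x] by (simp add: norm_minus_commute)
  also have "\<dots> \<le> norm x + norm (x - y) + norm x * norm (x - y)" by simp
  finally have "1 + norm y \<le> (1 + norm x) * (1 + norm (x - y))" by (simp add: algebra_simps)
  then have "(1 + norm y) powr a \<le> ((1 + norm x) * (1 + norm (x - y))) powr a" using assms by (intro powr_mono2) auto
  also have "\<dots> = (1 + norm x) powr a * (1 + norm (x - y)) powr a" by (rule powr_mult)
  finally have "(1 + norm y) powr a \<le> (1 + norm x) powr a * (1 + norm (x - y)) powr a" .
  moreover have "0 < (1 + norm y) powr a" "0 < (1 + norm (x - y)) powr a" by (auto simp: add_nonneg_eq_0_iff)
  ultimately show ?thesis by (simp add: powr_minus_divide divide_simps mult.commute)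
qed

lemma integrable_weight_shift:
  fixes f :: "'a::euclidean_space \<Rightarrow> real"
  assumes f: "weight_integrable \<beta> f" and [measurable]: "f \<in> borel_measurable borel" and \<beta>: "0 < \<beta>"
  shows "integrable lborel (\<lambda>y. \<bar>f y\<bar> * (1 + norm (x - y)) powr (- (real DIM('a) + \<beta>)))"
proof (rule Bochner_Integration.integrable_bound)
  let ?a = "real DIM('a) + \<beta>"
  show "integrable lborel (\<lambda>y. (1 + norm x) powr ?a * \<bar>f y * (1 + norm y) powr (- ?a)\<bar>)"
    using f unfolding weight_integrable_def by (intro integrable_mult_right integrable_abs)
  show "AE y in lborel. norm (\<bar>f y\<bar> * (1 + norm (x - y)) powr (- ?a)) \<le> norm ((1 + norm x) powr ?a * \<bar>f y * (1 + norm y) powr (- ?a)\<bar>)"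
  proof (intro AE_I2)
    fix y
    have "\<bar>f y\<bar> * (1 + norm (x - y)) powr (- ?a) \<le> \<bar>f y\<bar> * ((1 + norm x) powr ?a * (1 + norm y) powr (- ?a))"
      using \<beta> by (intro mult_left_mono kernel_weight_shift) auto
    then show "norm (\<bar>f y\<bar> * (1 + norm (x - y)) powr (- ?a)) \<le> norm ((1 + norm x) powr ?a * \<bar>f y * (1 + norm y) powr (- ?a)\<bar>)"
      by (simp add: abs_mult mult_ac)
  qed
qed measurable

lemma stable_ext_facts:
  fixes f :: "'a::euclidean_space \<Rightarrow> real"
  assumes f: "weight_integrable \<beta> f" and [measurable]: "f \<in> borel_measurable borel"
    and \<beta>: "0 < \<beta>" "\<beta> < 2" and t: "0 < t"
  shows integrable_stable_ext: "integrable lborel (\<lambda>y. f y * stable_kernel \<beta> t (x - y))"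
    and integrable_stable_ext_dt: "integrable lborel (\<lambda>y. f y * stable_kernel_dt \<beta> t (x - y))"
    and DERIV_stable_ext: "((\<lambda>s. stable_ext \<beta> f s x) has_real_derivative stable_ext_dt \<beta> f t x) (at t)"
proof -
  let ?a = "real DIM('a) + \<beta>"
  from stable_kernel_weights[OF \<beta> t, where ?'a = 'a] obtain C e where C: "0 \<le> C" and e: "0 < e" "e < t" and
    "\<forall>s. \<forall>z :: 'a. \<bar>s - t\<bar> < e \<longrightarrow>
     \<bar>stable_kernel \<beta> s z\<bar> \<le> C * (1 + norm z) powr (- ?a) \<and>
     \<bar>stable_kernel \<beta> s z - stable_kernel \<beta> t z\<bar> \<le> \<bar>s - t\<bar> * (C * (1 + norm z) powr (- ?a)) \<and>
     \<bar>stable_kernel_dt \<beta> t z\<bar> \<le> C * (1 + norm z) powr (- ?a)"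
    by (elim exE conjE)
  note K = this(4)[rule_format]
  have w: "integrable lborel (\<lambda>y. C * (\<bar>f y\<bar> * (1 + norm (x - y)) powr (- ?a)))"
    by (intro integrable_mult_right integrable_weight_shift f \<beta>) simp
  have int: "integrable lborel (\<lambda>y. f y * g y)" if [measurable]: "g \<in> borel_measurable borel" and g: "\<And>y. \<bar>g y\<bar> \<le> C * (1 + norm (x - y)) powr (- ?a)" for g
  proof (rule Bochner_Integration.integrable_bound[OF w])
    show "AE y in lborel. norm (f y * g y) \<le> norm (C * (\<bar>f y\<bar> * (1 + norm (x - y)) powr (- ?a)))"
    proof (intro AE_I2)
      fix y
      have "\<bar>f y\<bar> * \<bar>g y\<bar> \<le> \<bar>f y\<bar> * (C * (1 + norm (x - y)) powr (- ?a))" by (intro mult_left_mono g) auto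
      then show "norm (f y * g y) \<le> norm (C * (\<bar>f y\<bar> * (1 + norm (x - y)) powr (- ?a)))"
        using C by (simp add: abs_mult mult_ac)
    qed
  qed measurable
  have ints: "integrable lborel (\<lambda>y. f y * stable_kernel \<beta> s (x - y))" if "\<bar>s - t\<bar> < e" for s
    by (rule int) (use K[OF that] in auto)
  show "integrable lborel (\<lambda>y. f y * stable_kernel \<beta> t (x - y))" using ints[of t] e by simp
  show "integrable lborel (\<lambda>y. f y * stable_kernel_dt \<beta> t (x - y))"
    by (rule int) (use K[of t] e in auto)
  show "((\<lambda>s. stable_ext \<beta> f s x) has_real_derivative stable_ext_dt \<beta> f t x) (at t)"
    unfolding stable_ext_def stable_ext_dt_def
  proof (rule has_real_derivative_integral[OF e(1) ints _ w])
    fix s y assume s: "\<bar>s - t\<bar> < e"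
    have "\<bar>f y\<bar> * \<bar>stable_kernel \<beta> s (x - y) - stable_kernel \<beta> t (x - y)\<bar> \<le> \<bar>f y\<bar> * (\<bar>s - t\<bar> * (C * (1 + norm (x - y)) powr (- ?a)))"
      using K[OF s, of "x - y"] by (intro mult_left_mono) auto
    then show "\<bar>f y * stable_kernel \<beta> s (x - y) - f y * stable_kernel \<beta> t (x - y)\<bar> \<le> \<bar>s - t\<bar> * (C * (\<bar>f y\<bar> * (1 + norm (x - y)) powr (- ?a)))"
      unfolding right_diff_distrib[symmetric] abs_mult by (simp only: mult_ac)
  next
    fix y
    show "((\<lambda>s. f y * stable_kernel \<beta> s (x - y)) has_real_derivative f y * stable_kernel_dt \<beta> t (x - y)) (at t)"
      by (intro DERIV_cmult DERIV_stable_kernel \<beta> t)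
  qed measurable
qed

subsection \<open>Global \<open>L\<^sup>2\<close> bounds\<close>

definition cos_kernel :: "('a::euclidean_space \<Rightarrow> real) \<Rightarrow> 'a \<Rightarrow> real" where
  "cos_kernel m z = (LINT \<xi>|lborel. cos (z \<bullet> \<xi>) * m \<xi>) / (2 * pi) ^ DIM('a)"

text \<open>The multiplication formula with the modulated symbol. Both transforms carry the same
  sign, so the multiplier acts on the transform of \<open>f\<close> at - \<xi>, that is, on the
  transform of the reflected function \<open>g\<close>.\<close>

lemma convolution_cos_kernel:
  fixes f m :: "'a::euclidean_space \<Rightarrow> real"
  assumes f: "integrable lborel f" and m: "integrable lborel m"
  shows "integrable lborel (\<lambda>\<xi>. complex_of_real (m \<xi>) * fourier (\<lambda>y. complex_of_real (f y)) (- \<xi>))"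
    and "(LINT y|lborel. f y * cos_kernel m (x - y)) =
     Re (fourier (\<lambda>\<xi>. complex_of_real (m \<xi>) * fourier (\<lambda>y. complex_of_real (f y)) (- \<xi>)) x) / (2 * pi) ^ DIM('a)"
proof -
  have [measurable]: "f \<in> borel_measurable borel" "m \<in> borel_measurable borel"
    using borel_measurable_integrable[OF f] borel_measurable_integrable[OF m] by simp_all
  let ?f = "\<lambda>y. complex_of_real (f y)" and ?m = "\<lambda>\<xi>. complex_of_real (m \<xi>)"
  have fc: "integrable lborel ?f" and mc: "integrable lborel ?m" using f m by auto
  define g where "g y = ?f (- y)" for y
  have g: "integrable lborel g"
    unfolding g_def using integrable_lborel_affine[OF fc, of "-1" 0] by simp
  have fg: "fourier g \<xi> = fourier ?f (- \<xi>)" for \<xi>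
    unfolding g_def by (rule fourier_uminus) measurable
  note [measurable] = measurable_fourier[OF g]
  show int: "integrable lborel (\<lambda>\<xi>. ?m \<xi> * fourier ?f (- \<xi>))"
    unfolding fg[symmetric]
  proof (rule Bochner_Integration.integrable_bound[OF integrable_scaleR_right[OF mc, of "LINT x|lborel. norm (g x)"]])
    show "AE \<xi> in lborel. norm (?m \<xi> * fourier g \<xi>) \<le> norm ((LINT x|lborel. norm (g x)) *\<^sub>R ?m \<xi>)"
    proof (intro AE_I2)
      fix \<xi>
      have "\<bar>m \<xi>\<bar> * norm (fourier g \<xi>) \<le> \<bar>m \<xi>\<bar> * (LINT x|lborel. norm (g x))" by (intro mult_left_mono norm_fourier_le) simp
      then show "norm (?m \<xi> * fourier g \<xi>) \<le> norm ((LINT x|lborel. norm (g x)) *\<^sub>R ?m \<xi>)"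
        by (simp add: norm_mult mult.commute)
    qed
  qed measurable
  have n: "integrable lborel (\<lambda>\<xi>. cis (x \<bullet> \<xi>) * ?m \<xi>)" by (rule integrable_cis_mult[OF mc])
  have "fourier (\<lambda>\<xi>. ?m \<xi> * fourier ?f (- \<xi>)) x = (LINT \<xi>|lborel. fourier g \<xi> * (cis (x \<bullet> \<xi>) * ?m \<xi>))"
    unfolding fourier_def[of _ x] fg by (simp only: mult_ac)
  also have "\<dots> = (LINT y|lborel. g y * fourier ?m (x + y))"
    unfolding fourier_multiplication[OF g n] fourier_cis_shift ..
  also have "\<dots> = (LINT y|lborel. ?f y * fourier ?m (x - y))"
  proof -
    note [measurable] = measurable_fourier[OF mc]
    show ?thesis unfolding g_def
      using integral_lborel_reflect[of "\<lambda>y. ?f y * fourier ?m (x - y)"] by simp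
  qed
  finally have e: "fourier (\<lambda>\<xi>. ?m \<xi> * fourier ?f (- \<xi>)) x = (LINT y|lborel. ?f y * fourier ?m (x - y))" .
  have "integrable lborel (\<lambda>y. ?f y * fourier ?m (x - y))"
  proof (rule Bochner_Integration.integrable_bound[OF integrable_scaleR_right[OF fc, of "LINT x|lborel. norm (?m x)"]])
    note [measurable] = measurable_fourier[OF mc]
    show "(\<lambda>y. ?f y * fourier ?m (x - y)) \<in> borel_measurable lborel" by measurable
    show "AE y in lborel. norm (?f y * fourier ?m (x - y)) \<le> norm ((LINT x|lborel. norm (?m x)) *\<^sub>R ?f y)"
    proof (intro AE_I2)
      fix y
      have "\<bar>f y\<bar> * norm (fourier ?m (x - y)) \<le> \<bar>f y\<bar> * (LINT x|lborel. norm (?m x))" by (intro mult_left_mono norm_fourier_le) simp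
      then show "norm (?f y * fourier ?m (x - y)) \<le> norm ((LINT x|lborel. norm (?m x)) *\<^sub>R ?f y)"
        by (simp add: norm_mult mult.commute)
    qed
  qed
  from integral_Re[OF this] have "Re (LINT y|lborel. ?f y * fourier ?m (x - y)) = (LINT y|lborel. f y * Re (fourier ?m (x - y)))"
    by simp
  then have "Re (fourier (\<lambda>\<xi>. ?m \<xi> * fourier ?f (- \<xi>)) x) = (LINT y|lborel. f y * (LINT \<xi>|lborel. cos ((x - y) \<bullet> \<xi>) * m \<xi>))"
    unfolding e by (simp only: Re_fourier_of_real[OF m])
  moreover have "(LINT y|lborel. f y * cos_kernel m (x - y)) = (LINT y|lborel. f y * (LINT \<xi>|lborel. cos ((x - y) \<bullet> \<xi>) * m \<xi>)) / (2 * pi) ^ DIM('a)"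
    unfolding cos_kernel_def times_divide_eq_right by (rule integral_divide_zero)
  ultimately show "(LINT y|lborel. f y * cos_kernel m (x - y)) = Re (fourier (\<lambda>\<xi>. ?m \<xi> * fourier ?f (- \<xi>)) x) / (2 * pi) ^ DIM('a)"
    by (simp only:)
qed

text \<open>The Plancherel inequality used from frequency to space; it consumes one of the two
  factors 1 / (2 pi)^d.\<close>

lemma nn_integral_Re_fourier_square:
  fixes H :: "'a::euclidean_space \<Rightarrow> complex"
  assumes "integrable lborel H"
  shows "(\<integral>\<^sup>+ x. ennreal ((Re (fourier H x) / (2 * pi) ^ DIM('a))\<^sup>2) \<partial>lborel)
    \<le> ennreal (1 / (2 * pi) ^ DIM('a)) * (\<integral>\<^sup>+ \<xi>. ennreal ((norm (H \<xi>))\<^sup>2) \<partial>lborel)"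
proof -
  let ?c = "(2 * pi) ^ DIM('a)"
  note [measurable] = measurable_fourier[OF assms]
  have "(\<integral>\<^sup>+ x. ennreal ((Re (fourier H x) / ?c)\<^sup>2) \<partial>lborel) \<le> (\<integral>\<^sup>+ x. ennreal (1 / ?c\<^sup>2) * ennreal ((norm (fourier H x))\<^sup>2) \<partial>lborel)"
  proof (rule nn_integral_mono)
    fix x
    have "\<bar>Re (fourier H x)\<bar>\<^sup>2 \<le> (norm (fourier H x))\<^sup>2" by (intro power_mono abs_Re_le_cmod) simp
    then have "(Re (fourier H x) / ?c)\<^sup>2 \<le> 1 / ?c\<^sup>2 * (norm (fourier H x))\<^sup>2"
      by (simp add: power_divide divide_right_mono)
    then have "ennreal ((Re (fourier H x) / ?c)\<^sup>2) \<le> ennreal (1 / ?c\<^sup>2 * (norm (fourier H x))\<^sup>2)" by (rule ennreal_leI)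
    also have "\<dots> = ennreal (1 / ?c\<^sup>2) * ennreal ((norm (fourier H x))\<^sup>2)" by (rule ennreal_mult) auto
    finally show "ennreal ((Re (fourier H x) / ?c)\<^sup>2) \<le> ennreal (1 / ?c\<^sup>2) * ennreal ((norm (fourier H x))\<^sup>2)" .
  qed
  also have "\<dots> = ennreal (1 / ?c\<^sup>2) * (\<integral>\<^sup>+ x. ennreal ((norm (fourier H x))\<^sup>2) \<partial>lborel)"
    by (rule nn_integral_cmult) measurable
  also have "\<dots> \<le> ennreal (1 / ?c\<^sup>2) * (ennreal ?c * (\<integral>\<^sup>+ \<xi>. ennreal ((norm (H \<xi>))\<^sup>2) \<partial>lborel))"
    by (intro mult_left_mono Bessel_fourier assms) simp
  also have "\<dots> = ennreal (1 / ?c) * (\<integral>\<^sup>+ \<xi>. ennreal ((norm (H \<xi>))\<^sup>2) \<partial>lborel)"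
  proof -
    have "ennreal (1 / ?c\<^sup>2) * ennreal ?c = ennreal (1 / ?c)"
      by (subst ennreal_mult[symmetric]) (auto simp: power2_eq_square)
    then show ?thesis by (simp only: mult.assoc[symmetric])
  qed
  finally show ?thesis .
qed

lemma stable_ext_eq_fourier:
  fixes f :: "'a::euclidean_space \<Rightarrow> real"
  assumes f: "integrable lborel f" and \<beta>: "0 < \<beta>" and t: "0 < t"
  defines "F \<equiv> \<lambda>\<xi>. fourier (\<lambda>y. complex_of_real (f y)) (- \<xi>)"
  shows "stable_ext \<beta> f t x = Re (fourier (\<lambda>\<xi>. complex_of_real (exp (- t * norm \<xi> powr \<beta>)) * F \<xi>) x) / (2 * pi) ^ DIM('a)"
    and "integrable lborel (\<lambda>\<xi>. complex_of_real (exp (- t * norm \<xi> powr \<beta>)) * F \<xi>)"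
    and "stable_ext_dt \<beta> f t x = Re (fourier (\<lambda>\<xi>. complex_of_real (- (norm \<xi> powr \<beta>) * exp (- t * norm \<xi> powr \<beta>)) * F \<xi>) x) / (2 * pi) ^ DIM('a)"
    and "integrable lborel (\<lambda>\<xi>. complex_of_real (- (norm \<xi> powr \<beta>) * exp (- t * norm \<xi> powr \<beta>)) * F \<xi>)"
proof -
  have 1: "integrable lborel (\<lambda>\<xi>::'a. exp (- t * norm \<xi> powr \<beta>))" by (rule integrable_exp_powr[OF t \<beta>])
  have 2: "integrable lborel (\<lambda>\<xi>::'a. - (norm \<xi> powr \<beta>) * exp (- t * norm \<xi> powr \<beta>))"
    using integrable_minus[OF integrable_powr_exp[OF t \<beta>, of \<beta>]] \<beta> by simp
  have e1: "stable_kernel \<beta> t = (cos_kernel (\<lambda>\<xi>::'a. exp (- t * norm \<xi> powr \<beta>)))"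
    by (simp add: fun_eq_iff stable_kernel_def cos_kernel_def)
  have e2: "stable_kernel_dt \<beta> t = (cos_kernel (\<lambda>\<xi>::'a. - (norm \<xi> powr \<beta>) * exp (- t * norm \<xi> powr \<beta>)))"
    by (simp add: fun_eq_iff stable_kernel_dt_def cos_kernel_def)
  show "stable_ext \<beta> f t x = Re (fourier (\<lambda>\<xi>. complex_of_real (exp (- t * norm \<xi> powr \<beta>)) * F \<xi>) x) / (2 * pi) ^ DIM('a)"
    unfolding stable_ext_def e1 F_def by (rule convolution_cos_kernel(2)[OF f 1])
  show "integrable lborel (\<lambda>\<xi>. complex_of_real (exp (- t * norm \<xi> powr \<beta>)) * F \<xi>)"
    unfolding F_def by (rule convolution_cos_kernel(1)[OF f 1])
  show "stable_ext_dt \<beta> f t x = Re (fourier (\<lambda>\<xi>. complex_of_real (- (norm \<xi> powr \<beta>) * exp (- t * norm \<xi> powr \<beta>)) * F \<xi>) x) / (2 * pi) ^ DIM('a)"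
    unfolding stable_ext_dt_def e2 F_def by (rule convolution_cos_kernel(2)[OF f 2])
  show "integrable lborel (\<lambda>\<xi>. complex_of_real (- (norm \<xi> powr \<beta>) * exp (- t * norm \<xi> powr \<beta>)) * F \<xi>)"
    unfolding F_def by (rule convolution_cos_kernel(1)[OF f 2])
qed

text \<open>The value does not depend on \<open>A\<close>: with A = |\<xi>| powr \<beta> every
  frequency receives the same total weight, which is why the square functions are bounded on L^2.
  The antiderivative comes from integration by parts.\<close>

lemma nn_integral_t_exp:
  fixes A :: real
  assumes "0 < A"
  shows "(\<integral>\<^sup>+ t. ennreal (t * A\<^sup>2 * exp (- 2 * t * A)) * indicator {0..} t \<partial>lborel) = ennreal (1 / 4)"
proof -
  have "(\<integral>\<^sup>+ t. ennreal (t * A\<^sup>2 * exp (- 2 * t * A)) * indicator {0..} t \<partial>lborel) = 0 - (- (0 * A / 2 + 1 / 4) * exp (- 2 * 0 * A))"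
  proof (rule nn_integral_FTC_atLeast)
    show "((\<lambda>t. - (t * A / 2 + 1 / 4) * exp (- 2 * t * A)) has_real_derivative t * A\<^sup>2 * exp (- 2 * t * A)) (at t)" for t
      by (auto intro!: derivative_eq_intros simp: algebra_simps power2_eq_square diff_divide_distrib)
    show "((\<lambda>t. - (t * A / 2 + 1 / 4) * exp (- 2 * t * A)) \<longlongrightarrow> 0) at_top" using assms by real_asymp
  qed auto
  then show ?thesis by simp
qed

lemma nn_integral_fourier_ext_square:
  fixes f :: "'a::euclidean_space \<Rightarrow> real"
  assumes f: "integrable lborel f"
  shows "ennreal (1 / (2 * pi) ^ DIM('a)) * (\<integral>\<^sup>+ \<xi>. ennreal ((norm (fourier (\<lambda>y. complex_of_real (f y)) (- \<xi>)))\<^sup>2) \<partial>lborel)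
     \<le> (\<integral>\<^sup>+ y. ennreal ((f y)\<^sup>2) \<partial>lborel)"
proof -
  let ?f = "\<lambda>y. complex_of_real (f y)"
  have fc: "integrable lborel ?f" using f by simp
  note [measurable] = measurable_fourier[OF fc]
  have "(\<integral>\<^sup>+ \<xi>. ennreal ((norm (fourier ?f (- \<xi>)))\<^sup>2) \<partial>lborel) = (\<integral>\<^sup>+ \<xi>. ennreal ((norm (fourier ?f \<xi>))\<^sup>2) \<partial>lborel)"
    using nn_integral_lborel_affine[of "\<lambda>\<xi>. ennreal ((norm (fourier ?f \<xi>))\<^sup>2)" "-1" 0] by simp
  also have "\<dots> \<le> ennreal ((2 * pi) ^ DIM('a)) * (\<integral>\<^sup>+ y. ennreal ((norm (?f y))\<^sup>2) \<partial>lborel)"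
    by (rule Bessel_fourier[OF fc])
  finally have "ennreal (1 / (2 * pi) ^ DIM('a)) * (\<integral>\<^sup>+ \<xi>. ennreal ((norm (fourier ?f (- \<xi>)))\<^sup>2) \<partial>lborel)
     \<le> ennreal (1 / (2 * pi) ^ DIM('a)) * (ennreal ((2 * pi) ^ DIM('a)) * (\<integral>\<^sup>+ y. ennreal ((f y)\<^sup>2) \<partial>lborel))"
    by (intro mult_left_mono) simp_all
  also have "\<dots> = (\<integral>\<^sup>+ y. ennreal ((f y)\<^sup>2) \<partial>lborel)"
  proof -
    have "ennreal (1 / (2 * pi) ^ DIM('a)) * ennreal ((2 * pi) ^ DIM('a)) = 1"
      by (subst ennreal_mult[symmetric]) auto
    then show ?thesis by (simp only: mult.assoc[symmetric] mult_1)
  qed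
  finally show ?thesis .
qed

text \<open>The common end of the vertical and the horizontal estimate: Tonelli, then at most 1 / 4
  from the time integral at each frequency, then the Plancherel inequality for
  \<open>f\<close>.\<close>

lemma nn_integral_time_fourier_bound:
  fixes f :: "'a::euclidean_space \<Rightarrow> real"
  assumes f: "integrable lborel f"
  shows "(\<integral>\<^sup>+ t. ennreal (1 / (2 * pi) ^ DIM('a)) * (\<integral>\<^sup>+ \<xi>. ennreal ((norm (fourier (\<lambda>y. complex_of_real (f y)) (- \<xi>)))\<^sup>2) *
      (ennreal (t * (norm \<xi> powr \<beta>)\<^sup>2 * exp (- 2 * t * norm \<xi> powr \<beta>)) * indicator {0..} t) \<partial>lborel) \<partial>lborel)
    \<le> ennreal (1 / 4) * (\<integral>\<^sup>+ y. ennreal ((f y)\<^sup>2) \<partial>lborel)"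
proof -
  have [measurable]: "f \<in> borel_measurable borel" using borel_measurable_integrable[OF f] by simp
  define F where "F \<xi> = fourier (\<lambda>y. complex_of_real (f y)) (- \<xi>)" for \<xi>
  have "integrable lborel (\<lambda>y. complex_of_real (f y))" using f by simp
  note [measurable] = measurable_fourier[OF this]
  have [measurable]: "F \<in> borel_measurable borel" unfolding F_def by measurable
  let ?c = "(2 * pi) ^ DIM('a)"
  let ?A = "\<lambda>\<xi>::'a. norm \<xi> powr \<beta>"
  have "(\<integral>\<^sup>+ t. ennreal (1 / ?c) * (\<integral>\<^sup>+ \<xi>. ennreal ((norm (F \<xi>))\<^sup>2) * (ennreal (t * (?A \<xi>)\<^sup>2 * exp (- 2 * t * ?A \<xi>)) * indicator {0..} t) \<partial>lborel) \<partial>lborel)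
    = ennreal (1 / ?c) * (\<integral>\<^sup>+ t. \<integral>\<^sup>+ \<xi>. ennreal ((norm (F \<xi>))\<^sup>2) * (ennreal (t * (?A \<xi>)\<^sup>2 * exp (- 2 * t * ?A \<xi>)) * indicator {0..} t) \<partial>lborel \<partial>lborel)"
    by (rule nn_integral_cmult) measurable
  also have "\<dots> = ennreal (1 / ?c) * (\<integral>\<^sup>+ \<xi>. \<integral>\<^sup>+ t. ennreal ((norm (F \<xi>))\<^sup>2) * (ennreal (t * (?A \<xi>)\<^sup>2 * exp (- 2 * t * ?A \<xi>)) * indicator {0..} t) \<partial>lborel \<partial>lborel)"
    by (subst lborel_pair.Fubini') simp_all
  also have "\<dots> \<le> ennreal (1 / ?c) * (\<integral>\<^sup>+ \<xi>. ennreal ((norm (F \<xi>))\<^sup>2) * ennreal (1 / 4) \<partial>lborel)"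
  proof (intro mult_left_mono nn_integral_mono)
    fix \<xi> :: 'a
    have "(\<integral>\<^sup>+ t. ennreal (t * (?A \<xi>)\<^sup>2 * exp (- 2 * t * ?A \<xi>)) * indicator {0..} t \<partial>lborel) \<le> ennreal (1 / 4)"
    proof (cases "\<xi> = 0")
      case False
      then have "0 < ?A \<xi>" by simp
      from nn_integral_t_exp[OF this] show ?thesis by simp
    qed simp
    then show "(\<integral>\<^sup>+ t. ennreal ((norm (F \<xi>))\<^sup>2) * (ennreal (t * (?A \<xi>)\<^sup>2 * exp (- 2 * t * ?A \<xi>)) * indicator {0..} t) \<partial>lborel)
      \<le> ennreal ((norm (F \<xi>))\<^sup>2) * ennreal (1 / 4)"
      by (subst nn_integral_cmult) (auto intro: mult_left_mono)
  qed simp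
  also have "\<dots> = ennreal (1 / 4) * (ennreal (1 / ?c) * (\<integral>\<^sup>+ \<xi>. ennreal ((norm (F \<xi>))\<^sup>2) \<partial>lborel))"
    by (subst nn_integral_multc) (auto simp: mult_ac)
  also have "\<dots> \<le> ennreal (1 / 4) * (\<integral>\<^sup>+ y. ennreal ((f y)\<^sup>2) \<partial>lborel)"
    unfolding F_def by (intro mult_left_mono nn_integral_fourier_ext_square f) simp
  finally show ?thesis by (simp only: F_def)
qed

section \<open>Energy of the time derivative\<close>

lemma vertical_L2_bound:
  fixes f :: "'a::euclidean_space \<Rightarrow> real"
  assumes f: "integrable lborel f" and \<beta>: "0 < \<beta>"
  shows "(\<integral>\<^sup>+ t. \<integral>\<^sup>+ x. ennreal t * ennreal ((stable_ext_dt \<beta> f t x)\<^sup>2) * indicator {0<..} t \<partial>lborel \<partial>lborel)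
    \<le> ennreal (1 / 4) * (\<integral>\<^sup>+ y. ennreal ((f y)\<^sup>2) \<partial>lborel)"
proof -
  have [measurable]: "f \<in> borel_measurable borel" using borel_measurable_integrable[OF f] by simp
  define F where "F \<xi> = fourier (\<lambda>y. complex_of_real (f y)) (- \<xi>)" for \<xi>
  have "integrable lborel (\<lambda>y. complex_of_real (f y))" using f by simp
  note [measurable] = measurable_fourier[OF this]
  have [measurable]: "F \<in> borel_measurable borel" unfolding F_def by measurable
  let ?c = "(2 * pi) ^ DIM('a)"
  let ?A = "\<lambda>\<xi>::'a. norm \<xi> powr \<beta>"
  have one: "(\<integral>\<^sup>+ x. ennreal t * ennreal ((stable_ext_dt \<beta> f t x)\<^sup>2) * indicator {0<..} t \<partial>lborel)
     \<le> ennreal (1 / ?c) * (\<integral>\<^sup>+ \<xi>. ennreal ((norm (F \<xi>))\<^sup>2) * (ennreal (t * (?A \<xi>)\<^sup>2 * exp (- 2 * t * ?A \<xi>)) * indicator {0..} t) \<partial>lborel)" for t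
  proof (cases "0 < t")
    case True
    note E = stable_ext_eq_fourier(3,4)[OF f \<beta> True, folded F_def]
    have [measurable]: "(\<lambda>x. stable_ext_dt \<beta> f t x) \<in> borel_measurable borel" unfolding stable_ext_dt_def by measurable
    have "(\<integral>\<^sup>+ x. ennreal t * ennreal ((stable_ext_dt \<beta> f t x)\<^sup>2) * indicator {0<..} t \<partial>lborel)
      = ennreal t * (\<integral>\<^sup>+ x. ennreal ((stable_ext_dt \<beta> f t x)\<^sup>2) \<partial>lborel)"
      using True by (simp add: nn_integral_cmult)
    also have "\<dots> \<le> ennreal t * (ennreal (1 / ?c) * (\<integral>\<^sup>+ \<xi>. ennreal ((norm (complex_of_real (- ?A \<xi> * exp (- t * ?A \<xi>)) * F \<xi>))\<^sup>2) \<partial>lborel))"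
      unfolding E(1) by (intro mult_left_mono nn_integral_Re_fourier_square E(2)) simp
    also have "\<dots> = ennreal (1 / ?c) * (\<integral>\<^sup>+ \<xi>. ennreal t * ennreal ((norm (complex_of_real (- ?A \<xi> * exp (- t * ?A \<xi>)) * F \<xi>))\<^sup>2) \<partial>lborel)"
      by (simp add: nn_integral_cmult mult.left_commute)
    also have "(\<integral>\<^sup>+ \<xi>. ennreal t * ennreal ((norm (complex_of_real (- ?A \<xi> * exp (- t * ?A \<xi>)) * F \<xi>))\<^sup>2) \<partial>lborel)
      = (\<integral>\<^sup>+ \<xi>. ennreal ((norm (F \<xi>))\<^sup>2) * (ennreal (t * (?A \<xi>)\<^sup>2 * exp (- 2 * t * ?A \<xi>)) * indicator {0..} t) \<partial>lborel)"
    proof (rule nn_integral_cong)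
      fix \<xi>
      have "(norm (complex_of_real (- ?A \<xi> * exp (- t * ?A \<xi>)) * F \<xi>))\<^sup>2 = (?A \<xi>)\<^sup>2 * (exp (- t * ?A \<xi>))\<^sup>2 * (norm (F \<xi>))\<^sup>2"
        by (simp only: norm_mult norm_of_real power_mult_distrib power2_abs power2_minus)
      also have "(exp (- t * ?A \<xi>))\<^sup>2 = exp (- 2 * t * ?A \<xi>)" by (simp add: exp_double[symmetric] power2_eq_square mult_exp_exp)
      finally have "t * (norm (complex_of_real (- ?A \<xi> * exp (- t * ?A \<xi>)) * F \<xi>))\<^sup>2 = (norm (F \<xi>))\<^sup>2 * (t * (?A \<xi>)\<^sup>2 * exp (- 2 * t * ?A \<xi>))"
        by (simp only: mult_ac)
      then have "ennreal t * ennreal ((norm (complex_of_real (- ?A \<xi> * exp (- t * ?A \<xi>)) * F \<xi>))\<^sup>2) = ennreal ((norm (F \<xi>))\<^sup>2) * ennreal (t * (?A \<xi>)\<^sup>2 * exp (- 2 * t * ?A \<xi>))"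
        using True by (subst (1 2) ennreal_mult[symmetric]) auto
      then show "ennreal t * ennreal ((norm (complex_of_real (- ?A \<xi> * exp (- t * ?A \<xi>)) * F \<xi>))\<^sup>2) = ennreal ((norm (F \<xi>))\<^sup>2) * (ennreal (t * (?A \<xi>)\<^sup>2 * exp (- 2 * t * ?A \<xi>)) * indicator {0..} t)"
        using True by simp
    qed
    finally show ?thesis .
  qed simp
  have "(\<integral>\<^sup>+ t. \<integral>\<^sup>+ x. ennreal t * ennreal ((stable_ext_dt \<beta> f t x)\<^sup>2) * indicator {0<..} t \<partial>lborel \<partial>lborel)
    \<le> (\<integral>\<^sup>+ t. ennreal (1 / ?c) * (\<integral>\<^sup>+ \<xi>. ennreal ((norm (F \<xi>))\<^sup>2) * (ennreal (t * (?A \<xi>)\<^sup>2 * exp (- 2 * t * ?A \<xi>)) * indicator {0..} t) \<partial>lborel) \<partial>lborel)"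
    by (intro nn_integral_mono one)
  also have "\<dots> \<le> ennreal (1 / 4) * (\<integral>\<^sup>+ y. ennreal ((f y)\<^sup>2) \<partial>lborel)"
    unfolding F_def by (rule nn_integral_time_fourier_bound[OF f])
  finally show ?thesis .
qed

section \<open>Energy of the spatial differences\<close>

lemma nn_integral_powr_tail:
  fixes u p :: real
  assumes "0 < p" "0 < u"
  shows "(\<integral>\<^sup>+ s. ennreal (p * s powr (- p - 1)) * indicator {u..} s \<partial>lborel) = ennreal (u powr (- p))"
proof -
  have "(\<integral>\<^sup>+ s. ennreal (p * s powr (- p - 1)) * indicator {u..} s \<partial>lborel) = 0 - (- (u powr (- p)))"
  proof (rule nn_integral_FTC_atLeast)
    show "((\<lambda>s. - (s powr (- p))) \<longlongrightarrow> 0) at_top"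
      using tendsto_minus[OF tendsto_neg_powr[of "- p", OF _ filterlim_ident]] assms by simp
    show "((\<lambda>s. - (s powr (- p))) has_real_derivative p * s powr (- p - 1)) (at s)" if "u \<le> s" for s
      using that assms by (auto intro!: derivative_eq_intros)
  qed (use assms in auto)
  then show ?thesis by simp
qed

text \<open>The Levy-Khintchine integral of \<open>|\<xi>|\<^sup>\<alpha>\<close>, up to constants.\<close>

lemma nn_integral_levy_le:
  fixes \<alpha> b :: real
  assumes \<alpha>: "0 < \<alpha>" "\<alpha> < 2" and b: "0 < b"
  shows "(\<integral>\<^sup>+ h. ennreal (min 4 ((norm (h::'a::euclidean_space))\<^sup>2 * b\<^sup>2) / norm h powr (real DIM('a) + \<alpha>)) \<partial>lborel)
    \<le> ennreal ((real DIM('a) + \<alpha>) * unit_ball_vol (real DIM('a)) * (1 / (2 - \<alpha>) + 4 / \<alpha>) * b powr \<alpha>)"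
proof -
  let ?d = "real DIM('a)"
  let ?p = "?d + \<alpha>"
  let ?v = "unit_ball_vol ?d"
  have v: "0 < ?v" by (rule unit_ball_vol_DIM_pos)
  have p: "0 < ?p" using \<alpha> by simp
  let ?m = "\<lambda>s::real. min 4 (s\<^sup>2 * b\<^sup>2)"
  \<comment> \<open>Writing the power of |h| as an integral over s \<ge> |h| leaves only volumes of
    balls of radius \<open>s\<close>, in place of polar coordinates.\<close>
  have "(\<integral>\<^sup>+ h. ennreal (?m (norm (h::'a)) / norm h powr ?p) \<partial>lborel)
     \<le> (\<integral>\<^sup>+ h. \<integral>\<^sup>+ s. ennreal (?m (norm (h::'a))) * (ennreal (?p * s powr (- ?p - 1)) * (indicator {h. norm h \<le> s} h * indicator {0<..} s)) \<partial>lborel \<partial>lborel)"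
  proof (rule nn_integral_mono)
    fix h :: 'a
    show "ennreal (?m (norm h) / norm h powr ?p) \<le> (\<integral>\<^sup>+ s. ennreal (?m (norm h)) * (ennreal (?p * s powr (- ?p - 1)) * (indicator {h. norm h \<le> s} h * indicator {0<..} s)) \<partial>lborel)"
    proof (cases "h = 0")
      case False
      then have h: "0 < norm h" by simp
      have "ennreal (?m (norm h) / norm h powr ?p) = ennreal (?m (norm h)) * ennreal (norm h powr (- ?p))"
        by (subst ennreal_mult[symmetric]) (simp, simp, simp only: powr_minus_divide times_divide_eq_right mult_1_right)
      also have "\<dots> = ennreal (?m (norm h)) * (\<integral>\<^sup>+ s. ennreal (?p * s powr (- ?p - 1)) * indicator {norm h..} s \<partial>lborel)"
        by (simp only: nn_integral_powr_tail[OF p h])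
      also have "\<dots> = (\<integral>\<^sup>+ s. ennreal (?m (norm h)) * (ennreal (?p * s powr (- ?p - 1)) * indicator {norm h..} s) \<partial>lborel)"
        by (rule nn_integral_cmult[symmetric]) measurable
      also have "\<dots> \<le> (\<integral>\<^sup>+ s. ennreal (?m (norm h)) * (ennreal (?p * s powr (- ?p - 1)) * (indicator {h. norm h \<le> s} h * indicator {0<..} s)) \<partial>lborel)"
        using less_le_trans[OF h] by (intro nn_integral_mono mult_left_mono) (auto split: split_indicator)
      finally show ?thesis .
    qed simp
  qed
  also have "\<dots> = (\<integral>\<^sup>+ s. \<integral>\<^sup>+ h. ennreal (?m (norm (h::'a))) * (ennreal (?p * s powr (- ?p - 1)) * (indicator {h. norm h \<le> s} h * indicator {0<..} s)) \<partial>lborel \<partial>lborel)"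
    by (subst lborel_pair.Fubini') simp_all
  \<comment> \<open>Split at s = 1 / b: below, the quadratic bound gives s powr (1 - \<alpha>),
    integrable at 0 as \<alpha> < 2; above, the constant 4 gives s powr (- \<alpha> - 1), integrable
    at infinity as \<alpha> > 0.\<close>
  also have "\<dots> \<le> (\<integral>\<^sup>+ s. ennreal (?p * ?v * (b\<^sup>2 / (2 - \<alpha>))) * (ennreal ((2 - \<alpha>) * s powr ((2 - \<alpha>) - 1)) * indicator {s. 0 < s \<and> ennreal s < ennreal (1 / b)} s)
     + ennreal (?p * ?v * (4 / \<alpha>)) * (ennreal (\<alpha> * s powr (- \<alpha> - 1)) * indicator {1 / b..} s) \<partial>lborel)"
  proof (rule nn_integral_mono)
    fix s :: real
    let ?R = "ennreal (?p * ?v * (b\<^sup>2 / (2 - \<alpha>))) * (ennreal ((2 - \<alpha>) * s powr ((2 - \<alpha>) - 1)) * indicator {s. 0 < s \<and> ennreal s < ennreal (1 / b)} s)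
     + ennreal (?p * ?v * (4 / \<alpha>)) * (ennreal (\<alpha> * s powr (- \<alpha> - 1)) * indicator {1 / b..} s)"
    show "(\<integral>\<^sup>+ h. ennreal (?m (norm (h::'a))) * (ennreal (?p * s powr (- ?p - 1)) * (indicator {h. norm h \<le> s} h * indicator {0<..} s)) \<partial>lborel) \<le> ?R"
    proof (cases "0 < s")
      case True
      have "(\<integral>\<^sup>+ h. ennreal (?m (norm (h::'a))) * (ennreal (?p * s powr (- ?p - 1)) * (indicator {h. norm h \<le> s} h * indicator {0<..} s)) \<partial>lborel)
         \<le> (\<integral>\<^sup>+ h. (ennreal (?m s) * ennreal (?p * s powr (- ?p - 1))) * indicator (cball (0::'a) s) h \<partial>lborel)"
        using True by (intro nn_integral_mono) (auto split: split_indicator intro!: mult_right_mono ennreal_leI min.mono power_mono)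
      also have "\<dots> = (ennreal (?m s) * ennreal (?p * s powr (- ?p - 1))) * ennreal (?v * s ^ DIM('a))"
        using True by (subst nn_integral_cmult_indicator) (auto simp: emeasure_cball)
      also have "\<dots> = ennreal (?m s * (?p * s powr (- ?p - 1)) * (?v * s ^ DIM('a)))"
        using True p v by (simp add: ennreal_mult[symmetric])
      also have "?m s * (?p * s powr (- ?p - 1)) * (?v * s ^ DIM('a)) = ?p * ?v * (?m s * s powr (- \<alpha> - 1))"
      proof -
        have "s powr (- \<alpha> - 1) = s powr (- ?p - 1) * s powr ?d"
        proof -
          have "- \<alpha> - 1 = (- ?p - 1) + ?d" by simp
          then show ?thesis by (simp only: powr_add)
        qed
        also have "s powr ?d = s ^ DIM('a)" using True by (rule powr_realpow)
        finally show ?thesis by simp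
      qed
      also have "ennreal (?p * ?v * (?m s * s powr (- \<alpha> - 1))) \<le> ?R"
      proof (cases "s < 1 / b")
        case lt: True
        have "?m s * s powr (- \<alpha> - 1) \<le> s\<^sup>2 * b\<^sup>2 * s powr (- \<alpha> - 1)" by (intro mult_right_mono) auto
        also have "s\<^sup>2 * b\<^sup>2 * s powr (- \<alpha> - 1) = b\<^sup>2 * s powr ((2 - \<alpha>) - 1)"
        proof -
          have "s powr ((2 - \<alpha>) - 1) = s powr 2 * s powr (- \<alpha> - 1)"
            by (subst powr_add[symmetric]) simp
          then show ?thesis using True by simp
        qed
        finally have "?p * ?v * (?m s * s powr (- \<alpha> - 1)) \<le> ?p * ?v * (b\<^sup>2 * s powr ((2 - \<alpha>) - 1))"
          using p v by (intro mult_left_mono) auto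
        also have "\<dots> = (?p * ?v * (b\<^sup>2 / (2 - \<alpha>))) * ((2 - \<alpha>) * s powr ((2 - \<alpha>) - 1))"
          using \<alpha> by simp
        finally have "ennreal (?p * ?v * (?m s * s powr (- \<alpha> - 1))) \<le> ennreal ((?p * ?v * (b\<^sup>2 / (2 - \<alpha>))) * ((2 - \<alpha>) * s powr ((2 - \<alpha>) - 1)))"
          by (rule ennreal_leI)
        also have "\<dots> = ennreal (?p * ?v * (b\<^sup>2 / (2 - \<alpha>))) * ennreal ((2 - \<alpha>) * s powr ((2 - \<alpha>) - 1))"
          using p v \<alpha> by (intro ennreal_mult) auto
        also have "\<dots> \<le> ?R" using True lt by (simp add: ennreal_less_iff)
        finally show ?thesis .
      next
        case ge: False
        have "?m s * s powr (- \<alpha> - 1) \<le> 4 * s powr (- \<alpha> - 1)" by (intro mult_right_mono) auto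
        then have "?p * ?v * (?m s * s powr (- \<alpha> - 1)) \<le> ?p * ?v * (4 * s powr (- \<alpha> - 1))"
          using p v by (intro mult_left_mono) auto
        also have "\<dots> = (?p * ?v * (4 / \<alpha>)) * (\<alpha> * s powr (- \<alpha> - 1))"
          using \<alpha> by simp
        finally have "ennreal (?p * ?v * (?m s * s powr (- \<alpha> - 1))) \<le> ennreal ((?p * ?v * (4 / \<alpha>)) * (\<alpha> * s powr (- \<alpha> - 1)))"
          by (rule ennreal_leI)
        also have "\<dots> = ennreal (?p * ?v * (4 / \<alpha>)) * ennreal (\<alpha> * s powr (- \<alpha> - 1))"
          using p v \<alpha> by (intro ennreal_mult) auto
        also have "\<dots> \<le> ?R" using ge by simp
        finally show ?thesis .
      qed
      finally show ?thesis .
    qed simp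
  qed
  also have "\<dots> = ennreal (?p * ?v * (b\<^sup>2 / (2 - \<alpha>))) * ennreal_pow (ennreal (1 / b)) (2 - \<alpha>) + ennreal (?p * ?v * (4 / \<alpha>)) * ennreal ((1 / b) powr (- \<alpha>))"
  proof -
    have *: "(\<integral>\<^sup>+ s. ennreal ((2 - \<alpha>) * s powr ((2 - \<alpha>) - 1)) * indicator {s. 0 < s \<and> ennreal s < ennreal (1 / b)} s \<partial>lborel) = ennreal_pow (ennreal (1 / b)) (2 - \<alpha>)"
      by (rule layer_cake_pow) (use \<alpha> in simp)
    have **: "(\<integral>\<^sup>+ s. ennreal (\<alpha> * s powr (- \<alpha> - 1)) * indicator {1 / b..} s \<partial>lborel) = ennreal ((1 / b) powr (- \<alpha>))"
      by (rule nn_integral_powr_tail) (use \<alpha> b in auto)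
    show ?thesis unfolding *[symmetric] **[symmetric]
      by (subst nn_integral_add) (auto simp: nn_integral_cmult)
  qed
  also have "\<dots> = ennreal (?p * ?v * (1 / (2 - \<alpha>) + 4 / \<alpha>) * b powr \<alpha>)"
  proof -
    have 1: "(1 / b) powr (2 - \<alpha>) = b powr \<alpha> / b\<^sup>2"
      using b by (simp add: powr_divide powr_diff field_simps)
    have 2: "(1 / b) powr (- \<alpha>) = b powr \<alpha>"
      using b by (simp add: powr_divide powr_minus_divide)
    have "ennreal (?p * ?v * (b\<^sup>2 / (2 - \<alpha>))) * ennreal_pow (ennreal (1 / b)) (2 - \<alpha>) = ennreal (?p * ?v * (1 / (2 - \<alpha>)) * b powr \<alpha>)"
      using b p v \<alpha> by (simp add: ennreal_pow_ennreal 1 ennreal_mult[symmetric])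
    moreover have "ennreal (?p * ?v * (4 / \<alpha>)) * ennreal ((1 / b) powr (- \<alpha>)) = ennreal (?p * ?v * (4 / \<alpha>) * b powr \<alpha>)"
      unfolding 2 using p v \<alpha> by (subst ennreal_mult) auto
    ultimately show ?thesis
      using p v \<alpha> by (simp add: ennreal_plus[symmetric] algebra_simps del: ennreal_plus)
  qed
  finally show ?thesis .
qed

text \<open>The modulus is 2 |sin (\<theta> / 2)| for \<theta> = h \<bullet> \<xi>, hence at most 2
  and at most |\<theta>|.\<close>

lemma norm_cis_minus_one_square_le:
  fixes h \<xi> :: "'a::euclidean_space"
  shows "(norm (cis (h \<bullet> \<xi>) - 1))\<^sup>2 \<le> min 4 ((norm h)\<^sup>2 * (norm \<xi>)\<^sup>2)"
proof -
  let ?\<theta> = "h \<bullet> \<xi>"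
  have "norm (cis ?\<theta> - 1) \<le> 2" using norm_triangle_ineq4[of "cis ?\<theta>" 1] by simp
  then have 4: "(norm (cis ?\<theta> - 1))\<^sup>2 \<le> 2\<^sup>2" by (intro power_mono) auto
  have "(norm (cis ?\<theta> - 1))\<^sup>2 = (cos ?\<theta> - 1)\<^sup>2 + (sin ?\<theta>)\<^sup>2" by (simp add: cmod_power2)
  then have "(norm (cis ?\<theta> - 1))\<^sup>2 = 2 - 2 * cos ?\<theta>" using sin_cos_squared_add[of ?\<theta>] by (simp add: power2_eq_square algebra_simps)
  then have "(norm (cis ?\<theta> - 1))\<^sup>2 = (2 * sin (?\<theta> / 2))\<^sup>2" using cos_double_sin[of "?\<theta> / 2"] by (simp add: power_mult_distrib)
  also have "\<dots> \<le> \<bar>?\<theta>\<bar>\<^sup>2" using abs_sin_x_le_abs_x[of "?\<theta> / 2"] by (subst power2_abs[symmetric], intro power_mono) (auto simp: abs_mult)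
  also have "\<dots> \<le> (norm h * norm \<xi>)\<^sup>2" by (intro power_mono Cauchy_Schwarz_ineq2) auto
  finally have "(norm (cis ?\<theta> - 1))\<^sup>2 \<le> (norm h)\<^sup>2 * (norm \<xi>)\<^sup>2" by (simp add: power_mult_distrib)
  then show ?thesis using 4 by simp
qed

lemma measurable_stable_ext [measurable]:
  fixes g :: "'b \<Rightarrow> 'a::euclidean_space"
  assumes [measurable]: "F \<in> borel_measurable borel" "f \<in> borel_measurable M" "g \<in> borel_measurable M"
  shows "(\<lambda>p. stable_ext \<beta> F (f p) (g p)) \<in> borel_measurable M"
  unfolding stable_ext_def by measurable

lemma measurable_stable_ext_dt [measurable]:
  fixes g :: "'b \<Rightarrow> 'a::euclidean_space"
  assumes [measurable]: "F \<in> borel_measurable borel" "f \<in> borel_measurable M" "g \<in> borel_measurable M"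
  shows "(\<lambda>p. stable_ext_dt \<beta> F (f p) (g p)) \<in> borel_measurable M"
  unfolding stable_ext_dt_def by measurable

lemma horizontal_L2_bound:
  fixes f :: "'a::euclidean_space \<Rightarrow> real"
  assumes f: "integrable lborel f" and \<alpha>: "0 < \<alpha>" "\<alpha> < 2"
  defines "C \<equiv> (real DIM('a) + \<alpha>) * unit_ball_vol (real DIM('a)) * (1 / (2 - \<alpha>) + 4 / \<alpha>)"
  shows "(\<integral>\<^sup>+ t. \<integral>\<^sup>+ x. ennreal t * Gamma_form \<alpha> t (stable_ext (\<alpha> / 2) f t) x * indicator {0<..} t \<partial>lborel \<partial>lborel)
    \<le> ennreal C * (ennreal (1 / 4) * (\<integral>\<^sup>+ y. ennreal ((f y)\<^sup>2) \<partial>lborel))"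
proof -
  let ?\<beta> = "\<alpha> / 2"
  have \<beta>: "0 < ?\<beta>" using \<alpha> by simp
  have C: "0 \<le> C" unfolding C_def using \<alpha> unit_ball_vol_DIM_pos[where ?'a = 'a] by simp
  have [measurable]: "f \<in> borel_measurable borel" using borel_measurable_integrable[OF f] by simp
  define F where "F \<xi> = fourier (\<lambda>y. complex_of_real (f y)) (- \<xi>)" for \<xi>
  have "integrable lborel (\<lambda>y. complex_of_real (f y))" using f by simp
  note [measurable] = measurable_fourier[OF this]
  have [measurable]: "F \<in> borel_measurable borel" unfolding F_def by measurable
  let ?c = "(2 * pi) ^ DIM('a)"
  let ?A = "\<lambda>\<xi>::'a. norm \<xi> powr ?\<beta>"
  let ?p = "real DIM('a) + \<alpha>"
  have one: "(\<integral>\<^sup>+ x. ennreal t * Gamma_form \<alpha> t (stable_ext ?\<beta> f t) x * indicator {0<..} t \<partial>lborel)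
     \<le> ennreal C * (ennreal (1 / ?c) * (\<integral>\<^sup>+ \<xi>. ennreal ((norm (F \<xi>))\<^sup>2) * (ennreal (t * (?A \<xi>)\<^sup>2 * exp (- 2 * t * ?A \<xi>)) * indicator {0..} t) \<partial>lborel))" for t
  proof (cases "0 < t")
    case True
    define u where "u = stable_ext ?\<beta> f t"
    have [measurable]: "u \<in> borel_measurable borel" unfolding u_def by measurable
    define H where "H \<xi> = complex_of_real (exp (- t * ?A \<xi>)) * F \<xi>" for \<xi>
    have H: "integrable lborel H" and uH: "u x = Re (fourier H x) / ?c" for x
      using stable_ext_eq_fourier(1,2)[OF f \<beta> True, folded F_def] by (auto simp: u_def H_def[abs_def])
    have diff: "(\<integral>\<^sup>+ x. ennreal ((u (x + h) - u x)\<^sup>2) \<partial>lborel)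
       \<le> ennreal (1 / ?c) * (\<integral>\<^sup>+ \<xi>. ennreal (min 4 ((norm h)\<^sup>2 * (norm \<xi>)\<^sup>2)) * ennreal ((norm (F \<xi>))\<^sup>2 * exp (- 2 * t * ?A \<xi>)) \<partial>lborel)" for h
    proof -
      have Hh: "integrable lborel (\<lambda>\<xi>. cis (h \<bullet> \<xi>) * H \<xi>)" by (rule integrable_cis_mult[OF H])
      have D: "integrable lborel (\<lambda>\<xi>. cis (h \<bullet> \<xi>) * H \<xi> - H \<xi>)" by (rule Bochner_Integration.integrable_diff[OF Hh H])
      have "fourier (\<lambda>\<xi>. cis (h \<bullet> \<xi>) * H \<xi> - H \<xi>) x = fourier (\<lambda>\<xi>. cis (h \<bullet> \<xi>) * H \<xi>) x - fourier H x" for x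
        unfolding fourier_def right_diff_distrib
        by (rule Bochner_Integration.integral_diff[OF integrable_cis_mult[OF Hh] integrable_cis_mult[OF H]])
      then have "fourier (\<lambda>\<xi>. cis (h \<bullet> \<xi>) * H \<xi> - H \<xi>) x = fourier H (x + h) - fourier H x" for x
        unfolding fourier_cis_shift by (simp add: add.commute)
      then have "u (x + h) - u x = Re (fourier (\<lambda>\<xi>. cis (h \<bullet> \<xi>) * H \<xi> - H \<xi>) x) / ?c" for x
        unfolding uH by (simp add: diff_divide_distrib)
      then have "(\<integral>\<^sup>+ x. ennreal ((u (x + h) - u x)\<^sup>2) \<partial>lborel)
         \<le> ennreal (1 / ?c) * (\<integral>\<^sup>+ \<xi>. ennreal ((norm (cis (h \<bullet> \<xi>) * H \<xi> - H \<xi>))\<^sup>2) \<partial>lborel)"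
        using nn_integral_Re_fourier_square[OF D] by simp
      also have "\<dots> \<le> ennreal (1 / ?c) * (\<integral>\<^sup>+ \<xi>. ennreal (min 4 ((norm h)\<^sup>2 * (norm \<xi>)\<^sup>2)) * ennreal ((norm (F \<xi>))\<^sup>2 * exp (- 2 * t * ?A \<xi>)) \<partial>lborel)"
      proof (intro mult_left_mono nn_integral_mono)
        fix \<xi>
        have "cis (h \<bullet> \<xi>) * H \<xi> - H \<xi> = (cis (h \<bullet> \<xi>) - 1) * H \<xi>" by (simp add: algebra_simps)
        then have "(norm (cis (h \<bullet> \<xi>) * H \<xi> - H \<xi>))\<^sup>2 = (norm (cis (h \<bullet> \<xi>) - 1))\<^sup>2 * ((exp (- t * ?A \<xi>))\<^sup>2 * (norm (F \<xi>))\<^sup>2)"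
          by (simp only: H_def norm_mult norm_of_real power_mult_distrib power2_abs)
        also have "(exp (- t * ?A \<xi>))\<^sup>2 = exp (- 2 * t * ?A \<xi>)" by (simp add: power2_eq_square mult_exp_exp)
        also have "(norm (cis (h \<bullet> \<xi>) - 1))\<^sup>2 * (exp (- 2 * t * ?A \<xi>) * (norm (F \<xi>))\<^sup>2) \<le> min 4 ((norm h)\<^sup>2 * (norm \<xi>)\<^sup>2) * (exp (- 2 * t * ?A \<xi>) * (norm (F \<xi>))\<^sup>2)"
          by (intro mult_right_mono norm_cis_minus_one_square_le) auto
        finally have "ennreal ((norm (cis (h \<bullet> \<xi>) * H \<xi> - H \<xi>))\<^sup>2) \<le> ennreal (min 4 ((norm h)\<^sup>2 * (norm \<xi>)\<^sup>2) * ((norm (F \<xi>))\<^sup>2 * exp (- 2 * t * ?A \<xi>)))"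
          by (intro ennreal_leI) (simp add: mult.commute)
        also have "\<dots> = ennreal (min 4 ((norm h)\<^sup>2 * (norm \<xi>)\<^sup>2)) * ennreal ((norm (F \<xi>))\<^sup>2 * exp (- 2 * t * ?A \<xi>))"
          by (intro ennreal_mult) auto
        finally show "ennreal ((norm (cis (h \<bullet> \<xi>) * H \<xi> - H \<xi>))\<^sup>2) \<le> \<dots>" .
      qed simp
      finally show ?thesis .
    qed
    have levy: "(\<integral>\<^sup>+ h. ennreal (1 / norm (h::'a) powr ?p) * ennreal (min 4 ((norm h)\<^sup>2 * (norm \<xi>)\<^sup>2)) \<partial>lborel) \<le> ennreal (C * (?A \<xi>)\<^sup>2)" for \<xi> :: 'a
    proof (cases "\<xi> = 0")
      case False
      have "(\<integral>\<^sup>+ h. ennreal (1 / norm (h::'a) powr ?p) * ennreal (min 4 ((norm h)\<^sup>2 * (norm \<xi>)\<^sup>2)) \<partial>lborel)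
        = (\<integral>\<^sup>+ h. ennreal (min 4 ((norm (h::'a))\<^sup>2 * (norm \<xi>)\<^sup>2) / norm h powr ?p) \<partial>lborel)"
        by (intro nn_integral_cong) (simp add: ennreal_mult[symmetric])
      also have "\<dots> \<le> ennreal (C * norm \<xi> powr \<alpha>)" unfolding C_def using False by (intro nn_integral_levy_le \<alpha>) simp
      also have "norm \<xi> powr \<alpha> = (?A \<xi>)\<^sup>2" by (simp add: power2_eq_square powr_add[symmetric])
      finally show ?thesis .
    qed simp
    have "(\<integral>\<^sup>+ x. ennreal t * Gamma_form \<alpha> t u x * indicator {0<..} t \<partial>lborel)
       \<le> (\<integral>\<^sup>+ x. ennreal t * (\<integral>\<^sup>+ h. ennreal (1 / norm h powr ?p) * ennreal ((u (x + h) - u x)\<^sup>2) \<partial>lborel) \<partial>lborel)"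
    proof (rule nn_integral_mono)
      fix x
      have "Gamma_form \<alpha> t u x \<le> (\<integral>\<^sup>+ h. ennreal (1 / norm h powr ?p) * ennreal ((u (x + h) - u x)\<^sup>2) \<partial>lborel)"
        unfolding Gamma_form_def
        by (intro nn_integral_mono) (auto split: split_indicator simp: ennreal_mult[symmetric])
      then show "ennreal t * Gamma_form \<alpha> t u x * indicator {0<..} t \<le> ennreal t * (\<integral>\<^sup>+ h. ennreal (1 / norm h powr ?p) * ennreal ((u (x + h) - u x)\<^sup>2) \<partial>lborel)"
        using True by (simp add: mult_left_mono)
    qed
    also have "\<dots> = ennreal t * (\<integral>\<^sup>+ x. \<integral>\<^sup>+ h. ennreal (1 / norm h powr ?p) * ennreal ((u (x + h) - u x)\<^sup>2) \<partial>lborel \<partial>lborel)"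
      by (rule nn_integral_cmult) measurable
    also have "(\<integral>\<^sup>+ x. \<integral>\<^sup>+ h. ennreal (1 / norm h powr ?p) * ennreal ((u (x + h) - u x)\<^sup>2) \<partial>lborel \<partial>lborel)
       = (\<integral>\<^sup>+ h. \<integral>\<^sup>+ x. ennreal (1 / norm h powr ?p) * ennreal ((u (x + h) - u x)\<^sup>2) \<partial>lborel \<partial>lborel)"
      by (rule lborel_pair.Fubini') measurable
    also have "\<dots> \<le> (\<integral>\<^sup>+ h. ennreal (1 / norm (h::'a) powr ?p) * (ennreal (1 / ?c) * (\<integral>\<^sup>+ \<xi>. ennreal (min 4 ((norm h)\<^sup>2 * (norm \<xi>)\<^sup>2)) * ennreal ((norm (F \<xi>))\<^sup>2 * exp (- 2 * t * ?A \<xi>)) \<partial>lborel)) \<partial>lborel)"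
    proof (rule nn_integral_mono)
      fix h :: 'a
      have "(\<integral>\<^sup>+ x. ennreal (1 / norm h powr ?p) * ennreal ((u (x + h) - u x)\<^sup>2) \<partial>lborel) = ennreal (1 / norm h powr ?p) * (\<integral>\<^sup>+ x. ennreal ((u (x + h) - u x)\<^sup>2) \<partial>lborel)"
        by (rule nn_integral_cmult) measurable
      also have "\<dots> \<le> ennreal (1 / norm h powr ?p) * (ennreal (1 / ?c) * (\<integral>\<^sup>+ \<xi>. ennreal (min 4 ((norm h)\<^sup>2 * (norm \<xi>)\<^sup>2)) * ennreal ((norm (F \<xi>))\<^sup>2 * exp (- 2 * t * ?A \<xi>)) \<partial>lborel))"
        by (rule mult_left_mono[OF diff]) simp
      finally show "(\<integral>\<^sup>+ x. ennreal (1 / norm h powr ?p) * ennreal ((u (x + h) - u x)\<^sup>2) \<partial>lborel) \<le> \<dots>" .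
    qed
    also have "\<dots> = (\<integral>\<^sup>+ h. ennreal (1 / ?c) * (\<integral>\<^sup>+ \<xi>. ennreal ((norm (F \<xi>))\<^sup>2 * exp (- 2 * t * ?A \<xi>)) * (ennreal (1 / norm h powr ?p) * ennreal (min 4 ((norm (h::'a))\<^sup>2 * (norm \<xi>)\<^sup>2))) \<partial>lborel) \<partial>lborel)"
    proof (rule nn_integral_cong)
      fix h :: 'a
      let ?m = "\<lambda>\<xi>::'a. ennreal (min 4 ((norm h)\<^sup>2 * (norm \<xi>)\<^sup>2))" and ?g = "\<lambda>\<xi>. ennreal ((norm (F \<xi>))\<^sup>2 * exp (- 2 * t * ?A \<xi>))"
      have "ennreal (1 / norm h powr ?p) * (ennreal (1 / ?c) * (\<integral>\<^sup>+ \<xi>. ?m \<xi> * ?g \<xi> \<partial>lborel)) = ennreal (1 / ?c) * (ennreal (1 / norm h powr ?p) * (\<integral>\<^sup>+ \<xi>. ?m \<xi> * ?g \<xi> \<partial>lborel))"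
        by (rule mult.left_commute)
      also have "ennreal (1 / norm h powr ?p) * (\<integral>\<^sup>+ \<xi>. ?m \<xi> * ?g \<xi> \<partial>lborel) = (\<integral>\<^sup>+ \<xi>. ennreal (1 / norm h powr ?p) * (?m \<xi> * ?g \<xi>) \<partial>lborel)"
        by (rule nn_integral_cmult[symmetric]) measurable
      also have "\<dots> = (\<integral>\<^sup>+ \<xi>. ?g \<xi> * (ennreal (1 / norm h powr ?p) * ?m \<xi>) \<partial>lborel)"
        by (intro nn_integral_cong) (simp only: mult_ac)
      finally show "ennreal (1 / norm h powr ?p) * (ennreal (1 / ?c) * (\<integral>\<^sup>+ \<xi>. ?m \<xi> * ?g \<xi> \<partial>lborel)) = ennreal (1 / ?c) * (\<integral>\<^sup>+ \<xi>. ?g \<xi> * (ennreal (1 / norm h powr ?p) * ?m \<xi>) \<partial>lborel)" .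
    qed
    also have "\<dots> = ennreal (1 / ?c) * (\<integral>\<^sup>+ h. \<integral>\<^sup>+ \<xi>. ennreal ((norm (F \<xi>))\<^sup>2 * exp (- 2 * t * ?A \<xi>)) * (ennreal (1 / norm h powr ?p) * ennreal (min 4 ((norm (h::'a))\<^sup>2 * (norm \<xi>)\<^sup>2))) \<partial>lborel \<partial>lborel)"
      by (rule nn_integral_cmult) measurable
    also have "(\<integral>\<^sup>+ h. \<integral>\<^sup>+ \<xi>. ennreal ((norm (F \<xi>))\<^sup>2 * exp (- 2 * t * ?A \<xi>)) * (ennreal (1 / norm h powr ?p) * ennreal (min 4 ((norm (h::'a))\<^sup>2 * (norm \<xi>)\<^sup>2))) \<partial>lborel \<partial>lborel)
      = (\<integral>\<^sup>+ \<xi>. \<integral>\<^sup>+ h. ennreal ((norm (F \<xi>))\<^sup>2 * exp (- 2 * t * ?A \<xi>)) * (ennreal (1 / norm h powr ?p) * ennreal (min 4 ((norm (h::'a))\<^sup>2 * (norm \<xi>)\<^sup>2))) \<partial>lborel \<partial>lborel)"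
      by (rule lborel_pair.Fubini') measurable
    also have "\<dots> \<le> (\<integral>\<^sup>+ \<xi>. ennreal ((norm (F \<xi>))\<^sup>2 * exp (- 2 * t * ?A \<xi>)) * ennreal (C * (?A \<xi>)\<^sup>2) \<partial>lborel)"
    proof (rule nn_integral_mono)
      fix \<xi> :: 'a
      let ?g = "ennreal ((norm (F \<xi>))\<^sup>2 * exp (- 2 * t * ?A \<xi>))"
      have "(\<integral>\<^sup>+ h. ?g * (ennreal (1 / norm h powr ?p) * ennreal (min 4 ((norm (h::'a))\<^sup>2 * (norm \<xi>)\<^sup>2))) \<partial>lborel)
        = ?g * (\<integral>\<^sup>+ h. ennreal (1 / norm h powr ?p) * ennreal (min 4 ((norm (h::'a))\<^sup>2 * (norm \<xi>)\<^sup>2)) \<partial>lborel)"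
        by (rule nn_integral_cmult) measurable
      also have "\<dots> \<le> ?g * ennreal (C * (?A \<xi>)\<^sup>2)" by (rule mult_left_mono[OF levy]) simp
      finally show "(\<integral>\<^sup>+ h. ?g * (ennreal (1 / norm h powr ?p) * ennreal (min 4 ((norm (h::'a))\<^sup>2 * (norm \<xi>)\<^sup>2))) \<partial>lborel) \<le> \<dots>" .
    qed
    finally have "(\<integral>\<^sup>+ x. ennreal t * Gamma_form \<alpha> t u x * indicator {0<..} t \<partial>lborel)
       \<le> ennreal t * (ennreal (1 / ?c) * (\<integral>\<^sup>+ \<xi>. ennreal ((norm (F \<xi>))\<^sup>2 * exp (- 2 * t * ?A \<xi>)) * ennreal (C * (?A \<xi>)\<^sup>2) \<partial>lborel))"
      by (simp add: mult_left_mono)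
    also have "\<dots> = ennreal (1 / ?c) * (\<integral>\<^sup>+ \<xi>. ennreal t * (ennreal ((norm (F \<xi>))\<^sup>2 * exp (- 2 * t * ?A \<xi>)) * ennreal (C * (?A \<xi>)\<^sup>2)) \<partial>lborel)"
      by (simp add: nn_integral_cmult mult.left_commute)
    also have "(\<integral>\<^sup>+ \<xi>. ennreal t * (ennreal ((norm (F \<xi>))\<^sup>2 * exp (- 2 * t * ?A \<xi>)) * ennreal (C * (?A \<xi>)\<^sup>2)) \<partial>lborel)
       = (\<integral>\<^sup>+ \<xi>. ennreal C * (ennreal ((norm (F \<xi>))\<^sup>2) * (ennreal (t * (?A \<xi>)\<^sup>2 * exp (- 2 * t * ?A \<xi>)) * indicator {0..} t)) \<partial>lborel)"
      using True C by (intro nn_integral_cong) (simp add: ennreal_mult mult_ac)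
    also have "\<dots> = ennreal C * (\<integral>\<^sup>+ \<xi>. ennreal ((norm (F \<xi>))\<^sup>2) * (ennreal (t * (?A \<xi>)\<^sup>2 * exp (- 2 * t * ?A \<xi>)) * indicator {0..} t) \<partial>lborel)"
      by (rule nn_integral_cmult) measurable
    finally show ?thesis unfolding u_def by (simp only: mult.left_commute)
  qed simp
  have "(\<integral>\<^sup>+ t. \<integral>\<^sup>+ x. ennreal t * Gamma_form \<alpha> t (stable_ext ?\<beta> f t) x * indicator {0<..} t \<partial>lborel \<partial>lborel)
    \<le> (\<integral>\<^sup>+ t. ennreal C * (ennreal (1 / ?c) * (\<integral>\<^sup>+ \<xi>. ennreal ((norm (F \<xi>))\<^sup>2) * (ennreal (t * (?A \<xi>)\<^sup>2 * exp (- 2 * t * ?A \<xi>)) * indicator {0..} t) \<partial>lborel)) \<partial>lborel)"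
    by (intro nn_integral_mono one)
  also have "\<dots> = ennreal C * (\<integral>\<^sup>+ t. ennreal (1 / ?c) * (\<integral>\<^sup>+ \<xi>. ennreal ((norm (F \<xi>))\<^sup>2) * (ennreal (t * (?A \<xi>)\<^sup>2 * exp (- 2 * t * ?A \<xi>)) * indicator {0..} t) \<partial>lborel) \<partial>lborel)"
    by (rule nn_integral_cmult) measurable
  also have "\<dots> \<le> ennreal C * (ennreal (1 / 4) * (\<integral>\<^sup>+ y. ennreal ((f y)\<^sup>2) \<partial>lborel))"
    unfolding F_def by (intro mult_left_mono nn_integral_time_fourier_bound[OF f]) simp
  finally show ?thesis .
qed

subsection \<open>The local energy estimate\<close>

lemma weight_integrable_cutoff:
  assumes "weight_integrable \<beta> f" "A \<in> sets borel" and [measurable]: "f \<in> borel_measurable borel"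
  shows "weight_integrable \<beta> (\<lambda>y. f y * indicator A y)"
proof -
  note [measurable] = assms(2)
  show ?thesis
    using assms(1) unfolding weight_integrable_def
    by (rule Bochner_Integration.integrable_bound) (auto simp: abs_mult split: split_indicator)
qed

lemma weight_integrable_imp_integrable_ball:
  fixes f :: "'a::euclidean_space \<Rightarrow> real"
  assumes f: "weight_integrable \<beta> f" and [measurable]: "f \<in> borel_measurable borel" and \<beta>: "0 < \<beta>"
  shows "integrable lborel (\<lambda>y. f y * indicator (ball x0 r) y)"
proof -
  let ?a = "real DIM('a) + \<beta>"
  have [measurable]: "ball x0 r \<in> sets borel" by simp
  define c where "c = (1 + norm x0 + \<bar>r\<bar>) powr ?a"
  show ?thesis
  proof (rule Bochner_Integration.integrable_bound)
    show "integrable lborel (\<lambda>y. c * (f y * (1 + norm y) powr (- ?a)))"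
      using f unfolding weight_integrable_def by (rule integrable_mult_right)
    show "AE y in lborel. norm (f y * indicator (ball x0 r) y) \<le> norm (c * (f y * (1 + norm y) powr (- ?a)))"
    proof (intro AE_I2)
      fix y
      show "norm (f y * indicator (ball x0 r) y) \<le> norm (c * (f y * (1 + norm y) powr (- ?a)))"
      proof (cases "y \<in> ball x0 r")
        case True
        then have "norm y \<le> norm x0 + \<bar>r\<bar>" using norm_triangle_sub[of y x0] by (auto simp: dist_norm norm_minus_commute)
        then have "(1 + norm y) powr ?a \<le> c" unfolding c_def using \<beta> by (intro powr_mono2) auto
        moreover have "0 < 1 + norm y" by (simp add: add_pos_nonneg)
        ultimately have "1 \<le> c * (1 + norm y) powr (- ?a)"
          by (simp only: powr_minus_divide) (simp add: pos_le_divide_eq)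
        then have "\<bar>f y\<bar> * 1 \<le> \<bar>f y\<bar> * (c * (1 + norm y) powr (- ?a))" by (intro mult_left_mono) auto
        moreover have "0 \<le> c" by (simp add: c_def)
        ultimately show ?thesis using True by (simp add: abs_mult mult_ac)
      qed simp
    qed
  qed measurable
qed

text \<open>With D = |y - x0| \<ge> 4 R one has |x - y| \<ge> D - R \<ge> (R + D) / 2. The second
  claim leaves room for shifting \<open>x\<close> by at most \<open>R\<close>: the distance to
  \<open>y\<close> then changes by at most a third.\<close>

lemma far_kernel_weight:
  fixes x x0 y :: "'a::euclidean_space"
  assumes R: "0 < R" and x: "dist x0 x < R" and y: "4 * R \<le> dist x0 y" and a: "0 \<le> a"
  shows "norm (x - y) powr (- a) \<le> (2 powr a) * R powr (- a) * (1 + norm (y - x0) / R) powr (- a)"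
    and "3 * R \<le> norm (x - y)"
proof -
  have D: "dist x0 y - R \<le> norm (x - y)"
    using x dist_triangle[of x0 y x] by (simp add: dist_norm)
  then show 3: "3 * R \<le> norm (x - y)" using y by simp
  have "(R + norm (y - x0)) / 2 \<le> norm (x - y)"
    using D y R by (simp add: dist_norm norm_minus_commute)
  moreover have e: "(R + norm (y - x0)) / 2 = R * (1 + norm (y - x0) / R) / 2" using R by (simp add: field_simps)
  moreover have p: "0 < 1 + norm (y - x0) / R" using R by (simp add: add_pos_nonneg)
  ultimately have "norm (x - y) powr (- a) \<le> (R * (1 + norm (y - x0) / R) / 2) powr (- a)"
    using a R by (intro powr_mono2') auto
  also have "\<dots> = R powr (- a) * (1 + norm (y - x0) / R) powr (- a) / 2 powr (- a)"
    by (simp only: powr_divide powr_mult)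
  also have "\<dots> = (2 powr a) * R powr (- a) * (1 + norm (y - x0) / R) powr (- a)"
    by (simp add: powr_minus_divide)
  finally show "norm (x - y) powr (- a) \<le> (2 powr a) * R powr (- a) * (1 + norm (y - x0) / R) powr (- a)" .
qed

text \<open>As \<open>f\<close> vanishes on the ball of radius 4 R, only kernel values at distance
  at least 3 R matter, where the homogeneous bounds hold: a spatial difference comes with the factor
  t |h| / R, whereas the time derivative has lost its factor \<open>t\<close>.\<close>

lemma far_pointwise:
  fixes \<beta> :: real
  assumes \<beta>: "0 < \<beta>" "\<beta> < 2"
  defines "a \<equiv> real DIM('a::euclidean_space) + \<beta>"
  shows "\<exists>K\<ge>0. \<forall>(f :: 'a \<Rightarrow> real) x0 R x t. f \<in> borel_measurable borel \<longrightarrow> weight_integrable \<beta> f \<longrightarrow> 0 < R \<longrightarrow>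
     dist x0 x < R \<longrightarrow> 0 < t \<longrightarrow> (\<forall>y \<in> ball x0 (4 * R). f y = 0) \<longrightarrow>
     (\<forall>h. norm h \<le> R \<longrightarrow> ennreal \<bar>stable_ext \<beta> f t (x + h) - stable_ext \<beta> f t x\<bar>
        \<le> ennreal (K * (t * norm h / R) * R powr (- a)) * (\<integral>\<^sup>+ y. ennreal (\<bar>f y\<bar> * (1 + norm (y - x0) / R) powr (- a)) \<partial>lborel)) \<and>
     ennreal \<bar>stable_ext_dt \<beta> f t x\<bar>
        \<le> ennreal (K * R powr (- a)) * (\<integral>\<^sup>+ y. ennreal (\<bar>f y\<bar> * (1 + norm (y - x0) / R) powr (- a)) \<partial>lborel)"
proof -
  from stable_kernel_bounds[OF \<beta>, where ?'a = 'a] obtain C where C: "0 \<le> C" and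
    "\<forall>t>0. \<forall>(x::'a) (y::'a). x \<noteq> 0 \<longrightarrow> norm x / 2 \<le> norm y \<longrightarrow> norm y \<le> 2 * norm x \<longrightarrow>
     \<bar>stable_kernel \<beta> t x\<bar> \<le> C * t * norm x powr (- (real DIM('a) + \<beta>)) \<and>
     \<bar>stable_kernel \<beta> t x - stable_kernel \<beta> t y\<bar>
       \<le> C * t * (\<bar>norm x - norm y\<bar> / norm x) * norm x powr (- (real DIM('a) + \<beta>))"
    by (elim exE conjE)
  note G = this(2)[rule_format, folded a_def]
  from stable_kernel_dt_bound[OF \<beta>, where ?'a = 'a] obtain C' where C': "0 \<le> C'" and
    "\<forall>t. \<forall>x :: 'a. 0 < t \<longrightarrow> x \<noteq> 0 \<longrightarrow>
     \<bar>stable_kernel_dt \<beta> t x\<bar> \<le> C' * norm x powr (- (real DIM('a) + \<beta>))"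
    by (elim exE conjE)
  note G' = this(2)[rule_format, folded a_def]
  define K where "K = (C + C') * 2 powr a"
  have K: "0 \<le> K" "C * 2 powr a \<le> K" "C' * 2 powr a \<le> K" using C C' by (auto simp: K_def intro: mult_right_mono)
  have a0: "0 \<le> a" using \<beta> by (simp add: a_def)
  have bound: "ennreal \<bar>LINT y|lborel. f y * g y\<bar> \<le> ennreal (c * R powr (- a)) * (\<integral>\<^sup>+ y. ennreal (\<bar>f y\<bar> * (1 + norm (y - x0) / R) powr (- a)) \<partial>lborel)"
    if [measurable]: "f \<in> borel_measurable borel" and int: "integrable lborel (\<lambda>y. f y * g y)" and R: "0 < R" and c: "0 \<le> c"
      and z: "\<And>y. y \<in> ball x0 (4 * R) \<Longrightarrow> f y = 0"
      and g: "\<And>y. 4 * R \<le> dist x0 y \<Longrightarrow> \<bar>g y\<bar> \<le> c * R powr (- a) * (1 + norm (y - x0) / R) powr (- a)"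
    for f g and x0 :: 'a and R c
  proof -
    have "ennreal \<bar>LINT y|lborel. f y * g y\<bar> \<le> (\<integral>\<^sup>+ y. norm (f y * g y) \<partial>lborel)"
      using integral_norm_bound_ennreal[OF int] by simp
    also have "\<dots> \<le> (\<integral>\<^sup>+ y. ennreal (c * R powr (- a)) * ennreal (\<bar>f y\<bar> * (1 + norm (y - x0) / R) powr (- a)) \<partial>lborel)"
    proof (rule nn_integral_mono)
      fix y
      have "\<bar>f y\<bar> * \<bar>g y\<bar> \<le> c * R powr (- a) * (\<bar>f y\<bar> * (1 + norm (y - x0) / R) powr (- a))"
      proof (cases "4 * R \<le> dist x0 y")
        case True
        have "\<bar>f y\<bar> * \<bar>g y\<bar> \<le> \<bar>f y\<bar> * (c * R powr (- a) * (1 + norm (y - x0) / R) powr (- a))"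
          by (intro mult_left_mono g True) auto
        then show ?thesis by (simp only: mult_ac)
      next
        case False
        then have "f y = 0" by (intro z) auto
        then show ?thesis by simp
      qed
      then have "ennreal (norm (f y * g y)) \<le> ennreal (c * R powr (- a) * (\<bar>f y\<bar> * (1 + norm (y - x0) / R) powr (- a)))"
        by (intro ennreal_leI) (simp add: abs_mult)
      also have "\<dots> = ennreal (c * R powr (- a)) * ennreal (\<bar>f y\<bar> * (1 + norm (y - x0) / R) powr (- a))"
        using c by (intro ennreal_mult) auto
      finally show "ennreal (norm (f y * g y)) \<le> \<dots>" .
    qed
    also have "\<dots> = ennreal (c * R powr (- a)) * (\<integral>\<^sup>+ y. ennreal (\<bar>f y\<bar> * (1 + norm (y - x0) / R) powr (- a)) \<partial>lborel)"
      by (rule nn_integral_cmult) measurable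
    finally show ?thesis .
  qed
  have "(\<forall>h. norm h \<le> R \<longrightarrow> ennreal \<bar>stable_ext \<beta> f t (x + h) - stable_ext \<beta> f t x\<bar>
        \<le> ennreal (K * (t * norm h / R) * R powr (- a)) * (\<integral>\<^sup>+ y. ennreal (\<bar>f y\<bar> * (1 + norm (y - x0) / R) powr (- a)) \<partial>lborel)) \<and>
     ennreal \<bar>stable_ext_dt \<beta> f t x\<bar>
        \<le> ennreal (K * R powr (- a)) * (\<integral>\<^sup>+ y. ennreal (\<bar>f y\<bar> * (1 + norm (y - x0) / R) powr (- a)) \<partial>lborel)"
    if fm: "f \<in> borel_measurable borel" and w: "weight_integrable \<beta> f" and R: "0 < R" and x: "dist x0 x < R" and t: "0 < t"
      and z: "\<And>y. y \<in> ball x0 (4 * R) \<Longrightarrow> f y = 0" for f :: "'a \<Rightarrow> real" and x0 x :: 'a and R t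
  proof (intro conjI allI impI)
    fix h :: 'a assume h: "norm h \<le> R"
    note i1 = integrable_stable_ext[OF w fm \<beta> t, of "x + h"]
    note i2 = integrable_stable_ext[OF w fm \<beta> t, of x]
    have "stable_ext \<beta> f t (x + h) - stable_ext \<beta> f t x = (LINT y|lborel. f y * (stable_kernel \<beta> t (x + h - y) - stable_kernel \<beta> t (x - y)))"
      unfolding stable_ext_def right_diff_distrib by (rule Bochner_Integration.integral_diff[OF i1 i2, symmetric])
    moreover have "ennreal \<bar>LINT y|lborel. f y * (stable_kernel \<beta> t (x + h - y) - stable_kernel \<beta> t (x - y))\<bar>
      \<le> ennreal (K * (t * norm h / R) * R powr (- a)) * (\<integral>\<^sup>+ y. ennreal (\<bar>f y\<bar> * (1 + norm (y - x0) / R) powr (- a)) \<partial>lborel)"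
    proof (rule bound[OF fm _ R _ z])
      show "integrable lborel (\<lambda>y. f y * (stable_kernel \<beta> t (x + h - y) - stable_kernel \<beta> t (x - y)))"
        unfolding right_diff_distrib by (rule Bochner_Integration.integrable_diff[OF i1 i2])
      show "0 \<le> K * (t * norm h / R)" using K t R by simp
      fix y assume y: "4 * R \<le> dist x0 y"
      note fk = far_kernel_weight[OF R x y a0]
      define zz where "zz = x - y"
      have zz: "3 * R \<le> norm zz" using fk(2) by (simp add: zz_def)
      then have z0: "zz \<noteq> 0" using R by auto
      have up: "norm (zz + h) \<le> norm zz + norm h" by (rule norm_triangle_ineq)
      have lo: "norm zz - norm h \<le> norm (zz + h)" using norm_triangle_ineq2[of zz "- h"] by simp
      have 1: "norm zz / 2 \<le> norm (zz + h)" "norm (zz + h) \<le> 2 * norm zz" using up lo zz h R by auto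
      have "\<bar>norm zz - norm (zz + h)\<bar> \<le> norm h" using up lo by (simp add: abs_le_iff)
      then have "\<bar>norm zz - norm (zz + h)\<bar> / norm zz \<le> norm h / R"
        using zz R by (intro frac_le) auto
      then have "C * t * (\<bar>norm zz - norm (zz + h)\<bar> / norm zz) * norm zz powr (- a) \<le> C * t * (norm h / R) * norm zz powr (- a)"
        using C t by (intro mult_right_mono mult_left_mono) auto
      also have "\<dots> \<le> C * t * (norm h / R) * ((2 powr a) * R powr (- a) * (1 + norm (y - x0) / R) powr (- a))"
        using fk(1) C t R unfolding zz_def by (intro mult_left_mono) auto
      also have "\<dots> = (C * 2 powr a) * ((t * norm h / R) * R powr (- a) * (1 + norm (y - x0) / R) powr (- a))"
        by simp
      also have "\<dots> \<le> K * ((t * norm h / R) * R powr (- a) * (1 + norm (y - x0) / R) powr (- a))"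
        using K t R by (intro mult_right_mono) auto
      finally have "\<bar>stable_kernel \<beta> t zz - stable_kernel \<beta> t (zz + h)\<bar> \<le> K * ((t * norm h / R) * R powr (- a) * (1 + norm (y - x0) / R) powr (- a))"
        using G[OF t z0 1] by linarith
      moreover have "x + h - y = zz + h" by (simp add: zz_def)
      ultimately show "\<bar>stable_kernel \<beta> t (x + h - y) - stable_kernel \<beta> t (x - y)\<bar> \<le> K * (t * norm h / R) * R powr (- a) * (1 + norm (y - x0) / R) powr (- a)"
        by (simp only: zz_def[symmetric] abs_minus_commute mult.assoc)
    qed
    ultimately show "ennreal \<bar>stable_ext \<beta> f t (x + h) - stable_ext \<beta> f t x\<bar>
        \<le> ennreal (K * (t * norm h / R) * R powr (- a)) * (\<integral>\<^sup>+ y. ennreal (\<bar>f y\<bar> * (1 + norm (y - x0) / R) powr (- a)) \<partial>lborel)"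
      by (simp only:)
  next
    show "ennreal \<bar>stable_ext_dt \<beta> f t x\<bar>
        \<le> ennreal (K * R powr (- a)) * (\<integral>\<^sup>+ y. ennreal (\<bar>f y\<bar> * (1 + norm (y - x0) / R) powr (- a)) \<partial>lborel)"
      unfolding stable_ext_dt_def
    proof (rule bound[OF fm integrable_stable_ext_dt[OF w fm \<beta> t] R K(1) z])
      fix y assume y: "4 * R \<le> dist x0 y"
      note fk = far_kernel_weight[OF R x y a0]
      have z0: "x - y \<noteq> 0" using fk(2) R by auto
      have "\<bar>stable_kernel_dt \<beta> t (x - y)\<bar> \<le> C' * norm (x - y) powr (- a)" by (rule G'[OF t z0])
      also have "\<dots> \<le> C' * ((2 powr a) * R powr (- a) * (1 + norm (y - x0) / R) powr (- a))"
        using fk(1) C' by (intro mult_left_mono) auto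
      also have "\<dots> = (C' * 2 powr a) * (R powr (- a) * (1 + norm (y - x0) / R) powr (- a))" by simp
      also have "\<dots> \<le> K * (R powr (- a) * (1 + norm (y - x0) / R) powr (- a))"
        using K by (intro mult_right_mono) auto
      finally show "\<bar>stable_kernel_dt \<beta> t (x - y)\<bar> \<le> K * R powr (- a) * (1 + norm (y - x0) / R) powr (- a)"
        by (simp only: mult.assoc)
    qed
  qed
  with K(1) show ?thesis by blast
qed

text \<open>Cauchy-Schwarz with the weight divided evenly between the two factors.\<close>

lemma nn_integral_weight_square_le:
  fixes f :: "'a::euclidean_space \<Rightarrow> real"
  assumes [measurable]: "f \<in> borel_measurable borel"
  shows "(\<integral>\<^sup>+ y. ennreal (\<bar>f y\<bar> * (1 + norm (y - x0) / R) powr (- a)) \<partial>lborel)\<^sup>2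
    \<le> (\<integral>\<^sup>+ y. ennreal ((f y)\<^sup>2 * (1 + norm (y - x0) / R) powr (- a)) \<partial>lborel) * (\<integral>\<^sup>+ y. ennreal ((1 + norm (y - x0) / R) powr (- a)) \<partial>lborel)"
proof -
  let ?w = "\<lambda>y. (1 + norm (y - x0) / R) powr (- a)"
  let ?s = "\<lambda>y. sqrt (?w y)"
  have "(\<integral>\<^sup>+ y. ennreal (\<bar>f y\<bar> * ?s y) * ennreal (?s y) \<partial>lborel)\<^sup>2 \<le> (\<integral>\<^sup>+ y. (ennreal (\<bar>f y\<bar> * ?s y))\<^sup>2 \<partial>lborel) * (\<integral>\<^sup>+ y. (ennreal (?s y))\<^sup>2 \<partial>lborel)"
    by (rule Cauchy_Schwarz_nn_integral) measurable
  moreover have "ennreal (\<bar>f y\<bar> * ?s y) * ennreal (?s y) = ennreal (\<bar>f y\<bar> * ?w y)" for y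
    by (subst ennreal_mult[symmetric]) (auto simp: mult.assoc)
  moreover have "(ennreal (\<bar>f y\<bar> * ?s y))\<^sup>2 = ennreal ((f y)\<^sup>2 * ?w y)" for y
    by (subst ennreal_power) (auto simp: power_mult_distrib)
  moreover have "(ennreal (?s y))\<^sup>2 = ennreal (?w y)" for y
    by (subst ennreal_power) auto
  ultimately show ?thesis by (simp only:)
qed

section \<open>The energy density and its local estimate\<close>

lemma add_square_le: "(x + y)\<^sup>2 \<le> 2 * x\<^sup>2 + 2 * (y::real)\<^sup>2"
  using sum_squares_bound[of x y] by (simp add: power2_eq_square algebra_simps)

lemma Gamma_form_measurable [measurable]:
  fixes g :: "'b \<Rightarrow> 'a::euclidean_space" and U :: "real \<Rightarrow> 'a \<Rightarrow> real"
  assumes U: "(\<lambda>p. U (fst p) (snd p)) \<in> borel_measurable (borel \<Otimes>\<^sub>M borel)"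
    and [measurable]: "f \<in> borel_measurable M" "g \<in> borel_measurable M"
  shows "(\<lambda>p. Gamma_form \<alpha> (f p) (U (f p)) (g p)) \<in> borel_measurable M"
proof -
  have "(\<lambda>q. (f (fst q), g (fst q) + snd q)) \<in> M \<Otimes>\<^sub>M lborel \<rightarrow>\<^sub>M borel \<Otimes>\<^sub>M borel" by measurable
  from measurable_compose[OF this U]
  have 1: "(\<lambda>q. U (f (fst q)) (g (fst q) + snd q)) \<in> borel_measurable (M \<Otimes>\<^sub>M lborel)" by simp
  have "(\<lambda>q. (f (fst q), g (fst q))) \<in> M \<Otimes>\<^sub>M lborel \<rightarrow>\<^sub>M borel \<Otimes>\<^sub>M borel" by measurable
  from measurable_compose[OF this U]
  have 2: "(\<lambda>q. U (f (fst q)) (g (fst q))) \<in> borel_measurable (M \<Otimes>\<^sub>M lborel)" by simp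
  note [measurable] = 1 2
  show ?thesis unfolding Gamma_form_def by measurable
qed

text \<open>Horizontal and vertical densities obey the same local estimate, so they are added at
  once and the squared functional becomes a single integral.\<close>

definition ext_energy :: "real \<Rightarrow> ('a::euclidean_space \<Rightarrow> real) \<Rightarrow> real \<Rightarrow> 'a \<Rightarrow> ennreal" where
  "ext_energy \<alpha> f t x = Gamma_form \<alpha> t (stable_ext (\<alpha> / 2) f t) x + ennreal ((stable_ext_dt (\<alpha> / 2) f t x)\<^sup>2)"

lemma measurable_ext_energy [measurable]:
  fixes f :: "'a::euclidean_space \<Rightarrow> real"
  assumes [measurable]: "f \<in> borel_measurable borel"
  shows "(\<lambda>(t, y). ext_energy \<alpha> f t y) \<in> borel_measurable (lborel \<Otimes>\<^sub>M lborel)"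
proof -
  have U: "(\<lambda>p::real \<times> 'a. stable_ext (\<alpha> / 2) f (fst p) (snd p)) \<in> borel_measurable (borel \<Otimes>\<^sub>M borel)"
    by measurable
  have "(\<lambda>p. Gamma_form \<alpha> (fst p) (stable_ext (\<alpha> / 2) f (fst p)) (snd p)) \<in> borel_measurable (lborel \<Otimes>\<^sub>M lborel)"
    by (rule Gamma_form_measurable[OF U]) measurable
  then show ?thesis unfolding ext_energy_def case_prod_beta by measurable
qed

lemma Gamma_form_add_le:
  fixes u v :: "'a::euclidean_space \<Rightarrow> real"
  assumes [measurable]: "u \<in> borel_measurable borel" "v \<in> borel_measurable borel"
  shows "Gamma_form \<alpha> t (\<lambda>x. u x + v x) x \<le> 2 * (Gamma_form \<alpha> t u x + Gamma_form \<alpha> t v x)"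
proof -
  let ?p = "real DIM('a) + \<alpha>"
  let ?S = "{h::'a. norm h < t powr (2 / \<alpha>)}"
  have "Gamma_form \<alpha> t (\<lambda>x. u x + v x) x
     \<le> (\<integral>\<^sup>+ h. 2 * (ennreal ((u (x + h) - u x)\<^sup>2 / norm h powr ?p) * indicator ?S h + ennreal ((v (x + h) - v x)\<^sup>2 / norm h powr ?p) * indicator ?S h) \<partial>lborel)"
    unfolding Gamma_form_def
  proof (rule nn_integral_mono)
    fix h
    have "(u (x + h) + v (x + h) - (u x + v x))\<^sup>2 = ((u (x + h) - u x) + (v (x + h) - v x))\<^sup>2" by (simp add: algebra_simps)
    also have "\<dots> \<le> 2 * (u (x + h) - u x)\<^sup>2 + 2 * (v (x + h) - v x)\<^sup>2" by (rule add_square_le)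
    finally have "(u (x + h) + v (x + h) - (u x + v x))\<^sup>2 / norm h powr ?p \<le> (2 * (u (x + h) - u x)\<^sup>2 + 2 * (v (x + h) - v x)\<^sup>2) / norm h powr ?p"
      by (intro divide_right_mono) auto
    also have "\<dots> = 2 * ((u (x + h) - u x)\<^sup>2 / norm h powr ?p + (v (x + h) - v x)\<^sup>2 / norm h powr ?p)"
      by (simp add: add_divide_distrib)
    finally have "ennreal ((u (x + h) + v (x + h) - (u x + v x))\<^sup>2 / norm h powr ?p)
      \<le> ennreal (2 * ((u (x + h) - u x)\<^sup>2 / norm h powr ?p + (v (x + h) - v x)\<^sup>2 / norm h powr ?p))"
      by (rule ennreal_leI)
    also have "\<dots> = 2 * (ennreal ((u (x + h) - u x)\<^sup>2 / norm h powr ?p) + ennreal ((v (x + h) - v x)\<^sup>2 / norm h powr ?p))"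
      by (subst ennreal_mult) auto
    finally show "ennreal ((u (x + h) + v (x + h) - (u x + v x))\<^sup>2 / norm h powr ?p) * indicator ?S h
      \<le> 2 * (ennreal ((u (x + h) - u x)\<^sup>2 / norm h powr ?p) * indicator ?S h + ennreal ((v (x + h) - v x)\<^sup>2 / norm h powr ?p) * indicator ?S h)"
      by (auto split: split_indicator)
  qed
  also have "\<dots> = 2 * (Gamma_form \<alpha> t u x + Gamma_form \<alpha> t v x)"
    unfolding Gamma_form_def by (subst nn_integral_cmult, measurable, subst nn_integral_add, measurable)
  finally show ?thesis .
qed

lemma ext_energy_add_le:
  fixes f g :: "'a::euclidean_space \<Rightarrow> real"
  assumes f: "weight_integrable (\<alpha> / 2) f" and g: "weight_integrable (\<alpha> / 2) g"
    and m[measurable]: "f \<in> borel_measurable borel" "g \<in> borel_measurable borel"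
    and \<alpha>: "0 < \<alpha>" "\<alpha> < 2" and t: "0 < t"
  shows "ext_energy \<alpha> (\<lambda>y. f y + g y) t x \<le> 2 * (ext_energy \<alpha> f t x + ext_energy \<alpha> g t x)"
proof -
  have \<beta>: "0 < \<alpha> / 2" "\<alpha> / 2 < 2" using \<alpha> by auto
  let ?f = "stable_ext (\<alpha> / 2) f t" and ?g = "stable_ext (\<alpha> / 2) g t"
  have e: "stable_ext (\<alpha> / 2) (\<lambda>y. f y + g y) t = (\<lambda>x. ?f x + ?g x)"
    unfolding stable_ext_def distrib_right
    by (intro ext Bochner_Integration.integral_add integrable_stable_ext f g m \<beta> t)
  have ed: "stable_ext_dt (\<alpha> / 2) (\<lambda>y. f y + g y) t x = stable_ext_dt (\<alpha> / 2) f t x + stable_ext_dt (\<alpha> / 2) g t x"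
    unfolding stable_ext_dt_def distrib_right
    by (intro Bochner_Integration.integral_add integrable_stable_ext_dt f g m \<beta> t)
  have "Gamma_form \<alpha> t (\<lambda>x. ?f x + ?g x) x \<le> 2 * (Gamma_form \<alpha> t ?f x + Gamma_form \<alpha> t ?g x)"
    by (rule Gamma_form_add_le) measurable
  moreover have "ennreal ((stable_ext_dt (\<alpha> / 2) f t x + stable_ext_dt (\<alpha> / 2) g t x)\<^sup>2)
     \<le> 2 * (ennreal ((stable_ext_dt (\<alpha> / 2) f t x)\<^sup>2) + ennreal ((stable_ext_dt (\<alpha> / 2) g t x)\<^sup>2))"
  proof -
    have "ennreal ((stable_ext_dt (\<alpha> / 2) f t x + stable_ext_dt (\<alpha> / 2) g t x)\<^sup>2)
      \<le> ennreal (2 * ((stable_ext_dt (\<alpha> / 2) f t x)\<^sup>2 + (stable_ext_dt (\<alpha> / 2) g t x)\<^sup>2))"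
      using add_square_le[of "stable_ext_dt (\<alpha> / 2) f t x" "stable_ext_dt (\<alpha> / 2) g t x"] by (intro ennreal_leI) simp
    also have "\<dots> = 2 * (ennreal ((stable_ext_dt (\<alpha> / 2) f t x)\<^sup>2) + ennreal ((stable_ext_dt (\<alpha> / 2) g t x)\<^sup>2))"
      by (subst ennreal_mult) auto
    finally show ?thesis .
  qed
  ultimately have "ext_energy \<alpha> (\<lambda>y. f y + g y) t x \<le> 2 * (Gamma_form \<alpha> t ?f x + Gamma_form \<alpha> t ?g x)
     + 2 * (ennreal ((stable_ext_dt (\<alpha> / 2) f t x)\<^sup>2) + ennreal ((stable_ext_dt (\<alpha> / 2) g t x)\<^sup>2))"
    unfolding ext_energy_def e ed by (rule add_mono)
  also have "\<dots> = 2 * (ext_energy \<alpha> f t x + ext_energy \<alpha> g t x)"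
    unfolding ext_energy_def by (simp only: distrib_left add_ac)
  finally show ?thesis .
qed

lemma ext_energy_near:
  fixes f :: "'a::euclidean_space \<Rightarrow> real"
  assumes f: "integrable lborel f" and \<alpha>: "0 < \<alpha>" "\<alpha> < 2"
  defines "C \<equiv> (real DIM('a) + \<alpha>) * unit_ball_vol (real DIM('a)) * (1 / (2 - \<alpha>) + 4 / \<alpha>)"
  shows "(\<integral>\<^sup>+ t. \<integral>\<^sup>+ x. ennreal t * ext_energy \<alpha> f t x * indicator {0<..} t \<partial>lborel \<partial>lborel)
     \<le> ennreal ((C + 1) / 4) * (\<integral>\<^sup>+ y. ennreal ((f y)\<^sup>2) \<partial>lborel)"
proof -
  have [measurable]: "f \<in> borel_measurable borel" using borel_measurable_integrable[OF f] by simp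
  have C: "0 \<le> C" unfolding C_def using \<alpha> unit_ball_vol_DIM_pos[where ?'a = 'a] by simp
  have U: "(\<lambda>p::real \<times> 'a. stable_ext (\<alpha> / 2) f (fst p) (snd p)) \<in> borel_measurable (borel \<Otimes>\<^sub>M borel)"
    by measurable
  have [measurable]: "(\<lambda>(t, x). Gamma_form \<alpha> t (stable_ext (\<alpha> / 2) f t) x) \<in> borel_measurable (lborel \<Otimes>\<^sub>M lborel)"
    unfolding case_prod_beta by (rule Gamma_form_measurable[OF U]) measurable
  have "(\<integral>\<^sup>+ t. \<integral>\<^sup>+ x. ennreal t * ext_energy \<alpha> f t x * indicator {0<..} t \<partial>lborel \<partial>lborel)
    = (\<integral>\<^sup>+ t. \<integral>\<^sup>+ x. ennreal t * Gamma_form \<alpha> t (stable_ext (\<alpha> / 2) f t) x * indicator {0<..} t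
       + ennreal t * ennreal ((stable_ext_dt (\<alpha> / 2) f t x)\<^sup>2) * indicator {0<..} t \<partial>lborel \<partial>lborel)"
    unfolding ext_energy_def by (simp only: distrib_left distrib_right)
  also have "\<dots> = (\<integral>\<^sup>+ t. \<integral>\<^sup>+ x. ennreal t * Gamma_form \<alpha> t (stable_ext (\<alpha> / 2) f t) x * indicator {0<..} t \<partial>lborel \<partial>lborel)
      + (\<integral>\<^sup>+ t. \<integral>\<^sup>+ x. ennreal t * ennreal ((stable_ext_dt (\<alpha> / 2) f t x)\<^sup>2) * indicator {0<..} t \<partial>lborel \<partial>lborel)"
    by (simp add: nn_integral_add)
  also have "\<dots> \<le> ennreal C * (ennreal (1 / 4) * (\<integral>\<^sup>+ y. ennreal ((f y)\<^sup>2) \<partial>lborel)) + ennreal (1 / 4) * (\<integral>\<^sup>+ y. ennreal ((f y)\<^sup>2) \<partial>lborel)"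
    unfolding C_def using \<alpha> by (intro add_mono horizontal_L2_bound vertical_L2_bound f) auto
  also have "\<dots> = ennreal ((C + 1) / 4) * (\<integral>\<^sup>+ y. ennreal ((f y)\<^sup>2) \<partial>lborel)"
  proof -
    have "ennreal ((C + 1) / 4) = ennreal C * ennreal (1 / 4) + ennreal (1 / 4)"
      using C by (subst ennreal_mult[symmetric], simp, simp, subst ennreal_plus[symmetric]) (auto simp: field_simps)
    then show ?thesis by (simp only: distrib_right mult.assoc)
  qed
  finally show ?thesis .
qed

text \<open>After squaring, the difference bound is quadratic in |h|, so the Gamma form is at most
  of order (t / R)^2 r powr (2 - \<alpha>), and t^2 = r powr \<alpha> turns this into (r / R)^2
  \<le> 1. Both parts of the energy thus obey one bound, and Cauchy-Schwarz converts the weighted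
  L^1 integral into a weighted L^2 integral at the price of R^d.\<close>

lemma ext_energy_far:
  fixes \<alpha> :: real
  assumes \<alpha>: "0 < \<alpha>" "\<alpha> < 2"
  defines "a \<equiv> real DIM('a::euclidean_space) + \<alpha> / 2"
  shows "\<exists>K\<ge>0. \<forall>(f :: 'a \<Rightarrow> real) x0 R x t. f \<in> borel_measurable borel \<longrightarrow> weight_integrable (\<alpha> / 2) f \<longrightarrow> 0 < R \<longrightarrow>
     dist x0 x < R \<longrightarrow> 0 < t \<longrightarrow> t powr (2 / \<alpha>) \<le> R \<longrightarrow> (\<forall>y \<in> ball x0 (4 * R). f y = 0) \<longrightarrow>
     ext_energy \<alpha> f t x \<le> ennreal (K * R powr (- 2 * a) * R ^ DIM('a)) *
       (\<integral>\<^sup>+ y. ennreal ((f y)\<^sup>2 * (1 + norm (y - x0) / R) powr (- a)) \<partial>lborel)"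
proof -
  have \<beta>: "0 < \<alpha> / 2" "\<alpha> / 2 < 2" using \<alpha> by auto
  have a: "real DIM('a) < a" "0 < a" using \<alpha> by (auto simp: a_def)
  from far_pointwise[OF \<beta>, where ?'a = 'a, folded a_def] obtain K where K: "0 \<le> K" and
    "\<forall>(f :: 'a \<Rightarrow> real) x0 R x t. f \<in> borel_measurable borel \<longrightarrow> weight_integrable (\<alpha> / 2) f \<longrightarrow> 0 < R \<longrightarrow>
     dist x0 x < R \<longrightarrow> 0 < t \<longrightarrow> (\<forall>y \<in> ball x0 (4 * R). f y = 0) \<longrightarrow>
     (\<forall>h. norm h \<le> R \<longrightarrow> ennreal \<bar>stable_ext (\<alpha> / 2) f t (x + h) - stable_ext (\<alpha> / 2) f t x\<bar>
        \<le> ennreal (K * (t * norm h / R) * R powr (- a)) * (\<integral>\<^sup>+ y. ennreal (\<bar>f y\<bar> * (1 + norm (y - x0) / R) powr (- a)) \<partial>lborel)) \<and>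
     ennreal \<bar>stable_ext_dt (\<alpha> / 2) f t x\<bar>
        \<le> ennreal (K * R powr (- a)) * (\<integral>\<^sup>+ y. ennreal (\<bar>f y\<bar> * (1 + norm (y - x0) / R) powr (- a)) \<partial>lborel)"
    by (elim exE conjE)
  note far = this(2)[THEN spec, THEN spec, THEN spec, THEN spec, THEN spec, THEN mp, THEN mp, THEN mp, THEN mp, THEN mp, THEN mp]
  define L where "L = (real DIM('a) + \<alpha>) * unit_ball_vol (real DIM('a)) * (1 / (2 - \<alpha>) + 4 / \<alpha>)"
  have L: "0 \<le> L" unfolding L_def using \<alpha> unit_ball_vol_DIM_pos[where ?'a = 'a] by simp
  define c where "c = 2 ^ DIM('a) * a / (a - real DIM('a)) * unit_ball_vol (real DIM('a))"
  have c: "0 \<le> c" unfolding c_def using a unit_ball_vol_DIM_pos[where ?'a = 'a] by simp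
  define K' where "K' = (L + 1) * K\<^sup>2 * c"
  have K': "0 \<le> K'" using K L c by (simp add: K'_def)
  have "ext_energy \<alpha> f t x \<le> ennreal (K' * R powr (- 2 * a) * R ^ DIM('a)) *
       (\<integral>\<^sup>+ y. ennreal ((f y)\<^sup>2 * (1 + norm (y - x0) / R) powr (- a)) \<partial>lborel)"
    if fm[measurable]: "f \<in> borel_measurable borel" and w: "weight_integrable (\<alpha> / 2) f" and R: "0 < R" and x: "dist x0 x < R"
      and t: "0 < t" "t powr (2 / \<alpha>) \<le> R" and z: "\<forall>y \<in> ball x0 (4 * R). f y = 0"
    for f :: "'a \<Rightarrow> real" and x0 x :: 'a and R t
  proof -
    define S where "S = (\<integral>\<^sup>+ y. ennreal (\<bar>f y\<bar> * (1 + norm (y - x0) / R) powr (- a)) \<partial>lborel)"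
    define W where "W = (\<integral>\<^sup>+ y. ennreal ((f y)\<^sup>2 * (1 + norm (y - x0) / R) powr (- a)) \<partial>lborel)"
    define r where "r = t powr (2 / \<alpha>)"
    have r: "0 < r" "r \<le> R" using t by (auto simp: r_def)
    define Q where "Q = R powr (- a)"
    have Q: "Q\<^sup>2 = R powr (- 2 * a)" by (simp add: Q_def power2_eq_square powr_add[symmetric])
    have Q0: "0 \<le> Q" by (simp add: Q_def)
    note far' = far[OF fm w R x t(1) z, folded S_def Q_def]
    have SW: "S\<^sup>2 \<le> W * ennreal (c * R ^ DIM('a))"
    proof -
      have "S\<^sup>2 \<le> W * (\<integral>\<^sup>+ y. ennreal ((1 + norm (y - x0) / R) powr (- a)) \<partial>lborel)"
        unfolding S_def W_def by (rule nn_integral_weight_square_le) measurable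
      also have "\<dots> \<le> W * ennreal (c * R ^ DIM('a))"
        unfolding c_def by (intro mult_left_mono nn_integral_kernel_le a R) simp
      finally show ?thesis .
    qed
    have sq: "ennreal (A\<^sup>2) \<le> ennreal (B\<^sup>2) * S\<^sup>2" if "ennreal \<bar>A\<bar> \<le> ennreal B * S" "0 \<le> B" for A B
    proof -
      have "ennreal (A\<^sup>2) = (ennreal \<bar>A\<bar>)\<^sup>2" by (subst ennreal_power) auto
      also have "\<dots> \<le> (ennreal B * S)\<^sup>2" using that by (intro power_mono) auto
      also have "\<dots> = ennreal (B\<^sup>2) * S\<^sup>2" using that by (simp add: power_mult_distrib ennreal_power)
      finally show ?thesis .
    qed
    let ?p = "real DIM('a) + \<alpha>"
    have dt: "ennreal ((stable_ext_dt (\<alpha> / 2) f t x)\<^sup>2) \<le> ennreal ((K * Q)\<^sup>2) * S\<^sup>2"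
      using far' K Q0 by (intro sq) auto
    have ga: "Gamma_form \<alpha> t (stable_ext (\<alpha> / 2) f t) x \<le> ennreal (L * (K * Q)\<^sup>2) * S\<^sup>2"
    proof -
      \<comment> \<open>The difference bound at |h| = r, without the factor \<open>S\<close>. For
        |h| < r the bound is smaller by the factor |h| / r; the minimum with 4 is then inactive, and
        the Levy integral with b = 1 / r can be reused.\<close>
      let ?g = "K * (t * r / R) * Q"
      have "Gamma_form \<alpha> t (stable_ext (\<alpha> / 2) f t) x
         \<le> (\<integral>\<^sup>+ h. (ennreal (?g\<^sup>2) * S\<^sup>2) * ennreal (min 4 ((norm (h::'a))\<^sup>2 * (1 / r)\<^sup>2) / norm h powr ?p) \<partial>lborel)"
        unfolding Gamma_form_def
      proof (rule nn_integral_mono)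
        fix h :: 'a
        let ?D = "stable_ext (\<alpha> / 2) f t (x + h) - stable_ext (\<alpha> / 2) f t x"
        show "ennreal (?D\<^sup>2 / norm h powr ?p) * indicator {h. norm h < t powr (2 / \<alpha>)} h
          \<le> (ennreal (?g\<^sup>2) * S\<^sup>2) * ennreal (min 4 ((norm h)\<^sup>2 * (1 / r)\<^sup>2) / norm h powr ?p)"
        proof (cases "norm h < r")
          case True
          have g: "0 \<le> K * (t * norm h / R) * Q" using K t R Q0 by simp
          have "ennreal (?D\<^sup>2) \<le> ennreal ((K * (t * norm h / R) * Q)\<^sup>2) * S\<^sup>2"
            using far' True r g by (intro sq) auto
          also have "(K * (t * norm h / R) * Q)\<^sup>2 = ?g\<^sup>2 * ((norm h)\<^sup>2 * (1 / r)\<^sup>2)"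
            using r by (simp add: power_mult_distrib power_divide field_simps)
          also have "(norm h)\<^sup>2 * (1 / r)\<^sup>2 = min 4 ((norm h)\<^sup>2 * (1 / r)\<^sup>2)"
          proof -
            have "(norm h * (1 / r))\<^sup>2 \<le> 1\<^sup>2" using True r by (intro power_mono) auto
            then show ?thesis by (simp only: power_mult_distrib) simp
          qed
          finally have D: "ennreal (?D\<^sup>2) \<le> ennreal (?g\<^sup>2 * min 4 ((norm h)\<^sup>2 * (1 / r)\<^sup>2)) * S\<^sup>2" .
          have "ennreal (?D\<^sup>2 / norm h powr ?p) = ennreal (1 / norm h powr ?p) * ennreal (?D\<^sup>2)"
            by (subst ennreal_mult[symmetric]) auto
          also have "\<dots> \<le> ennreal (1 / norm h powr ?p) * (ennreal (?g\<^sup>2 * min 4 ((norm h)\<^sup>2 * (1 / r)\<^sup>2)) * S\<^sup>2)"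
            by (intro mult_left_mono D) simp
          also have "\<dots> = (ennreal (1 / norm h powr ?p) * ennreal (?g\<^sup>2 * min 4 ((norm h)\<^sup>2 * (1 / r)\<^sup>2))) * S\<^sup>2"
            by (simp only: mult.assoc)
          also have "ennreal (1 / norm h powr ?p) * ennreal (?g\<^sup>2 * min 4 ((norm h)\<^sup>2 * (1 / r)\<^sup>2)) = ennreal (?g\<^sup>2) * ennreal (min 4 ((norm h)\<^sup>2 * (1 / r)\<^sup>2) / norm h powr ?p)"
            by (subst (1 2) ennreal_mult[symmetric]) auto
          finally show ?thesis using True by (simp add: r_def[symmetric] mult_ac)
        qed (simp add: r_def)
      qed
      also have "\<dots> = (ennreal (?g\<^sup>2) * S\<^sup>2) * (\<integral>\<^sup>+ h. ennreal (min 4 ((norm (h::'a))\<^sup>2 * (1 / r)\<^sup>2) / norm h powr ?p) \<partial>lborel)"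
        by (rule nn_integral_cmult) measurable
      also have "\<dots> \<le> (ennreal (?g\<^sup>2) * S\<^sup>2) * ennreal (L * (1 / r) powr \<alpha>)"
        unfolding L_def using r by (intro mult_left_mono nn_integral_levy_le \<alpha>) auto
      also have "\<dots> = ennreal (?g\<^sup>2 * (L * (1 / r) powr \<alpha>)) * S\<^sup>2"
        using L by (simp add: ennreal_mult mult_ac)
      also have "?g\<^sup>2 * (L * (1 / r) powr \<alpha>) \<le> L * (K * Q)\<^sup>2"
      proof -
        have "r powr \<alpha> = t\<^sup>2" using t \<alpha> by (simp add: r_def powr_powr)
        then have "(1 / r) powr \<alpha> = 1 / t\<^sup>2" by (simp add: powr_divide)
        then have "?g\<^sup>2 * (L * (1 / r) powr \<alpha>) = L * (K * Q)\<^sup>2 * (r / R)\<^sup>2"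
          using t by (simp add: power_mult_distrib power_divide field_simps)
        also have "\<dots> \<le> L * (K * Q)\<^sup>2 * 1"
          using r L R by (intro mult_left_mono power_le_one) auto
        finally show ?thesis by simp
      qed
      finally show ?thesis by (simp add: ennreal_leI mult_right_mono)
    qed
    have "ext_energy \<alpha> f t x \<le> ennreal (L * (K * Q)\<^sup>2) * S\<^sup>2 + ennreal ((K * Q)\<^sup>2) * S\<^sup>2"
      unfolding ext_energy_def by (intro add_mono ga dt)
    also have "\<dots> = ennreal ((L + 1) * (K * Q)\<^sup>2) * S\<^sup>2"
    proof -
      have "ennreal ((L + 1) * (K * Q)\<^sup>2) = ennreal (L * (K * Q)\<^sup>2) + ennreal ((K * Q)\<^sup>2)"
        using L by (subst ennreal_plus[symmetric]) (auto simp: algebra_simps)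
      then show ?thesis by (simp only: distrib_right)
    qed
    also have "\<dots> \<le> ennreal ((L + 1) * (K * Q)\<^sup>2) * (W * ennreal (c * R ^ DIM('a)))"
      by (intro mult_left_mono SW) simp
    also have "\<dots> = (ennreal ((L + 1) * (K * Q)\<^sup>2) * ennreal (c * R ^ DIM('a))) * W" by (simp only: mult_ac)
    also have "ennreal ((L + 1) * (K * Q)\<^sup>2) * ennreal (c * R ^ DIM('a)) = ennreal (K' * R powr (- 2 * a) * R ^ DIM('a))"
      unfolding Q[symmetric] K'_def using L c R by (subst ennreal_mult[symmetric]) (auto simp: power_mult_distrib mult_ac)
    finally show ?thesis unfolding W_def .
  qed
  with K' show ?thesis by blast
qed

text \<open>Splitting at radius 4 R. The near part is integrable and its energy is bounded globally;
  the weight on the near ball is at least 5 powr (- a). For the far part the pointwise bound is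
  integrated over the box, whose volume weighted by \<open>t\<close> is at most of order R powr
  \<alpha> R^d; the powers of \<open>R\<close> cancel because 2 a = 2 d + \<alpha>.\<close>

lemma local_energy_bound:
  fixes \<alpha> :: real
  assumes \<alpha>: "0 < \<alpha>" "\<alpha> < 2"
  defines "a \<equiv> real DIM('a::euclidean_space) + \<alpha> / 2"
  shows "\<exists>C\<ge>0. \<forall>f :: 'a \<Rightarrow> real. f \<in> borel_measurable borel \<longrightarrow> weight_integrable (\<alpha> / 2) f \<longrightarrow>
    (\<forall>x0 R. 0 < R \<longrightarrow> (\<integral>\<^sup>+ t. \<integral>\<^sup>+ y. ennreal t * ext_energy \<alpha> f t y * (indicator {t. 0 < t \<and> t powr (2 / \<alpha>) \<le> R} t * indicator (ball x0 R) y) \<partial>lborel \<partial>lborel)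
       \<le> ennreal C * (\<integral>\<^sup>+ y. ennreal ((f y)\<^sup>2) * ennreal ((1 + norm (y - x0) / R) powr (- a)) \<partial>lborel))"
proof -
  define C1 where "C1 = ((real DIM('a) + \<alpha>) * unit_ball_vol (real DIM('a)) * (1 / (2 - \<alpha>) + 4 / \<alpha>) + 1) / 4"
  have v: "0 < unit_ball_vol (real DIM('a))" by (rule unit_ball_vol_DIM_pos)
  have C1: "0 \<le> C1" unfolding C1_def using \<alpha> v by simp
  have a: "0 < a" using \<alpha> by (simp add: a_def add_pos_pos)
  from ext_energy_far[OF \<alpha>, where ?'a = 'a, folded a_def] obtain K where K: "0 \<le> K" and
    "\<forall>(f :: 'a \<Rightarrow> real) x0 R x t. f \<in> borel_measurable borel \<longrightarrow> weight_integrable (\<alpha> / 2) f \<longrightarrow> 0 < R \<longrightarrow>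
     dist x0 x < R \<longrightarrow> 0 < t \<longrightarrow> t powr (2 / \<alpha>) \<le> R \<longrightarrow> (\<forall>y \<in> ball x0 (4 * R). f y = 0) \<longrightarrow>
     ext_energy \<alpha> f t x \<le> ennreal (K * R powr (- 2 * a) * R ^ DIM('a)) *
       (\<integral>\<^sup>+ y. ennreal ((f y)\<^sup>2 * (1 + norm (y - x0) / R) powr (- a)) \<partial>lborel)"
    by (elim exE conjE)
  note far = this(2)[THEN spec, THEN spec, THEN spec, THEN spec, THEN spec, THEN mp, THEN mp, THEN mp, THEN mp, THEN mp, THEN mp, THEN mp]
  \<comment> \<open>The factors 2 stem from the square of a sum, the power of 5 from the weight on
    the near ball, and the unit ball volume from the volume of the box.\<close>
  define C where "C = 2 * (C1 * 5 powr a) + 2 * K * unit_ball_vol (real DIM('a))"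
  have C: "0 \<le> C" unfolding C_def using C1 K v by simp
  have "(\<integral>\<^sup>+ t. \<integral>\<^sup>+ y. ennreal t * ext_energy \<alpha> f t y * (indicator {t. 0 < t \<and> t powr (2 / \<alpha>) \<le> R} t * indicator (ball x0 R) y) \<partial>lborel \<partial>lborel)
       \<le> ennreal C * (\<integral>\<^sup>+ y. ennreal ((f y)\<^sup>2) * ennreal ((1 + norm (y - x0) / R) powr (- a)) \<partial>lborel)"
    if fm[measurable]: "f \<in> borel_measurable borel" and w: "weight_integrable (\<alpha> / 2) f" and R: "0 < R"
    for f :: "'a \<Rightarrow> real" and x0 R
  proof -
    let ?T = "{t. 0 < t \<and> t powr (2 / \<alpha>) \<le> R}"
    let ?B = "ball x0 R"
    let ?A = "ball x0 (4 * R)"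
    have A[measurable]: "?A \<in> sets borel" "- ?A \<in> sets borel" "?B \<in> sets borel" by auto
    define f1 where "f1 y = f y * indicator ?A y" for y
    define f2 where "f2 y = f y * indicator (- ?A) y" for y
    have [measurable]: "f1 \<in> borel_measurable borel" "f2 \<in> borel_measurable borel" unfolding f1_def f2_def by measurable
    have w1: "weight_integrable (\<alpha> / 2) f1" unfolding f1_def by (intro weight_integrable_cutoff w A fm)
    have w2: "weight_integrable (\<alpha> / 2) f2" unfolding f2_def by (intro weight_integrable_cutoff w A fm)
    have i1: "integrable lborel f1" unfolding f1_def using \<alpha> by (intro weight_integrable_imp_integrable_ball[OF w fm]) simp
    have f12: "(\<lambda>y. f1 y + f2 y) = f" by (auto simp: f1_def f2_def split: split_indicator)
    define W where "W = (\<integral>\<^sup>+ y. ennreal ((f y)\<^sup>2 * (1 + norm (y - x0) / R) powr (- a)) \<partial>lborel)"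
    define Q where "Q = K * R powr (- 2 * a) * R ^ DIM('a)"
    have Q: "0 \<le> Q" using K R by (simp add: Q_def)
    have f2W: "(\<integral>\<^sup>+ y. ennreal ((f2 y)\<^sup>2 * (1 + norm (y - x0) / R) powr (- a)) \<partial>lborel) \<le> W"
      unfolding W_def f2_def by (intro nn_integral_mono ennreal_leI) (auto split: split_indicator)
    have f1W: "(\<integral>\<^sup>+ y. ennreal ((f1 y)\<^sup>2) \<partial>lborel) \<le> ennreal (5 powr a) * W"
    proof -
      have "ennreal ((f1 y)\<^sup>2) \<le> ennreal (5 powr a) * ennreal ((f y)\<^sup>2 * (1 + norm (y - x0) / R) powr (- a))" for y
      proof (cases "y \<in> ?A")
        case True
        then have "norm (y - x0) / R \<le> 4" using R by (simp add: dist_norm norm_minus_commute pos_divide_le_eq)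
        moreover have "0 < 1 + norm (y - x0) / R" using R by (simp add: add_pos_nonneg)
        ultimately have "5 powr (- a) \<le> (1 + norm (y - x0) / R) powr (- a)" using a by (intro powr_mono2') auto
        then have "(f y)\<^sup>2 * 5 powr a * 5 powr (- a) \<le> (f y)\<^sup>2 * 5 powr a * (1 + norm (y - x0) / R) powr (- a)"
          by (intro mult_left_mono) auto
        moreover have "5 powr a * 5 powr (- a) = (1::real)" by (simp add: powr_minus)
        ultimately have "(f y)\<^sup>2 \<le> 5 powr a * ((f y)\<^sup>2 * (1 + norm (y - x0) / R) powr (- a))" by (simp add: mult_ac)
        then have "ennreal ((f y)\<^sup>2) \<le> ennreal (5 powr a * ((f y)\<^sup>2 * (1 + norm (y - x0) / R) powr (- a)))" by (rule ennreal_leI)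
        also have "\<dots> = ennreal (5 powr a) * ennreal ((f y)\<^sup>2 * (1 + norm (y - x0) / R) powr (- a))" by (rule ennreal_mult) auto
        finally show ?thesis using True by (simp add: f1_def)
      qed (simp add: f1_def)
      then have "(\<integral>\<^sup>+ y. ennreal ((f1 y)\<^sup>2) \<partial>lborel) \<le> (\<integral>\<^sup>+ y. ennreal (5 powr a) * ennreal ((f y)\<^sup>2 * (1 + norm (y - x0) / R) powr (- a)) \<partial>lborel)"
        by (intro nn_integral_mono)
      also have "\<dots> = ennreal (5 powr a) * W" unfolding W_def by (rule nn_integral_cmult) measurable
      finally show ?thesis .
    qed
    \<comment> \<open>The near energy is released from the box, its bound being global; the far
      energy has a bound independent of \<open>t\<close> and \<open>y\<close>, so only the box
      itself remains to be measured.\<close>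
    have pw: "ennreal t * ext_energy \<alpha> f t y * (indicator ?T t * indicator ?B y)
      \<le> 2 * (ennreal t * ext_energy \<alpha> f1 t y * indicator {0<..} t) + (2 * (ennreal Q * W)) * (ennreal t * (indicator ?T t * indicator ?B y))" for t y
    proof (cases "t \<in> ?T \<and> y \<in> ?B")
      case True
      have "ext_energy \<alpha> f2 t y \<le> ennreal Q * (\<integral>\<^sup>+ y. ennreal ((f2 y)\<^sup>2 * (1 + norm (y - x0) / R) powr (- a)) \<partial>lborel)"
        unfolding Q_def by (rule far[OF _ w2 R]) (use True in \<open>auto simp: f2_def\<close>)
      also have "\<dots> \<le> ennreal Q * W" by (intro mult_left_mono f2W) simp
      finally have 2: "ext_energy \<alpha> f2 t y \<le> ennreal Q * W" .
      have "ext_energy \<alpha> f t y \<le> 2 * (ext_energy \<alpha> f1 t y + ext_energy \<alpha> f2 t y)"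
        using ext_energy_add_le[OF w1 w2 _ _ \<alpha>, of t y] True by (simp only: f12) simp
      also have "\<dots> \<le> 2 * (ext_energy \<alpha> f1 t y + ennreal Q * W)" by (intro mult_left_mono add_left_mono 2) simp
      finally have "ennreal t * ext_energy \<alpha> f t y \<le> ennreal t * (2 * (ext_energy \<alpha> f1 t y + ennreal Q * W))"
        by (intro mult_left_mono) simp_all
      also have "\<dots> = 2 * (ennreal t * ext_energy \<alpha> f1 t y) + (2 * (ennreal Q * W)) * ennreal t"
        by (simp only: distrib_left mult_ac)
      finally show ?thesis using True by simp
    qed (auto split: split_indicator)
    \<comment> \<open>In the box t \<le> R powr (\<alpha> / 2), which bounds both the integrand and
      the length of the time interval.\<close>
    have TB: "(\<integral>\<^sup>+ t. \<integral>\<^sup>+ y. ennreal t * (indicator ?T t * indicator ?B y) \<partial>lborel \<partial>lborel)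
        \<le> ennreal (R powr \<alpha> * (unit_ball_vol (real DIM('a)) * R ^ DIM('a)))"
    proof -
      have le: "t \<le> R powr (\<alpha> / 2)" if "t \<in> ?T" for t
      proof -
        have "(t powr (2 / \<alpha>)) powr (\<alpha> / 2) \<le> R powr (\<alpha> / 2)" using that \<alpha> by (intro powr_mono2) auto
        then show ?thesis using that \<alpha> by (simp add: powr_powr)
      qed
      have eB: "emeasure lborel ?B = ennreal (unit_ball_vol (real DIM('a)) * R ^ DIM('a))"
        using R by (simp add: emeasure_ball)
      have "(\<integral>\<^sup>+ t. \<integral>\<^sup>+ y. ennreal t * (indicator ?T t * indicator ?B y) \<partial>lborel \<partial>lborel)
        \<le> (\<integral>\<^sup>+ t. (\<integral>\<^sup>+ y. ennreal (R powr (\<alpha> / 2)) * indicator {0..R powr (\<alpha> / 2)} t * indicator ?B y \<partial>lborel) \<partial>lborel)"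
      proof (intro nn_integral_mono)
        fix t and y :: 'a
        show "ennreal t * (indicator ?T t * indicator ?B y) \<le> ennreal (R powr (\<alpha> / 2)) * indicator {0..R powr (\<alpha> / 2)} t * indicator ?B y"
          using le[of t] by (auto split: split_indicator intro!: ennreal_leI)
      qed
      also have "\<dots> = (\<integral>\<^sup>+ t. (ennreal (R powr (\<alpha> / 2)) * emeasure lborel ?B) * indicator {0..R powr (\<alpha> / 2)} t \<partial>lborel)"
        by (rule nn_integral_cong, subst nn_integral_cmult_indicator) (simp_all add: mult_ac)
      also have "\<dots> = (ennreal (R powr (\<alpha> / 2)) * emeasure lborel ?B) * ennreal (R powr (\<alpha> / 2))"
        by (subst nn_integral_cmult_indicator) auto
      also have "\<dots> = ennreal (R powr (\<alpha> / 2) * (unit_ball_vol (real DIM('a)) * R ^ DIM('a)) * R powr (\<alpha> / 2))"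
        unfolding eB using v R by (simp add: ennreal_mult)
      also have "R powr (\<alpha> / 2) * (unit_ball_vol (real DIM('a)) * R ^ DIM('a)) * R powr (\<alpha> / 2) = R powr \<alpha> * (unit_ball_vol (real DIM('a)) * R ^ DIM('a))"
        by (simp add: powr_add[symmetric])
      finally show ?thesis .
    qed
    have "(\<integral>\<^sup>+ t. \<integral>\<^sup>+ y. ennreal t * ext_energy \<alpha> f t y * (indicator ?T t * indicator ?B y) \<partial>lborel \<partial>lborel)
      \<le> (\<integral>\<^sup>+ t. \<integral>\<^sup>+ y. 2 * (ennreal t * ext_energy \<alpha> f1 t y * indicator {0<..} t) + (2 * (ennreal Q * W)) * (ennreal t * (indicator ?T t * indicator ?B y)) \<partial>lborel \<partial>lborel)"
      by (intro nn_integral_mono pw)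
    also have "\<dots> = 2 * (\<integral>\<^sup>+ t. \<integral>\<^sup>+ y. ennreal t * ext_energy \<alpha> f1 t y * indicator {0<..} t \<partial>lborel \<partial>lborel)
       + (2 * (ennreal Q * W)) * (\<integral>\<^sup>+ t. \<integral>\<^sup>+ y. ennreal t * (indicator ?T t * indicator ?B y) \<partial>lborel \<partial>lborel)"
      by (simp add: nn_integral_add nn_integral_cmult)
    also have "\<dots> \<le> 2 * (ennreal C1 * (ennreal (5 powr a) * W)) + (2 * (ennreal Q * W)) * ennreal (R powr \<alpha> * (unit_ball_vol (real DIM('a)) * R ^ DIM('a)))"
    proof (intro add_mono mult_left_mono TB)
      have "(\<integral>\<^sup>+ t. \<integral>\<^sup>+ y. ennreal t * ext_energy \<alpha> f1 t y * indicator {0<..} t \<partial>lborel \<partial>lborel) \<le> ennreal C1 * (\<integral>\<^sup>+ y. ennreal ((f1 y)\<^sup>2) \<partial>lborel)"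
        unfolding C1_def by (rule ext_energy_near[OF i1 \<alpha>])
      also have "\<dots> \<le> ennreal C1 * (ennreal (5 powr a) * W)" by (intro mult_left_mono f1W) simp
      finally show "(\<integral>\<^sup>+ t. \<integral>\<^sup>+ y. ennreal t * ext_energy \<alpha> f1 t y * indicator {0<..} t \<partial>lborel \<partial>lborel) \<le> \<dots>" .
    qed auto
    also have "\<dots> = ennreal C * W"
    proof -
      have "R ^ DIM('a) = R powr real DIM('a)" using R by (simp add: powr_realpow)
      then have "R powr (- 2 * a) * R ^ DIM('a) * (R powr \<alpha> * R ^ DIM('a)) = R powr (- 2 * a + real DIM('a) + (\<alpha> + real DIM('a)))"
        by (simp only: powr_add)
      also have "\<dots> = 1" using R by (simp add: a_def)
      finally have r: "R powr (- 2 * a) * R ^ DIM('a) * (R powr \<alpha> * R ^ DIM('a)) = 1" .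
      have "Q * (R powr \<alpha> * (unit_ball_vol (real DIM('a)) * R ^ DIM('a)))
        = K * unit_ball_vol (real DIM('a)) * (R powr (- 2 * a) * R ^ DIM('a) * (R powr \<alpha> * R ^ DIM('a)))"
        unfolding Q_def by (simp only: mult_ac)
      then have "Q * (R powr \<alpha> * (unit_ball_vol (real DIM('a)) * R ^ DIM('a))) = K * unit_ball_vol (real DIM('a))"
        unfolding r by simp
      then have q: "ennreal Q * ennreal (R powr \<alpha> * (unit_ball_vol (real DIM('a)) * R ^ DIM('a))) = ennreal (K * unit_ball_vol (real DIM('a)))"
        using Q R v by (subst ennreal_mult[symmetric]) auto
      have "ennreal C = ennreal (2 * (C1 * 5 powr a)) + ennreal (2 * (K * unit_ball_vol (real DIM('a))))"
        unfolding C_def using C1 K v by (subst ennreal_plus[symmetric]) (auto simp: mult.assoc)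
      also have "ennreal (2 * (C1 * 5 powr a)) = 2 * (ennreal C1 * ennreal (5 powr a))"
        using C1 by (simp add: ennreal_mult)
      also have "ennreal (2 * (K * unit_ball_vol (real DIM('a)))) = 2 * ennreal (K * unit_ball_vol (real DIM('a)))"
        using K v by (subst ennreal_mult) auto
      finally show ?thesis unfolding q[symmetric] by (simp only: distrib_left distrib_right mult_ac)
    qed
    also have "W = (\<integral>\<^sup>+ y. ennreal ((f y)\<^sup>2) * ennreal ((1 + norm (y - x0) / R) powr (- a)) \<partial>lborel)"
      unfolding W_def by (intro nn_integral_cong ennreal_mult) auto
    finally show ?thesis .
  qed
  with C show ?thesis by blast
qed

subsection \<open>The \<open>L\<^sup>p\<close> bound\<close>

text \<open>Pointwise domination in place of Hoelder's inequality: since the weight is at most 1,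
  its product with |g| is at most the weight where |g| \<le> 1 and at most |g| powr p
  elsewhere.\<close>

lemma weight_integrable_of_powr:
  fixes g :: "'a::euclidean_space \<Rightarrow> real"
  assumes [measurable]: "g \<in> borel_measurable borel" and p: "1 \<le> p" and \<beta>: "0 < \<beta>"
    and fin: "(\<integral>\<^sup>+ x. ennreal_pow (ennreal \<bar>g x\<bar>) p \<partial>lborel) < top"
  shows "weight_integrable \<beta> g"
  unfolding weight_integrable_def
proof (rule Bochner_Integration.integrable_bound)
  let ?w = "\<lambda>y::'a. (1 + norm y) powr (- (real DIM('a) + \<beta>))"
  have "integrable lborel (\<lambda>x. \<bar>g x\<bar> powr p)"
    by (rule integrableI_nonneg) (use fin in \<open>auto simp: ennreal_pow_ennreal\<close>)
  then show "integrable lborel (\<lambda>y. ?w y + \<bar>g y\<bar> powr p)"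
    using \<beta> by (intro Bochner_Integration.integrable_add integrable_kernel) auto
  show "AE y in lborel. norm (g y * ?w y) \<le> norm (?w y + \<bar>g y\<bar> powr p)"
  proof (intro AE_I2)
    fix y
    have "?w y \<le> (1 + norm y) powr 0" using \<beta> by (intro powr_mono) auto
    moreover have "0 < 1 + norm y" by (simp add: add_pos_nonneg)
    ultimately have w: "0 \<le> ?w y" "?w y \<le> 1" by auto
    have "\<bar>g y\<bar> * ?w y \<le> ?w y + \<bar>g y\<bar> powr p"
    proof (cases "\<bar>g y\<bar> \<le> 1")
      case True
      then have "\<bar>g y\<bar> * ?w y \<le> 1 * ?w y" using w by (intro mult_right_mono)
      then show ?thesis by (simp add: add_increasing2)
    next
      case False
      then have "\<bar>g y\<bar> powr 1 \<le> \<bar>g y\<bar> powr p" using p by (intro powr_mono) auto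
      then have "\<bar>g y\<bar> \<le> \<bar>g y\<bar> powr p" by simp
      moreover have "\<bar>g y\<bar> * ?w y \<le> \<bar>g y\<bar> * 1" using w by (intro mult_left_mono) auto
      ultimately show ?thesis using w by linarith
    qed
    then show "norm (g y * ?w y) \<le> norm (?w y + \<bar>g y\<bar> powr p)" by (simp add: abs_mult)
  qed
qed measurable

text \<open>The function \<open>f\<close> is only Lebesgue measurable, but it enters under an
  integral, so passing to a Borel representative \<open>g\<close> leaves the extension unchanged at
  every point.\<close>

lemma extension_eq_stable_ext:
  fixes k :: "real \<Rightarrow> 'a::euclidean_space \<Rightarrow> 'a \<Rightarrow> real"
  assumes k: "stable_transition_density \<alpha> k" and \<alpha>: "0 < \<alpha>" and t: "0 < t"
    and f: "f \<in> borel_measurable lebesgue" and g[measurable]: "g \<in> borel_measurable borel" and fg: "AE x in lborel. f x = g x"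
  shows "extension k f t x = stable_ext (\<alpha> / 2) g t x"
proof -
  have g': "g \<in> borel_measurable lebesgue" using g by (simp add: measurable_completion)
  have s: "(\<lambda>y. stable_kernel (\<alpha> / 2) t (x - y)) \<in> borel_measurable lebesgue"
    by (rule measurable_completion) measurable
  have "extension k f t x = (LINT y|lebesgue. f y * stable_kernel (\<alpha> / 2) t (x - y))"
    unfolding extension_def subord_density_eq_stable_kernel[OF k \<alpha> t] ..
  also have "\<dots> = (LINT y|lebesgue. g y * stable_kernel (\<alpha> / 2) t (x - y))"
  proof (rule integral_cong_AE)
    show "AE y in lebesgue. f y * stable_kernel (\<alpha> / 2) t (x - y) = g y * stable_kernel (\<alpha> / 2) t (x - y)"
      using AE_completion[OF fg] by eventually_elim simp
  qed (intro borel_measurable_times f g' s)+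
  also have "\<dots> = stable_ext (\<alpha> / 2) g t x"
    unfolding stable_ext_def by (rule integral_completion) measurable
  finally show ?thesis .
qed

text \<open>The two extensions agree for all positive times, an open set, so the derivative carries
  over. In particular \<open>deriv\<close> is a true derivative here and not a default
  value.\<close>

lemma deriv_extension_eq_stable_ext_dt:
  fixes k :: "real \<Rightarrow> 'a::euclidean_space \<Rightarrow> 'a \<Rightarrow> real"
  assumes k: "stable_transition_density \<alpha> k" and \<alpha>: "0 < \<alpha>" "\<alpha> < 2" and t: "0 < t"
    and f: "f \<in> borel_measurable lebesgue" and g: "g \<in> borel_measurable borel" and fg: "AE x in lborel. f x = g x"
    and w: "weight_integrable (\<alpha> / 2) g"
  shows "deriv (\<lambda>\<tau>. extension k f \<tau> x) t = stable_ext_dt (\<alpha> / 2) g t x"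
proof (rule DERIV_imp_deriv)
  have d: "((\<lambda>s. stable_ext (\<alpha> / 2) g s x) has_real_derivative stable_ext_dt (\<alpha> / 2) g t x) (at t)"
    using \<alpha> by (intro DERIV_stable_ext w g t) auto
  show "((\<lambda>\<tau>. extension k f \<tau> x) has_real_derivative stable_ext_dt (\<alpha> / 2) g t x) (at t)"
    by (rule has_field_derivative_transform_within_open[OF d, of "{0<..}"])
       (use t extension_eq_stable_ext[OF k \<alpha>(1) _ f g fg] in auto)
qed

text \<open>Squaring undoes the inner roots, also at infinity, and additivity of the integrals
  merges the two parts.\<close>

lemma G_star_eq:
  fixes k :: "real \<Rightarrow> 'a::euclidean_space \<Rightarrow> 'a \<Rightarrow> real"
  assumes k: "stable_transition_density \<alpha> k" and \<alpha>: "0 < \<alpha>" "\<alpha> < 2"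
    and f: "f \<in> borel_measurable lebesgue" and g[measurable]: "g \<in> borel_measurable borel" and fg: "AE x in lborel. f x = g x"
    and w: "weight_integrable (\<alpha> / 2) g"
  shows "G_star k \<alpha> l f x = ennreal_pow (\<integral>\<^sup>+ t \<in> {0<..}. (ennreal t * K_conv \<alpha> l t (ext_energy \<alpha> g t) x) \<partial>lborel) (1 / 2)"
proof -
  let ?u = "\<lambda>t. stable_ext (\<alpha> / 2) g t" and ?v = "\<lambda>t. stable_ext_dt (\<alpha> / 2) g t"
  have U: "(\<lambda>p::real \<times> 'a. ?u (fst p) (snd p)) \<in> borel_measurable (borel \<Otimes>\<^sub>M borel)"
    by measurable
  have [measurable]: "(\<lambda>p. Gamma_form \<alpha> (fst p) (?u (fst p)) (snd p)) \<in> borel_measurable (lborel \<Otimes>\<^sub>M lborel)"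
    by (rule Gamma_form_measurable[OF U]) measurable
  have [measurable]: "(\<lambda>y. Gamma_form \<alpha> t (?u t) y) \<in> borel_measurable lborel" for t
    by (rule Gamma_form_measurable[OF U, of "\<lambda>_. t" lborel "\<lambda>y. y"]) measurable
  have sq: "(ennreal_pow X (1 / 2))\<^sup>2 = X" for X
    by (simp add: ennreal_pow_two[symmetric] ennreal_pow_pow ennreal_pow_one)
  have h: "(\<integral>\<^sup>+ t \<in> {0<..}. (ennreal t * K_conv \<alpha> l t (Gamma_form \<alpha> t (extension k f t)) x) \<partial>lborel)
     = (\<integral>\<^sup>+ t \<in> {0<..}. (ennreal t * K_conv \<alpha> l t (Gamma_form \<alpha> t (?u t)) x) \<partial>lborel)"
  proof (intro nn_integral_cong)
    fix t :: real
    have "extension k f t = ?u t" if "0 < t" by (intro ext extension_eq_stable_ext[OF k \<alpha>(1) that f g fg])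
    then show "ennreal t * K_conv \<alpha> l t (Gamma_form \<alpha> t (extension k f t)) x * indicator {0<..} t
      = ennreal t * K_conv \<alpha> l t (Gamma_form \<alpha> t (?u t)) x * indicator {0<..} t"
      by (auto split: split_indicator)
  qed
  have v: "(\<integral>\<^sup>+ t \<in> {0<..}. (ennreal t * K_conv \<alpha> l t (\<lambda>y. ennreal ((deriv (\<lambda>\<tau>. extension k f \<tau> y) t)\<^sup>2)) x) \<partial>lborel)
     = (\<integral>\<^sup>+ t \<in> {0<..}. (ennreal t * K_conv \<alpha> l t (\<lambda>y. ennreal ((?v t y)\<^sup>2)) x) \<partial>lborel)"
  proof (intro nn_integral_cong)
    fix t :: real
    have "deriv (\<lambda>\<tau>. extension k f \<tau> y) t = ?v t y" if "0 < t" for y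
      by (intro deriv_extension_eq_stable_ext_dt[OF k \<alpha> that f g fg w])
    then show "ennreal t * K_conv \<alpha> l t (\<lambda>y. ennreal ((deriv (\<lambda>\<tau>. extension k f \<tau> y) t)\<^sup>2)) x * indicator {0<..} t
      = ennreal t * K_conv \<alpha> l t (\<lambda>y. ennreal ((?v t y)\<^sup>2)) x * indicator {0<..} t"
      by (auto split: split_indicator)
  qed
  have s: "K_conv \<alpha> l t (ext_energy \<alpha> g t) x = K_conv \<alpha> l t (Gamma_form \<alpha> t (?u t)) x + K_conv \<alpha> l t (\<lambda>y. ennreal ((?v t y)\<^sup>2)) x" for t
    unfolding K_conv_def ext_energy_def distrib_left by (rule nn_integral_add) measurable
  have [measurable]: "(\<lambda>t. K_conv \<alpha> l t (Gamma_form \<alpha> t (?u t)) x) \<in> borel_measurable lborel"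
    unfolding K_conv_def by measurable
  have [measurable]: "(\<lambda>t. K_conv \<alpha> l t (\<lambda>y. ennreal ((?v t y)\<^sup>2)) x) \<in> borel_measurable lborel"
    unfolding K_conv_def by measurable
  show ?thesis
    unfolding G_star_def G_star_horiz_def G_star_vert_def h v sq s distrib_left distrib_right
    by (subst nn_integral_add) measurable
qed

theorem theorem2p4:
  fixes k :: "real \<Rightarrow> 'a::euclidean_space \<Rightarrow> 'a \<Rightarrow> real"
    and \<alpha> l p :: real
  assumes "0 < \<alpha>" and "\<alpha> < 2"
    and "1 < l"
    and "2 \<le> p"
    and "stable_transition_density \<alpha> k"
  shows "\<exists>c::real. 0 < c \<and>
    (\<forall>f \<in> Lp_space p.
       Lp_norm p (G_star k \<alpha> l f) \<le> ennreal c * Lp_norm p (\<lambda>x. ennreal \<bar>f x\<bar>))"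
proof -
  define a where "a = real DIM('a) + \<alpha> / 2"
  have a: "real DIM('a) < a" using assms by (simp add: a_def)
  from local_energy_bound[OF assms(1,2), where ?'a = 'a, folded a_def] obtain C0 where C0: "0 \<le> C0" and
    "\<forall>f :: 'a \<Rightarrow> real. f \<in> borel_measurable borel \<longrightarrow> weight_integrable (\<alpha> / 2) f \<longrightarrow>
    (\<forall>x0 R. 0 < R \<longrightarrow> (\<integral>\<^sup>+ t. \<integral>\<^sup>+ y. ennreal t * ext_energy \<alpha> f t y * (indicator {t. 0 < t \<and> t powr (2 / \<alpha>) \<le> R} t * indicator (ball x0 R) y) \<partial>lborel \<partial>lborel)
       \<le> ennreal C0 * (\<integral>\<^sup>+ y. ennreal ((f y)\<^sup>2) * ennreal ((1 + norm (y - x0) / R) powr (- a)) \<partial>lborel))"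
    by (elim exE conjE)
  note loc = this(2)[THEN spec, THEN mp, THEN mp]
  \<comment> \<open>The exponent is halved because the square of the functional is compared with F =
    g^2; this is where 2 \<le> p is used.\<close>
  have q: "1 \<le> p / 2" using assms by simp
  from square_function_bound[OF assms(1,3) a q C0] obtain C where C: "0 \<le> C" and
    "\<forall>(\<gamma> :: real \<Rightarrow> 'a \<Rightarrow> ennreal) F.
    (\<lambda>(t, y). \<gamma> t y) \<in> borel_measurable (lborel \<Otimes>\<^sub>M lborel) \<longrightarrow> F \<in> borel_measurable borel \<longrightarrow>
    (\<forall>x0 R. 0 < R \<longrightarrow> (\<integral>\<^sup>+ t. \<integral>\<^sup>+ y. ennreal t * \<gamma> t y * (indicator {t. 0 < t \<and> t powr (2 / \<alpha>) \<le> R} t * indicator (ball x0 R) y) \<partial>lborel \<partial>lborel)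
       \<le> ennreal C0 * (\<integral>\<^sup>+ y. F y * ennreal ((1 + norm (y - x0) / R) powr (- a)) \<partial>lborel)) \<longrightarrow>
    (\<integral>\<^sup>+ x. ennreal_pow (\<integral>\<^sup>+ t \<in> {0<..}. (ennreal t * K_conv \<alpha> l t (\<gamma> t) x) \<partial>lborel) (p / 2) \<partial>lborel)
      \<le> ennreal C * (\<integral>\<^sup>+ x. ennreal_pow (F x) (p / 2) \<partial>lborel)"
    by (elim exE conjE)
  note sq = this(2)[THEN spec, THEN spec, THEN mp, THEN mp, THEN mp]
  \<comment> \<open>The summand 1 makes the constant positive even if \<open>C = 0\<close>.\<close>
  define c where "c = C powr (1 / p) + 1"
  have c: "0 < c" unfolding c_def by (rule add_nonneg_pos) auto
  have p: "0 < p" "1 \<le> p" using assms by auto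
  have "Lp_norm p (G_star k \<alpha> l f) \<le> ennreal c * Lp_norm p (\<lambda>x. ennreal \<bar>f x\<bar>)" if "f \<in> Lp_space p" for f
  proof -
    have f: "f \<in> borel_measurable lebesgue" and fin: "Lp_norm p (\<lambda>x. ennreal \<bar>f x\<bar>) < top"
      using that by (auto simp: Lp_space_def)
    from completion_ex_borel_measurable_real[OF f] obtain g where g': "g \<in> borel_measurable lborel" and fg: "AE x in lborel. f x = g x"
      by blast
    have g[measurable]: "g \<in> borel_measurable borel" using g' by simp
    have norm: "Lp_norm p (\<lambda>x. ennreal \<bar>f x\<bar>) = ennreal_pow (\<integral>\<^sup>+ x. ennreal_pow (ennreal \<bar>g x\<bar>) p \<partial>lborel) (1 / p)"
    proof -
      have "(\<integral>\<^sup>+ x. ennreal_pow (ennreal \<bar>f x\<bar>) p \<partial>lborel) = (\<integral>\<^sup>+ x. ennreal_pow (ennreal \<bar>g x\<bar>) p \<partial>lborel)"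
        by (rule nn_integral_cong_AE) (use fg in eventually_elim, simp)
      then show ?thesis by (simp only: Lp_norm_def nn_integral_completion)
    qed
    have fin': "(\<integral>\<^sup>+ x. ennreal_pow (ennreal \<bar>g x\<bar>) p \<partial>lborel) < top"
      using fin unfolding norm by (auto simp: less_top[symmetric])
    have w: "weight_integrable (\<alpha> / 2) g"
      using assms by (intro weight_integrable_of_powr[OF g p(2) _ fin']) simp
    note G = G_star_eq[OF assms(5,1,2) f g fg w]
    have "(\<integral>\<^sup>+ x. ennreal_pow (G_star k \<alpha> l f x) p \<partial>lborel)
      = (\<integral>\<^sup>+ x. ennreal_pow (\<integral>\<^sup>+ t \<in> {0<..}. (ennreal t * K_conv \<alpha> l t (ext_energy \<alpha> g t) x) \<partial>lborel) (p / 2) \<partial>lborel)"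
      unfolding G using p by (simp add: ennreal_pow_pow)
    also have "\<dots> \<le> ennreal C * (\<integral>\<^sup>+ x. ennreal_pow (ennreal ((g x)\<^sup>2)) (p / 2) \<partial>lborel)"
      by (rule sq[OF measurable_ext_energy[OF g] _ loc[OF g w]]) measurable
    also have "(\<integral>\<^sup>+ x. ennreal_pow (ennreal ((g x)\<^sup>2)) (p / 2) \<partial>lborel) = (\<integral>\<^sup>+ x. ennreal_pow (ennreal \<bar>g x\<bar>) p \<partial>lborel)"
    proof (intro nn_integral_cong)
      fix x
      have "((g x)\<^sup>2) powr (p / 2) = \<bar>g x\<bar> powr p"
        using powr_powr[of "\<bar>g x\<bar>" 2 "p / 2"] by (simp add: powr_numeral)
      then show "ennreal_pow (ennreal ((g x)\<^sup>2)) (p / 2) = ennreal_pow (ennreal \<bar>g x\<bar>) p"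
        by (simp add: ennreal_pow_ennreal)
    qed
    finally have "Lp_norm p (G_star k \<alpha> l f) \<le> ennreal_pow (ennreal C * (\<integral>\<^sup>+ x. ennreal_pow (ennreal \<bar>g x\<bar>) p \<partial>lborel)) (1 / p)"
      unfolding Lp_norm_def nn_integral_completion using p by (intro ennreal_pow_mono) auto
    also have "\<dots> = ennreal (C powr (1 / p)) * Lp_norm p (\<lambda>x. ennreal \<bar>f x\<bar>)"
      unfolding norm using p C by (simp add: ennreal_pow_mult ennreal_pow_ennreal)
    also have "\<dots> \<le> ennreal c * Lp_norm p (\<lambda>x. ennreal \<bar>f x\<bar>)"
      by (intro mult_right_mono ennreal_leI) (auto simp: c_def)
    finally show ?thesis .
  qed
  with c show ?thesis by blast
qed

end
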